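(* Let $(\Omega,T)$ be a topologically mixing countable Markov shift endowed with a null recurrent potential $\phi$ satisfying Walters' condition and $P_G(\phi)<+\infty$, and let $\mu$ be the associated invariant measure. Assume that the (non-decreasing) normalizing sequence $(a_n)$ of $(\Omega,T,\mu)$ is regularly varying of index $\alpha$ for some $0<\alpha\le1$. Let $x\in\Omega$ and $B_n:=[x_0^{n-1}]$ for $n\ge1$, and assume $|\mathcal O(x)\cap[x_0]|<+\infty$. Set $j_{x_0}:=\max\{k\ge0:T^kx\in[x_0]\}$. Let $\nu$ be a probability measure on $\mathbb R_+$ and $W$ a random variable of law $\nu$. Then $$\gamma(\mu(B_n))\,r_{[x_0]}\circ T^{j_{x_0}}\ \text{ converges in law to } W \text{ under } \mu_{B_n} \text{ as } n\to+\infty$$ if and only if, as $n\to+\infty$, $N_{B_n}^\gamma$ converges in law to $\mathrm{RPP}(\widetilde J_\alpha(\nu))$ under $\mu_{B_n}$ and $N_{B_n}^\gamma$ converges in law to $\mathrm{DRPP}(J_\alpha(\nu),\widetilde J_\alpha(\nu))$ under every probability measure absolutely continuous with respect to $\mu$.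
   Context: Topological Markov shifts. Let $V$ be an at most countable alphabet and $A:V\times V\to\{0,1\}$ a transition matrix. $\Omega=\{x=(x_n)_{n\ge0}\in V^{\mathbb N}: A(x_n,x_{n+1})=1\ \forall n\ge0\}$, $T$ is the left shift, topology given by $d(x,y)=\eta^{\min\{n\ge0:x_n\ne y_n\}}$, $\eta\in(0,1)$ fixed; this is a countable Markov shift (CMS) when $V$ is infinite. A word $v_0^{n-1}=(v_0,\dots,v_{n-1})$ is admissible if $A(v_i,v_{i+1})=1$ for all $i$; $[v_0^{n-1}]=\{x\in\Omega:x_i=v_i,\ 0\le i<n\}$. Topologically mixing: for all $v,w\in V$ there is $N$ such that for all $n\ge N$ there is an admissible path of $n$ steps from $v$ to $w$. $|\mathcal O(x)\cap[v]|$ denotes the number of visits $\#\{k\ge0:T^kx\in[v]\}$. Potentials. $\phi:\Omega\to\mathbb R$ is measurable, $S_n\phi=\sum_{k=0}^{n-1}\phi\circ T^k$, $\mathrm{var}_n(\phi)=\sup\{|\phi(x)-\phi(y)|:x_0^{n-1}=y_0^{n-1}\}$. Walters' condition: for all $k\ge1$, $W_k(\phi):=\sup_{n\ge1}\mathrm{var}_{n+k}(S_n\phi)<\infty$, and $W_k(\phi)\to0$ as $k\to\infty$. For measurable $B$, $r_B=r_B^{(1)}(x)=\inf\{n\ge1:T^nx\in B\}$, $r_B^{(k+1)}(x)=\inf\{n>r_B^{(k)}(x):T^nx\in B\}$. $Z_n(\phi,v)=\sum_{T^nx=x}e^{S_n\phi(x)}\mathbf 1_{[v]}(x)$, $Z_n^*(\phi,v)=\sum_{T^nx=x}e^{S_n\phi(x)}\mathbf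 1_{\{r_{[v]}=n\}}(x)\mathbf 1_{[v]}(x)$. $P_G(\phi)=\lim_n\frac1n\log Z_n(\phi,v)$ (independent of $v$), $\lambda_\phi=e^{P_G(\phi)}$. $\phi$ is null recurrent if $\sum_n\lambda_\phi^{-n}Z_n(\phi,v)=\infty$ and $\sum_n n\lambda_\phi^{-n}Z_n^*(\phi,v)=\infty$ for some (all) $v$. Then, with $L_\phi f(x)=\sum_{Ty=x}e^{\phi(y)}f(y)$, there are a continuous $h_\phi>0$ and a conservative measure $\nu_\phi$, finite on cylinders, with $L_\phi h_\phi=\lambda_\phi h_\phi$, $L_\phi^*\nu_\phi=\lambda_\phi\nu_\phi$, $\int h_\phi\,d\nu_\phi=+\infty$; $\mu=h_\phi\nu_\phi$ is a conservative ergodic shift-invariant $\sigma$-finite infinite measure. $(\Omega,T,\mu)$ is pointwise dual ergodic: with $\widehat T$ the transfer operator ($\int f\cdot g\circ T\,d\mu=\int(\widehat Tf)g\,d\mu$), there is a normalizing sequence $(a_n)$ with $\frac1{a_n}\sum_{k=0}^{n-1}\widehat T^kf\to\int f\,d\mu$ $\mu$-a.e. for all $f\in L^1(\mu)$; one has $a_n\sim\frac1{\mu[v]}\sum_{k=1}^n\lambda_\phi^{-k}Z_k(\phi,v)$. Scaling. With $a(s)=a_{\lfloor s\rfloor}$ and $a^{\leftarrow}(y)=\inf\{s\ge0:a(s)>y\}$, put $\gamma(s)=1/a^{\leftarrow}(1/s)$. For $\mu(B)>0$, $\mu_B=\mu(\cdot\cap B)/\mu(B)$ and $N_B^\gamma=\sum_{k\ge1}\delta_{\gamma(\mu(B))\,r_B^{(k)}}$.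 Point processes on $\mathbb R_+=[0,\infty)$ are random boundedly finite counting measures; convergence in law is for the weak$^*$ (vague) topology. $\mathrm{RPP}(W)=\sum_{i\ge1}\delta_{W_1+\dots+W_i}$, $(W_i)$ i.i.d. copies of $W\ge0$. $\mathrm{DRPP}(U,W)=\sum_{i\ge1}\delta_{T_i}$ with $T_1=U$ and $T_{i+1}-T_i=W_{i+1}$ for $i\ge1$, $(W_i)_{i\ge2}$ i.i.d. copies of $W$ independent of $U$. For $W\sim\nu$, $J_\alpha(\nu)$ and $\widetilde J_\alpha(\nu)$ are the nonnegative random variables with Laplace transforms, for $s\ge0$, $$\mathbb E[e^{-sJ_\alpha(\nu)}]=\Big(\mathbb E[e^{-sW}]+\tfrac{s^\alpha}{\Gamma(1+\alpha)}\Big)^{-1},\qquad \mathbb E[e^{-s\widetilde J_\alpha(\nu)}]=\frac{\mathbb E[e^{-sW}]}{\mathbb E[e^{-sW}]+s^\alpha/\Gamma(1+\alpha)}.$$ A statement asserting convergence to processes built from $J_\alpha(\nu),\widetilde J_\alpha(\nu)$ includes the assertion that these expressions are Laplace transforms of probability laws on $\mathbb R_+$. *)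

theory Defs
  imports "HOL-Probability.Probability"
begin

section \<open>Topological Markov shifts\<close>

text \<open>The alphabet is the whole type \<open>'v\<close>; the 0-1 transition matrix is a predicate \<open>A\<close>.\<close>

definition shift_space :: "('v \<Rightarrow> 'v \<Rightarrow> bool) \<Rightarrow> (nat \<Rightarrow> 'v) set" where
  "shift_space A = {x. \<forall>n. A (x n) (x (Suc n))}"

definition left_shift :: "(nat \<Rightarrow> 'v) \<Rightarrow> nat \<Rightarrow> 'v" where
  "left_shift x = (\<lambda>n. x (Suc n))"

definition seq_dist :: "real \<Rightarrow> (nat \<Rightarrow> 'v) \<Rightarrow> (nat \<Rightarrow> 'v) \<Rightarrow> real" where
  "seq_dist \<eta> x y = (if x = y then 0 else \<eta> ^ (LEAST n. x n \<noteq> y n))"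

lemma Metric_space_seq_dist:
  assumes "0 < \<eta>" "\<eta> < 1"
  shows "Metric_space S (seq_dist \<eta>)"
proof
  fix x y z :: "nat \<Rightarrow> 'a"
  show "0 \<le> seq_dist \<eta> x y"
    using assms by (simp add: seq_dist_def)
  show "seq_dist \<eta> x y = seq_dist \<eta> y x"
    by (simp add: seq_dist_def eq_commute)
  show "seq_dist \<eta> x y = 0 \<longleftrightarrow> x = y"
    using assms by (simp add: seq_dist_def)
  show "seq_dist \<eta> x z \<le> seq_dist \<eta> x y + seq_dist \<eta> y z"
  proof (cases "x = y \<or> y = z \<or> x = z")
    case True
    then show ?thesis using assms by (auto simp: seq_dist_def)
  next
    case False
    define k where "k = (LEAST n. x n \<noteq> z n)"
    have k: "x k \<noteq> z k"
      unfolding k_def by (rule LeastI_ex) (use False in auto)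
    then have "x k \<noteq> y k \<or> y k \<noteq> z k" by auto
    then have "(LEAST n. x n \<noteq> y n) \<le> k \<or> (LEAST n. y n \<noteq> z n) \<le> k"
      by (auto intro: Least_le)
    then have "\<eta> ^ k \<le> \<eta> ^ (LEAST n. x n \<noteq> y n) \<or> \<eta> ^ k \<le> \<eta> ^ (LEAST n. y n \<noteq> z n)"
      using assms by (auto intro: power_decreasing)
    moreover have "0 \<le> \<eta> ^ (LEAST n. x n \<noteq> y n)" "0 \<le> \<eta> ^ (LEAST n. y n \<noteq> z n)"
      using assms by auto
    ultimately show ?thesis
      using False by (auto simp: seq_dist_def k_def)
  qed
qed

definition shift_topology :: "('v \<Rightarrow> 'v \<Rightarrow> bool) \<Rightarrow> real \<Rightarrow> (nat \<Rightarrow> 'v) topology" where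
  "shift_topology A \<eta> = Metric_space.mtopology (shift_space A) (seq_dist \<eta>)"

definition shift_borel :: "('v \<Rightarrow> 'v \<Rightarrow> bool) \<Rightarrow> real \<Rightarrow> (nat \<Rightarrow> 'v) measure" where
  "shift_borel A \<eta> = sigma (shift_space A) {U. openin (shift_topology A \<eta>) U}"

definition cylinder :: "('v \<Rightarrow> 'v \<Rightarrow> bool) \<Rightarrow> 'v list \<Rightarrow> (nat \<Rightarrow> 'v) set" where
  "cylinder A w = {x \<in> shift_space A. \<forall>i<length w. x i = w ! i}"

text \<open>\<open>(A ^^ n) v w\<close> says that there is an admissible path of \<open>n\<close> steps from \<open>v\<close> to \<open>w\<close>.\<close>

definition topologically_mixing :: "('v \<Rightarrow> 'v \<Rightarrow> bool) \<Rightarrow> bool" where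
  "topologically_mixing A \<longleftrightarrow> (\<forall>v w. \<exists>N. \<forall>n\<ge>N. (A ^^ n) v w)"

text \<open>\<open>hit_time B k x\<close> is the time of the \<open>k\<close>-th visit to \<open>B\<close> at positive times
  (\<open>\<infinity>\<close> if there are fewer visits), with the auxiliary value \<open>0\<close> for \<open>k = 0\<close>.\<close>

fun hit_time :: "(nat \<Rightarrow> 'v) set \<Rightarrow> nat \<Rightarrow> (nat \<Rightarrow> 'v) \<Rightarrow> enat" where
  "hit_time B 0 x = 0"
| "hit_time B (Suc k) x = Inf (enat ` {n. hit_time B k x < enat n \<and> (left_shift ^^ n) x \<in> B})"

definition visit_times :: "(nat \<Rightarrow> 'v) set \<Rightarrow> (nat \<Rightarrow> 'v) \<Rightarrow> nat set" where
  "visit_times B x = {k. (left_shift ^^ k) x \<in> B}"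


section \<open>Potentials\<close>

definition birkhoff_sum :: "((nat \<Rightarrow> 'v) \<Rightarrow> real) \<Rightarrow> nat \<Rightarrow> (nat \<Rightarrow> 'v) \<Rightarrow> real" where
  "birkhoff_sum \<phi> n x = (\<Sum>k<n. \<phi> ((left_shift ^^ k) x))"

definition variation ::
    "('v \<Rightarrow> 'v \<Rightarrow> bool) \<Rightarrow> nat \<Rightarrow> ((nat \<Rightarrow> 'v) \<Rightarrow> real) \<Rightarrow> ennreal" where
  "variation A n f =
    (SUP (x, y) \<in> {(x, y). x \<in> shift_space A \<and> y \<in> shift_space A \<and> (\<forall>i<n. x i = y i)}.
       ennreal \<bar>f x - f y\<bar>)"

definition walters_var ::
    "('v \<Rightarrow> 'v \<Rightarrow> bool) \<Rightarrow> ((nat \<Rightarrow> 'v) \<Rightarrow> real) \<Rightarrow> nat \<Rightarrow> ennreal" where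
  "walters_var A \<phi> k = (SUP n\<in>{1..}. variation A (n + k) (birkhoff_sum \<phi> n))"

definition walters_condition :: "('v \<Rightarrow> 'v \<Rightarrow> bool) \<Rightarrow> ((nat \<Rightarrow> 'v) \<Rightarrow> real) \<Rightarrow> bool" where
  "walters_condition A \<phi> \<longleftrightarrow>
    (\<forall>k\<ge>1. walters_var A \<phi> k < \<infinity>) \<and> walters_var A \<phi> \<longlonglongrightarrow> 0"

text \<open>Sums of nonnegative terms over countable sets of points are written as integrals with
  respect to counting measure, with values in \<open>[0, \<infinity>]\<close>.\<close>

definition partition_fun ::
    "('v \<Rightarrow> 'v \<Rightarrow> bool) \<Rightarrow> ((nat \<Rightarrow> 'v) \<Rightarrow> real) \<Rightarrow> nat \<Rightarrow> 'v \<Rightarrow> ennreal" where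
  "partition_fun A \<phi> n v =
    (\<integral>\<^sup>+ x. ennreal (exp (birkhoff_sum \<phi> n x)) * indicator (cylinder A [v]) x
       \<partial>count_space {x \<in> shift_space A. (left_shift ^^ n) x = x})"

definition first_return_partition_fun ::
    "('v \<Rightarrow> 'v \<Rightarrow> bool) \<Rightarrow> ((nat \<Rightarrow> 'v) \<Rightarrow> real) \<Rightarrow> nat \<Rightarrow> 'v \<Rightarrow> ennreal" where
  "first_return_partition_fun A \<phi> n v =
    (\<integral>\<^sup>+ x. ennreal (exp (birkhoff_sum \<phi> n x))
           * indicator {x. hit_time (cylinder A [v]) 1 x = enat n} x
           * indicator (cylinder A [v]) x
       \<partial>count_space {x \<in> shift_space A. (left_shift ^^ n) x = x})"

definition ext_ln :: "ennreal \<Rightarrow> ereal" where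
  "ext_ln z = (if z = 0 then -\<infinity> else if z = \<infinity> then \<infinity> else ereal (ln (enn2real z)))"

definition gurevich_pressure ::
    "('v \<Rightarrow> 'v \<Rightarrow> bool) \<Rightarrow> ((nat \<Rightarrow> 'v) \<Rightarrow> real) \<Rightarrow> ereal" where
  "gurevich_pressure A \<phi> =
    (THE p. \<forall>v. (\<lambda>n. ereal (1 / real n) * ext_ln (partition_fun A \<phi> n v)) \<longlonglongrightarrow> p)"

text \<open>Meaningful only when the pressure is finite.\<close>

definition pressure_exp :: "('v \<Rightarrow> 'v \<Rightarrow> bool) \<Rightarrow> ((nat \<Rightarrow> 'v) \<Rightarrow> real) \<Rightarrow> real" where
  "pressure_exp A \<phi> = exp (real_of_ereal (gurevich_pressure A \<phi>))"

text \<open>The series start at \<open>n = 1\<close>.\<close>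

definition null_recurrent :: "('v \<Rightarrow> 'v \<Rightarrow> bool) \<Rightarrow> ((nat \<Rightarrow> 'v) \<Rightarrow> real) \<Rightarrow> bool" where
  "null_recurrent A \<phi> \<longleftrightarrow>
    (\<exists>v. (\<Sum>n. ennreal (inverse (pressure_exp A \<phi>) ^ Suc n) * partition_fun A \<phi> (Suc n) v) = \<infinity>
       \<and> (\<Sum>n. of_nat (Suc n) * ennreal (inverse (pressure_exp A \<phi>) ^ Suc n)
                 * first_return_partition_fun A \<phi> (Suc n) v) = \<infinity>)"

definition ruelle_operator ::
    "('v \<Rightarrow> 'v \<Rightarrow> bool) \<Rightarrow> ((nat \<Rightarrow> 'v) \<Rightarrow> real) \<Rightarrow> ((nat \<Rightarrow> 'v) \<Rightarrow> ennreal)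
       \<Rightarrow> (nat \<Rightarrow> 'v) \<Rightarrow> ennreal" where
  "ruelle_operator A \<phi> f x =
    (\<integral>\<^sup>+ y. ennreal (exp (\<phi> y)) * f y \<partial>count_space {y \<in> shift_space A. left_shift y = x})"


section \<open>The invariant measure of a null recurrent potential\<close>

definition conservative :: "'a measure \<Rightarrow> ('a \<Rightarrow> 'a) \<Rightarrow> bool" where
  "conservative M T \<longleftrightarrow>
    (\<forall>W\<in>sets M. disjoint_family (\<lambda>n. (T ^^ n) -` W \<inter> space M) \<longrightarrow> emeasure M W = 0)"

definition ruelle_eigendata ::
    "('v \<Rightarrow> 'v \<Rightarrow> bool) \<Rightarrow> real \<Rightarrow> ((nat \<Rightarrow> 'v) \<Rightarrow> real)
       \<Rightarrow> ((nat \<Rightarrow> 'v) \<Rightarrow> real) \<Rightarrow> (nat \<Rightarrow> 'v) measure \<Rightarrow> bool" where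
  "ruelle_eigendata A \<eta> \<phi> h m \<longleftrightarrow>
    continuous_map (shift_topology A \<eta>) euclideanreal h \<and>
    (\<forall>x\<in>shift_space A. 0 < h x) \<and>
    space m = shift_space A \<and> sets m = sets (shift_borel A \<eta>) \<and>
    conservative m left_shift \<and>
    (\<forall>w. w \<noteq> [] \<longrightarrow> emeasure m (cylinder A w) < \<infinity>) \<and>
    (\<forall>x\<in>shift_space A.
       ruelle_operator A \<phi> (\<lambda>y. ennreal (h y)) x = ennreal (pressure_exp A \<phi> * h x)) \<and>
    (\<forall>f\<in>borel_measurable m.
       (\<integral>\<^sup>+ x. ruelle_operator A \<phi> f x \<partial>m) = ennreal (pressure_exp A \<phi>) * (\<integral>\<^sup>+ x. f x \<partial>m)) \<and>
    (\<integral>\<^sup>+ x. ennreal (h x) \<partial>m) = \<infinity>"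

text \<open>The eigendata, and hence the measure, are unique up to positive constant factors.\<close>

definition associated_invariant_measure ::
    "('v \<Rightarrow> 'v \<Rightarrow> bool) \<Rightarrow> real \<Rightarrow> ((nat \<Rightarrow> 'v) \<Rightarrow> real) \<Rightarrow> (nat \<Rightarrow> 'v) measure \<Rightarrow> bool" where
  "associated_invariant_measure A \<eta> \<phi> \<mu> \<longleftrightarrow>
    (\<exists>h m. ruelle_eigendata A \<eta> \<phi> h m \<and> \<mu> = density m (\<lambda>x. ennreal (h x)))"

text \<open>A version of the transfer operator on integrable functions; it is determined by duality
  up to null sets.\<close>

definition transfer_operator ::
    "'a measure \<Rightarrow> ('a \<Rightarrow> 'a) \<Rightarrow> ('a \<Rightarrow> real) \<Rightarrow> 'a \<Rightarrow> real" where
  "transfer_operator M T f =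
    (SOME u. integrable M u \<and>
       (\<forall>g\<in>borel_measurable M. bounded (g ` space M) \<longrightarrow>
          (\<integral>x. f x * g (T x) \<partial>M) = (\<integral>x. u x * g x \<partial>M)))"

definition normalizing_sequence ::
    "'a measure \<Rightarrow> ('a \<Rightarrow> 'a) \<Rightarrow> (nat \<Rightarrow> real) \<Rightarrow> bool" where
  "normalizing_sequence M T a \<longleftrightarrow>
    (\<forall>f. integrable M f \<longrightarrow>
       (AE x in M. (\<lambda>n. (1 / a n) * (\<Sum>k<n. (transfer_operator M T ^^ k) f x))
                      \<longlonglongrightarrow> (\<integral>y. f y \<partial>M)))"

definition regularly_varying_seq :: "(nat \<Rightarrow> real) \<Rightarrow> real \<Rightarrow> bool" where
  "regularly_varying_seq a \<alpha> \<longleftrightarrow>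
    eventually (\<lambda>n. 0 < a n) sequentially \<and>
    (\<forall>c>0. (\<lambda>n. a (nat \<lfloor>c * real n\<rfloor>) / a n) \<longlonglongrightarrow> c powr \<alpha>)"

definition gen_inverse :: "(nat \<Rightarrow> real) \<Rightarrow> real \<Rightarrow> real" where
  "gen_inverse a y = Inf {s. 0 \<le> s \<and> y < a (nat \<lfloor>s\<rfloor>)}"

definition scaling :: "(nat \<Rightarrow> real) \<Rightarrow> real \<Rightarrow> real" where
  "scaling a s = 1 / gen_inverse a (1 / s)"


section \<open>Point processes on the half-line\<close>

abbreviation borel_nonneg :: "real measure" where
  "borel_nonneg \<equiv> restrict_space borel {0..}"

definition counting_measures :: "real measure set" where
  "counting_measures =
    {m. sets m = sets borel_nonneg \<and> (\<forall>B\<in>sets m. bounded B \<longrightarrow> emeasure m B \<in> \<nat>)}"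

definition vague_test_functions :: "(real \<Rightarrow> real) set" where
  "vague_test_functions = {f. continuous_on {0..} f \<and> (\<exists>K. \<forall>t>K. f t = 0)}"

definition vague_topology :: "real measure topology" where
  "vague_topology = topology_generated_by
    {{m \<in> counting_measures. (\<integral>t. f t \<partial>m) \<in> U} | f U. f \<in> vague_test_functions \<and> open U}"

lemma topspace_vague_topology: "topspace vague_topology = counting_measures"
proof -
  have "(\<lambda>_. 0) \<in> vague_test_functions"
    by (simp add: vague_test_functions_def)
  then have "counting_measures \<in>
    {{m \<in> counting_measures. (\<integral>t. f t \<partial>m) \<in> U} | f U. f \<in> vague_test_functions \<and> open U}"
    by (intro CollectI exI[of _ "\<lambda>_. 0"] exI[of _ UNIV]) auto
  then show ?thesis
    unfolding vague_topology_def topology_generated_by_topspace by blast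
qed

text \<open>A random element of a topological space need only take values there almost surely: points
  may accumulate on a null set. This is why the completion appears.\<close>

definition random_element :: "'c topology \<Rightarrow> 'a measure \<Rightarrow> ('a \<Rightarrow> 'c) \<Rightarrow> bool" where
  "random_element X P N \<longleftrightarrow>
    prob_space P \<and> (AE x in P. N x \<in> topspace X) \<and>
    (\<forall>U. openin X U \<longrightarrow> {x \<in> space P. N x \<in> U} \<in> sets (completion P))"

definition converges_in_law ::
    "'c topology \<Rightarrow> (nat \<Rightarrow> 'a measure) \<Rightarrow> (nat \<Rightarrow> 'a \<Rightarrow> 'c) \<Rightarrow> 'b measure \<Rightarrow> ('b \<Rightarrow> 'c) \<Rightarrow> bool" where
  "converges_in_law X P N Q Y \<longleftrightarrow>
    eventually (\<lambda>n. random_element X (P n) (N n)) sequentially \<and> random_element X Q Y \<and>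
    (\<forall>F. continuous_map X euclideanreal F \<and> bounded (F ` topspace X) \<longrightarrow>
       (\<lambda>n. \<integral>x. F (N n x) \<partial>completion (P n)) \<longlonglongrightarrow> (\<integral>y. F (Y y) \<partial>completion Q))"

text \<open>The measure \<open>\<Sum>k. \<delta>(t k)\<close> on the half-line; points outside \<open>[0, \<infinity>)\<close>, in particular
  at \<open>\<infinity>\<close>, are discarded.\<close>

definition point_measure :: "(nat \<Rightarrow> ereal) \<Rightarrow> real measure" where
  "point_measure t =
    distr (count_space {k. 0 \<le> t k \<and> t k < \<infinity>}) borel_nonneg (\<lambda>k. real_of_ereal (t k))"

definition hitting_process ::
    "(nat \<Rightarrow> real) \<Rightarrow> (nat \<Rightarrow> 'v) measure \<Rightarrow> (nat \<Rightarrow> 'v) set \<Rightarrow> (nat \<Rightarrow> 'v) \<Rightarrow> real measure" where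
  "hitting_process a \<mu> B x =
    point_measure (\<lambda>k. ereal (scaling a (measure \<mu> B)) * ereal_of_enat (hit_time B (Suc k) x))"

text \<open>The renewal processes \<open>RPP(W)\<close> and \<open>DRPP(U, W)\<close> live on the canonical product spaces of
  their waiting times, given the laws of \<open>W\<close> and \<open>U\<close>.\<close>

definition renewal_process :: "(nat \<Rightarrow> real) \<Rightarrow> real measure" where
  "renewal_process w = point_measure (\<lambda>k. ereal (\<Sum>i\<le>k. w i))"

definition RPP_space :: "real measure \<Rightarrow> (nat \<Rightarrow> real) measure" where
  "RPP_space law_W = PiM UNIV (\<lambda>_. law_W)"

definition DRPP_space :: "real measure \<Rightarrow> real measure \<Rightarrow> (nat \<Rightarrow> real) measure" where
  "DRPP_space law_U law_W = PiM UNIV (\<lambda>i. if i = 0 then law_U else law_W)"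


section \<open>The limit laws\<close>

definition nonneg_law :: "real measure \<Rightarrow> bool" where
  "nonneg_law \<nu> \<longleftrightarrow> real_distribution \<nu> \<and> (AE w in \<nu>. 0 \<le> w)"

definition laplace_transform :: "real measure \<Rightarrow> real \<Rightarrow> real" where
  "laplace_transform \<nu> s = (\<integral>w. exp (- (s * w)) \<partial>\<nu>)"

definition is_J_law :: "real \<Rightarrow> real measure \<Rightarrow> real measure \<Rightarrow> bool" where
  "is_J_law \<alpha> \<nu> \<rho> \<longleftrightarrow> nonneg_law \<rho> \<and>
    (\<forall>s\<ge>0. laplace_transform \<rho> s
              = inverse (laplace_transform \<nu> s + s powr \<alpha> / Gamma (1 + \<alpha>)))"

definition is_J_tilde_law :: "real \<Rightarrow> real measure \<Rightarrow> real measure \<Rightarrow> bool" where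
  "is_J_tilde_law \<alpha> \<nu> \<rho> \<longleftrightarrow> nonneg_law \<rho> \<and>
    (\<forall>s\<ge>0. laplace_transform \<rho> s
              = laplace_transform \<nu> s / (laplace_transform \<nu> s + s powr \<alpha> / Gamma (1 + \<alpha>)))"

end

theory Submission
  imports Defs
begin

text \<open>Write \<open>q = exp (- s / N)\<close> with \<open>1 / N\<close> the scaling factor of \<open>B n\<close>. The word of \<open>x\<close> leaves \<open>x 0\<close> for good
at time \<open>j\<close>, so two hits of \<open>B n\<close> are separated by an excursion: from a hit the orbit runs
to its first visit of \<open>x 0\<close> after time \<open>j\<close>, and from there to the next hit. Walters' condition makes the
density of the conformal measure on a cylinder almost independent of the past, so that up to factors tending
to \<open>1\<close> the excursion (mean \<open>m\<close> of \<open>q ^ time\<close>) and the passage to the next hit (mean \<open>J\<close>) are independent of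
what happened before. The mean \<open>R\<close> of the sum of \<open>q ^ k\<close> over all hits \<open>k\<close> then satisfies
\<open>R = J * (1 + m * R)\<close>, and Karamata's theorem for the regularly varying sequence \<open>a\<close> gives
\<open>R \<longlonglongrightarrow> Gamma (1 + \<alpha>) * s powr (- \<alpha>)\<close>. So the gaps are asymptotically independent with transform \<open>m * J\<close>, the first
one with transform \<open>J\<close>, and these converge iff \<open>m\<close> does, that is, iff the scaled excursion
converges in law. Points \<open>t\<close> are encoded by \<open>exp (- t)\<close>, which turns the joint transforms into moments
on a compact cube.\<close>

text \<open>The obstacle is that target and discount change together, whereas Karamata's theorem
  needs return sums to one fixed cylinder. Distortion repairs this: inside a long cylinder
  \<open>B n0\<close> the return measures of all smaller targets are proportional up to a factor
  near 1. Estimates must be uniform over the past, because an excursion or a passage ends at a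
  random time and the next estimate is applied with the past so produced. Hence the tests run over
  all events ending in a visit to \<open>x 0\<close>; this letter serves as renewal state because
  distortion compares futures from a common letter on. Finitely many visits of the orbit of
  \<open>x\<close> to its first letter keep occurrences of the word from overlapping. In the
  equivalence \<open>m\<close> is not known to converge, so means are compared through differences.
  Since \<open>m * J = R * m / (1 + R * m)\<close> is injective in \<open>m\<close>, the first gap
  determines the excursion. Dual ergodicity holds almost everywhere only; dominated convergence,
  with distortion supplying the bound, turns it into convergence of return measures.\<close>

type_synonym 'v seq = "nat \<Rightarrow> 'v"

section \<open>Regular variation and Karamata's theorem\<close>

lemma regularly_varying_double:
  assumes "regularly_varying_seq a \<alpha>"
  shows "(\<lambda>n. a (2 * n) / a n) \<longlonglongrightarrow> 2 powr \<alpha>"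
proof -
  have "nat \<lfloor>2 * real n\<rfloor> = 2 * n" for n by linarith
  moreover have "(\<lambda>n. a (nat \<lfloor>2 * real n\<rfloor>) / a n) \<longlonglongrightarrow> 2 powr \<alpha>"
    using assms unfolding regularly_varying_seq_def by (metis zero_less_numeral)
  ultimately show ?thesis by simp
qed

text \<open>A bounded monotone sequence with a positive term has a positive limit, so
  \<open>a (2 * n) / a n\<close> would tend to 1; but it tends to \<open>2 powr \<alpha>\<close>,
  which exceeds 1.\<close>

lemma regularly_varying_at_top:
  assumes "mono a" "regularly_varying_seq a \<alpha>" "0 < \<alpha>"
  shows "filterlim a at_top sequentially"
proof -
  have pos: "eventually (\<lambda>n. 0 < a n) sequentially"
    using assms(2) by (simp add: regularly_varying_seq_def)
  note lim = regularly_varying_double[OF assms(2)]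
  show ?thesis
  proof (rule ccontr)
    assume "\<not> filterlim a at_top sequentially"
    then obtain Z where Z: "\<not> eventually (\<lambda>n. Z \<le> a n) sequentially"
      by (auto simp: filterlim_at_top)
    have bdd: "a n \<le> Z" for n
    proof (rule ccontr)
      assume "\<not> a n \<le> Z"
      then have "\<forall>m\<ge>n. Z \<le> a m" using monoD[OF assms(1)] by (meson le_less_trans less_imp_le not_le)
      then show False using Z eventually_sequentially by blast
    qed
    then have bd: "bdd_above (range a)" by (auto intro!: bdd_aboveI)
    define l where "l = (SUP n. a n)"
    have al: "a \<longlonglongrightarrow> l" unfolding l_def
      using LIMSEQ_incseq_SUP[OF bd] assms(1) by simp
    obtain n0 where "0 < a n0" using pos by (auto simp: eventually_sequentially)
    then have "0 < l" unfolding l_def using bd by (meson cSUP_upper less_le_trans UNIV_I)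
    have "(\<lambda>n. a (2 * n)) \<longlonglongrightarrow> l"
      using LIMSEQ_subseq_LIMSEQ[OF al, of "\<lambda>n. 2 * n"] by (simp add: strict_mono_def o_def)
    then have "(\<lambda>n. a (2 * n) / a n) \<longlonglongrightarrow> l / l"
      using al \<open>0 < l\<close> by (intro tendsto_divide) auto
    then have "2 powr \<alpha> = 1" using LIMSEQ_unique[OF lim] \<open>0 < l\<close> by simp
    moreover have "2 powr \<alpha> > (1::real)" using assms(3) by simp
    ultimately show False by simp
  qed
qed

lemma floor_mult_at_top: "0 < b \<Longrightarrow> filterlim (\<lambda>n. nat \<lfloor>b * real n\<rfloor>) at_top sequentially"
  by (intro filterlim_compose[OF filterlim_nat_sequentially] filterlim_compose[OF filterlim_floor_sequentially]
    filterlim_tendsto_pos_mult_at_top[OF tendsto_const _ filterlim_real_sequentially])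

text \<open>Monotonicity gives the lower bound 1. For the upper bound, \<open>Suc n\<close> lies
  below \<open>c * n\<close> for every \<open>c > 1\<close> and large \<open>n\<close>, so the ratio
  is asymptotically at most \<open>c powr \<alpha>\<close>, which is as close to 1 as
  desired.\<close>

lemma regularly_varying_Suc:
  assumes "mono a" "regularly_varying_seq a \<alpha>"
  shows "(\<lambda>n. a (Suc n) / a n) \<longlonglongrightarrow> 1"
proof -
  have pos: "eventually (\<lambda>n. 0 < a n) sequentially"
    using assms(2) by (simp add: regularly_varying_seq_def)
  show ?thesis
  proof (rule order_tendstoI)
    fix y :: real assume y: "y < 1"
    show "eventually (\<lambda>n. y < a (Suc n) / a n) sequentially"
      using pos
    proof eventually_elim
      case (elim n)
      have "1 \<le> a (Suc n) / a n" using elim monoD[OF assms(1), of n "Suc n"] by simp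
      with y show ?case by simp
    qed
  next
    fix y :: real assume y: "1 < y"
    have "((\<lambda>c. c powr \<alpha>) \<longlongrightarrow> 1 powr \<alpha>) (at_right (1::real))"
      by (intro tendsto_powr tendsto_ident_at tendsto_const) auto
    then have "eventually (\<lambda>c. c powr \<alpha> < y) (at_right (1::real))"
      using y by (intro order_tendstoD) auto
    then have "eventually (\<lambda>c. c powr \<alpha> < y \<and> 1 < c) (at_right (1::real))"
      by (rule eventually_conj) (rule eventually_at_right_less)
    then obtain c where c: "c powr \<alpha> < y" "1 < c"
      using eventually_happens'[OF trivial_limit_at_right_real] by blast
    have "eventually (\<lambda>n. a (nat \<lfloor>c * real n\<rfloor>) / a n < y) sequentially"
      using assms(2) c unfolding regularly_varying_seq_def by (intro order_tendstoD[where a = y]) auto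
    moreover have "eventually (\<lambda>n. 1 / (c - 1) \<le> real n) sequentially"
      using filterlim_real_sequentially by (auto simp: filterlim_at_top)
    ultimately show "eventually (\<lambda>n. a (Suc n) / a n < y) sequentially"
      using pos
    proof eventually_elim
      case (elim n)
      have "1 \<le> (c - 1) * real n" using elim(2) c by (simp add: field_simps)
      then have "real (Suc n) \<le> c * real n" by (simp add: algebra_simps)
      then have "Suc n \<le> nat \<lfloor>c * real n\<rfloor>" by (rule le_nat_floor)
      then have "a (Suc n) / a n \<le> a (nat \<lfloor>c * real n\<rfloor>) / a n"
        using elim(3) monoD[OF assms(1)] by (intro divide_right_mono) auto
      with elim(1) show ?case by simp
    qed
  qed
qed

lemma regularly_varying_succ_floor:
  assumes "mono a" "regularly_varying_seq a \<alpha>" "0 < b"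
  shows "(\<lambda>n. a (Suc (nat \<lfloor>b * real n\<rfloor>)) / a n) \<longlonglongrightarrow> b powr \<alpha>"
proof -
  let ?k = "\<lambda>n. nat \<lfloor>b * real n\<rfloor>"
  note top = floor_mult_at_top[OF assms(3)]
  have "(\<lambda>n. a (Suc (?k n)) / a (?k n) * (a (?k n) / a n)) \<longlonglongrightarrow> 1 * b powr \<alpha>"
    using assms(2,3) unfolding regularly_varying_seq_def
    by (intro tendsto_mult filterlim_compose[OF regularly_varying_Suc[OF assms(1,2)] top]) auto
  moreover have "eventually (\<lambda>n. 0 < a n) sequentially"
    using assms(2) by (simp add: regularly_varying_seq_def)
  then have "eventually (\<lambda>n. 0 < a (?k n)) sequentially" using top by (rule eventually_compose_filterlim)
  then have "eventually (\<lambda>n. a (Suc (?k n)) / a (?k n) * (a (?k n) / a n) = a (Suc (?k n)) / a n) sequentially"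
    by eventually_elim simp
  ultimately have "(\<lambda>n. a (Suc (?k n)) / a n) \<longlonglongrightarrow> 1 * b powr \<alpha>" by (rule Lim_transform_eventually)
  then show ?thesis by simp
qed

text \<open>A crude Potter bound from iterating the doubling ratio. As
  \<open>2 powr \<alpha>\<close> is at most 2, every constant above 2 would serve; 4 makes the bound
  the square of the factor \<open>2 ^ i\<close>.\<close>

lemma regularly_varying_polynomial_bound:
  assumes "mono a" "regularly_varying_seq a \<alpha>" "\<alpha> \<le> 1"
  obtains n0 where "0 < n0"
    "\<And>n i. n0 \<le> n \<Longrightarrow> 0 < a n \<and> a (2 ^ i * n) \<le> 4 ^ i * a n"
proof -
  have pos: "eventually (\<lambda>n. 0 < a n) sequentially"
    using assms(2) by (simp add: regularly_varying_seq_def)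
  note lim = regularly_varying_double[OF assms(2)]
  have "2 powr \<alpha> \<le> 2 powr (1::real)" using assms(3) by (intro powr_mono) auto
  then have "2 powr \<alpha> < (4::real)" by simp
  with lim have "eventually (\<lambda>n. a (2 * n) / a n < 4) sequentially"
    by (rule order_tendstoD)
  with pos have "eventually (\<lambda>n. 0 < a n \<and> a (2 * n) \<le> 4 * a n) sequentially"
    by eventually_elim (auto simp: field_simps)
  then obtain n1 where n1: "\<And>n. n1 \<le> n \<Longrightarrow> 0 < a n \<and> a (2 * n) \<le> 4 * a n"
    by (auto simp: eventually_sequentially)
  have "0 < a n \<and> a (2 ^ i * n) \<le> 4 ^ i * a n" if "n1 \<le> n" for n i
  proof (induction i)
    case 0
    then show ?case using n1[OF that] by simp
  next
    case (Suc i)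
    have "n1 \<le> 2 ^ i * n" using that by (metis le_trans mult_le_mono1 nat_mult_1 one_le_numeral one_le_power)
    from n1[OF this] Suc show ?case by (auto simp: mult.assoc)
  qed
  then show ?thesis by (intro that[of "Suc n1"]) auto
qed

text \<open>The tail integral of \<open>exp (-y)\<close> replaces each weight, which is summation by parts.\<close>

lemma laplace_sum_eq_integral:
  fixes c :: "nat \<Rightarrow> real"
  assumes c: "\<And>k. 0 \<le> c k" and s: "0 < s" and N: "0 < N"
  shows "(\<Sum>k. ennreal (exp (- (s / real N)) ^ k * c k)) =
    (\<integral>\<^sup>+y. ennreal (exp (- y) * (\<Sum>k<Suc (nat \<lfloor>y / s * real N\<rfloor>). c k)) * indicator {0..} y \<partial>lborel)"
proof -
  have tail: "(\<integral>\<^sup>+y. ennreal (exp (- y)) * indicator {u..} y \<partial>lborel) = ennreal (exp (- u))" for u :: real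
  proof -
    have "(\<integral>\<^sup>+y. ennreal (exp (- y)) * indicator {u..} y \<partial>lborel) = 0 - (- exp (- u))"
    proof (rule nn_integral_FTC_atLeast)
      have "((\<lambda>y::real. exp (- y)) \<longlongrightarrow> 0) at_top"
        by (rule filterlim_compose[OF exp_at_bot filterlim_uminus_at_bot_at_top])
      then show "((\<lambda>y. - exp (- y)) \<longlongrightarrow> (0::real)) at_top" using tendsto_minus by fastforce
    qed (auto intro!: derivative_eq_intros)
    then show ?thesis by simp
  qed
  have "(\<Sum>k. ennreal (exp (- (s / real N)) ^ k * c k)) =
    (\<Sum>k. ennreal (c k) * ennreal (exp (- (s * real k / real N))))"
    using c by (intro suminf_cong) (simp add: ennreal_mult exp_of_nat_mult[symmetric] mult.commute)
  also have "\<dots> = (\<Sum>k. ennreal (c k) * (\<integral>\<^sup>+y. ennreal (exp (- y)) * indicator {s * real k / real N..} y \<partial>lborel))"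
    by (simp add: tail)
  also have "\<dots> = (\<Sum>k. (\<integral>\<^sup>+y. ennreal (c k) * (ennreal (exp (- y)) * indicator {s * real k / real N..} y) \<partial>lborel))"
    by (simp add: nn_integral_cmult)
  also have "\<dots> = (\<integral>\<^sup>+y. (\<Sum>k. ennreal (c k) * (ennreal (exp (- y)) * indicator {s * real k / real N..} y)) \<partial>lborel)"
    by (intro nn_integral_suminf[symmetric]) auto
  also have "\<dots> = (\<integral>\<^sup>+y. ennreal (exp (- y) * (\<Sum>k<Suc (nat \<lfloor>y / s * real N\<rfloor>). c k)) * indicator {0..} y \<partial>lborel)"
  proof (intro nn_integral_cong)
    fix y :: real
    show "(\<Sum>k. ennreal (c k) * (ennreal (exp (- y)) * indicator {s * real k / real N..} y)) =
      ennreal (exp (- y) * (\<Sum>k<Suc (nat \<lfloor>y / s * real N\<rfloor>). c k)) * indicator {0..} y"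
    proof (cases "0 \<le> y")
      case False
      have "\<not> s * real k / real N \<le> y" for k
        using False s N by (auto simp: not_le intro!: less_le_trans[of y 0])
      then show ?thesis using False by simp
    next
      case True
      \<comment> \<open>The index 0 counts as well, hence \<open>Suc\<close>: the prefix sum has one
        term more than the floor indicates.\<close>
      have iff: "s * real k / real N \<le> y \<longleftrightarrow> k < Suc (nat \<lfloor>y / s * real N\<rfloor>)" for k
      proof -
        have "s * real k / real N \<le> y \<longleftrightarrow> real k \<le> y / s * real N"
          using s N by (simp add: field_simps)
        also have "\<dots> \<longleftrightarrow> int k \<le> \<lfloor>y / s * real N\<rfloor>" by (simp add: le_floor_iff)
        also have "\<dots> \<longleftrightarrow> k < Suc (nat \<lfloor>y / s * real N\<rfloor>)"
          using True s by (auto simp: le_nat_iff less_Suc_eq_le)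
        finally show ?thesis .
      qed
      have "(\<Sum>k. ennreal (c k) * (ennreal (exp (- y)) * indicator {s * real k / real N..} y)) =
        (\<Sum>k<Suc (nat \<lfloor>y / s * real N\<rfloor>). ennreal (c k) * (ennreal (exp (- y)) * indicator {s * real k / real N..} y))"
        by (intro suminf_finite) (auto simp: iff simp del: sum.lessThan_Suc)
      also have "\<dots> = (\<Sum>k<Suc (nat \<lfloor>y / s * real N\<rfloor>). ennreal (exp (- y) * c k))"
        using c by (intro sum.cong) (auto simp: iff ennreal_mult mult.commute simp del: sum.lessThan_Suc)
      also have "\<dots> = ennreal (\<Sum>k<Suc (nat \<lfloor>y / s * real N\<rfloor>). exp (- y) * c k)"
        using c by (intro sum_ennreal) auto
      finally show ?thesis using True by (simp add: sum_distrib_left del: sum.lessThan_Suc)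
    qed
  qed
  finally show ?thesis .
qed

text \<open>After summation by parts the quotient is the integral of \<open>exp (- y)\<close> times
  \<open>A (M N y) / a N\<close>. Pointwise the second factor tends to
  \<open>C * (y / s) powr \<alpha>\<close>, whose integral against \<open>exp (- y)\<close> produces
  the Gamma function; the doubling bound provides domination.\<close>

theorem karamata_laplace:
  fixes a c :: "nat \<Rightarrow> real"
  assumes a: "mono a" "regularly_varying_seq a \<alpha>" "0 < \<alpha>" "\<alpha> \<le> 1"
    and c: "\<And>k. 0 \<le> c k" and lim: "(\<lambda>n. (\<Sum>k<n. c k) / a n) \<longlonglongrightarrow> C" and s: "0 < s"
    and summ: "\<And>N. 0 < N \<Longrightarrow> summable (\<lambda>k. exp (- (s / real N)) ^ k * c k)"
  shows "(\<lambda>N. (\<Sum>k. exp (- (s / real N)) ^ k * c k) / a N) \<longlonglongrightarrow> C * Gamma (1 + \<alpha>) * s powr (- \<alpha>)"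
proof -
  define A where "A n = (\<Sum>k<n. c k)" for n
  have A_mono: "A m \<le> A n" if "m \<le> n" for m n
    unfolding A_def using that c by (intro sum_mono2) auto
  have A_nonneg: "0 \<le> A n" for n unfolding A_def using c by (intro sum_nonneg) auto
  obtain n0 where n0: "0 < n0" "\<And>n i. n0 \<le> n \<Longrightarrow> 0 < a n \<and> a (2 ^ i * n) \<le> 4 ^ i * a n"
    using regularly_varying_polynomial_bound[OF a(1,2,4)] by blast
  have "Bseq (\<lambda>n. A n / a n)"
    using lim unfolding A_def by (intro convergent_imp_Bseq) (auto simp: convergent_def)
  then obtain K where K: "0 < K" "\<And>n. norm (A n / a n) \<le> K"
    by (auto simp: Bseq_def)
  have AK: "A n \<le> K * a n" if "n0 \<le> n" for n
    using K(2)[of n] n0(2)[OF that, of 0] A_nonneg[of n] by (auto simp: field_simps)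
  define M where "M N y = Suc (nat \<lfloor>y / s * real N\<rfloor>)" for N :: nat and y
  define F where "F N y = indicator {0..} y * (exp (- y) * A (M N y) / a N)" for N y
  define G where "G y = indicator {0..} y * (exp (- y) * (C * (y / s) powr \<alpha>))" for y
  \<comment> \<open>The dominating function; the square comes from the constant 4 in the doubling
    bound.\<close>
  define w where "w y = 4 * K * (y / s + 1)\<^sup>2 * exp (- y) * indicator {0..} y" for y :: real
  have bound: "A (M N y) / a N \<le> 4 * K * (y / s + 1)\<^sup>2" if N: "n0 \<le> N" and y: "0 \<le> y" for N y
  proof -
    \<comment> \<open>The summand 1 absorbs the extra term in \<open>M N y\<close>, because
      \<open>N\<close> is at least 1.\<close>
    define u where "u = y / s + 1"
    have u: "1 \<le> u" using y s by (simp add: u_def)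
    \<comment> \<open>The number of doublings that carry \<open>N\<close> beyond
      \<open>M N y\<close>; rounding up costs at most a factor 2.\<close>
    define i where "i = nat \<lceil>log 2 u\<rceil>"
    have "0 \<le> log 2 u" using u by simp
    then have i: "log 2 u \<le> real i" "real i \<le> log 2 u + 1" unfolding i_def by linarith+
    have "u = 2 powr log 2 u" using u by simp
    also have "\<dots> \<le> 2 powr real i" using i by (intro powr_mono) auto
    finally have ui: "u \<le> 2 ^ i" by (simp add: powr_realpow)
    have "(2::real) ^ i = 2 powr real i" by (simp add: powr_realpow)
    also have "\<dots> \<le> 2 powr (log 2 u + 1)" using i by (intro powr_mono) auto
    also have "\<dots> = 2 * u" using u by (simp add: powr_add)
    finally have iu: "(2::real) ^ i \<le> 2 * u" .
    have "real (nat \<lfloor>y / s * real N\<rfloor>) \<le> y / s * real N"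
      using y s by (intro of_nat_floor) auto
    then have "real (M N y) \<le> y / s * real N + 1" by (simp add: M_def)
    also have "\<dots> \<le> u * real N" using N n0(1) by (simp add: u_def algebra_simps)
    also have "\<dots> \<le> 2 ^ i * real N" using ui by (intro mult_right_mono) auto
    finally have "real (M N y) \<le> real (2 ^ i * N)" by simp
    then have MN: "M N y \<le> 2 ^ i * N" by (simp only: of_nat_le_iff)
    have "n0 \<le> 2 ^ i * N" using N by (metis le_trans mult_le_mono1 nat_mult_1 one_le_numeral one_le_power)
    then have "A (M N y) \<le> K * a (2 ^ i * N)" using A_mono[OF MN] AK by (meson order_trans)
    also have "\<dots> \<le> K * (4 ^ i * a N)" using n0(2)[OF N, of i] K by (intro mult_left_mono) auto
    also have "(4::real) ^ i = (2 ^ i)\<^sup>2" by (simp add: power2_eq_square flip: power_mult_distrib)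
    also have "K * ((2 ^ i)\<^sup>2 * a N) \<le> K * ((2 * u)\<^sup>2 * a N)"
      using iu K n0(2)[OF N, of 0] by (intro mult_left_mono mult_right_mono power_mono) auto
    finally show ?thesis
      unfolding u_def[symmetric] using n0(2)[OF N, of 0] by (simp add: field_simps power2_eq_square)
  qed
  have meas[measurable]: "F N \<in> borel_measurable lborel" for N
    unfolding F_def M_def by measurable
  have [measurable]: "G \<in> borel_measurable lborel" unfolding G_def by measurable
  have int_F: "integral\<^sup>L lborel (F N) = (\<Sum>k. exp (- (s / real N)) ^ k * c k) / a N" if N: "n0 \<le> N" for N
  proof -
    have Npos: "0 < N" and aN: "0 < a N" using N n0 by auto
    have "(\<integral>\<^sup>+y. ennreal (F N y) \<partial>lborel) =
      (\<integral>\<^sup>+y. ennreal (1 / a N) * (ennreal (exp (- y) * (\<Sum>k<Suc (nat \<lfloor>y / s * real N\<rfloor>). c k)) * indicator {0..} y) \<partial>lborel)"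
      using aN A_nonneg unfolding A_def
      by (intro nn_integral_cong)
        (auto simp: F_def M_def A_def ennreal_mult[symmetric] c sum_nonneg split: split_indicator)
    also have "\<dots> = ennreal (1 / a N) * (\<integral>\<^sup>+y. (ennreal (exp (- y) * (\<Sum>k<Suc (nat \<lfloor>y / s * real N\<rfloor>). c k)) * indicator {0..} y) \<partial>lborel)"
      by (intro nn_integral_cmult) measurable
    also have "\<dots> = ennreal (1 / a N) * (\<Sum>k. ennreal (exp (- (s / real N)) ^ k * c k))"
      by (simp only: laplace_sum_eq_integral[OF c s Npos])
    also have "(\<Sum>k. ennreal (exp (- (s / real N)) ^ k * c k)) = ennreal (\<Sum>k. exp (- (s / real N)) ^ k * c k)"
      using c summ[OF Npos] by (intro suminf_ennreal2) auto
    also have "ennreal (1 / a N) * \<dots> = ennreal ((\<Sum>k. exp (- (s / real N)) ^ k * c k) / a N)"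
      using aN c summ[OF Npos] by (subst ennreal_mult[symmetric]) (auto intro!: suminf_nonneg)
    finally have nn: "(\<integral>\<^sup>+y. ennreal (F N y) \<partial>lborel) = ennreal ((\<Sum>k. exp (- (s / real N)) ^ k * c k) / a N)" .
    have "integral\<^sup>L lborel (F N) = enn2real (\<integral>\<^sup>+y. ennreal (F N y) \<partial>lborel)"
      using aN A_nonneg by (intro integral_eq_nn_integral) (auto simp: F_def)
    moreover have "0 \<le> (\<Sum>k. exp (- (s / real N)) ^ k * c k) / a N"
      using aN c summ[OF Npos] by (intro divide_nonneg_pos suminf_nonneg) auto
    ultimately show ?thesis using nn by simp
  qed
  have int_w: "integrable lborel w"
  proof -
    have power: "integrable lborel (\<lambda>y. y ^ k * exp (- y) * indicator {0..} y :: real)" for k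
    proof (rule integrableI_nonneg)
      have "(\<integral>\<^sup>+y. ennreal (y ^ k * exp (- y) * indicator {0..} y) \<partial>lborel) = ennreal (real (fact k))"
        unfolding nn_intergal_power_times_exp_Ici[symmetric] by (intro nn_integral_cong) (simp split: split_indicator)
      then show "(\<integral>\<^sup>+y. ennreal (y ^ k * exp (- y) * indicator {0..} y) \<partial>lborel) < \<infinity>" by simp
    qed (auto split: split_indicator)
    have "integrable lborel (\<lambda>y. 4 * K * (1 / s\<^sup>2 * (y ^ 2 * exp (- y) * indicator {0..} y)
        + 2 / s * (y ^ 1 * exp (- y) * indicator {0..} y) + y ^ 0 * exp (- y) * indicator {0..} y))"
      by (intro integrable_mult_right Bochner_Integration.integrable_add power)
    then show ?thesis unfolding w_def by (simp add: power2_eq_square algebra_simps add_divide_distrib)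
  qed
  have conv: "(\<lambda>N. F (N + n0) y) \<longlonglongrightarrow> G y" if y: "y \<noteq> 0" for y
  proof (cases "0 < y")
    case False
    then show ?thesis using y by (simp add: F_def G_def)
  next
    case True
    then have b: "0 < y / s" using s by simp
    have Mtop: "filterlim (\<lambda>N. M N y) at_top sequentially"
      unfolding M_def by (rule filterlim_compose[OF filterlim_Suc floor_mult_at_top[OF b]])
    have "(\<lambda>N. (A (M N y) / a (M N y)) * (a (M N y) / a N)) \<longlonglongrightarrow> C * (y / s) powr \<alpha>"
    proof (rule tendsto_mult)
      show "(\<lambda>N. A (M N y) / a (M N y)) \<longlonglongrightarrow> C"
        using filterlim_compose[OF lim Mtop] by (simp add: A_def)
      show "(\<lambda>N. a (M N y) / a N) \<longlonglongrightarrow> (y / s) powr \<alpha>"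
        using regularly_varying_succ_floor[OF a(1,2) b] by (simp add: M_def)
    qed
    moreover have "eventually (\<lambda>N. n0 \<le> M N y) sequentially"
      using Mtop by (auto simp: filterlim_at_top)
    then have "eventually (\<lambda>N. (A (M N y) / a (M N y)) * (a (M N y) / a N) = A (M N y) / a N) sequentially"
      by eventually_elim (use n0(2)[of _ 0] in force)
    ultimately have "(\<lambda>N. A (M N y) / a N) \<longlonglongrightarrow> C * (y / s) powr \<alpha>"
      by (rule Lim_transform_eventually)
    then have "(\<lambda>N. exp (- y) * (A (M (N + n0) y) / a (N + n0))) \<longlonglongrightarrow> exp (- y) * (C * (y / s) powr \<alpha>)"
      by (intro tendsto_mult tendsto_const LIMSEQ_ignore_initial_segment)
    then show ?thesis using True by (simp add: F_def G_def)
  qed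
  have "(\<lambda>N. integral\<^sup>L lborel (F (N + n0))) \<longlonglongrightarrow> integral\<^sup>L lborel G"
  proof (rule integral_dominated_convergence[OF _ _ int_w])
    show "AE y in lborel. (\<lambda>N. F (N + n0) y) \<longlonglongrightarrow> G y"
      using AE_lborel_singleton[of 0] by eventually_elim (rule conv)
    fix N
    show "AE y in lborel. norm (F (N + n0) y) \<le> w y"
    proof (rule AE_I2)
      fix y :: real
      show "norm (F (N + n0) y) \<le> w y"
      proof (cases "0 \<le> y")
        case True
        have aN: "0 < a (N + n0)" using n0(2)[of "N + n0" 0] by simp
        have "exp (- y) * (A (M (N + n0) y) / a (N + n0)) \<le> exp (- y) * (4 * K * (y / s + 1)\<^sup>2)"
          using bound[OF _ True, of "N + n0"] by (intro mult_left_mono) auto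
        then show ?thesis using True A_nonneg aN by (simp add: F_def w_def mult.commute)
      qed (simp add: F_def w_def)
    qed
  qed auto
  then have 1: "(\<lambda>N. (\<Sum>k. exp (- (s / real N)) ^ k * c k) / a N) \<longlonglongrightarrow> integral\<^sup>L lborel G"
    by (simp add: int_F LIMSEQ_offset[where k = n0])
  have C: "0 \<le> C"
  proof (rule tendsto_lowerbound[OF lim])
    show "\<forall>\<^sub>F n in sequentially. 0 \<le> (\<Sum>k<n. c k) / a n"
      using eventually_ge_at_top[of n0]
      by eventually_elim (use n0(2)[of _ 0] A_nonneg in \<open>force simp: A_def\<close>)
  qed simp
  have "integral\<^sup>L lborel G = C * s powr (- \<alpha>) * Gamma (1 + \<alpha>)"
  proof -
    have "(\<integral>\<^sup>+y. ennreal (G y) \<partial>lborel) =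
      (\<integral>\<^sup>+y. ennreal (C * s powr (- \<alpha>)) * ennreal (indicator {0..} y * y powr (1 + \<alpha> - 1) / exp y) \<partial>lborel)"
    proof (intro nn_integral_cong)
      fix y :: real
      show "ennreal (G y) = ennreal (C * s powr (- \<alpha>)) * ennreal (indicator {0..} y * y powr (1 + \<alpha> - 1) / exp y)"
        using C s by (auto simp: G_def ennreal_mult[symmetric] powr_divide powr_minus exp_minus field_simps split: split_indicator)
    qed
    also have "\<dots> = ennreal (C * s powr (- \<alpha>)) * ennreal (Gamma (1 + \<alpha>))"
      using a(3) Gamma_conv_nn_integral_real[of "1 + \<alpha>"] by (subst nn_integral_cmult) auto
    also have "\<dots> = ennreal (C * s powr (- \<alpha>) * Gamma (1 + \<alpha>))"
      using C a(3) by (intro ennreal_mult[symmetric]) (auto intro!: Gamma_real_nonneg)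
    finally show ?thesis
      using C s a(3) by (intro integral_eq_nn_integral[THEN trans])
        (auto simp: G_def intro!: mult_nonneg_nonneg Gamma_real_nonneg split: split_indicator)
  qed
  with 1 show ?thesis by (simp add: mult_ac)
qed

text \<open>Because \<open>a\<close> is read at the floor, its generalised inverse is attained at an
  integer, the first index where \<open>a\<close> exceeds \<open>1 / m n\<close>. So
  \<open>1 / m n\<close> lies between \<open>a (N n - 1)\<close> and \<open>a (N n)\<close>, whose
  ratio tends to 1.\<close>

lemma scaling_eq_inverse_nat:
  assumes a: "mono a" "regularly_varying_seq a \<alpha>" "0 < \<alpha>"
    and m: "eventually (\<lambda>n. 0 < m n) sequentially" "m \<longlonglongrightarrow> 0"
  obtains N :: "nat \<Rightarrow> nat" where "filterlim N at_top sequentially"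
    "eventually (\<lambda>n. scaling a (m n) = 1 / real (N n)) sequentially"
    "(\<lambda>n. a (N n) * m n) \<longlonglongrightarrow> 1"
proof
  have top: "filterlim a at_top sequentially" by (rule regularly_varying_at_top[OF a])
  define N where "N n = (LEAST k. 1 / m n < a k)" for n
  have N: "1 / m n < a (N n)" for n
    unfolding N_def
  proof (rule LeastI_ex)
    have "eventually (\<lambda>k. 1 / m n < a k) sequentially"
      using top by (simp add: filterlim_at_top_dense)
    then show "\<exists>k. 1 / m n < a k" by (auto simp: eventually_sequentially)
  qed
  have N_least: "a k \<le> 1 / m n" if "k < N n" for k n
    using not_less_Least[of k "\<lambda>k. 1 / m n < a k"] that by (simp add: N_def)
  have inv_top: "filterlim (\<lambda>n. 1 / m n) at_top sequentially"
    using m by (auto intro!: filterlim_inverse_at_top simp: inverse_eq_divide[symmetric])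
  show Ntop: "filterlim N at_top sequentially"
    unfolding filterlim_at_top
  proof
    fix Z
    have "eventually (\<lambda>n. a Z < 1 / m n) sequentially"
      using inv_top by (simp add: filterlim_at_top_dense)
    then show "eventually (\<lambda>n. Z \<le> N n) sequentially"
    proof eventually_elim
      case (elim n)
      show ?case
      proof (rule ccontr)
        assume "\<not> Z \<le> N n"
        then have "a (N n) \<le> a Z" using monoD[OF a(1)] by simp
        then show False using N[of n] elim by simp
      qed
    qed
  qed
  have "gen_inverse a (1 / m n) = real (N n)" for n
  proof -
    have "{s. 0 \<le> s \<and> 1 / m n < a (nat \<lfloor>s\<rfloor>)} = {real (N n)..}"
    proof (intro set_eqI iffI)
      fix s :: real assume s: "s \<in> {s. 0 \<le> s \<and> 1 / m n < a (nat \<lfloor>s\<rfloor>)}"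
      then have "N n \<le> nat \<lfloor>s\<rfloor>" unfolding N_def by (intro Least_le) auto
      then have "real (N n) \<le> real (nat \<lfloor>s\<rfloor>)" by simp
      also have "\<dots> \<le> s" using s by (intro of_nat_floor) auto
      finally show "s \<in> {real (N n)..}" by simp
    next
      fix s :: real assume s: "s \<in> {real (N n)..}"
      then have "N n \<le> nat \<lfloor>s\<rfloor>" by (simp add: le_nat_floor)
      then have "1 / m n < a (nat \<lfloor>s\<rfloor>)" using N[of n] monoD[OF a(1)] by (meson less_le_trans)
      with s show "s \<in> {s. 0 \<le> s \<and> 1 / m n < a (nat \<lfloor>s\<rfloor>)}"
        using of_nat_0_le_iff order_trans by (metis (mono_tags, lifting) atLeast_iff mem_Collect_eq)
    qed
    then show ?thesis by (simp add: gen_inverse_def)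
  qed
  then show "eventually (\<lambda>n. scaling a (m n) = 1 / real (N n)) sequentially"
    by (simp add: scaling_def)
  have N1: "eventually (\<lambda>n. 1 \<le> N n) sequentially" using Ntop by (auto simp: filterlim_at_top)
  have pred: "filterlim (\<lambda>n. N n - 1) at_top sequentially"
    by (rule filterlim_compose[OF filterlim_minus_const_nat_at_top Ntop])
  have "eventually (\<lambda>n. a (Suc (N n - 1)) / a (N n - 1) = a (N n) / a (N n - 1)) sequentially"
    using N1 by eventually_elim simp
  with filterlim_compose[OF regularly_varying_Suc[OF a(1,2)] pred]
  have upper: "(\<lambda>n. a (N n) / a (N n - 1)) \<longlonglongrightarrow> 1" by (rule Lim_transform_eventually)
  have "eventually (\<lambda>n. 0 < a n) sequentially"
    using a(2) by (simp add: regularly_varying_seq_def)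
  then have pos': "eventually (\<lambda>n. 0 < a (N n - 1)) sequentially"
    using pred by (rule eventually_compose_filterlim)
  show "(\<lambda>n. a (N n) * m n) \<longlonglongrightarrow> 1"
  proof (rule tendsto_sandwich[OF _ _ tendsto_const upper])
    show "\<forall>\<^sub>F n in sequentially. 1 \<le> a (N n) * m n"
      using m(1)
    proof eventually_elim
      case (elim n)
      then show ?case using N[of n] by (simp add: field_simps)
    qed
    show "\<forall>\<^sub>F n in sequentially. a (N n) * m n \<le> a (N n) / a (N n - 1)"
      using N1 m(1) pos'
    proof eventually_elim
      case (elim n)
      have "a (N n - 1) \<le> 1 / m n" using elim N_least[of "N n - 1" n] by auto
      then have "m n \<le> 1 / a (N n - 1)" using elim by (simp add: field_simps)
      moreover have "0 \<le> a (N n)" using N[of n] elim(2) by (meson divide_pos_pos less_imp_le less_trans zero_less_one)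
      ultimately have "a (N n) * m n \<le> a (N n) * (1 / a (N n - 1))" by (rule mult_left_mono)
      then show ?case by simp
    qed
  qed
qed

section \<open>Excursions and passages between hits of cylinders\<close>

text \<open>A closed form of the iterated shift, chosen so that composition adds indices;
  \<open>funpow_left_shift\<close> makes the link to \<open>left_shift\<close>.\<close>

definition shift_by :: "nat \<Rightarrow> 'v seq \<Rightarrow> 'v seq" where
  "shift_by k z = (\<lambda>i. z (i + k))"

abbreviation seq_algebra :: "'v seq measure" where
  "seq_algebra \<equiv> PiM UNIV (\<lambda>_::nat. count_space UNIV)"

definition cyl :: "nat \<Rightarrow> 'v seq \<Rightarrow> 'v seq set" where
  "cyl k p = {z. \<forall>i<k. z i = p i}"

text \<open>The bound is inclusive, so the letter \<open>z N\<close> at which a past ends belongs to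
  the past and also to the future \<open>shift_by N z\<close>.\<close>

definition determined :: "nat \<Rightarrow> 'v seq set \<Rightarrow> bool" where
  "determined N D \<longleftrightarrow> (\<forall>z z'. (\<forall>i\<le>N. z i = z' i) \<longrightarrow> z \<in> D \<longrightarrow> z' \<in> D)"

lemma shift_by_shift_by [simp]: "shift_by k (shift_by l z) = shift_by (k + l) z"
  by (simp add: shift_by_def add.assoc)

lemma shift_by_0 [simp]: "shift_by 0 z = z"
  by (simp add: shift_by_def)

lemma shift_by_apply: "shift_by k z i = z (i + k)"
  by (simp add: shift_by_def)

lemma funpow_left_shift: "(left_shift ^^ k) z = shift_by k z"
  by (induction k) (auto simp: left_shift_def shift_by_def)

lemma measurable_shift_by [measurable]: "shift_by k \<in> measurable seq_algebra seq_algebra"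
  unfolding shift_by_def
proof (rule measurable_PiM_single')
  show "(\<lambda>z. z (i + k)) \<in> measurable seq_algebra (count_space UNIV)" for i
    by (rule measurable_component_singleton) simp
qed (simp add: PiE_def extensional_def)

lemma determinedD:
  assumes D: "determined N D" and eq: "\<And>i. i \<le> N \<Longrightarrow> z i = z' i"
  shows "z \<in> D \<longleftrightarrow> z' \<in> D"
proof -
  have "\<forall>i\<le>N. z i = z' i" "\<forall>i\<le>N. z' i = z i" using eq by auto
  then show ?thesis using D unfolding determined_def by blast
qed

lemma determinedI: "(\<And>z z'. (\<And>i. i \<le> N \<Longrightarrow> z i = z' i) \<Longrightarrow> z \<in> D \<Longrightarrow> z' \<in> D) \<Longrightarrow> determined N D"
  unfolding determined_def by blast

lemma determined_mono: "determined N D \<Longrightarrow> N \<le> N' \<Longrightarrow> determined N' D"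
  by (rule determinedI, rule determinedD[THEN iffD1]) auto

lemma determined_Int: "determined N D \<Longrightarrow> determined N E \<Longrightarrow> determined N (D \<inter> E)"
  by (rule determinedI) (auto dest: determinedD)

lemma determined_cyl: "k \<le> Suc N \<Longrightarrow> determined N (cyl k p)"
  unfolding determined_def cyl_def by auto

lemma determined_shift_by: "determined N D \<Longrightarrow> determined (N + l) (shift_by l -` D)"
proof (rule determinedI)
  fix z z' :: "nat \<Rightarrow> 'a"
  assume D: "determined N D" and "\<And>i. i \<le> N + l \<Longrightarrow> z i = z' i" and "z \<in> shift_by l -` D"
  then show "z' \<in> shift_by l -` D"
    using determinedD[OF D, of "shift_by l z" "shift_by l z'"] by (simp add: shift_by_def)
qed

text \<open>Over a countable alphabet there are only countably many words of a given length, so the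
  set is a countable union of cylinders.\<close>

lemma determined_sets:
  fixes D :: "'v::countable seq set"
  assumes "determined N D"
  shows "D \<in> sets seq_algebra"
proof -
  have "y \<in> D" if "z \<in> D" "y \<in> cyl (Suc N) z" for y z
    using determinedD[OF assms, of z y] that by (simp add: cyl_def less_Suc_eq_le)
  then have D: "D = (\<Union>z\<in>D. cyl (Suc N) z)"
    by (force simp: cyl_def)
  have "countable ((\<lambda>z. cyl (Suc N) z) ` D)"
  proof -
    have eq: "cyl (Suc N) z = {y. map y [0..<Suc N] = map z [0..<Suc N]}" for z :: "'v seq"
      by (auto simp: cyl_def map_eq_conv simp del: upt_Suc)
    have "(\<lambda>z. cyl (Suc N) z) ` D \<subseteq> range (\<lambda>w. {y. map y [0..<Suc N] = w})"
      unfolding eq by blast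
    then show ?thesis by (rule countable_subset) auto
  qed
  moreover have "cyl (Suc N) z \<in> sets seq_algebra" for z :: "'v seq"
  proof -
    have "cyl (Suc N) z = {y \<in> space seq_algebra. \<forall>i<Suc N. y i = z i}"
      by (auto simp: cyl_def space_PiM)
    also have "\<dots> \<in> sets seq_algebra" by measurable
    finally show ?thesis .
  qed
  ultimately have "\<Union> ((\<lambda>z. cyl (Suc N) z) ` D) \<in> sets seq_algebra"
    by (intro sets.countable_Union) auto
  with D show ?thesis by simp
qed

lemma cyl_sets [measurable]: "cyl k (p :: 'v::countable seq) \<in> sets seq_algebra"
  by (rule determined_sets[OF determined_cyl[of k k]]) simp

lemma suminf_single:
  fixes f :: "nat \<Rightarrow> ennreal"
  assumes "\<And>i. i \<noteq> l \<Longrightarrow> f i = 0"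
  shows "(\<Sum>i. f i) = f l"
  using suminf_finite[of "{l}" f] assms by auto

lemma ennreal_suminf_split:
  fixes f :: "nat \<Rightarrow> ennreal"
  shows "(\<Sum>i. f i) = (\<Sum>i<l. f i) + (\<Sum>i. f (i + l))"
  using suminf_offset[OF summableI, of f l] by (simp only: add.commute[of "sum f {..<l}"])

text \<open>The word of \<open>x\<close> visits its first letter \<open>x 0\<close> for the last time at index \<open>j\<close>. The measure \<open>M\<close>
  has conditionally almost constant density on cylinders, given a past that determines a visit to
  \<open>x 0\<close>; \<open>\<omega> k\<close> bounds the logarithmic oscillation on cylinders of length \<open>k\<close>.\<close>

locale regular_measure =
  fixes M :: "'v::countable seq measure" and x :: "'v seq" and \<omega> :: "nat \<Rightarrow> real" and j :: nat
  assumes sets_M: "sets M = sets seq_algebra"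
    and finite_Y: "emeasure M (cyl 1 x) < \<infinity>"
    and cyl_pos: "0 < emeasure M (cyl n x)"
    and oscillation: "\<omega> \<longlonglongrightarrow> 0"
    and last_visit: "x j = x 0" "\<And>i. j < i \<Longrightarrow> x i \<noteq> x 0"
    and distortion: "\<And>N D k p f g. 1 \<le> k \<Longrightarrow> determined N D \<Longrightarrow> D \<subseteq> {z. z N = x 0} \<Longrightarrow>
      f \<in> borel_measurable M \<Longrightarrow> g \<in> borel_measurable M \<Longrightarrow>
      (\<integral>\<^sup>+z\<in>D \<inter> shift_by N -` cyl k p. f (shift_by N z) \<partial>M) * (\<integral>\<^sup>+z\<in>cyl k p. g z \<partial>M) \<le>
      ennreal (exp (\<omega> k)) *
        ((\<integral>\<^sup>+z\<in>D \<inter> shift_by N -` cyl k p. g (shift_by N z) \<partial>M) * (\<integral>\<^sup>+z\<in>cyl k p. f z \<partial>M))"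
begin

text \<open>The pasts against which averages are tested. The class is stable under running on to the
  end of an excursion or to a visit before a hit, which is what permits iteration of the renewal
  argument.\<close>

definition detv :: "nat \<Rightarrow> 'v seq set \<Rightarrow> bool" where
  "detv N D \<longleftrightarrow> determined N D \<and> D \<subseteq> {z. z N = x 0} \<and> emeasure M D < top"

abbreviation B :: "nat \<Rightarrow> 'v seq set" where
  "B n \<equiv> cyl n x"

abbreviation past :: "nat \<Rightarrow> 'v seq set \<Rightarrow> ('v seq \<Rightarrow> ennreal) \<Rightarrow> ennreal" where
  "past N D f \<equiv> \<integral>\<^sup>+z\<in>D. f (shift_by N z) \<partial>M"

text \<open>Bounds on the conditional mean of \<open>f\<close> after any past, given that the future
  lies in \<open>E\<close>. Division by the measure of the past is avoided, so null pasts need no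
  case of their own.\<close>

definition mean_between :: "'v seq set \<Rightarrow> ennreal \<Rightarrow> ennreal \<Rightarrow> ('v seq \<Rightarrow> ennreal) \<Rightarrow> bool" where
  "mean_between E l u f \<longleftrightarrow> (\<forall>N D. detv N D \<longrightarrow>
    l * emeasure M (D \<inter> shift_by N -` E) \<le> past N (D \<inter> shift_by N -` E) f \<and>
    past N (D \<inter> shift_by N -` E) f \<le> u * emeasure M (D \<inter> shift_by N -` E))"

definition excursion :: "nat \<Rightarrow> 'v seq set" where
  "excursion l = {z. j < l \<and> z l = x 0 \<and> (\<forall>i. j < i \<and> i < l \<longrightarrow> z i \<noteq> x 0)}"

text \<open>The sets \<open>excursion l\<close> are disjoint, so at most one term survives: the sum
  is \<open>q\<close> to the excursion time, times \<open>H\<close> at its end. A point without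
  excursion gets 0, the natural value of \<open>q\<close> to the power infinity.\<close>

definition Exc :: "ennreal \<Rightarrow> ('v seq \<Rightarrow> ennreal) \<Rightarrow> 'v seq \<Rightarrow> ennreal" where
  "Exc q H z = (\<Sum>l. indicator (excursion l) z * (q ^ l * H (shift_by l z)))"

definition first_hit :: "nat \<Rightarrow> nat \<Rightarrow> 'v seq set" where
  "first_hit n l = {z. shift_by l z \<in> B n \<and> (\<forall>k<l. shift_by k z \<notin> B n)}"

text \<open>Same encoding as \<open>Exc\<close>, for the first hit. Time 0 counts as a hit, so
  \<open>Pass\<close> is trivial at a point of \<open>B n\<close>.\<close>

definition Pass :: "nat \<Rightarrow> ennreal \<Rightarrow> ('v seq \<Rightarrow> ennreal) \<Rightarrow> 'v seq \<Rightarrow> ennreal" where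
  "Pass n q K z = (\<Sum>l. indicator (first_hit n l) z * (q ^ l * K (shift_by l z)))"

definition G :: "nat \<Rightarrow> ennreal \<Rightarrow> 'v seq \<Rightarrow> ennreal" where
  "G n q z = (\<Sum>k. q ^ k * indicator (B n) (shift_by k z))"

definition exc_mean :: "nat \<Rightarrow> ennreal \<Rightarrow> ennreal" where
  "exc_mean n q = (\<integral>\<^sup>+z\<in>B n. Exc q (\<lambda>_. 1) z \<partial>M) / emeasure M (B n)"

lemma mean_between_UNIV:
  "mean_between UNIV l u f \<longleftrightarrow>
    (\<forall>N D. detv N D \<longrightarrow> l * emeasure M D \<le> past N D f \<and> past N D f \<le> u * emeasure M D)"
  by (simp add: mean_between_def)

lemma space_M [simp]: "space M = UNIV"
  using sets_eq_imp_space_eq[OF sets_M] by (simp add: space_PiM)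

lemma detv_sets: "detv N D \<Longrightarrow> D \<in> sets M"
  using determined_sets sets_M by (auto simp: detv_def)

lemma detv_subset: "detv N D \<Longrightarrow> determined l D' \<Longrightarrow> D' \<subseteq> D \<inter> {z. z l = x 0} \<Longrightarrow> detv l D'"
  using emeasure_mono[of D' D M] detv_sets[of N D] by (auto simp: detv_def le_less_trans)

lemma measurable_shift_by_M [measurable]: "shift_by k \<in> measurable M M"
  using measurable_shift_by by (simp add: measurable_cong_sets[OF sets_M sets_M])

lemma cyl_sets_M [measurable]: "cyl k p \<in> sets M"
  using cyl_sets sets_M by blast

lemma vimage_shift_by_sets [measurable]: "E \<in> sets M \<Longrightarrow> shift_by N -` E \<in> sets M"
  using measurable_sets[OF measurable_shift_by_M, of E N] by simp

lemma excursion_sets [measurable]: "excursion l \<in> sets M"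
proof -
  have "determined l (excursion l)"
    by (auto simp: determined_def excursion_def)
  then show ?thesis using determined_sets sets_M by blast
qed

lemma first_hit_sets [measurable]: "first_hit n l \<in> sets M"
proof -
  have "first_hit n l = {z \<in> space M. shift_by l z \<in> B n \<and> (\<forall>k<l. shift_by k z \<notin> B n)}"
    by (auto simp: first_hit_def)
  also have "\<dots> \<in> sets M" by measurable
  finally show ?thesis .
qed

lemma measurable_Exc [measurable]:
  assumes [measurable]: "H \<in> borel_measurable M"
  shows "Exc q H \<in> borel_measurable M"
proof -
  have [measurable]: "(\<lambda>z. H (shift_by l z)) \<in> borel_measurable M" for l
    by (rule measurable_compose[OF measurable_shift_by_M assms])
  show ?thesis unfolding Exc_def by measurable
qed

lemma measurable_Pass [measurable]:
  assumes [measurable]: "H \<in> borel_measurable M"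
  shows "Pass n q H \<in> borel_measurable M"
proof -
  have [measurable]: "(\<lambda>z. H (shift_by l z)) \<in> borel_measurable M" for l
    by (rule measurable_compose[OF measurable_shift_by_M assms])
  show ?thesis unfolding Pass_def by measurable
qed

lemma measurable_G [measurable]: "G n q \<in> borel_measurable M"
  unfolding G_def by measurable

lemma B_finite: "1 \<le> n \<Longrightarrow> emeasure M (B n) < \<infinity>"
proof -
  assume "1 \<le> n"
  then have "emeasure M (B n) \<le> emeasure M (cyl 1 x)"
    by (intro emeasure_mono cyl_sets_M) (auto simp: cyl_def)
  then show ?thesis using finite_Y by (rule le_less_trans)
qed

text \<open>If two occurrences overlapped, the lag would be a position of \<open>x 0\<close> in the
  word, hence at most \<open>j\<close>. Then position \<open>j\<close> plus the lag would carry
  \<open>x j = x 0\<close> as well, beyond the last visit; \<open>2 * j < n\<close> keeps this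
  position inside the word.\<close>

lemma no_overlap:
  assumes "2 * j < n" "shift_by k z \<in> B n" "shift_by l z \<in> B n" "k < l"
  shows "k + n \<le> l"
proof (rule ccontr)
  assume "\<not> k + n \<le> l"
  then have l: "l - k < n" using assms(1) by linarith
  have "x (l - k) = shift_by k z (l - k)" using assms(2) l by (auto simp: cyl_def)
  also have "\<dots> = shift_by l z 0" using assms(4) by (simp add: shift_by_def)
  also have "\<dots> = x 0" using assms(1,3) by (auto simp: cyl_def)
  finally have lk: "l - k \<le> j" using last_visit(2) by (meson not_le)
  have "x (j + (l - k)) = shift_by k z (j + (l - k))" using assms(1,2) lk by (auto simp: cyl_def)
  also have "\<dots> = shift_by l z j" using assms(4) by (simp add: shift_by_def)
  also have "\<dots> = x j" using assms(1,3) by (auto simp: cyl_def)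
  finally show False using last_visit assms(4) by auto
qed

lemma excursion_long:
  assumes "z \<in> B n" "z \<in> excursion l"
  shows "n \<le> l"
proof (rule ccontr)
  assume "\<not> n \<le> l"
  then have "z l = x l" using assms(1) by (simp add: cyl_def)
  then show False using assms(2) last_visit(2)[of l] by (simp add: excursion_def)
qed

lemma excursion_unique:
  assumes "z \<in> excursion l" "z \<in> excursion l'"
  shows "l = l'"
  using assms by (cases l l' rule: linorder_cases) (auto simp: excursion_def)

lemma first_hit_unique:
  assumes "z \<in> first_hit n l" "z \<in> first_hit n l'"
  shows "l = l'"
  using assms by (cases l l' rule: linorder_cases) (simp_all add: first_hit_def)

text \<open>A hit begins with the letter \<open>x 0\<close> and, by \<open>no_overlap\<close>, comes
  after time \<open>j\<close>; a hit before \<open>l\<close> would end the excursion too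
  early.\<close>

lemma no_hit_in_excursion:
  assumes "2 * j < n" "z \<in> B n" "0 < k" "shift_by k z \<in> B n" "z \<in> excursion l"
  shows "l \<le> k"
proof (rule ccontr)
  assume "\<not> l \<le> k"
  have "n \<le> k" using no_overlap[OF assms(1), of 0 z k] assms by simp
  moreover have "z k = x 0"
  proof -
    have "shift_by k z 0 = x 0" using assms(1,4) by (auto simp: cyl_def)
    then show ?thesis by (simp add: shift_by_def)
  qed
  ultimately show False using assms(1,5) \<open>\<not> l \<le> k\<close> by (auto simp: excursion_def)
qed

text \<open>The converse bookkeeping: the later hit is itself a visit to \<open>x 0\<close> after
  time \<open>j\<close>, so a first such visit exists.\<close>

lemma hit_after_excursion:
  assumes "2 * j < n" "z \<in> B n" "0 < k" "shift_by k z \<in> B n"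
  shows "\<exists>l\<le>k. z \<in> excursion l"
proof -
  have nk: "n \<le> k" using no_overlap[OF assms(1), of 0 z k] assms by simp
  have zk: "z k = x 0"
  proof -
    have "shift_by k z 0 = x 0" using assms(1,4) by (auto simp: cyl_def)
    then show ?thesis by (simp add: shift_by_def)
  qed
  define l where "l = (LEAST i. j < i \<and> z i = x 0)"
  have P: "j < k \<and> z k = x 0" using nk zk assms(1) by simp
  have "j < l \<and> z l = x 0" unfolding l_def by (rule LeastI[of _ k]) (rule P)
  moreover have "l \<le> k" unfolding l_def by (rule Least_le) (rule P)
  moreover have "z i \<noteq> x 0" if "j < i" "i < l" for i
    using not_less_Least[of i "\<lambda>i. j < i \<and> z i = x 0"] that unfolding l_def by blast
  ultimately show ?thesis unfolding excursion_def by blast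
qed

section \<open>Pointwise renewal identities\<close>

lemma Exc_eq:
  assumes "z \<in> excursion l"
  shows "Exc q H z = q ^ l * H (shift_by l z)"
proof -
  have "Exc q H z = indicator (excursion l) z * (q ^ l * H (shift_by l z))"
    unfolding Exc_def using excursion_unique[OF assms] by (intro suminf_single) (auto split: split_indicator)
  then show ?thesis using assms by simp
qed

lemma Exc_eq_0: "(\<And>l. z \<notin> excursion l) \<Longrightarrow> Exc q H z = 0"
  unfolding Exc_def by simp

lemma Pass_eq:
  assumes "z \<in> first_hit n l"
  shows "Pass n q K z = q ^ l * K (shift_by l z)"
proof -
  have "Pass n q K z = indicator (first_hit n l) z * (q ^ l * K (shift_by l z))"
    unfolding Pass_def using first_hit_unique[OF assms] by (intro suminf_single) (auto split: split_indicator)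
  then show ?thesis using assms by simp
qed

lemma Pass_eq_0: "(\<And>l. z \<notin> first_hit n l) \<Longrightarrow> Pass n q K z = 0"
  unfolding Pass_def by simp

lemma first_hit_ex: "shift_by k z \<in> B n \<Longrightarrow> \<exists>l\<le>k. z \<in> first_hit n l"
proof -
  assume *: "shift_by k z \<in> B n"
  define l where "l = (LEAST i. shift_by i z \<in> B n)"
  have "shift_by l z \<in> B n" unfolding l_def by (rule LeastI) (rule *)
  moreover have "l \<le> k" unfolding l_def by (rule Least_le) (rule *)
  moreover have "shift_by i z \<notin> B n" if "i < l" for i
    using not_less_Least that unfolding l_def by blast
  ultimately show ?thesis unfolding first_hit_def by blast
qed

lemma G_shift_by:
  assumes "\<And>k. k < l \<Longrightarrow> shift_by k z \<notin> B n"
  shows "G n q z = q ^ l * G n q (shift_by l z)"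
proof -
  have "G n q z = (\<Sum>k<l. q ^ k * indicator (B n) (shift_by k z)) + (\<Sum>k. q ^ (k + l) * indicator (B n) (shift_by (k + l) z))"
    unfolding G_def by (rule ennreal_suminf_split)
  also have "(\<Sum>k<l. q ^ k * indicator (B n) (shift_by k z)) = 0"
    using assms by (intro sum.neutral) auto
  also have "(\<Sum>k. q ^ (k + l) * indicator (B n) (shift_by (k + l) z)) = q ^ l * G n q (shift_by l z)"
    unfolding G_def by (subst ennreal_suminf_cmult[symmetric]) (simp add: power_add mult_ac)
  finally show ?thesis by simp
qed

text \<open>The present hit contributes 1. The excursion contains no other hit, so the count resumes
  at its end with the discount accumulated until then.\<close>

lemma G_on_B:
  assumes n: "2 * j < n" and z: "z \<in> B n"
  shows "G n q z = 1 + Exc q (G n q) z"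
proof -
  have "G n q z = (\<Sum>k<Suc 0. q ^ k * indicator (B n) (shift_by k z)) + (\<Sum>k. q ^ (k + Suc 0) * indicator (B n) (shift_by (k + Suc 0) z))"
    unfolding G_def by (rule ennreal_suminf_split)
  also have "\<dots> = 1 + q * G n q (shift_by 1 z)"
    unfolding G_def using z by (subst ennreal_suminf_cmult[symmetric]) (simp add: mult_ac)
  also have "q * G n q (shift_by 1 z) = Exc q (G n q) z"
  proof (cases "\<exists>l. z \<in> excursion l")
    case True
    then obtain l where l: "z \<in> excursion l" by blast
    then have "0 < l" by (auto simp: excursion_def)
    have "G n q (shift_by 1 z) = q ^ (l - 1) * G n q (shift_by (l - 1) (shift_by 1 z))"
      using no_hit_in_excursion[OF n z _ _ l] by (intro G_shift_by) (auto, force)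
    then show ?thesis using \<open>0 < l\<close>
      by (simp add: Exc_eq[OF l] mult.assoc[symmetric] power_Suc[symmetric] del: power_Suc)
  next
    case False
    have "shift_by (Suc k) z \<notin> B n" for k
      using hit_after_excursion[OF n z, of "Suc k"] False by blast
    then have "G n q (shift_by 1 z) = 0" by (simp add: G_def)
    then show ?thesis using False by (simp add: Exc_eq_0)
  qed
  finally show ?thesis .
qed

text \<open>The pointwise form of the renewal equation: nothing is counted before the first hit, and
  \<open>G_on_B\<close> takes over there.\<close>

lemma G_eq_Pass:
  assumes n: "2 * j < n"
  shows "G n q z = Pass n q (\<lambda>y. 1 + Exc q (G n q) y) z"
proof (cases "\<exists>l. z \<in> first_hit n l")
  case True
  then obtain l where l: "z \<in> first_hit n l" by blast
  then show ?thesis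
    using G_shift_by[of l z n q] G_on_B[OF n, of "shift_by l z" q] by (simp add: Pass_eq[OF l] first_hit_def)
next
  case False
  then have "shift_by k z \<notin> B n" for k using first_hit_ex by blast
  then show ?thesis using False by (simp add: Pass_eq_0 G_def)
qed

section \<open>Averages of excursions and passages over pasts\<close>

lemma exc_integral:
  assumes [measurable]: "H \<in> borel_measurable M" and D: "detv N D"
  shows "past N (D \<inter> shift_by N -` B n) (Exc q H) =
    (\<Sum>l. q ^ l * past (l + N) (D \<inter> shift_by N -` (B n \<inter> excursion l)) H)"
proof -
  have [measurable]: "D \<in> sets M" using D by (rule detv_sets)
  have "past N (D \<inter> shift_by N -` B n) (Exc q H) =
    (\<integral>\<^sup>+z. (\<Sum>l. q ^ l * (H (shift_by (l + N) z) * indicator (D \<inter> shift_by N -` (B n \<inter> excursion l)) z)) \<partial>M)"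
    unfolding Exc_def ennreal_suminf_multc[symmetric]
    by (intro nn_integral_cong suminf_cong) (auto split: split_indicator)
  also have "\<dots> = (\<Sum>l. q ^ l * past (l + N) (D \<inter> shift_by N -` (B n \<inter> excursion l)) H)"
    by (subst nn_integral_suminf) (auto simp: vimage_Int intro!: suminf_cong nn_integral_cmult)
  finally show ?thesis .
qed

text \<open>When \<open>n \<le> l\<close>, all letters prescribed by \<open>B n\<close> already lie
  in the new past. Shorter excursions do not occur on \<open>B n\<close>, since the word avoids
  \<open>x 0\<close> after position \<open>j\<close>.\<close>

lemma detv_excursion:
  assumes D: "detv N D"
  shows "detv (l + N) (D \<inter> shift_by N -` (B n \<inter> excursion l))"
proof (cases "n \<le> l")
  case True
  have "determined l (B n \<inter> excursion l)"
    using True by (auto simp: determined_def cyl_def excursion_def)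
  from determined_shift_by[OF this] have "determined (l + N) (D \<inter> shift_by N -` (B n \<inter> excursion l))"
    using D by (intro determined_Int) (auto simp: detv_def intro: determined_mono)
  then show ?thesis by (intro detv_subset[OF D]) (auto simp: excursion_def shift_by_def)
next
  case False
  then have "B n \<inter> excursion l = {}" using excursion_long by auto
  then show ?thesis by (simp add: detv_def determined_def)
qed

lemma emeasure_B:
  assumes "1 \<le> n"
  shows "emeasure M (B n) \<noteq> 0" "emeasure M (B n) \<noteq> top"
  using cyl_pos[of n] B_finite[OF assms] by (simp_all only: zero_less_iff_neq_zero infinity_ennreal_def less_top not_False_eq_True)

lemma exc_mean_mult:
  assumes "1 \<le> n"
  shows "exc_mean n q * emeasure M (B n) = (\<integral>\<^sup>+z\<in>B n. Exc q (\<lambda>_. 1) z \<partial>M)"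
proof -
  have "emeasure M (B n) / emeasure M (B n) = 1"
    using emeasure_B[OF assms] by (intro ennreal_divide_self) (simp_all only: less_top not_False_eq_True)
  then show ?thesis by (simp only: exc_mean_def ennreal_divide_times mult_1_right)
qed

text \<open>The distortion hypothesis restricted to two subsets of one cylinder: it is applied to
  \<open>f\<close> on \<open>E\<close> and to the constant 1 on \<open>F\<close>, and once more with
  the two functions exchanged.\<close>

lemma past_distortion:
  assumes i: "1 \<le> i" and D: "detv N D" and f [measurable]: "f \<in> borel_measurable M"
    and [measurable]: "E \<in> sets M" "F \<in> sets M" and E: "E \<subseteq> cyl i p" and F: "F \<subseteq> cyl i p"
  shows "past N (D \<inter> shift_by N -` E) f * emeasure M F \<le>
      ennreal (exp (\<omega> i)) * (emeasure M (D \<inter> shift_by N -` F) * (\<integral>\<^sup>+z\<in>E. f z \<partial>M))"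
    and "emeasure M (D \<inter> shift_by N -` F) * (\<integral>\<^sup>+z\<in>E. f z \<partial>M) \<le>
      ennreal (exp (\<omega> i)) * (past N (D \<inter> shift_by N -` E) f * emeasure M F)"
proof -
  note [measurable] = detv_sets[OF D]
  have D': "determined N D" "D \<subseteq> {z. z N = x 0}" using D by (simp_all add: detv_def)
  have past: "(\<integral>\<^sup>+z\<in>D \<inter> shift_by N -` cyl i p. g (shift_by N z) * indicator H (shift_by N z) \<partial>M) =
      past N (D \<inter> shift_by N -` H) g"
    and present: "(\<integral>\<^sup>+z\<in>cyl i p. g z * indicator H z \<partial>M) = (\<integral>\<^sup>+z\<in>H. g z \<partial>M)"
    if "H \<subseteq> cyl i p" for g :: "_ \<Rightarrow> ennreal" and H
    using that by (auto intro!: nn_integral_cong split: split_indicator)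
  have one: "(\<integral>\<^sup>+z\<in>H. 1 \<partial>M) = emeasure M H" if "H \<in> sets M" for H using that by simp
  note * = past[OF E, of f] past[OF F, of "\<lambda>_. 1"] present[OF E, of f] present[OF F, of "\<lambda>_. 1"]
  show "past N (D \<inter> shift_by N -` E) f * emeasure M F \<le>
      ennreal (exp (\<omega> i)) * (emeasure M (D \<inter> shift_by N -` F) * (\<integral>\<^sup>+z\<in>E. f z \<partial>M))"
    using distortion[OF i D', of "\<lambda>z. f z * indicator E z" "\<lambda>z. 1 * indicator F z" p] unfolding * by (simp add: one)
  show "emeasure M (D \<inter> shift_by N -` F) * (\<integral>\<^sup>+z\<in>E. f z \<partial>M) \<le>
      ennreal (exp (\<omega> i)) * (past N (D \<inter> shift_by N -` E) f * emeasure M F)"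
    using distortion[OF i D', of "\<lambda>z. 1 * indicator F z" "\<lambda>z. f z * indicator E z" p] unfolding * by (simp add: one)
qed

text \<open>Conditioned on the whole word \<open>B n\<close>, the excursion can feel the past only
  through a density that oscillates by \<open>\<omega> n\<close>. The cross-multiplied inequality is
  divided by the positive finite measure of \<open>B n\<close>.\<close>

lemma exc_distortion:
  assumes n: "1 \<le> n" and D: "detv N D"
  shows "past N (D \<inter> shift_by N -` B n) (Exc q (\<lambda>_. 1)) \<le>
      ennreal (exp (\<omega> n)) * (exc_mean n q * emeasure M (D \<inter> shift_by N -` B n))" (is "?E \<le> _")
    and "exc_mean n q * emeasure M (D \<inter> shift_by N -` B n) \<le>
      ennreal (exp (\<omega> n)) * past N (D \<inter> shift_by N -` B n) (Exc q (\<lambda>_. 1))"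
proof -
  have [measurable]: "Exc q (\<lambda>_. 1) \<in> borel_measurable M" by measurable
  note dist = past_distortion[OF n D this cyl_sets_M cyl_sets_M order_refl order_refl, of x, folded exc_mean_mult[OF n]]
  have "emeasure M (B n) * ?E \<le> emeasure M (B n) * (ennreal (exp (\<omega> n)) * (exc_mean n q * emeasure M (D \<inter> shift_by N -` B n)))"
    "emeasure M (B n) * (exc_mean n q * emeasure M (D \<inter> shift_by N -` B n)) \<le> emeasure M (B n) * (ennreal (exp (\<omega> n)) * ?E)"
    using dist by (simp_all only: mult_ac)
  then show "?E \<le> ennreal (exp (\<omega> n)) * (exc_mean n q * emeasure M (D \<inter> shift_by N -` B n))"
    "exc_mean n q * emeasure M (D \<inter> shift_by N -` B n) \<le> ennreal (exp (\<omega> n)) * ?E"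
    unfolding ennreal_mult_le_mult_iff[OF emeasure_B[OF n]] .
qed

text \<open>Each possible excursion end produces a past to which the bounds on \<open>H\<close>
  apply, so these bounds factor out of the sum; what remains is the excursion mean, controlled by
  \<open>exc_distortion\<close>.\<close>

lemma exc_between:
  assumes n: "1 \<le> n" and [measurable]: "H \<in> borel_measurable M" and H: "mean_between UNIV l u H"
  shows "mean_between (B n) (l * (ennreal (exp (- \<omega> n)) * exc_mean n q)) (u * (ennreal (exp (\<omega> n)) * exc_mean n q)) (Exc q H)"
  unfolding mean_between_def
proof (intro allI impI conjI)
  fix N D assume D: "detv N D"
  let ?D = "D \<inter> shift_by N -` B n"
  define X where "X l = D \<inter> shift_by N -` (B n \<inter> excursion l)" for l
  have X: "detv (l + N) (X l)" for l unfolding X_def by (rule detv_excursion[OF D])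
  note [measurable] = detv_sets[OF X]
  let ?E = "past N ?D (Exc q (\<lambda>_. 1))"
  have sums: "(\<Sum>l. q ^ l * (c * emeasure M (X l))) = c * ?E" for c
    unfolding exc_integral[OF borel_measurable_const D] X_def[symmetric]
    by (subst ennreal_suminf_cmult[symmetric]) (simp add: mult.left_commute)
  have H': "l * emeasure M (X k) \<le> past (k + N) (X k) H" "past (k + N) (X k) H \<le> u * emeasure M (X k)" for k
    using H X[of k] by (auto simp: mean_between_def)
  have "l * (ennreal (exp (- \<omega> n)) * (exc_mean n q * emeasure M ?D)) \<le> l * (ennreal (exp (- \<omega> n)) * (ennreal (exp (\<omega> n)) * ?E))"
    by (intro mult_left_mono exc_distortion[OF n D]) auto
  also have "\<dots> = l * ?E" by (simp add: mult.assoc[symmetric] ennreal_mult[symmetric] flip: exp_add)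
  also have "\<dots> \<le> past N ?D (Exc q H)"
    unfolding sums[symmetric] exc_integral[OF assms(2) D] X_def[symmetric] by (intro suminf_le mult_left_mono H') auto
  finally show "l * (ennreal (exp (- \<omega> n)) * exc_mean n q) * emeasure M ?D \<le> past N ?D (Exc q H)" by (simp add: mult_ac)
  have "past N ?D (Exc q H) \<le> u * ?E"
    unfolding sums[symmetric] exc_integral[OF assms(2) D] X_def[symmetric] by (intro suminf_le mult_left_mono H') auto
  also have "\<dots> \<le> u * (ennreal (exp (\<omega> n)) * (exc_mean n q * emeasure M ?D))"
    by (intro mult_left_mono exc_distortion[OF n D]) auto
  finally show "past N ?D (Exc q H) \<le> u * (ennreal (exp (\<omega> n)) * exc_mean n q) * emeasure M ?D" by (simp add: mult_ac)
qed

text \<open>A hit at time \<open>l\<close> is decided only by letters after \<open>l\<close>. This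
  set retains the part known at time \<open>l\<close>: a visit to \<open>x 0\<close>, and no
  occurrence of the word completed before \<open>l\<close>.\<close>

definition before_hit :: "nat \<Rightarrow> nat \<Rightarrow> nat \<Rightarrow> 'v seq set" where
  "before_hit n N l = {z. z (l + N) = x 0 \<and> (\<forall>k. k + n \<le> l \<longrightarrow> shift_by (k + N) z \<notin> B n)}"

lemma detv_before_hit:
  assumes D: "detv N D"
  shows "detv (l + N) (D \<inter> before_hit n N l)"
proof -
  have "determined (l + N) (before_hit n N l)"
  proof (rule determinedI)
    fix z z' :: "'v seq" assume eq: "\<And>i. i \<le> l + N \<Longrightarrow> z i = z' i" and z: "z \<in> before_hit n N l"
    have "shift_by (k + N) z' \<in> B n \<longleftrightarrow> shift_by (k + N) z \<in> B n" if "k + n \<le> l" for k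
      using eq that by (auto simp: cyl_def shift_by_def)
    then show "z' \<in> before_hit n N l" using z eq by (auto simp: before_hit_def)
  qed
  moreover have "determined (l + N) D" using D by (auto simp: detv_def intro: determined_mono)
  ultimately show ?thesis
    by (intro detv_subset[OF D] determined_Int) (auto simp: before_hit_def)
qed

text \<open>Earlier hits whose word would still be running at time \<open>l\<close> are excluded by
  \<open>no_overlap\<close> once a hit occurs at \<open>l\<close>. Thus a first hit splits into a
  determined past and a hit.\<close>

lemma first_hit_eq:
  assumes n: "2 * j < n"
  shows "shift_by N -` first_hit n l = before_hit n N l \<inter> shift_by (l + N) -` B n"
proof (intro set_eqI iffI)
  fix z assume z: "z \<in> shift_by N -` first_hit n l"
  then have "shift_by (l + N) z 0 = x 0" using n by (auto simp: first_hit_def cyl_def)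
  moreover have "shift_by (k + N) z \<notin> B n" if "k + n \<le> l" for k
    using z that n by (auto simp: first_hit_def)
  ultimately show "z \<in> before_hit n N l \<inter> shift_by (l + N) -` B n"
    using z by (auto simp: first_hit_def before_hit_def shift_by_apply)
next
  fix z assume z: "z \<in> before_hit n N l \<inter> shift_by (l + N) -` B n"
  have "shift_by k (shift_by N z) \<notin> B n" if "k < l" for k
  proof
    assume "shift_by k (shift_by N z) \<in> B n"
    then have "k + n \<le> l" using no_overlap[OF n, of k "shift_by N z" l] z that by auto
    then show False using z \<open>shift_by k (shift_by N z) \<in> B n\<close> by (auto simp: before_hit_def)
  qed
  then show "z \<in> shift_by N -` first_hit n l" using z by (auto simp: first_hit_def)
qed

lemma pass_integral:
  assumes n: "2 * j < n" and [measurable]: "K \<in> borel_measurable M" and D: "detv N D"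
  shows "past N D (Pass n q K) =
    (\<Sum>l. q ^ l * past (l + N) ((D \<inter> before_hit n N l) \<inter> shift_by (l + N) -` B n) K)"
proof -
  have [measurable]: "D \<in> sets M" using D by (rule detv_sets)
  have "past N D (Pass n q K) =
    (\<integral>\<^sup>+z. (\<Sum>l. q ^ l * (K (shift_by (l + N) z) * indicator (D \<inter> shift_by N -` first_hit n l) z)) \<partial>M)"
    unfolding Pass_def ennreal_suminf_multc[symmetric]
    by (intro nn_integral_cong suminf_cong) (auto split: split_indicator)
  also have "\<dots> = (\<Sum>l. q ^ l * past (l + N) (D \<inter> shift_by N -` first_hit n l) K)"
    by (subst nn_integral_suminf) (auto intro!: suminf_cong nn_integral_cmult)
  finally show ?thesis by (simp add: first_hit_eq[OF n] Int_assoc)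
qed

text \<open>The decomposition \<open>first_hit_eq\<close> exhibits each first hit as a past followed
  by \<open>B n\<close>, exactly where the bounds on \<open>K\<close> are available.\<close>

lemma pass_between:
  assumes n: "2 * j < n" and [measurable]: "K \<in> borel_measurable M" and K: "mean_between (B n) l u K" and D: "detv N D"
  shows "l * past N D (Pass n q (\<lambda>_. 1)) \<le> past N D (Pass n q K)" "past N D (Pass n q K) \<le> u * past N D (Pass n q (\<lambda>_. 1))"
proof -
  define X where "X l = (D \<inter> before_hit n N l) \<inter> shift_by (l + N) -` B n" for l
  have [measurable]: "X l \<in> sets M" for l
    using detv_sets[OF detv_before_hit[OF D]] unfolding X_def by measurable
  have sums: "(\<Sum>l. q ^ l * (c * emeasure M (X l))) = c * past N D (Pass n q (\<lambda>_. 1))" for c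
    unfolding pass_integral[OF n borel_measurable_const D] X_def[symmetric]
    by (subst ennreal_suminf_cmult[symmetric]) (simp add: mult.left_commute)
  have K': "l * emeasure M (X k) \<le> past (k + N) (X k) K" "past (k + N) (X k) K \<le> u * emeasure M (X k)" for k
    using K detv_before_hit[OF D, of k n] unfolding X_def mean_between_def by blast+
  show "l * past N D (Pass n q (\<lambda>_. 1)) \<le> past N D (Pass n q K)" "past N D (Pass n q K) \<le> u * past N D (Pass n q (\<lambda>_. 1))"
    unfolding sums[symmetric] pass_integral[OF n assms(2) D] X_def[symmetric] by (intro suminf_le mult_left_mono K'; simp)+
qed

text \<open>By \<open>G_eq_Pass\<close>, the count is the passage plus the passage followed by an
  excursion and a new count. Bounding the new count by the same constants gives linear inequalities
  for the passage mean \<open>X\<close>.\<close>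

lemma renewal_bounds:
  assumes n: "2 * j < n" and G: "mean_between UNIV Rm Rp (G n q)" and D: "detv N D"
  defines "X \<equiv> past N D (Pass n q (\<lambda>_. 1))"
  shows "Rm * emeasure M D \<le> (1 + Rp * (ennreal (exp (\<omega> n)) * exc_mean n q)) * X"
    and "(1 + Rm * (ennreal (exp (- \<omega> n)) * exc_mean n q)) * X \<le> Rp * emeasure M D"
proof -
  have n1: "1 \<le> n" using n by simp
  have [measurable]: "D \<in> sets M" using D by (rule detv_sets)
  let ?P = "past N D (Pass n q (Exc q (G n q)))"
  have "G n q z = Pass n q (\<lambda>_. 1) z + Pass n q (Exc q (G n q)) z" for z
    unfolding G_eq_Pass[OF n, of q z] unfolding Pass_def
    by (subst suminf_add) (auto simp: distrib_left)
  then have "past N D (G n q) =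
    (\<integral>\<^sup>+z. Pass n q (\<lambda>_. 1) (shift_by N z) * indicator D z + Pass n q (Exc q (G n q)) (shift_by N z) * indicator D z \<partial>M)"
    by (simp add: distrib_right)
  also have "\<dots> = X + ?P"
    unfolding X_def by (intro nn_integral_add) measurable
  finally have eq: "past N D (G n q) = X + ?P" .
  have GD: "Rm * emeasure M D \<le> X + ?P" "X + ?P \<le> Rp * emeasure M D"
    using G D unfolding mean_between_def eq[symmetric] by auto
  have "mean_between (B n) (Rm * (ennreal (exp (- \<omega> n)) * exc_mean n q)) (Rp * (ennreal (exp (\<omega> n)) * exc_mean n q)) (Exc q (G n q))"
    by (rule exc_between[OF n1 _ G]) measurable
  note P = pass_between[OF n _ this D, of q, folded X_def]
  show "Rm * emeasure M D \<le> (1 + Rp * (ennreal (exp (\<omega> n)) * exc_mean n q)) * X"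
    unfolding distrib_right mult_1_left using P(2) by (intro order_trans[OF GD(1)] add_left_mono) measurable
  show "(1 + Rm * (ennreal (exp (- \<omega> n)) * exc_mean n q)) * X \<le> Rp * emeasure M D"
    unfolding distrib_right mult_1_left using P(1) by (intro order_trans[OF _ GD(2)] add_left_mono) measurable
qed

end

section \<open>The mean number of hits\<close>

text \<open>A squeeze with an auxiliary parameter: \<open>n\<close> tends to infinity first, for
  fixed \<open>k\<close>, and then \<open>k\<close> does. The range of \<open>n\<close> in which the
  bounds hold may depend on \<open>k\<close>.\<close>

lemma tendsto_double_bound:
  fixes f :: "nat \<Rightarrow> real"
  assumes ev: "eventually (\<lambda>k. l k \<longlonglongrightarrow> l' k \<and> u k \<longlonglongrightarrow> u' k \<and>
      eventually (\<lambda>n. l k n \<le> f n \<and> f n \<le> u k n) sequentially) sequentially"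
    and lim: "l' \<longlonglongrightarrow> c" "u' \<longlonglongrightarrow> c"
  shows "f \<longlonglongrightarrow> c"
proof (rule order_tendstoI)
  fix y assume "y < c"
  from eventually_happens'[OF sequentially_bot eventually_conj[OF order_tendstoD(1)[OF lim(1) this] ev]]
  obtain k where k: "y < l' k" "l k \<longlonglongrightarrow> l' k" "eventually (\<lambda>n. l k n \<le> f n \<and> f n \<le> u k n) sequentially"
    by blast
  from order_tendstoD(1)[OF k(2,1)] k(3) show "eventually (\<lambda>n. y < f n) sequentially" by eventually_elim simp
next
  fix y assume "c < y"
  from eventually_happens'[OF sequentially_bot eventually_conj[OF order_tendstoD(2)[OF lim(2) this] ev]]
  obtain k where k: "u' k < y" "u k \<longlonglongrightarrow> u' k" "eventually (\<lambda>n. l k n \<le> f n \<and> f n \<le> u k n) sequentially"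
    by blast
  from order_tendstoD(2)[OF k(2,1)] k(3) show "eventually (\<lambda>n. f n < y) sequentially" by eventually_elim simp
qed

lemma weighted_suminf_le:
  fixes w f g :: "nat \<Rightarrow> real"
  assumes s: "summable (\<lambda>k. w k * f k)" "summable (\<lambda>k. w k * g k)" and w: "\<And>k. 0 \<le> w k"
    and le: "\<And>k. f k * b \<le> c * g k"
  shows "(\<Sum>k. w k * f k) * b \<le> c * (\<Sum>k. w k * g k)"
proof -
  have "w k * f k * b \<le> c * (w k * g k)" for k using mult_left_mono[OF le w, of k k] by (simp add: mult_ac)
  then have "(\<Sum>k. w k * f k * b) \<le> (\<Sum>k. c * (w k * g k))"
    by (intro suminf_le summable_mult summable_mult2 s)
  then show ?thesis by (simp add: suminf_mult2[OF s(1), symmetric] suminf_mult[OF s(2), symmetric])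
qed

text \<open>Turns a property valid eventually for each fixed tolerance into one with a tolerance
  tending to 0, by letting the tolerance shrink as slowly as the thresholds \<open>K\<close>
  demand.\<close>

lemma eventually_diagonal:
  assumes "\<And>e::real. 0 < e \<Longrightarrow> eventually (P e) sequentially"
  obtains e :: "nat \<Rightarrow> real" where "e \<longlonglongrightarrow> 0" "eventually (\<lambda>n. P (e n) n) sequentially"
proof -
  have "\<forall>m. \<exists>K. \<forall>n\<ge>K. P (1 / real (Suc m)) n"
    using assms[of "1 / real (Suc _)"] by (simp add: eventually_sequentially)
  then obtain K where K: "\<And>m n. K m \<le> n \<Longrightarrow> P (1 / real (Suc m)) n" by metis
  \<comment> \<open>The index 0 is inserted so that the maximum exists before the first threshold is
    reached.\<close>
  define S where "S n = insert 0 {m. m \<le> n \<and> K m \<le> n}" for n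
  define idx where "idx n = Max (S n)" for n
  have fin: "finite (S n)" for n unfolding S_def by simp
  have idx: "idx n \<in> S n" for n unfolding idx_def using fin by (intro Max_in) (auto simp: S_def)
  have PK: "P (1 / real (Suc (idx n))) n" if "K 0 \<le> n" for n
  proof -
    have "K (idx n) \<le> n" using idx[of n] that by (auto simp: S_def)
    then show ?thesis by (rule K)
  qed
  have "m \<le> idx n" if "m \<le> n" "K m \<le> n" for m n
    unfolding idx_def using fin that by (intro Max_ge) (auto simp: S_def)
  then have "filterlim idx at_top sequentially"
    unfolding filterlim_at_top eventually_sequentially by (metis max.bounded_iff order_refl)
  then have "(\<lambda>n. 1 / real (Suc (idx n))) \<longlonglongrightarrow> 0"
    by (rule filterlim_compose[OF LIMSEQ_inverse_real_of_nat[unfolded inverse_eq_divide]])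
  moreover have "eventually (\<lambda>n. P (1 / real (Suc (idx n))) n) sequentially"
    using PK by (auto simp: eventually_sequentially)
  ultimately show thesis by (rule that)
qed

section \<open>Return measures to shrinking cylinders\<close>

context regular_measure
begin

abbreviation Y :: "'v seq set" where "Y \<equiv> cyl 1 x"

lemma detv_eq_Int: "detv N D \<Longrightarrow> D \<inter> shift_by N -` Y = D"
  by (auto simp: detv_def cyl_def shift_by_def)

lemma finite_subset_Y: "E \<subseteq> Y \<Longrightarrow> emeasure M E \<noteq> top"
  using emeasure_mono[of E Y M] finite_Y by (auto simp: top_unique)

lemma finite_subset_detv: "detv N D \<Longrightarrow> E \<subseteq> D \<Longrightarrow> emeasure M E \<noteq> top"
  using emeasure_mono[of E D M] detv_sets[of N D] by (auto simp: top_unique detv_def)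

lemma measure_mono_Y: "F \<in> sets M \<Longrightarrow> F \<subseteq> Y \<Longrightarrow> E \<subseteq> F \<Longrightarrow> measure M E \<le> measure M F"
  unfolding measure_def using finite_subset_Y[of F]
  by (intro enn2real_mono emeasure_mono) (simp_all add: less_top[symmetric])

lemma distortion_measure:
  assumes "1 \<le> i" and D: "detv N D" and E: "E \<in> sets M" "E \<subseteq> cyl i p" "E \<subseteq> Y"
    and F: "F \<in> sets M" "F \<subseteq> cyl i p" "F \<subseteq> Y"
  shows "measure M (D \<inter> shift_by N -` E) * measure M F \<le>
    exp (\<omega> i) * (measure M (D \<inter> shift_by N -` F) * measure M E)"
proof -
  note [measurable] = E(1) F(1) detv_sets[OF D]
  have "emeasure M (D \<inter> shift_by N -` E) * emeasure M F \<le>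
    ennreal (exp (\<omega> i)) * (emeasure M (D \<inter> shift_by N -` F) * emeasure M E)"
    using past_distortion(1)[OF assms(1) D, of "\<lambda>_. 1" E F p] E(2) F(2) by simp
  moreover have "emeasure M (D \<inter> shift_by N -` E) = ennreal (measure M (D \<inter> shift_by N -` E))"
    "emeasure M (D \<inter> shift_by N -` F) = ennreal (measure M (D \<inter> shift_by N -` F))"
    "emeasure M E = ennreal (measure M E)" "emeasure M F = ennreal (measure M F)"
    by (rule emeasure_eq_ennreal_measure finite_subset_Y[OF E(3)] finite_subset_Y[OF F(3)]
      finite_subset_detv[OF D Int_lower1])+
  ultimately show ?thesis
    by (simp add: ennreal_mult[symmetric])
qed

lemma detv_Y: "detv 0 Y"
  using finite_Y by (auto simp: detv_def cyl_def determined_def)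

text \<open>A return to a subset of \<open>Y\<close> at time \<open>k\<close> forces the letter
  \<open>x 0\<close> there, so adding this letter loses nothing (\<open>Int_visit\<close>) and makes
  \<open>C\<close> an eligible past.\<close>

lemma detv_Int_visit:
  assumes "determined d C" "C \<subseteq> Y" "d \<le> k"
  shows "detv k (C \<inter> {z. z k = x 0})"
proof -
  have "determined k (C \<inter> {z. z k = x 0})"
    by (intro determined_Int determined_mono[OF assms(1,3)]) (auto simp: determined_def)
  moreover have "emeasure M (C \<inter> {z. z k = x 0}) < top"
    using finite_subset_Y[of "C \<inter> {z. z k = x 0}"] assms(2) by (auto simp: less_top)
  ultimately show ?thesis by (auto simp: detv_def)
qed

lemma Int_visit: "E \<subseteq> Y \<Longrightarrow> C \<inter> {z. z k = x 0} \<inter> shift_by k -` E = C \<inter> shift_by k -` E"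
  by (auto simp: cyl_def shift_by_def)

lemma B_subset_Y: "1 \<le> n \<Longrightarrow> B n \<subseteq> Y"
  by (auto simp: cyl_def)

lemma measure_B_pos: "1 \<le> n \<Longrightarrow> 0 < measure M (B n)"
  using emeasure_B[of n] by (simp add: measure_def enn2real_positive_iff less_top zero_less_iff_neq_zero)

text \<open>Both targets lie in \<open>cyl n0 x\<close>, so their return measures from any past are
  proportional to their measures up to \<open>exp (\<omega> n0)\<close>. This replaces the moving
  target by a fixed one.\<close>

lemma return_measure_compare:
  assumes C: "determined d C" "C \<subseteq> Y" "d \<le> k" and n: "1 \<le> n0" "n0 \<le> n"
  shows "measure M (C \<inter> shift_by k -` B n) * measure M (B n0) \<le>
      exp (\<omega> n0) * (measure M (C \<inter> shift_by k -` B n0) * measure M (B n))"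
    and "measure M (C \<inter> shift_by k -` B n0) * measure M (B n) \<le>
      exp (\<omega> n0) * (measure M (C \<inter> shift_by k -` B n) * measure M (B n0))"
proof -
  have B: "B n \<subseteq> cyl n0 x" "B n \<subseteq> Y" "B n0 \<subseteq> Y" using n by (auto simp: cyl_def)
  show "measure M (C \<inter> shift_by k -` B n) * measure M (B n0) \<le>
      exp (\<omega> n0) * (measure M (C \<inter> shift_by k -` B n0) * measure M (B n))"
    using distortion_measure[OF n(1) detv_Int_visit[OF C], of "B n" x "B n0"] B
    by (simp add: Int_visit cyl_sets_M)
  show "measure M (C \<inter> shift_by k -` B n0) * measure M (B n) \<le>
      exp (\<omega> n0) * (measure M (C \<inter> shift_by k -` B n) * measure M (B n0))"
    using distortion_measure[OF n(1) detv_Int_visit[OF C], of "B n0" x "B n"] B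
    by (simp add: Int_visit cyl_sets_M)
qed

text \<open>A crude bound that also covers times before \<open>C\<close> is determined; it makes
  those finitely many early returns negligible.\<close>

lemma return_measure_le:
  assumes C: "C \<subseteq> Y" and n: "1 \<le> n"
  shows "measure M (C \<inter> shift_by k -` B n) \<le> exp (\<omega> 1) * measure M (B n)"
proof -
  have Y: "determined 0 Y" "Y \<subseteq> Y" by (auto simp: determined_def cyl_def)
  have "measure M (C \<inter> shift_by k -` B n) \<le> measure M (Y \<inter> shift_by k -` B n)"
    using C by (intro measure_mono_Y) auto
  moreover have "measure M (Y \<inter> shift_by k -` B n) * measure M Y \<le>
      exp (\<omega> 1) * (measure M (Y \<inter> shift_by k -` Y) * measure M (B n))"
    using return_measure_compare(1)[OF Y, of k 1 n] n by simp
  moreover have "measure M (Y \<inter> shift_by k -` Y) \<le> measure M Y"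
    by (intro measure_mono_Y) auto
  then have "exp (\<omega> 1) * (measure M (Y \<inter> shift_by k -` Y) * measure M (B n)) \<le> exp (\<omega> 1) * (measure M Y * measure M (B n))"
    by (intro mult_left_mono mult_right_mono) auto
  ultimately have "measure M (C \<inter> shift_by k -` B n) * measure M Y \<le> exp (\<omega> 1) * measure M (B n) * measure M Y"
    by (smt (verit) measure_nonneg mult.assoc mult.commute mult_right_mono)
  then show ?thesis using measure_B_pos[of 1] by simp
qed

end

text \<open>\<open>\<beta> n\<close> stands for the invariant measure of \<open>B n\<close>, and \<open>1 / \<N> n\<close> for the scaling factor.\<close>

locale regular_renewal = regular_measure M x \<omega> j
  for M :: "'v::countable seq measure" and x \<omega> j +
  fixes a :: "nat \<Rightarrow> real" and \<alpha> :: real and \<beta> :: "nat \<Rightarrow> real" and h0 :: real and \<N> :: "nat \<Rightarrow> nat"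
  assumes a: "mono a" "regularly_varying_seq a \<alpha>" "0 < \<alpha>" "\<alpha> \<le> 1"
    and density: "0 < h0" "(\<lambda>n. \<beta> n / measure M (B n)) \<longlonglongrightarrow> h0"
    and return_sums: "eventually (\<lambda>n. \<forall>C\<in>sets M. C \<subseteq> cyl 1 x \<longrightarrow>
      (\<lambda>K. (\<Sum>k<K. measure M (C \<inter> shift_by k -` B n)) / a K) \<longlonglongrightarrow> \<beta> n * measure M C) sequentially"
    and measure_B_0: "(\<lambda>n. measure M (B n)) \<longlonglongrightarrow> 0"
    and scale: "filterlim \<N> at_top sequentially" "(\<lambda>n. a (\<N> n) * \<beta> n) \<longlonglongrightarrow> 1"
begin

definition q :: "real \<Rightarrow> nat \<Rightarrow> real" where "q s n = exp (- (s / real (\<N> n)))"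

definition R :: "real \<Rightarrow> real" where "R s = Gamma (1 + \<alpha>) * s powr (- \<alpha>)"

definition visits :: "real \<Rightarrow> nat \<Rightarrow> 'v seq set \<Rightarrow> real" where
  "visits s n C = (\<Sum>k. q s n ^ k * measure M (C \<inter> shift_by k -` B n))"

lemma R_pos: "0 < s \<Longrightarrow> 0 < R s"
  using a by (auto simp: R_def intro!: mult_pos_pos Gamma_real_pos)

lemma q_bounds: "0 < s \<Longrightarrow> 0 < \<N> n \<Longrightarrow> 0 < q s n \<and> q s n < 1"
  by (simp add: q_def)

lemma eventually_scale_pos: "eventually (\<lambda>n. 0 < \<N> n) sequentially"
  using scale(1) unfolding filterlim_at_top by (auto dest: spec[of _ 1] simp: Suc_le_eq)

lemma summable_geometric_bounded:
  fixes f :: "nat \<Rightarrow> real"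
  assumes "0 < r" "r < 1" "\<And>k. 0 \<le> f k" "\<And>k. f k \<le> c"
  shows "summable (\<lambda>k. r ^ k * f k)"
proof (rule summable_comparison_test')
  show "summable (\<lambda>k. c * r ^ k)" using assms by (intro summable_mult summable_geometric) auto
  show "norm (r ^ k * f k) \<le> c * r ^ k" if "0 \<le> k" for k
    using assms by (simp add: mult.commute mult_right_mono)
qed

text \<open>Karamata's theorem applies to each fixed \<open>B n0\<close>; comparison of
  \<open>B n\<close> with \<open>B n0\<close> from time \<open>d\<close> on then bounds the moving
  count, with an error that disappears when \<open>n0\<close> grows after \<open>n\<close>.\<close>

lemma visits_tendsto:
  assumes C: "determined d C" "C \<subseteq> Y" and s: "0 < s"
  shows "(\<lambda>n. visits s n C) \<longlonglongrightarrow> R s * measure M C"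
proof -
  have C_sets [measurable]: "C \<in> sets M" using determined_sets[OF C(1)] sets_M by blast
  define c where "c k n = measure M (C \<inter> shift_by k -` B n)" for k n
  have c_nonneg: "0 \<le> c k n" for k n by (simp add: c_def)
  have c_le: "c k n \<le> measure M Y" for k n
    unfolding c_def using C by (intro measure_mono_Y) auto
  have summ: "summable (\<lambda>k. q s n ^ k * c k m)" if "0 < \<N> n" for n m
    using q_bounds[OF s that] c_nonneg c_le by (intro summable_geometric_bounded) auto
  have summ_d: "summable (\<lambda>k. q s n ^ (k + d) * c (k + d) m)" if "0 < \<N> n" for n m
    using summ[OF that, of m] by (subst summable_iff_shift[where f = "\<lambda>k. q s n ^ k * c k m"])
  have split: "(\<Sum>k. q s n ^ k * c k m) = (\<Sum>k. q s n ^ (k + d) * c (k + d) m) + (\<Sum>k<d. q s n ^ k * c k m)"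
    if "0 < \<N> n" for n m
    by (rule suminf_split_initial_segment[OF summ[OF that]])
  have mB: "0 < measure M (B n)" if "1 \<le> n" for n using measure_B_pos that .
  have init: "(\<lambda>n. \<Sum>k<d. q s n ^ k * c k n) \<longlonglongrightarrow> 0"
  proof (rule tendsto_sandwich[OF _ _ tendsto_const])
    show "\<forall>\<^sub>F n in sequentially. 0 \<le> (\<Sum>k<d. q s n ^ k * c k n)"
      by (intro always_eventually allI sum_nonneg mult_nonneg_nonneg c_nonneg) (simp add: q_def)
    show "\<forall>\<^sub>F n in sequentially. (\<Sum>k<d. q s n ^ k * c k n) \<le> real d * (exp (\<omega> 1) * measure M (B n))"
      using eventually_scale_pos eventually_ge_at_top[of 1]
    proof eventually_elim
      case (elim n)
      have "q s n ^ k * c k n \<le> 1 * (exp (\<omega> 1) * measure M (B n))" for k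
        using q_bounds[OF s elim(1)] return_measure_le[OF C(2) elim(2), of k] c_nonneg
        by (intro mult_mono) (auto simp: c_def power_le_one)
      then show ?case using sum_bounded_above[of "{..<d}" "\<lambda>k. q s n ^ k * c k n" "exp (\<omega> 1) * measure M (B n)"] by simp
    qed
    show "(\<lambda>n. real d * (exp (\<omega> 1) * measure M (B n))) \<longlonglongrightarrow> 0"
      using tendsto_mult[OF tendsto_const tendsto_mult[OF tendsto_const measure_B_0], of "real d" "exp (\<omega> 1)"] by simp
  qed
  \<comment> \<open>The normalisation is given for \<open>\<beta>\<close>; dividing by the density
    ratio expresses it through \<open>M\<close>, and the constant \<open>h0\<close> cancels later
    against \<open>\<beta> n0\<close>.\<close>
  have scaled: "(\<lambda>n. measure M (B n) * a (\<N> n)) \<longlonglongrightarrow> 1 / h0"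
  proof -
    have "(\<lambda>n. (a (\<N> n) * \<beta> n) / (\<beta> n / measure M (B n))) \<longlonglongrightarrow> 1 / h0"
      using density scale by (intro tendsto_divide) auto
    moreover have "eventually (\<lambda>n. 0 < \<beta> n / measure M (B n)) sequentially"
      using density by (intro order_tendstoD)
    then have "eventually (\<lambda>n. (a (\<N> n) * \<beta> n) / (\<beta> n / measure M (B n)) = measure M (B n) * a (\<N> n)) sequentially"
      by eventually_elim (auto simp: field_simps)
    ultimately show ?thesis by (rule Lim_transform_eventually)
  qed
  define S where "S n0 n = (\<Sum>k. q s n ^ k * c k n0)" for n0 n
  have S_lim: "(\<lambda>n. measure M (B n) * S n0 n) \<longlonglongrightarrow> (\<beta> n0 / h0) * (R s * measure M C)"
    if n0: "(\<lambda>K. (\<Sum>k<K. c k n0) / a K) \<longlonglongrightarrow> \<beta> n0 * measure M C" for n0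
  proof -
    have "(\<lambda>N. (\<Sum>k. exp (- (s / real N)) ^ k * c k n0) / a N) \<longlonglongrightarrow> \<beta> n0 * measure M C * Gamma (1 + \<alpha>) * s powr (- \<alpha>)"
      by (rule karamata_laplace[OF a c_nonneg n0 s])
        (use s c_nonneg c_le in \<open>intro summable_geometric_bounded, auto\<close>)
    from tendsto_mult[OF scaled filterlim_compose[OF this scale(1)]]
    have "(\<lambda>n. (measure M (B n) * a (\<N> n)) * (S n0 n / a (\<N> n))) \<longlonglongrightarrow> 1 / h0 * (\<beta> n0 * measure M C * Gamma (1 + \<alpha>) * s powr (- \<alpha>))"
      by (simp add: S_def q_def)
    moreover have "eventually (\<lambda>n. 0 < a n) sequentially"
      using a(2) by (simp add: regularly_varying_seq_def)
    then have "eventually (\<lambda>n. 0 < a (\<N> n)) sequentially"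
      using scale(1) by (rule eventually_compose_filterlim)
    then have "eventually (\<lambda>n. (measure M (B n) * a (\<N> n)) * (S n0 n / a (\<N> n)) = measure M (B n) * S n0 n) sequentially"
      by eventually_elim auto
    ultimately have "(\<lambda>n. measure M (B n) * S n0 n) \<longlonglongrightarrow> 1 / h0 * (\<beta> n0 * measure M C * Gamma (1 + \<alpha>) * s powr (- \<alpha>))"
      by (rule Lim_transform_eventually)
    then show ?thesis by (simp add: R_def mult_ac)
  qed
  let ?L = "R s * measure M C"
  \<comment> \<open>Used with \<open>e\<close> equal to 1 and to -1, for the upper and the lower
    bound.\<close>
  have ratio: "(\<lambda>n. exp (e * \<omega> n) * (\<beta> n / measure M (B n)) / h0 * ?L) \<longlonglongrightarrow> ?L" for e
  proof -
    have "(\<lambda>n. exp (e * \<omega> n) * (\<beta> n / measure M (B n)) / h0 * ?L) \<longlonglongrightarrow> exp (e * 0) * h0 / h0 * ?L"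
      using density oscillation by (intro tendsto_intros) auto
    then show ?thesis using density(1) by simp
  qed
  have visits: "visits s n C = (\<Sum>k. q s n ^ k * c k n)" for n
    by (simp add: visits_def c_def)
  show ?thesis
  proof (rule tendsto_double_bound[where c = ?L])
    \<comment> \<open>The lower bound drops the first \<open>d\<close> returns of the fixed target,
      each at most the measure of \<open>Y\<close>; the upper bound keeps the early returns to
      \<open>B n\<close>, which vanish by \<open>init\<close>.\<close>
    let ?l = "\<lambda>n0 n. exp (- \<omega> n0) / measure M (B n0) * (measure M (B n) * S n0 n - measure M (B n) * (real d * measure M Y))"
    let ?l' = "\<lambda>n0. exp (- \<omega> n0) / measure M (B n0) * (\<beta> n0 / h0 * ?L - 0 * (real d * measure M Y))"
    let ?u = "\<lambda>n0 n. exp (\<omega> n0) / measure M (B n0) * (measure M (B n) * S n0 n) + (\<Sum>k<d. q s n ^ k * c k n)"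
    let ?u' = "\<lambda>n0. exp (\<omega> n0) / measure M (B n0) * (\<beta> n0 / h0 * ?L) + 0"
    show "?l' \<longlonglongrightarrow> ?L" "?u' \<longlonglongrightarrow> ?L" using ratio[of "- 1"] ratio[of 1] by (simp_all add: mult_ac)
    show "eventually (\<lambda>n0. ?l n0 \<longlonglongrightarrow> ?l' n0 \<and> ?u n0 \<longlonglongrightarrow> ?u' n0 \<and>
      eventually (\<lambda>n. ?l n0 n \<le> visits s n C \<and> visits s n C \<le> ?u n0 n) sequentially) sequentially"
      using return_sums eventually_ge_at_top[of 1]
    proof (eventually_elim, intro conjI)
      fix n0
      assume "\<forall>C\<in>sets M. C \<subseteq> Y \<longrightarrow> (\<lambda>K. (\<Sum>k<K. measure M (C \<inter> shift_by k -` B n0)) / a K) \<longlonglongrightarrow> \<beta> n0 * measure M C"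
        and n0: "1 \<le> n0"
      then have "(\<lambda>K. (\<Sum>k<K. c k n0) / a K) \<longlonglongrightarrow> \<beta> n0 * measure M C" using C C_sets by (simp add: c_def)
      note S_lim = S_lim[OF this]
      show "?l n0 \<longlonglongrightarrow> ?l' n0" by (intro tendsto_intros S_lim measure_B_0)
      show "?u n0 \<longlonglongrightarrow> ?u' n0" by (intro tendsto_intros S_lim init)
      show "eventually (\<lambda>n. ?l n0 n \<le> visits s n C \<and> visits s n C \<le> ?u n0 n) sequentially"
        using eventually_scale_pos eventually_ge_at_top[of n0]
      proof eventually_elim
        case (elim n)
        have q: "0 < q s n" "q s n < 1" using q_bounds[OF s elim(1)] by auto
        have b0: "0 < measure M (B n0)" by (rule mB[OF n0])
        let ?T = "\<lambda>m. \<Sum>k. q s n ^ (k + d) * c (k + d) m"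
        have head: "0 \<le> (\<Sum>k<d. q s n ^ k * c k m)" "(\<Sum>k<d. q s n ^ k * c k m) \<le> real d * measure M Y" for m
          using sum_bounded_above[of "{..<d}" "\<lambda>k. q s n ^ k * c k m" "measure M Y"] c_le[of _ m] c_nonneg q
          by (auto simp: mult_le_cancel_left1 mult_le_one order_trans[OF mult_left_le_one_le] power_le_one intro!: sum_nonneg)
        have cmp: "c (k + d) n * measure M (B n0) \<le> exp (\<omega> n0) * measure M (B n) * c (k + d) n0"
          "c (k + d) n0 * measure M (B n) \<le> exp (\<omega> n0) * measure M (B n0) * c (k + d) n" for k
          using return_measure_compare[OF C _ n0 elim(2), of "k + d"] by (simp_all add: c_def mult_ac)
        have T: "?T n * measure M (B n0) \<le> exp (\<omega> n0) * measure M (B n) * ?T n0"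
          "?T n0 * measure M (B n) \<le> exp (\<omega> n0) * measure M (B n0) * ?T n"
          by (rule weighted_suminf_le[OF summ_d[OF elim(1)] summ_d[OF elim(1)]]; use q cmp in simp)+
        have "measure M (B n) * S n0 n - measure M (B n) * (real d * measure M Y) \<le> ?T n0 * measure M (B n)"
          unfolding S_def split[OF elim(1)] using mult_left_mono[OF head(2)[of n0], of "measure M (B n)"] by (simp add: algebra_simps)
        with T(2) have "exp (- \<omega> n0) / measure M (B n0) * (measure M (B n) * S n0 n - measure M (B n) * (real d * measure M Y)) \<le> ?T n"
          using b0 by (simp add: exp_minus field_simps)
        moreover have "exp (\<omega> n0) * measure M (B n) * ?T n0 \<le> exp (\<omega> n0) * measure M (B n) * S n0 n"
          unfolding S_def split[OF elim(1)] using head(1)[of n0] by (intro mult_left_mono) auto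
        with T(1) have "?T n * measure M (B n0) \<le> exp (\<omega> n0) * measure M (B n) * S n0 n" by (rule order_trans)
        then have "?T n \<le> exp (\<omega> n0) / measure M (B n0) * (measure M (B n) * S n0 n)"
          using b0 by (simp add: field_simps)
        ultimately show ?case using head(1)[of n] unfolding visits split[OF elim(1), of n] by simp
      qed
    qed
  qed
qed

end

section \<open>The hit count, uniformly over pasts\<close>

context regular_renewal
begin

lemma Y_partition:
  assumes "1 \<le> d"
  shows "\<exists>C :: nat \<Rightarrow> 'v seq set. (\<forall>i. determined d (C i) \<and> C i \<subseteq> Y \<and> (\<exists>p. C i \<subseteq> cyl d p)) \<and>
    disjoint_family C \<and> (\<Union>i. C i) = Y"
proof -
  define C where "C i = {z \<in> Y. to_nat (map z [0..<d]) = i}" for i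
  have 1: "determined d (C i)" for i
  proof (rule determinedI)
    fix z z' :: "'v seq" assume eq: "\<And>i. i \<le> d \<Longrightarrow> z i = z' i" and z: "z \<in> C i"
    have "map z [0..<d] = map z' [0..<d]" using eq by simp
    then show "z' \<in> C i" using z eq[of 0] by (simp add: C_def cyl_def del: map_eq_conv)
  qed
  have 2: "C i \<subseteq> Y" for i by (auto simp: C_def)
  have 3: "\<exists>p. C i \<subseteq> cyl d p" for i
  proof (cases "C i = {}")
    case False
    then obtain p where "p \<in> C i" by blast
    then have "C i \<subseteq> cyl d p" by (auto simp: C_def cyl_def)
    then show ?thesis by blast
  qed auto
  have 4: "disjoint_family C"
    by (auto simp: disjoint_family_on_def C_def)
  have 5: "(\<Union>i. C i) = Y"
    by (auto simp: C_def)
  show ?thesis using 1 2 3 4 5 by (intro exI[of _ C] conjI allI)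
qed

lemma nn_visits:
  assumes s: "0 < s" "0 < \<N> n" and E: "E \<in> sets M" "E \<subseteq> Y"
  shows "(\<integral>\<^sup>+z\<in>E. G n (ennreal (q s n)) z \<partial>M) = ennreal (visits s n E)"
proof -
  note [measurable] = E(1)
  have q: "0 < q s n" "q s n < 1" using q_bounds[OF s] by auto
  have "(\<integral>\<^sup>+z\<in>E. G n (ennreal (q s n)) z \<partial>M) =
      (\<integral>\<^sup>+z. (\<Sum>k. ennreal (q s n ^ k) * indicator (E \<inter> shift_by k -` B n) z) \<partial>M)"
    unfolding G_def ennreal_suminf_multc[symmetric] using q
    by (intro nn_integral_cong suminf_cong) (auto split: split_indicator simp: ennreal_power)
  also have "\<dots> = (\<Sum>k. ennreal (q s n ^ k) * emeasure M (E \<inter> shift_by k -` B n))"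
    by (subst nn_integral_suminf) (auto simp: nn_integral_cmult)
  also have "\<dots> = (\<Sum>k. ennreal (q s n ^ k * measure M (E \<inter> shift_by k -` B n)))"
  proof (intro suminf_cong)
    fix k
    have "emeasure M (E \<inter> shift_by k -` B n) \<noteq> top" using E(2) by (intro finite_subset_Y) auto
    then show "ennreal (q s n ^ k) * emeasure M (E \<inter> shift_by k -` B n) = ennreal (q s n ^ k * measure M (E \<inter> shift_by k -` B n))"
      using q by (simp add: ennreal_mult emeasure_eq_ennreal_measure)
  qed
  also have "\<dots> = ennreal (visits s n E)"
    unfolding visits_def using q E
    by (intro suminf_ennreal2 summable_geometric_bounded[of _ _ "measure M Y"]) (auto intro!: measure_mono_Y)
  finally show ?thesis .
qed

text \<open>Decomposing \<open>Y\<close> into finitely many long cylinders and a remainder of small measure, the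
  return measure seen from any past is a mixture of the ones in lemma \<open>visits_tendsto\<close>.\<close>

lemma G_uniform:
  assumes s: "0 < s" and e: "0 < e"
  shows "eventually (\<lambda>n. mean_between UNIV (ennreal (R s - e)) (ennreal (R s + e)) (G n (ennreal (q s n)))) sequentially"
proof -
  define r where "r = R s"
  have r: "0 < r" unfolding r_def using R_pos[OF s] .
  have "(\<lambda>d. exp (\<omega> d) * r) \<longlonglongrightarrow> exp 0 * r" "(\<lambda>d. exp (- \<omega> d) * r) \<longlonglongrightarrow> exp (- 0) * r"
    using oscillation by (intro tendsto_intros; assumption)+
  then have "eventually (\<lambda>d. exp (\<omega> d) * r < r + e) sequentially" "eventually (\<lambda>d. r - e < exp (- \<omega> d) * r) sequentially"
    using e by (auto elim!: order_tendstoD)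
  then have "eventually (\<lambda>d. exp (\<omega> d) * r < r + e \<and> r - e < exp (- \<omega> d) * r \<and> 1 \<le> d) sequentially"
    using eventually_ge_at_top[of 1] by eventually_elim auto
  \<comment> \<open>The cylinder length is fixed first: its distortion alone must leave room within
    the tolerance.\<close>
  then obtain d where d: "exp (\<omega> d) * r < r + e" "r - e < exp (- \<omega> d) * r" "1 \<le> d"
    by (auto simp: eventually_sequentially)
  from Y_partition[OF d(3)] obtain C :: "nat \<Rightarrow> 'v seq set" where
    C': "(\<forall>i. determined d (C i) \<and> C i \<subseteq> Y \<and> (\<exists>p. C i \<subseteq> cyl d p)) \<and> disjoint_family C \<and> (\<Union>i. C i) = Y"
    by (rule exE)
  have C: "\<And>i. determined d (C i)" "\<And>i. C i \<subseteq> Y" "\<And>i. \<exists>p. C i \<subseteq> cyl d p" "disjoint_family C" "(\<Union>i. C i) = Y"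
    using C' by simp_all
  have C_sets [measurable]: "C i \<in> sets M" for i
    using determined_sets[OF C(1)] sets_M by blast
  define Y' where "Y' m = Y - (\<Union>i<m. C i)" for m
  have Y'_sets [measurable]: "Y' m \<in> sets M" for m unfolding Y'_def by measurable
  have Y'_det: "determined d (Y' m)" for m
  proof (rule determinedI)
    fix z z' :: "'v seq" assume eq: "\<And>i. i \<le> d \<Longrightarrow> z i = z' i" and z: "z \<in> Y' m"
    have "z \<in> C i \<longleftrightarrow> z' \<in> C i" for i by (rule determinedD[OF C(1)[of i] eq])
    then show "z' \<in> Y' m" using z eq[of 0] by (auto simp: Y'_def cyl_def)
  qed
  define mY where "mY = measure M Y"
  have mY: "0 < mY" unfolding mY_def using measure_B_pos[of 1] by simp
  have "(\<lambda>m. measure M (Y' m)) \<longlonglongrightarrow> measure M (\<Inter>m. Y' m)"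
  proof (rule Lim_measure_decseq)
    show "decseq Y'" unfolding Y'_def by (intro antimonoI) (auto intro: less_le_trans)
    show "emeasure M (Y' m) \<noteq> \<infinity>" for m
      unfolding infinity_ennreal_def by (rule finite_subset_Y) (auto simp: Y'_def)
  qed (use Y'_sets in blast)
  moreover have "(\<Inter>m. Y' m) = {}" using C(5) by (auto simp: Y'_def)
  ultimately have Y'_lim: "(\<lambda>m. measure M (Y' m)) \<longlonglongrightarrow> 0" by simp
  define \<delta> where "\<delta> m = inverse (real (Suc m))" for m
  have \<delta>_lim: "\<delta> \<longlonglongrightarrow> 0" unfolding \<delta>_def by (rule LIMSEQ_inverse_real_of_nat)
  \<comment> \<open>The cylinders \<open>C i\<close> enter with distortion
    \<open>\<omega> d\<close>. The remainder \<open>Y' m\<close> is confined only to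
    \<open>Y\<close>, hence \<open>\<omega> 1\<close>. The lower bound ignores hits from the
    remainder but has to pay for its mass.\<close>
  define U where "U m = exp (\<omega> d) * (r + \<delta> m) + exp (\<omega> 1) * (r * measure M (Y' m) + \<delta> m) / mY" for m
  define L where "L m = exp (- \<omega> d) * (r - \<delta> m) * (1 - exp (\<omega> 1) * measure M (Y' m) / mY)" for m
  have "U \<longlonglongrightarrow> exp (\<omega> d) * (r + 0) + exp (\<omega> 1) * (r * 0 + 0) / mY"
    "L \<longlonglongrightarrow> exp (- \<omega> d) * (r - 0) * (1 - exp (\<omega> 1) * 0 / mY)"
    unfolding U_def L_def using mY by (intro tendsto_intros \<delta>_lim Y'_lim; simp)+
  then have "eventually (\<lambda>m. U m < r + e) sequentially" "eventually (\<lambda>m. r - e < L m) sequentially" "eventually (\<lambda>m. \<delta> m < r) sequentially"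
    using d r \<delta>_lim by (auto elim!: order_tendstoD)
  then have "eventually (\<lambda>m. U m < r + e \<and> r - e < L m \<and> \<delta> m < r) sequentially"
    by eventually_elim auto
  then obtain m where m: "U m < r + e" "r - e < L m" "\<delta> m < r" by (auto simp: eventually_sequentially)
  have \<delta>: "0 < \<delta> m" by (simp add: \<delta>_def)
  have visits_0: "visits s n E = 0" if "E \<subseteq> Y" "E \<in> sets M" "measure M E = 0" for n E
  proof -
    have "measure M (E \<inter> shift_by k -` B n) = 0" for k
      using measure_mono_Y[of E "E \<inter> shift_by k -` B n"] that by (simp add: measure_le_0_iff)
    then show ?thesis by (simp add: visits_def)
  qed
  have vC: "eventually (\<lambda>n. (r - \<delta> m) * measure M (C i) \<le> visits s n (C i) \<and> visits s n (C i) \<le> (r + \<delta> m) * measure M (C i)) sequentially" for i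
  proof (cases "measure M (C i) = 0")
    case True
    then show ?thesis using visits_0[OF C(2) C_sets] by simp
  next
    case False
    then have pos: "0 < measure M (C i)" by (simp add: zero_less_measure_iff)
    have lim: "(\<lambda>n. visits s n (C i)) \<longlonglongrightarrow> r * measure M (C i)"
      unfolding r_def by (rule visits_tendsto[OF C(1,2) s])
    have "(r - \<delta> m) * measure M (C i) < r * measure M (C i)" "r * measure M (C i) < (r + \<delta> m) * measure M (C i)"
      using pos \<delta> by simp_all
    from order_tendstoD(1)[OF lim this(1)] order_tendstoD(2)[OF lim this(2)] show ?thesis by eventually_elim auto
  qed
  have vY': "eventually (\<lambda>n. visits s n (Y' m) < r * measure M (Y' m) + \<delta> m) sequentially"
    using visits_tendsto[OF Y'_det[of m] _ s] \<delta>
    by (intro order_tendstoD(2)[of _ "r * measure M (Y' m)"]) (auto simp: r_def Y'_def)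
  \<comment> \<open>Convergence is known for each cylinder separately; uniformity is obtained
    because only \<open>m\<close> of them remain.\<close>
  have "eventually (\<lambda>n. \<forall>i\<in>{..<m}. (r - \<delta> m) * measure M (C i) \<le> visits s n (C i) \<and> visits s n (C i) \<le> (r + \<delta> m) * measure M (C i)) sequentially"
    by (rule eventually_ball_finite) (auto intro: vC)
  then show ?thesis
    using vY' eventually_scale_pos
  proof (eventually_elim, unfold mean_between_UNIV, intro allI impI)
    fix n N D
    assume vC: "\<forall>i\<in>{..<m}. (r - \<delta> m) * measure M (C i) \<le> visits s n (C i) \<and> visits s n (C i) \<le> (r + \<delta> m) * measure M (C i)"
      and vY': "visits s n (Y' m) < r * measure M (Y' m) + \<delta> m" and n: "0 < \<N> n" and D: "detv N D"
    note [measurable] = detv_sets[OF D]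
    let ?G = "G n (ennreal (q s n))"
    define I where "I f E = past N (D \<inter> shift_by N -` E) f" for f :: "_ \<Rightarrow> ennreal" and E
    define k where "k E = measure M (D \<inter> shift_by N -` E)" for E
    define V where "V E = enn2real (I ?G E)" for E
    have emeasure_k: "emeasure M (D \<inter> shift_by N -` E) = ennreal (k E)" for E
      unfolding k_def by (rule emeasure_eq_ennreal_measure[OF finite_subset_detv[OF D Int_lower1]])
    then have I_1: "I (\<lambda>_. 1) E = ennreal (k E)" if [measurable]: "E \<in> sets M" for E by (simp add: I_def)
    have emeasure: "emeasure M E = ennreal (measure M E)" if "E \<subseteq> Y" for E
      by (rule emeasure_eq_ennreal_measure[OF finite_subset_Y[OF that]])
    have visits_nonneg: "0 \<le> visits s n E" if "E \<in> sets M" "E \<subseteq> Y" for E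
      unfolding visits_def using q_bounds[OF s n] that
      by (intro suminf_nonneg summable_geometric_bounded[of _ _ "measure M Y"]) (auto intro!: measure_mono_Y)
    have I_G: "I ?G E * ennreal (measure M F) \<le> ennreal (exp (\<omega> i) * (k F * visits s n E))"
      "ennreal (k F * visits s n E) \<le> ennreal (exp (\<omega> i)) * (I ?G E * ennreal (measure M F))"
      if "1 \<le> i" "E \<in> sets M" "E \<subseteq> cyl i p" "E \<subseteq> Y" "F \<in> sets M" "F \<subseteq> cyl i p" "F \<subseteq> Y" for i E F p
      using past_distortion[OF that(1) D measurable_G that(2,5,3,6), of n "ennreal (q s n)"] visits_nonneg[OF that(2,4)]
      unfolding nn_visits[OF s n that(2,4)] I_def[symmetric] emeasure[OF that(7)] emeasure_k
      by (simp_all add: k_def ennreal_mult)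
    \<comment> \<open>Finiteness of the discounted count over this past allows all further estimates
      to be made with real numbers.\<close>
    have "I ?G Y * ennreal mY < top"
      using I_G(1)[of 1 Y x Y] by (auto simp: mY_def intro: le_less_trans)
    then have I_Y: "I ?G Y < top" using mY by (auto simp: ennreal_mult_less_top)
    have I_V: "I ?G E = ennreal (V E)" if "E \<subseteq> Y" for E
    proof -
      have "I ?G E \<le> I ?G Y" unfolding I_def using that by (intro nn_integral_mono) (auto split: split_indicator)
      with I_Y have "I ?G E < top" by (rule le_less_trans[rotated])
      then show ?thesis by (simp add: V_def)
    qed
    have V_nonneg: "0 \<le> V E" for E by (simp add: V_def)
    have k_nonneg: "0 \<le> k E" for E by (simp add: k_def)
    have V_upper: "V E * measure M F \<le> exp (\<omega> i) * (k F * visits s n E)"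
      and V_lower: "k F * visits s n E \<le> exp (\<omega> i) * (V E * measure M F)"
      if "1 \<le> i" "E \<in> sets M" "E \<subseteq> cyl i p" "E \<subseteq> Y" "F \<in> sets M" "F \<subseteq> cyl i p" "F \<subseteq> Y" for i E F p
      using I_G[OF that] visits_nonneg[OF that(2,4)] V_nonneg[of E] k_nonneg[of F]
      unfolding I_V[OF that(4)] by (simp_all add: ennreal_mult[symmetric])
    \<comment> \<open>A cylinder of measure 0 has no mass after any past either, by distortion
      against \<open>Y\<close>; it has to be separated because the estimates below divide by its
      measure.\<close>
    have null: "k (C i) = 0 \<and> V (C i) = 0" if 0: "measure M (C i) = 0" for i
    proof -
      have "k (C i) * mY \<le> 0"
        using distortion_measure[OF order_refl D, of "C i" x Y] C(2) 0 by (auto simp: k_def mY_def)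
      moreover have "V (C i) * mY \<le> 0"
        unfolding mY_def using V_upper[of 1 "C i" x Y] C(2) visits_0[OF C(2) C_sets 0] by auto
      ultimately show ?thesis using mY V_nonneg[of "C i"] k_nonneg[of "C i"] by (auto simp: mult_le_0_iff)
    qed
    have VC: "V (C i) \<le> exp (\<omega> d) * (r + \<delta> m) * k (C i)" "exp (- \<omega> d) * (r - \<delta> m) * k (C i) \<le> V (C i)" if i: "i < m" for i
    proof -
      have "V (C i) \<le> exp (\<omega> d) * (r + \<delta> m) * k (C i) \<and> exp (- \<omega> d) * (r - \<delta> m) * k (C i) \<le> V (C i)"
      proof (cases "measure M (C i) = 0")
        case False
        then have pos: "0 < measure M (C i)" by (simp add: zero_less_measure_iff)
        obtain p where p: "C i \<subseteq> cyl d p" using C(3) by blast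
        note args = d(3) C_sets p C(2) C_sets p C(2)
        have "V (C i) * measure M (C i) \<le> exp (\<omega> d) * (k (C i) * ((r + \<delta> m) * measure M (C i)))"
          using vC i by (intro order_trans[OF V_upper[OF args]] mult_left_mono k_nonneg) auto
        moreover have "k (C i) * ((r - \<delta> m) * measure M (C i)) \<le> exp (\<omega> d) * (V (C i) * measure M (C i))"
          using vC i by (intro order_trans[OF _ V_lower[OF args]] mult_left_mono k_nonneg) auto
        ultimately have "V (C i) * measure M (C i) \<le> exp (\<omega> d) * (r + \<delta> m) * k (C i) * measure M (C i)"
          "(r - \<delta> m) * k (C i) * measure M (C i) \<le> exp (\<omega> d) * V (C i) * measure M (C i)"
          by (simp_all only: mult_ac)
        then show ?thesis using pos unfolding mult_le_cancel_right_pos[OF pos] by (simp add: exp_minus field_simps)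
      qed (simp add: null)
      then show "V (C i) \<le> exp (\<omega> d) * (r + \<delta> m) * k (C i)" "exp (- \<omega> d) * (r - \<delta> m) * k (C i) \<le> V (C i)" by simp_all
    qed
    have "V (Y' m) * mY \<le> exp (\<omega> 1) * (k Y * visits s n (Y' m))"
      unfolding mY_def by (rule V_upper[where p = x]) (auto simp: Y'_def)
    also have "\<dots> \<le> exp (\<omega> 1) * (k Y * (r * measure M (Y' m) + \<delta> m))"
      using vY' k_nonneg by (intro mult_left_mono) auto
    finally have VY': "V (Y' m) \<le> exp (\<omega> 1) * (r * measure M (Y' m) + \<delta> m) / mY * k Y"
      using mY by (simp add: field_simps)
    have "k (Y' m) * mY \<le> exp (\<omega> 1) * (k Y * measure M (Y' m))"
      unfolding mY_def k_def by (rule distortion_measure[OF order_refl D, of _ x]) (auto simp: Y'_def)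
    then have kY': "k (Y' m) \<le> exp (\<omega> 1) * measure M (Y' m) / mY * k Y" using mY by (simp add: field_simps)
    have add: "I f Y = (\<Sum>i<m. I f (C i)) + I f (Y' m)" if [measurable]: "f \<in> borel_measurable M" for f
    proof -
      have "Y = (\<Union>i<m. C i) \<union> Y' m" using C(2) by (auto simp: Y'_def)
      then have "indicator Y z = (\<Sum>i<m. indicator (C i) z) + (indicator (Y' m) z :: ennreal)" for z
        using disjoint_family_on_mono[OF subset_UNIV C(4)]
        by (subst indicator_UN_disjoint[symmetric]) (auto simp: Y'_def split: split_indicator)
      then have eq: "f (shift_by N z) * indicator (D \<inter> shift_by N -` Y) z =
          (\<Sum>i<m. f (shift_by N z) * indicator (D \<inter> shift_by N -` C i) z) + f (shift_by N z) * indicator (D \<inter> shift_by N -` Y' m) z" for z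
        by (simp add: indicator_inter_arith sum_distrib_left[symmetric] distrib_left[symmetric] indicator_vimage mult.assoc[symmetric])
      have meas: "(\<lambda>z. f (shift_by N z) * indicator (D \<inter> shift_by N -` E) z) \<in> borel_measurable M" if [measurable]: "E \<in> sets M" for E
        by measurable
      show ?thesis
        unfolding I_def eq nn_integral_add[OF borel_measurable_sum[OF meas[OF C_sets]] meas[OF Y'_sets]] nn_integral_sum[OF meas[OF C_sets]] ..
    qed
    have VY: "V Y = (\<Sum>i<m. V (C i)) + V (Y' m)" and kY: "k Y = (\<Sum>i<m. k (C i)) + k (Y' m)"
      using add[OF measurable_G[of n "ennreal (q s n)"]] add[of "\<lambda>_. 1"] C(2) V_nonneg k_nonneg
      by (simp_all add: I_V I_1 Y'_def sum_nonneg flip: ennreal_plus)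
    have "V Y \<le> (\<Sum>i<m. exp (\<omega> d) * (r + \<delta> m) * k (C i)) + exp (\<omega> 1) * (r * measure M (Y' m) + \<delta> m) / mY * k Y"
      unfolding VY using VC(1) by (intro add_mono sum_mono VY') auto
    also have "(\<Sum>i<m. exp (\<omega> d) * (r + \<delta> m) * k (C i)) \<le> exp (\<omega> d) * (r + \<delta> m) * k Y"
      unfolding kY sum_distrib_left[symmetric] using r \<delta> k_nonneg by (intro mult_left_mono) auto
    finally have "V Y \<le> U m * k Y" by (simp add: U_def distrib_right)
    also have "\<dots> \<le> (r + e) * k Y" using m(1) k_nonneg by (intro mult_right_mono) auto
    finally have upper: "V Y \<le> (r + e) * k Y" .
    have "(r - e) * k Y \<le> L m * k Y" using m(2) k_nonneg by (intro mult_right_mono) auto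
    also have "\<dots> = exp (- \<omega> d) * (r - \<delta> m) * (k Y - exp (\<omega> 1) * measure M (Y' m) / mY * k Y)"
      by (simp add: L_def left_diff_distrib mult.assoc)
    also have "\<dots> \<le> exp (- \<omega> d) * (r - \<delta> m) * (\<Sum>i<m. k (C i))"
      using kY kY' m(3) by (intro mult_left_mono) auto
    also have "\<dots> \<le> (\<Sum>i<m. V (C i))" unfolding sum_distrib_left using VC(2) by (intro sum_mono) auto
    also have "\<dots> \<le> V Y" using VY V_nonneg by simp
    finally have lower: "(r - e) * k Y \<le> V Y" .
    have "D \<inter> shift_by N -` Y = D" by (rule detv_eq_Int[OF D])
    then have D_eq: "emeasure M D = ennreal (k Y)" "past N D ?G = ennreal (V Y)"
      using I_1[of Y] I_V[of Y] by (simp_all add: I_def)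
    show "ennreal (R s - e) * emeasure M D \<le> past N D ?G \<and>
        past N D ?G \<le> ennreal (R s + e) * emeasure M D"
    proof
      show "ennreal (R s - e) * emeasure M D \<le> past N D ?G"
        unfolding D_eq r_def[symmetric] using lower k_nonneg[of Y]
        by (cases "0 \<le> r - e") (simp_all add: ennreal_mult[symmetric] ennreal_leI ennreal_neg)
      show "past N D ?G \<le> ennreal (R s + e) * emeasure M D"
        unfolding D_eq r_def[symmetric] using upper r e k_nonneg[of Y]
        by (simp add: ennreal_mult[symmetric] ennreal_leI del: ennreal_plus)
    qed
  qed
qed

end

section \<open>Asymptotic means of passages and gaps\<close>

lemma ennreal_divide_bounds:
  assumes "0 < F" "0 \<le> r"
  shows "ennreal r * A \<le> ennreal F * X \<Longrightarrow> ennreal (r / F) * A \<le> X"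
    and "ennreal F * X \<le> ennreal r * A \<Longrightarrow> X \<le> ennreal (r / F) * A"
proof -
  have r: "ennreal (r / F) = ennreal (1 / F) * ennreal r"
    using assms by (simp add: ennreal_mult[symmetric])
  have F: "ennreal (1 / F) * ennreal F = 1"
    using assms by (simp add: ennreal_mult[symmetric])
  show "ennreal (r / F) * A \<le> X" if "ennreal r * A \<le> ennreal F * X"
    using mult_left_mono[OF that, of "ennreal (1 / F)"] F by (simp add: r mult.assoc[symmetric])
  show "X \<le> ennreal (r / F) * A" if "ennreal F * X \<le> ennreal r * A"
    using mult_left_mono[OF that, of "ennreal (1 / F)"] F by (simp add: r mult.assoc[symmetric])
qed

lemma tendsto_null_mult_bounded:
  fixes f g :: "nat \<Rightarrow> real"
  assumes "f \<longlonglongrightarrow> 0" "\<And>n. \<bar>g n\<bar> \<le> K"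
  shows "(\<lambda>n. f n * g n) \<longlonglongrightarrow> 0"
proof (rule Lim_null_comparison)
  show "\<forall>\<^sub>F n in sequentially. norm (f n * g n) \<le> \<bar>f n\<bar> * K"
    using assms(2) by (intro always_eventually allI) (auto simp: abs_mult intro: mult_left_mono)
  show "(\<lambda>n. \<bar>f n\<bar> * K) \<longlonglongrightarrow> 0"
    using tendsto_mult[OF tendsto_rabs[OF assms(1)] tendsto_const[of K]] by simp
qed

lemma tendsto_diff_mult_bounded:
  fixes f g f' g' :: "nat \<Rightarrow> real"
  assumes "(\<lambda>n. f n - f' n) \<longlonglongrightarrow> 0" "(\<lambda>n. g n - g' n) \<longlonglongrightarrow> 0"
    "\<And>n. \<bar>f' n\<bar> \<le> K" "\<And>n. \<bar>g' n\<bar> \<le> L"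
  shows "(\<lambda>n. f n * g n - f' n * g' n) \<longlonglongrightarrow> 0"
proof -
  have "(\<lambda>n. (f n - f' n) * (g n - g' n) + (f n - f' n) * g' n + (g n - g' n) * f' n) \<longlonglongrightarrow> 0 * 0 + 0 + 0"
    by (intro tendsto_add tendsto_mult assms(1,2) tendsto_null_mult_bounded[OF assms(1,4)]
        tendsto_null_mult_bounded[OF assms(2,3)])
  then show ?thesis by (simp add: algebra_simps)
qed

text \<open>The sequence \<open>m\<close> need not converge, so only the difference of the quotients
  is controlled. Both denominators are at least 1, which bounds the difference by those of the
  coefficients.\<close>

lemma renewal_quotient_tendsto:
  fixes a b m :: "nat \<Rightarrow> real"
  assumes "a \<longlonglongrightarrow> r" "b \<longlonglongrightarrow> r" "0 < r" "\<And>n. 0 \<le> b n" "\<And>n. 0 \<le> m n \<and> m n \<le> 1"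
  shows "(\<lambda>n. a n / (1 + b n * m n) - r / (1 + r * m n)) \<longlonglongrightarrow> 0"
proof (rule Lim_null_comparison)
  show "\<forall>\<^sub>F n in sequentially. norm (a n / (1 + b n * m n) - r / (1 + r * m n)) \<le> \<bar>a n - r\<bar> + r * \<bar>a n - b n\<bar>"
  proof (intro always_eventually allI)
    fix n
    have pos: "1 \<le> 1 + b n * m n" "1 \<le> 1 + r * m n" using assms(3-5) by auto
    have "1 * 1 \<le> (1 + b n * m n) * (1 + r * m n)"
      using pos by (intro mult_mono) auto
    then have den: "1 \<le> (1 + b n * m n) * (1 + r * m n)" by simp
    have "a n / (1 + b n * m n) - r / (1 + r * m n) =
      (a n * (1 + r * m n) - r * (1 + b n * m n)) / ((1 + b n * m n) * (1 + r * m n))"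
      using pos by (subst diff_frac_eq) auto
    then have "\<bar>a n / (1 + b n * m n) - r / (1 + r * m n)\<bar> =
      \<bar>a n * (1 + r * m n) - r * (1 + b n * m n)\<bar> / ((1 + b n * m n) * (1 + r * m n))"
      using den by (simp only: abs_divide)
    also have "\<dots> \<le> \<bar>a n * (1 + r * m n) - r * (1 + b n * m n)\<bar> / 1"
      using den by (intro divide_left_mono) auto
    also have "a n * (1 + r * m n) - r * (1 + b n * m n) = (a n - r) + r * (m n * (a n - b n))"
      by (simp add: algebra_simps)
    also have "\<bar>\<dots>\<bar> \<le> \<bar>a n - r\<bar> + r * (m n * \<bar>a n - b n\<bar>)"
      using assms(3,5) abs_triangle_ineq[of "a n - r" "r * (m n * (a n - b n))"] by (simp add: abs_mult)
    also have "r * (m n * \<bar>a n - b n\<bar>) \<le> r * (1 * \<bar>a n - b n\<bar>)"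
      using assms(3,5) by (intro mult_left_mono mult_right_mono) auto
    finally show "norm (a n / (1 + b n * m n) - r / (1 + r * m n)) \<le> \<bar>a n - r\<bar> + r * \<bar>a n - b n\<bar>" by simp
  qed
  have "(\<lambda>n. \<bar>a n - r\<bar> + r * \<bar>a n - b n\<bar>) \<longlonglongrightarrow> \<bar>r - r\<bar> + r * \<bar>r - r\<bar>"
    by (intro tendsto_intros assms)
  then show "(\<lambda>n. \<bar>a n - r\<bar> + r * \<bar>a n - b n\<bar>) \<longlonglongrightarrow> 0" by simp
qed

context regular_measure
begin

text \<open>The conditional mean of \<open>H n\<close> is \<open>c n\<close> up to an error tending
  to 0 uniformly over pasts. Differences are used because \<open>c\<close> may have no limit, as
  happens before either side of the equivalence is assumed.\<close>

definition asymp_mean :: "(nat \<Rightarrow> 'v seq \<Rightarrow> ennreal) \<Rightarrow> (nat \<Rightarrow> real) \<Rightarrow> bool" where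
  "asymp_mean H c \<longleftrightarrow> (\<exists>l u. (\<forall>n. 0 \<le> l n) \<and> (\<forall>n. 0 \<le> u n) \<and>
    (\<lambda>n. l n - c n) \<longlonglongrightarrow> 0 \<and> (\<lambda>n. u n - c n) \<longlonglongrightarrow> 0 \<and>
    eventually (\<lambda>n. mean_between UNIV (ennreal (l n)) (ennreal (u n)) (H n)) sequentially)"

text \<open>A product of discounts, one rate per successive gap. Hitting times are positive whereas
  \<open>Pass\<close> admits time 0; hence the step by 1 and the extra factor
  \<open>r\<close>.\<close>

primrec Gaps :: "nat \<Rightarrow> ennreal list \<Rightarrow> 'v seq \<Rightarrow> ennreal" where
  "Gaps n [] = (\<lambda>_. 1)"
| "Gaps n (r # rs) = (\<lambda>y. r * Pass n r (Gaps n rs) (shift_by 1 y))"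

lemma measurable_Gaps [measurable]: "Gaps n rs \<in> borel_measurable M"
proof (induction rs)
  case (Cons r rs)
  note [measurable] = Cons
  have "Pass n r (Gaps n rs) \<in> borel_measurable M" by measurable
  from measurable_compose[OF measurable_shift_by_M this]
  show ?case by simp
qed simp

lemma Pass_shift_by:
  assumes "\<And>k. k < l \<Longrightarrow> shift_by k z \<notin> B n"
  shows "Pass n r K z = r ^ l * Pass n r K (shift_by l z)"
proof (cases "\<exists>i. shift_by l z \<in> first_hit n i")
  case True
  then obtain i where i: "shift_by l z \<in> first_hit n i" by blast
  have "shift_by k z \<notin> B n" if "k < i + l" for k
  proof (cases "k < l")
    case False
    then have "k - l < i" using that by linarith
    then have "shift_by (k - l) (shift_by l z) \<notin> B n" using i unfolding first_hit_def by blast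
    then show ?thesis using False by simp
  qed (rule assms)
  then have "z \<in> first_hit n (i + l)" using i by (auto simp: first_hit_def)
  then show ?thesis by (simp add: Pass_eq Pass_eq[OF i] power_add mult_ac)
next
  case False
  have "z \<notin> first_hit n i" for i
  proof
    assume i: "z \<in> first_hit n i"
    then have "l \<le> i" using assms by (auto simp: first_hit_def not_less[symmetric])
    then have "shift_by (i - l) (shift_by l z) \<in> B n" using i by (simp add: first_hit_def)
    then show False using first_hit_ex False by blast
  qed
  then show ?thesis using False by (simp add: Pass_eq_0)
qed

text \<open>From a hit, the next strictly later hit is found by completing the excursion, which
  contains none, and then passing to a hit. This converts the shifted form in \<open>Gaps\<close>
  into the form with known means.\<close>

lemma next_hit_on_B:
  assumes n: "2 * j < n" and z: "z \<in> B n"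
  shows "r * Pass n r K (shift_by 1 z) = Exc r (Pass n r K) z"
proof (cases "\<exists>l. z \<in> excursion l")
  case True
  then obtain l where l: "z \<in> excursion l" by blast
  then have "0 < l" by (auto simp: excursion_def)
  have "Pass n r K (shift_by 1 z) = r ^ (l - 1) * Pass n r K (shift_by (l - 1) (shift_by 1 z))"
  proof (rule Pass_shift_by)
    fix k assume k: "k < l - 1"
    show "shift_by k (shift_by 1 z) \<notin> B n"
      using no_hit_in_excursion[OF n z, of "Suc k" l] l k by auto
  qed
  then show ?thesis using \<open>0 < l\<close>
    by (simp add: Exc_eq[OF l] mult.assoc[symmetric] power_Suc[symmetric] del: power_Suc)
next
  case False
  have "shift_by 1 z \<notin> first_hit n k" for k
  proof
    assume "shift_by 1 z \<in> first_hit n k"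
    then have "shift_by (Suc k) z \<in> B n" by (simp add: first_hit_def)
    then show False using hit_after_excursion[OF n z, of "Suc k"] False by blast
  qed
  then show ?thesis using False by (simp add: Exc_eq_0 Pass_eq_0)
qed

lemma Pass_Gaps_Cons:
  assumes n: "2 * j < n"
  shows "Pass n t (Gaps n (r # rs)) z = Pass n t (Exc r (Pass n r (Gaps n rs))) z"
proof (cases "\<exists>l. z \<in> first_hit n l")
  case True
  then obtain l where l: "z \<in> first_hit n l" by blast
  then have "shift_by l z \<in> B n" by (simp add: first_hit_def)
  from next_hit_on_B[OF n this, of r "Gaps n rs"] show ?thesis by (simp add: Pass_eq[OF l])
qed (simp add: Pass_eq_0)

lemma exc_mean_le_1:
  assumes "1 \<le> n" "r \<le> 1"
  shows "exc_mean n r \<le> 1"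
proof -
  have pow: "r ^ l \<le> 1" for l using assms(2) by (induction l) (auto intro: mult_le_one)
  have "Exc r (\<lambda>_. 1) z \<le> 1" for z
  proof (cases "\<exists>l. z \<in> excursion l")
    case True
    then show ?thesis using pow by (auto simp: Exc_eq)
  qed (simp add: Exc_eq_0)
  then have "(\<integral>\<^sup>+z\<in>B n. Exc r (\<lambda>_. 1) z \<partial>M) \<le> (\<integral>\<^sup>+z\<in>B n. 1 \<partial>M)"
    by (intro nn_integral_mono mult_right_mono) auto
  then have "exc_mean n r \<le> emeasure M (B n) / emeasure M (B n)"
    unfolding exc_mean_def by (intro divide_right_mono_ennreal) simp
  also have "\<dots> = 1" using emeasure_B[OF assms(1)] by (intro ennreal_divide_self) (auto simp: less_top)
  finally show ?thesis .
qed

end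

context regular_renewal
begin

text \<open>The truncation at 1 makes the bounds valid for every \<open>n\<close>;
  \<open>exc_mean_eq\<close> shows that it changes nothing once the scale is positive.\<close>

definition mean :: "real \<Rightarrow> nat \<Rightarrow> real" where
  "mean s n = min 1 (enn2real (exc_mean n (ennreal (q s n))))"

text \<open>The solution of the renewal equation \<open>R = J * (1 + m * R)\<close> for the passage
  mean.\<close>

definition J :: "real \<Rightarrow> nat \<Rightarrow> real" where
  "J s n = R s / (1 + R s * mean s n)"

lemma mean_bounds: "0 \<le> mean s n" "mean s n \<le> 1"
  by (auto simp: mean_def)

lemma J_bounds:
  assumes "0 < s"
  shows "0 \<le> J s n" "J s n \<le> R s"
proof -
  have "0 < R s" "0 \<le> mean s n" using R_pos[OF assms] mean_bounds by auto
  then have "1 \<le> 1 + R s * mean s n" by simp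
  then show "0 \<le> J s n" "J s n \<le> R s"
    using \<open>0 < R s\<close> unfolding J_def by (auto simp: divide_le_eq mult_le_cancel_left1)
qed

lemma exc_mean_eq:
  assumes "0 < s" "0 < \<N> n" "1 \<le> n"
  shows "exc_mean n (ennreal (q s n)) = ennreal (mean s n)"
proof -
  have "ennreal (q s n) \<le> 1" using q_bounds[OF assms(1,2)] by simp
  from exc_mean_le_1[OF assms(3) this] show ?thesis
    unfolding mean_def by (cases "exc_mean n (ennreal (q s n))") (auto simp: min_def top_unique)
qed

lemma exp_mean_tendsto: "(\<lambda>n. exp (e * \<omega> n) * mean t n - mean t n) \<longlonglongrightarrow> 0"
proof -
  have "(\<lambda>n. exp (e * \<omega> n) - 1) \<longlonglongrightarrow> exp (e * 0) - 1"
    using oscillation by (intro tendsto_intros)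
  then have "(\<lambda>n. (exp (e * \<omega> n) - 1) * mean t n) \<longlonglongrightarrow> 0"
    using mean_bounds[of t] by (intro tendsto_null_mult_bounded[where K = 1]) simp_all
  then show ?thesis by (simp add: algebra_simps)
qed

text \<open>Solves the two inequalities of \<open>renewal_bounds\<close> for the passage mean, with
  a tolerance for the count that shrinks with \<open>n\<close>; both solutions have the same
  asymptotics \<open>J s\<close>.\<close>

lemma pass_asymp_mean:
  assumes s: "0 < s"
  shows "asymp_mean (\<lambda>n. Pass n (ennreal (q s n)) (\<lambda>_. 1)) (J s)"
proof -
  obtain e :: "nat \<Rightarrow> real" where e: "e \<longlonglongrightarrow> 0"
    and ev: "eventually (\<lambda>n. mean_between UNIV (ennreal (R s - e n)) (ennreal (R s + e n)) (G n (ennreal (q s n)))) sequentially"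
    by (rule eventually_diagonal[OF G_uniform[OF s]])
  \<comment> \<open>Cutting at 0 matches the conversion to \<open>ennreal\<close>, which sends
    negative numbers to 0; in the limit it is invisible since \<open>R s\<close> is
    positive.\<close>
  define Rm where "Rm n = max 0 (R s - e n)" for n
  define Rp where "Rp n = max 0 (R s + e n)" for n
  have r: "0 < R s" using R_pos[OF s] .
  have "(\<lambda>n. max 0 (R s - e n)) \<longlonglongrightarrow> max 0 (R s - 0)" "(\<lambda>n. max 0 (R s + e n)) \<longlonglongrightarrow> max 0 (R s + 0)"
    using e by (intro tendsto_intros; assumption)+
  then have lim: "Rm \<longlonglongrightarrow> R s" "Rp \<longlonglongrightarrow> R s" using r by (simp_all add: Rm_def[abs_def] Rp_def[abs_def] max_absorb2)
  have nonneg: "0 \<le> Rm n" "0 \<le> Rp n" for n by (auto simp: Rm_def Rp_def)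
  have Rm_eq: "ennreal (R s - e n) = ennreal (Rm n)" "ennreal (R s + e n) = ennreal (Rp n)" for n
    by (auto simp: Rm_def Rp_def max_def ennreal_neg)
  define l where "l n = Rm n / (1 + (Rp n * exp (\<omega> n)) * mean s n)" for n
  define u where "u n = Rp n / (1 + (Rm n * exp (- \<omega> n)) * mean s n)" for n
  have "(\<lambda>n. Rp n * exp (\<omega> n)) \<longlonglongrightarrow> R s * exp 0"
    using lim oscillation by (intro tendsto_intros)
  then have lim'1: "(\<lambda>n. Rp n * exp (\<omega> n)) \<longlonglongrightarrow> R s" by simp
  have "(\<lambda>n. Rm n * exp (- \<omega> n)) \<longlonglongrightarrow> R s * exp (- 0)"
    using lim oscillation by (intro tendsto_intros)
  then have lim'2: "(\<lambda>n. Rm n * exp (- \<omega> n)) \<longlonglongrightarrow> R s" by simp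
  note lim' = lim'1 lim'2
  have l_lim: "(\<lambda>n. l n - J s n) \<longlonglongrightarrow> 0" unfolding l_def J_def
    using mean_bounds nonneg by (intro renewal_quotient_tendsto lim lim' r) auto
  have u_lim: "(\<lambda>n. u n - J s n) \<longlonglongrightarrow> 0" unfolding u_def J_def
    using mean_bounds nonneg by (intro renewal_quotient_tendsto lim lim' r) auto
  have lu: "0 \<le> l n" "0 \<le> u n" for n
    unfolding l_def u_def using nonneg mean_bounds by (auto intro!: divide_nonneg_nonneg add_nonneg_nonneg)
  have "eventually (\<lambda>n. mean_between UNIV (ennreal (l n)) (ennreal (u n)) (Pass n (ennreal (q s n)) (\<lambda>_. 1))) sequentially"
    using ev eventually_scale_pos eventually_gt_at_top[of "2 * j"]
  proof eventually_elim
    case (elim n)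
    have m: "exc_mean n (ennreal (q s n)) = ennreal (mean s n)"
      by (rule exc_mean_eq[OF s elim(2)]) (use elim(3) in simp)
    have G: "mean_between UNIV (ennreal (Rm n)) (ennreal (Rp n)) (G n (ennreal (q s n)))"
      using elim(1) unfolding Rm_eq .
    have F: "1 + ennreal c * (ennreal (exp w) * exc_mean n (ennreal (q s n))) = ennreal (1 + c * exp w * mean s n)"
      and pos: "0 < 1 + c * exp w * mean s n" if "0 \<le> c" for c w
      using that mean_bounds[of s n] by (simp_all add: m ennreal_mult mult.assoc add_pos_nonneg flip: ennreal_1)
    show ?case
      unfolding mean_between_UNIV l_def u_def
      using renewal_bounds[OF elim(3) G] unfolding F[OF nonneg(1)] F[OF nonneg(2)]
      by (intro allI impI conjI ennreal_divide_bounds pos nonneg) auto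
  qed
  then show ?thesis
    unfolding asymp_mean_def using lu l_lim u_lim by (intro exI[of _ l] exI[of _ u]) auto
qed

text \<open>Asymptotic independence: the bounds for continuation, excursion and passage multiply,
  each being uniform over the past that the preceding piece creates.\<close>

lemma pass_exc_asymp_mean:
  assumes s: "0 < s" and t: "0 < t" and H: "asymp_mean H c" and [measurable]: "\<And>n. H n \<in> borel_measurable M"
    and c: "\<And>n. \<bar>c n\<bar> \<le> K"
  shows "asymp_mean (\<lambda>n. Pass n (ennreal (q s n)) (Exc (ennreal (q t n)) (H n))) (\<lambda>n. c n * mean t n * J s n)"
proof -
  obtain l u where lu: "\<And>n. 0 \<le> l n" "\<And>n. 0 \<le> u n" and lim: "(\<lambda>n. l n - c n) \<longlonglongrightarrow> 0" "(\<lambda>n. u n - c n) \<longlonglongrightarrow> 0"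
    and ev: "eventually (\<lambda>n. mean_between UNIV (ennreal (l n)) (ennreal (u n)) (H n)) sequentially"
    using H unfolding asymp_mean_def by auto
  obtain l' u' where lu': "\<And>n. 0 \<le> l' n" "\<And>n. 0 \<le> u' n" and lim': "(\<lambda>n. l' n - J s n) \<longlonglongrightarrow> 0" "(\<lambda>n. u' n - J s n) \<longlonglongrightarrow> 0"
    and ev': "eventually (\<lambda>n. mean_between UNIV (ennreal (l' n)) (ennreal (u' n)) (Pass n (ennreal (q s n)) (\<lambda>_. 1))) sequentially"
    using pass_asymp_mean[OF s] unfolding asymp_mean_def by auto
  define L where "L n = (l n * (exp (- \<omega> n) * mean t n)) * l' n" for n
  define U where "U n = (u n * (exp (\<omega> n) * mean t n)) * u' n" for n
  have mean_abs: "\<bar>mean t n\<bar> \<le> 1" for n using mean_bounds[of t n] by simp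
  have J_abs: "\<bar>J s n\<bar> \<le> R s" for n using J_bounds[OF s, of n] by simp
  have K0: "0 \<le> K" using c[of 0] by simp
  have cm: "\<bar>c n * mean t n\<bar> \<le> K * 1" for n
    unfolding abs_mult using c[of n] mean_abs[of n] K0 by (intro mult_mono) auto
  have L_lim: "(\<lambda>n. L n - c n * mean t n * J s n) \<longlonglongrightarrow> 0"
    unfolding L_def using exp_mean_tendsto[of "-1" t]
    by (intro tendsto_diff_mult_bounded[OF tendsto_diff_mult_bounded[OF lim(1) _ c mean_abs] lim'(1) cm J_abs]) simp
  have U_lim: "(\<lambda>n. U n - c n * mean t n * J s n) \<longlonglongrightarrow> 0"
    unfolding U_def using exp_mean_tendsto[of 1 t]
    by (intro tendsto_diff_mult_bounded[OF tendsto_diff_mult_bounded[OF lim(2) _ c mean_abs] lim'(2) cm J_abs]) simp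
  have "eventually (\<lambda>n. mean_between UNIV (ennreal (L n)) (ennreal (U n)) (Pass n (ennreal (q s n)) (Exc (ennreal (q t n)) (H n)))) sequentially"
    using ev ev' eventually_scale_pos eventually_gt_at_top[of "2 * j"]
  proof eventually_elim
    case (elim n)
    have n1: "1 \<le> n" using elim(4) by simp
    have m: "exc_mean n (ennreal (q t n)) = ennreal (mean t n)"
      by (rule exc_mean_eq[OF t elim(3) n1])
    have "mean_between (B n) (ennreal (l n) * (ennreal (exp (- \<omega> n)) * ennreal (mean t n)))
        (ennreal (u n) * (ennreal (exp (\<omega> n)) * ennreal (mean t n))) (Exc (ennreal (q t n)) (H n))"
      unfolding m[symmetric] by (rule exc_between[OF n1 _ elim(1)]) measurable
    note P = pass_between[OF elim(4) _ this]
    show ?case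
      unfolding mean_between_UNIV
    proof (intro allI impI conjI)
      fix N D assume D: "detv N D"
      let ?X = "past N D (Pass n (ennreal (q s n)) (\<lambda>_. 1))"
      have X: "ennreal (l' n) * emeasure M D \<le> ?X" "?X \<le> ennreal (u' n) * emeasure M D"
        using elim(2) D unfolding mean_between_UNIV by auto
      let ?I = "past N D (Pass n (ennreal (q s n)) (Exc (ennreal (q t n)) (H n)))"
      have "ennreal (L n) * emeasure M D = ennreal (l n) * (ennreal (exp (- \<omega> n)) * ennreal (mean t n)) * (ennreal (l' n) * emeasure M D)"
        unfolding L_def using lu(1) lu'(1) mean_bounds by (simp add: ennreal_mult mult.assoc)
      also have "\<dots> \<le> ?I" by (rule order_trans[OF mult_left_mono[OF X(1)] P(1)[OF _ D]]) measurable
      finally show "ennreal (L n) * emeasure M D \<le> ?I" .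
      have "?I \<le> ennreal (u n) * (ennreal (exp (\<omega> n)) * ennreal (mean t n)) * (ennreal (u' n) * emeasure M D)"
        by (rule order_trans[OF P(2)[OF _ D] mult_left_mono[OF X(2)]]) measurable
      also have "\<dots> = ennreal (U n) * emeasure M D"
        unfolding U_def using lu(2) lu'(2) mean_bounds by (simp add: ennreal_mult mult.assoc)
      finally show "?I \<le> ennreal (U n) * emeasure M D" .
    qed
  qed
  moreover have "0 \<le> L n" "0 \<le> U n" for n
    unfolding L_def U_def using lu lu' mean_bounds by simp_all
  ultimately show ?thesis
    unfolding asymp_mean_def using L_lim U_lim by (intro exI[of _ L] exI[of _ U]) auto
qed

definition gap_product :: "real list \<Rightarrow> nat \<Rightarrow> real" where
  "gap_product ss n = (\<Prod>t\<leftarrow>ss. mean t n * J t n)"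

definition gaps :: "real list \<Rightarrow> nat \<Rightarrow> ennreal list" where
  "gaps ss n = map (\<lambda>t. ennreal (q t n)) ss"

lemma gap_product_bounded:
  assumes "\<forall>t\<in>set ss. 0 < t"
  shows "\<exists>K. \<forall>n. \<bar>gap_product ss n\<bar> \<le> K"
  using assms
proof (induction ss)
  case (Cons t ss)
  then obtain K where K: "\<And>n. \<bar>gap_product ss n\<bar> \<le> K" by auto
  have "\<bar>gap_product (t # ss) n\<bar> \<le> (1 * R t) * K" for n
  proof -
    have "\<bar>mean t n * J t n\<bar> \<le> 1 * R t"
      unfolding abs_mult using J_bounds[of t n] mean_bounds[of t n] Cons.prems by (intro mult_mono) auto
    moreover have "0 < R t" using R_pos Cons.prems by simp
    ultimately show ?thesis
      using K[of n] unfolding gap_product_def by (simp add: abs_mult mult_mono)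
  qed
  then show ?case by blast
qed (auto simp: gap_product_def)

lemma asymp_mean_cong:
  assumes "asymp_mean H c" "eventually (\<lambda>n. H n = H' n) sequentially" "\<And>n. c n = c' n"
  shows "asymp_mean H' c'"
proof -
  have c: "c = c'" using assms(3) by auto
  obtain l u where "\<And>n. 0 \<le> l n" "\<And>n. 0 \<le> u n" "(\<lambda>n. l n - c n) \<longlonglongrightarrow> 0" "(\<lambda>n. u n - c n) \<longlonglongrightarrow> 0"
    and ev: "eventually (\<lambda>n. mean_between UNIV (ennreal (l n)) (ennreal (u n)) (H n)) sequentially"
    using assms(1) unfolding asymp_mean_def by auto
  moreover have "eventually (\<lambda>n. mean_between UNIV (ennreal (l n)) (ennreal (u n)) (H' n)) sequentially"
    using ev assms(2) by eventually_elim simp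
  ultimately show ?thesis unfolding asymp_mean_def c by (intro exI[of _ l] exI[of _ u]) auto
qed

text \<open>The first passage contributes \<open>J\<close> alone; each further gap starts from a hit
  and contributes an excursion and a passage, with its own rate. Induction prepends one gap.\<close>

theorem pass_gaps_asymp_mean:
  assumes "0 < s" "\<forall>t\<in>set ss. 0 < t"
  shows "asymp_mean (\<lambda>n. Pass n (ennreal (q s n)) (Gaps n (gaps ss n))) (\<lambda>n. J s n * gap_product ss n)"
  using assms
proof (induction ss arbitrary: s)
  case Nil
  then show ?case using pass_asymp_mean by (simp add: gaps_def gap_product_def)
next
  case (Cons t ss)
  have t: "0 < t" "\<forall>t\<in>set ss. 0 < t" using Cons.prems by auto
  obtain K where K: "\<And>n. \<bar>gap_product ss n\<bar> \<le> K" using gap_product_bounded[OF t(2)] by auto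
  have "\<bar>J t n * gap_product ss n\<bar> \<le> R t * K" for n
    unfolding abs_mult using J_bounds[OF t(1), of n] K[of n] by (intro mult_mono) auto
  then have "asymp_mean (\<lambda>n. Pass n (ennreal (q s n)) (Exc (ennreal (q t n)) (Pass n (ennreal (q t n)) (Gaps n (gaps ss n)))))
    (\<lambda>n. J t n * gap_product ss n * mean t n * J s n)"
    by (intro pass_exc_asymp_mean[OF Cons.prems(1) t(1) Cons.IH[OF t]]) measurable
  then show ?case
  proof (rule asymp_mean_cong)
    show "eventually (\<lambda>n. Pass n (ennreal (q s n)) (Exc (ennreal (q t n)) (Pass n (ennreal (q t n)) (Gaps n (gaps ss n)))) =
      Pass n (ennreal (q s n)) (Gaps n (gaps (t # ss) n))) sequentially"
      using eventually_gt_at_top[of "2 * j"]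
      by eventually_elim (auto simp: gaps_def Pass_Gaps_Cons fun_eq_iff simp del: Gaps.simps)
  qed (simp add: gap_product_def)
qed

text \<open>Starting in \<open>B n\<close> means taking the trivial past \<open>Y\<close> at time 0
  and conditioning on \<open>B n\<close>. The first gap therefore already begins with an excursion
  and has the same form as all later ones.\<close>

theorem gaps_from_B:
  assumes "\<forall>t\<in>set ss. 0 < t" "ss \<noteq> []"
  shows "(\<lambda>n. enn2real (\<integral>\<^sup>+z\<in>B n. Gaps n (gaps ss n) z \<partial>M) / measure M (B n) - gap_product ss n) \<longlonglongrightarrow> 0"
proof -
  obtain t ts where ss: "ss = t # ts" using assms(2) by (cases ss) auto
  have t: "0 < t" "\<forall>t\<in>set ts. 0 < t" using assms ss by auto
  obtain K where K: "\<And>n. \<bar>gap_product ts n\<bar> \<le> K" using gap_product_bounded[OF t(2)] by auto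
  have cb: "\<bar>J t n * gap_product ts n\<bar> \<le> R t * K" for n
    unfolding abs_mult using J_bounds[OF t(1), of n] K[of n] by (intro mult_mono) auto
  obtain l u where lu: "\<And>n. 0 \<le> l n" "\<And>n. 0 \<le> u n"
    and lim: "(\<lambda>n. l n - J t n * gap_product ts n) \<longlonglongrightarrow> 0" "(\<lambda>n. u n - J t n * gap_product ts n) \<longlonglongrightarrow> 0"
    and ev: "eventually (\<lambda>n. mean_between UNIV (ennreal (l n)) (ennreal (u n)) (Pass n (ennreal (q t n)) (Gaps n (gaps ts n)))) sequentially"
    using pass_gaps_asymp_mean[OF t] unfolding asymp_mean_def by auto
  let ?H = "\<lambda>n. Pass n (ennreal (q t n)) (Gaps n (gaps ts n))"
  define A where "A n = enn2real (\<integral>\<^sup>+z\<in>B n. Gaps n (gaps ss n) z \<partial>M) / measure M (B n)" for n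
  have mean_abs: "\<bar>mean t n\<bar> \<le> 1" for n using mean_bounds[of t n] by simp
  have gp: "gap_product ss n = J t n * gap_product ts n * mean t n" for n
    by (simp add: ss gap_product_def)
  have L: "(\<lambda>n. l n * (exp (- 1 * \<omega> n) * mean t n) - gap_product ss n) \<longlonglongrightarrow> 0"
    and U: "(\<lambda>n. u n * (exp (1 * \<omega> n) * mean t n) - gap_product ss n) \<longlonglongrightarrow> 0"
    unfolding gp by (rule tendsto_diff_mult_bounded[OF lim(1) exp_mean_tendsto cb mean_abs] tendsto_diff_mult_bounded[OF lim(2) exp_mean_tendsto cb mean_abs])+
  have ev2: "eventually (\<lambda>n. l n * (exp (- 1 * \<omega> n) * mean t n) \<le> A n \<and> A n \<le> u n * (exp (1 * \<omega> n) * mean t n)) sequentially"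
    using ev eventually_scale_pos eventually_gt_at_top[of "2 * j"]
  proof eventually_elim
    case (elim n)
    have n1: "1 \<le> n" using elim(3) by simp
    have m: "exc_mean n (ennreal (q t n)) = ennreal (mean t n)"
      by (rule exc_mean_eq[OF t(1) elim(2) n1])
    define I where "I = (\<integral>\<^sup>+z\<in>B n. Gaps n (gaps ss n) z \<partial>M)"
    have YB: "Y \<inter> shift_by 0 -` B n = B n" using B_subset_Y[OF n1] by auto
    have eq: "I = past 0 (B n) (Exc (ennreal (q t n)) (?H n))"
      unfolding I_def
    proof (intro nn_integral_cong)
      fix z
      show "Gaps n (gaps ss n) z * indicator (B n) z = Exc (ennreal (q t n)) (?H n) (shift_by 0 z) * indicator (B n) z"
        using next_hit_on_B[OF elim(3), of z "ennreal (q t n)" "Gaps n (gaps ts n)"]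
        by (cases "z \<in> B n") (auto simp: ss gaps_def)
    qed
    have eB: "emeasure M (B n) = ennreal (measure M (B n))"
      using emeasure_B(2)[OF n1] by (simp add: emeasure_eq_ennreal_measure)
    have mB: "0 < measure M (B n)" using measure_B_pos[OF n1] .
    have H_meas: "?H n \<in> borel_measurable M" by measurable
    note exc_between[OF n1 H_meas elim(1), of "ennreal (q t n)", unfolded mean_between_def, rule_format, OF detv_Y, unfolded YB m eB, folded eq]
    then have I: "ennreal (l n * (exp (- \<omega> n) * mean t n) * measure M (B n)) \<le> I" "I \<le> ennreal (u n * (exp (\<omega> n) * mean t n) * measure M (B n))"
      using lu mean_bounds by (simp_all add: ennreal_mult)
    then have fin: "I \<noteq> top" by (auto simp: top_unique)
    have "l n * (exp (- \<omega> n) * mean t n) * measure M (B n) \<le> enn2real I"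
      using enn2real_mono[OF I(1)] fin lu mean_bounds by (simp add: less_top)
    moreover have "enn2real I \<le> u n * (exp (\<omega> n) * mean t n) * measure M (B n)"
      using enn2real_mono[OF I(2)] lu mean_bounds by simp
    ultimately show ?case using mB by (simp add: A_def I_def pos_le_divide_eq pos_divide_le_eq)
  qed
  show ?thesis
    unfolding A_def[symmetric]
    by (rule tendsto_sandwich[OF eventually_mono[OF ev2] eventually_mono[OF ev2] L U]) simp_all
qed

end

section \<open>Independence of the start\<close>

text \<open>Provides an intersection-stable generator for the extension from determined sets to all
  measurable ones.\<close>

lemma sets_seq_algebra_determined:
  "sets (seq_algebra :: 'v::countable seq measure) = sigma_sets UNIV {D. \<exists>N. determined N D}"
proof
  have "sigma_sets (space seq_algebra) {D. \<exists>N. determined N D} \<subseteq> sets (seq_algebra :: 'v seq measure)"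
    using determined_sets by (intro sets.sigma_sets_subset) blast
  then show "sigma_sets UNIV {D. \<exists>N. determined N D} \<subseteq> sets (seq_algebra :: 'v seq measure)"
    by (simp add: space_PiM)
  have "determined i {f :: 'v seq. f i \<in> A}" for i A by (simp add: determined_def)
  then have "sigma_sets UNIV {{f :: 'v seq. f i \<in> A} | i A. True} \<subseteq> sigma_sets UNIV {D. \<exists>N. determined N D}"
    by (intro sigma_sets_mono') blast
  then show "sets (seq_algebra :: 'v seq measure) \<subseteq> sigma_sets UNIV {D. \<exists>N. determined N D}"
    by (simp add: sets_PiM_single)
qed

lemma abs_integral_le:
  fixes u v :: "'a \<Rightarrow> real"
  assumes v: "integrable M v" and le: "AE z in M. \<bar>u z\<bar> \<le> v z"
  shows "\<bar>\<integral>z. u z \<partial>M\<bar> \<le> (\<integral>z. v z \<partial>M)"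
proof -
  have "\<bar>\<integral>z. u z \<partial>M\<bar> \<le> (\<integral>z. \<bar>u z\<bar> \<partial>M)" using integral_norm_bound[of M u] by simp
  also have "\<dots> \<le> (\<integral>z. v z \<partial>M)"
    using le by (intro integral_mono_AE'[OF v]) (auto elim: eventually_mono)
  finally show ?thesis .
qed

locale bounded_functionals =
  fixes M :: "'a measure" and g :: "nat \<Rightarrow> 'a \<Rightarrow> real" and c :: real
  assumes g_meas [measurable]: "\<And>n. g n \<in> borel_measurable M" and g_bound: "\<And>n z. \<bar>g n z\<bar> \<le> c"
begin

text \<open>The weights along which the functionals \<open>g n\<close> average to 0. Uniform
  boundedness makes this class closed under dominated limits, so it suffices to test it on a
  generator.\<close>

definition good :: "('a \<Rightarrow> real) \<Rightarrow> bool" where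
  "good f \<longleftrightarrow> integrable M f \<and> (\<lambda>n. \<integral>z. f z * g n z \<partial>M) \<longlonglongrightarrow> 0"

lemma mult_g_bound: "\<bar>f z * g n z\<bar> \<le> c * \<bar>f z\<bar>"
  using mult_right_mono[OF g_bound[of n z], of "\<bar>f z\<bar>"] by (simp add: abs_mult mult.commute)

lemma integrable_mult_g: "integrable M f \<Longrightarrow> integrable M (\<lambda>z. f z * g n z)"
  by (rule Bochner_Integration.integrable_bound[where f = "\<lambda>z. c * f z"])
    (auto intro!: AE_I2 order_trans[OF mult_g_bound[unfolded abs_mult]] simp: abs_mult intro: mult_right_mono)

lemma good_add: "good f \<Longrightarrow> good f' \<Longrightarrow> good (\<lambda>z. f z + f' z)"
  using tendsto_add[of "\<lambda>n. \<integral>z. f z * g n z \<partial>M" 0 sequentially "\<lambda>n. \<integral>z. f' z * g n z \<partial>M" 0]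
  by (simp add: good_def distrib_right integrable_mult_g)

lemma good_scale: "good f \<Longrightarrow> good (\<lambda>z. r * f z)"
  using tendsto_mult_left[of "\<lambda>n. \<integral>z. f z * g n z \<partial>M" 0 sequentially r] by (simp add: good_def mult.assoc)

lemma good_diff: "good f \<Longrightarrow> good f' \<Longrightarrow> good (\<lambda>z. f z - f' z)"
  using good_add[of f "\<lambda>z. - 1 * f' z"] good_scale[of f' "- 1"] by simp

lemma good_AE:
  assumes f: "good f" and eq: "AE z in M. f z = f' z" and [measurable]: "f' \<in> borel_measurable M"
  shows "good f'"
proof -
  have [measurable]: "f \<in> borel_measurable M" using f by (auto simp: good_def)
  have "(\<integral>z. f z * g n z \<partial>M) = (\<integral>z. f' z * g n z \<partial>M)" for n
    using eq by (intro integral_cong_AE) auto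
  moreover have "integrable M f'" using f integrable_cong_AE[OF _ _ eq] by (simp add: good_def)
  ultimately show ?thesis using f by (simp add: good_def)
qed

text \<open>Dominated convergence gives approximation in L1, and the common bound on
  \<open>g n\<close> makes the error of the approximation independent of \<open>n\<close>.\<close>

lemma good_lim:
  assumes s: "\<And>i. good (s i)" and lim: "AE z in M. (\<lambda>i. s i z) \<longlonglongrightarrow> f z"
    and w: "integrable M w" "\<And>i. AE z in M. \<bar>s i z\<bar> \<le> w z" and f: "integrable M f" "AE z in M. \<bar>f z\<bar> \<le> w z"
  shows "good f"
proof -
  have s_int: "integrable M (s i)" for i using s by (simp add: good_def)
  have L1: "(\<lambda>i. \<integral>z. \<bar>s i z - f z\<bar> \<partial>M) \<longlonglongrightarrow> (\<integral>z. 0 \<partial>M)"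
  proof (intro integral_dominated_convergence[where w = "\<lambda>z. 2 * w z"])
    show "AE z in M. (\<lambda>i. \<bar>s i z - f z\<bar>) \<longlonglongrightarrow> 0"
      using lim by eventually_elim (intro tendsto_rabs_zero, simp add: LIM_zero_iff)
    show "AE z in M. norm \<bar>s i z - f z\<bar> \<le> 2 * w z" for i
      using w(2)[of i] f(2) by eventually_elim auto
  qed (use w(1) s_int f(1) in auto)
  have "(\<lambda>n. \<integral>z. f z * g n z \<partial>M) \<longlonglongrightarrow> 0"
  proof (rule LIMSEQ_I)
    fix e :: real assume e: "0 < e"
    have "(\<lambda>i. c * (\<integral>z. \<bar>s i z - f z\<bar> \<partial>M)) \<longlonglongrightarrow> 0" using tendsto_mult_left[OF L1, of c] by simp
    then have "eventually (\<lambda>i. c * (\<integral>z. \<bar>s i z - f z\<bar> \<partial>M) < e / 2) sequentially"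
      using e by (intro order_tendstoD) auto
    then obtain i where i: "c * (\<integral>z. \<bar>s i z - f z\<bar> \<partial>M) < e / 2" by (auto simp: eventually_sequentially)
    have "eventually (\<lambda>n. \<bar>\<integral>z. s i z * g n z \<partial>M\<bar> < e / 2) sequentially"
      using s[of i] e by (intro order_tendstoD(2)[of _ 0] tendsto_rabs_zero) (auto simp: good_def)
    then have "eventually (\<lambda>n. norm ((\<integral>z. f z * g n z \<partial>M) - 0) < e) sequentially"
    proof eventually_elim
      case (elim n)
      have "\<bar>(\<integral>z. s i z * g n z \<partial>M) - (\<integral>z. f z * g n z \<partial>M)\<bar> = \<bar>\<integral>z. (s i z - f z) * g n z \<partial>M\<bar>"
        by (simp add: left_diff_distrib integrable_mult_g s_int f)
      also have "\<dots> \<le> (\<integral>z. c * \<bar>s i z - f z\<bar> \<partial>M)"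
        using s_int f by (intro abs_integral_le AE_I2 mult_g_bound[of "\<lambda>z. s i z - f z"]) auto
      finally show ?case using i elim by simp
    qed
    then show "\<exists>no. \<forall>n\<ge>no. norm ((\<integral>z. f z * g n z \<partial>M) - 0) < e" by (simp add: eventually_sequentially)
  qed
  with f show ?thesis by (simp add: good_def)
qed

lemma good_indicator_UN:
  assumes E: "\<And>i::nat. good (indicator (E i))" "\<And>i. E i \<in> sets M" "disjoint_family E" "emeasure M (\<Union>i. E i) < \<infinity>"
  shows "good (indicator (\<Union>i. E i))"
proof (rule good_lim[where s = "\<lambda>k z. \<Sum>i<k. indicator (E i) z" and w = "indicator (\<Union>i. E i)"])
  show "good (\<lambda>z. \<Sum>i<k. indicator (E i) z)" for k
    by (induction k) (auto intro: good_add E simp: good_def[of "\<lambda>_. 0"])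
  have eq: "(\<Sum>i<k. indicator (E i) z :: real) = indicator (\<Union>i<k. E i) z" for k z
    using E(3) by (intro indicator_UN_disjoint[symmetric]) (auto simp: disjoint_family_on_def)
  show "AE z in M. (\<lambda>k. \<Sum>i<k. indicator (E i) z) \<longlonglongrightarrow> (indicator (\<Union>i. E i) z :: real)"
    unfolding eq by (intro AE_I2 LIMSEQ_indicator_UN)
  show "AE z in M. \<bar>\<Sum>i<k. indicator (E i) z\<bar> \<le> (indicator (\<Union>i. E i) z :: real)" for k
    unfolding eq by (auto split: split_indicator)
qed (use E(2,4) in \<open>auto intro!: integrable_real_indicator\<close>)

lemma good_all:
  assumes "\<And>E. E \<in> sets M \<Longrightarrow> emeasure M E < \<infinity> \<Longrightarrow> good (indicator E)" and f: "integrable M f"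
  shows "good f"
  using f
proof (induction rule: integrable_induct)
  case (base A r)
  then show ?case using good_scale[OF assms(1)[of A], of r] by (simp add: mult.commute)
next
  case (add f g)
  then show ?case by (intro good_add)
next
  case (lim f s)
  then show ?case by (intro good_lim[of s f "\<lambda>z. 2 * norm (f z)"]) auto
qed

end

section \<open>Absolutely continuous starting laws\<close>

locale ergodic_renewal = regular_renewal M x \<omega> j a \<alpha> \<beta> h0 \<N>
  for M :: "'v::countable seq measure" and x \<omega> j a \<alpha> \<beta> h0 \<N> +
  assumes finite_letters: "\<And>p. emeasure M (cyl 1 p) < \<infinity>"
    and nonsingular: "\<And>E k. E \<in> null_sets M \<Longrightarrow> shift_by k -` E \<in> null_sets M"
    and visit_AE: "AE z in M. \<exists>l. z l = x 0"
begin

lemma determined_sets_M: "determined N D \<Longrightarrow> D \<in> sets M"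
  using determined_sets sets_M by blast

lemma singleton_Inter: "(\<Inter>n. B n) = {x}"
  by (auto simp: cyl_def fun_eq_iff)

lemma singleton_sets: "{x} \<in> sets M"
proof -
  have "(\<Inter>n. B n) \<in> sets M" by measurable
  then show ?thesis unfolding singleton_Inter .
qed

lemma null_x: "{x} \<in> null_sets M"
proof -
  have "emeasure M {x} \<le> ennreal (measure M (B n))" if "1 \<le> n" for n
  proof -
    have "emeasure M {x} \<le> emeasure M (B n)" by (intro emeasure_mono cyl_sets_M) (auto simp: cyl_def)
    also have "\<dots> = ennreal (measure M (B n))" using emeasure_B(2)[OF that] by (rule emeasure_eq_ennreal_measure)
    finally show ?thesis .
  qed
  then have "eventually (\<lambda>n. emeasure M {x} \<le> ennreal (measure M (B n))) sequentially"
    by (auto simp: eventually_sequentially)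
  then have "emeasure M {x} \<le> ennreal 0"
    by (intro tendsto_lowerbound[OF tendsto_ennrealI[OF measure_B_0]]) auto
  then show ?thesis using singleton_sets by (auto intro: null_setsI)
qed

text \<open>Splits a set known up to time \<open>d\<close> according to the first visit to
  \<open>x 0\<close> from then on, which turns it into countably many eligible pasts.\<close>

definition visit_from :: "nat \<Rightarrow> nat \<Rightarrow> 'v seq set" where
  "visit_from d l = {z. d \<le> l \<and> z l = x 0 \<and> (\<forall>i. d \<le> i \<and> i < l \<longrightarrow> z i \<noteq> x 0)}"

lemma determined_visit_from: "determined l (visit_from d l)"
  by (auto simp: determined_def visit_from_def)

lemma visit_from_unique:
  assumes "z \<in> visit_from d l" "z \<in> visit_from d l'"
  shows "l = l'"
  using assms by (cases l l' rule: linorder_cases) (auto simp: visit_from_def)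

lemma visit_from_AE: "AE z in M. \<exists>l. z \<in> visit_from d l"
proof -
  have 1: "{z. \<not> (\<exists>l. z l = x 0)} \<in> sets M"
  proof -
    have "{z. z l = x 0} \<in> sets M" for l by (rule determined_sets_M[of l]) (auto simp: determined_def)
    then have "(\<Inter>l. - {z. z l = x 0}) \<in> sets M" by (intro sets.countable_INT) (auto simp: Compl_eq_Diff_UNIV sets.compl_sets[of _ M, simplified])
    also have "(\<Inter>l. - {z. z l = x 0}) = {z. \<not> (\<exists>l. z l = x 0)}" by auto
    finally show ?thesis .
  qed
  then have "{z. \<not> (\<exists>l. z l = x 0)} \<in> null_sets M"
    using visit_AE by (simp add: AE_iff_null)
  from nonsingular[OF this, of d] have "AE z in M. z \<notin> shift_by d -` {z. \<not> (\<exists>l. z l = x 0)}"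
    by (rule AE_not_in)
  then show ?thesis
  proof eventually_elim
    case (elim z)
    then obtain l0 where l0: "z (l0 + d) = x 0" by (auto simp: shift_by_apply)
    define l where "l = (LEAST i. d \<le> i \<and> z i = x 0)"
    have "d \<le> l \<and> z l = x 0" unfolding l_def by (rule LeastI[of _ "l0 + d"]) (simp add: l0)
    moreover have "z i \<noteq> x 0" if "d \<le> i" "i < l" for i
      using not_less_Least[of i "\<lambda>i. d \<le> i \<and> z i = x 0"] that unfolding l_def by blast
    ultimately have "z \<in> visit_from d l" unfolding visit_from_def by blast
    then show ?case by blast
  qed
qed

text \<open>The sets decrease to the points of \<open>D\<close> whose orbit is exactly
  \<open>x\<close> at time \<open>k\<close>, a null set by nonsingularity.\<close>

lemma early_hit_0:
  assumes D: "detv N D"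
  shows "(\<lambda>n. measure M (D \<inter> shift_by k -` B n)) \<longlonglongrightarrow> 0"
proof -
  note [measurable] = detv_sets[OF D]
  have "(\<lambda>n. measure M (D \<inter> shift_by k -` B n)) \<longlonglongrightarrow> measure M (\<Inter>n. D \<inter> shift_by k -` B n)"
  proof (rule Lim_measure_decseq)
    show "decseq (\<lambda>n. D \<inter> shift_by k -` B n)" by (rule decseq_SucI) (auto simp: cyl_def)
    show "emeasure M (D \<inter> shift_by k -` B n) \<noteq> \<infinity>" for n
      using finite_subset_detv[OF D, of "D \<inter> shift_by k -` B n"] by simp
  qed auto
  also have "(\<Inter>n. D \<inter> shift_by k -` B n) = D \<inter> shift_by k -` {x}"
    unfolding singleton_Inter[symmetric] by blast
  also have "measure M \<dots> = 0"
    using null_set_Int1[OF nonsingular[OF null_x], of D k] by (auto simp: measure_def null_sets_def Int_commute)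
  finally show ?thesis .
qed

context
  fixes s c0 :: real and c :: "nat \<Rightarrow> real" and K :: "nat \<Rightarrow> 'v seq \<Rightarrow> ennreal"
  assumes s: "0 < s" and H: "asymp_mean (\<lambda>n. Pass n (ennreal (q s n)) (K n)) c" and c: "c \<longlonglongrightarrow> c0"
    and K_meas [measurable]: "\<And>n. K n \<in> borel_measurable M" and K_le: "\<And>n z. K n z \<le> 1"
begin

lemma q_le_1: "q s n \<le> 1" "0 < q s n"
  using s by (auto simp: q_def)

lemma Pass_le_1: "Pass n (ennreal (q s n)) (K n) z \<le> 1"
proof (cases "\<exists>l. z \<in> first_hit n l")
  case True
  then obtain l where l: "z \<in> first_hit n l" by blast
  have "ennreal (q s n) ^ l = ennreal (q s n ^ l)" using q_le_1[of n] by (simp add: ennreal_power)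
  also have "\<dots> \<le> ennreal 1" using q_le_1[of n] by (intro ennreal_leI power_le_one) auto
  finally show ?thesis using mult_mono[of "ennreal (q s n) ^ l" 1 "K n (shift_by l z)" 1] K_le by (simp add: Pass_eq[OF l])
qed (simp add: Pass_eq_0)

definition hit_fun :: "nat \<Rightarrow> 'v seq \<Rightarrow> real" where
  "hit_fun n z = enn2real (Pass n (ennreal (q s n)) (K n) z)"

lemma ennreal_hit_fun: "ennreal (hit_fun n z) = Pass n (ennreal (q s n)) (K n) z"
  using Pass_le_1[of n z] unfolding hit_fun_def by (intro ennreal_enn2real) (simp add: less_top order.strict_trans1)

lemma hit_fun_bounds: "0 \<le> hit_fun n z \<and> hit_fun n z \<le> 1"
  using Pass_le_1[of n z] unfolding hit_fun_def by (auto simp: enn2real_leI)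

lemma hit_fun_measurable [measurable]: "hit_fun n \<in> borel_measurable M"
  unfolding hit_fun_def by measurable

lemma functionals: "bounded_functionals M (\<lambda>n z. hit_fun n z - c0) (1 + \<bar>c0\<bar>)"
proof
  show "\<bar>hit_fun n z - c0\<bar> \<le> 1 + \<bar>c0\<bar>" for n z using hit_fun_bounds[of n z] by linarith
qed measurable

interpretation bounded_functionals M "\<lambda>n z. hit_fun n z - c0" "1 + \<bar>c0\<bar>" by (rule functionals)

text \<open>Moving the start by \<open>l\<close> steps multiplies by \<open>q ^ l\<close> unless a
  hit occurs in between; in that case the sum of indicators is at least 1 and covers any difference
  of two numbers in the unit interval.\<close>

lemma hit_fun_shift_by:
  assumes "1 \<le> n"
  shows "\<bar>hit_fun n z - hit_fun n (shift_by l z)\<bar> \<le> (1 - q s n ^ l) + (\<Sum>k<l. indicator (shift_by k -` B n) z)"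
proof (cases "\<exists>k<l. shift_by k z \<in> B n")
  case True
  then obtain k where k: "k < l" "shift_by k z \<in> B n" by blast
  have "(1 :: real) = (\<Sum>i\<in>{k}. indicator (shift_by i -` B n) z)" using k by simp
  also have "\<dots> \<le> (\<Sum>k<l. indicator (shift_by k -` B n) z)" using k by (intro sum_mono2) auto
  finally have "1 \<le> (\<Sum>k<l. indicator (shift_by k -` B n) z :: real)" .
  moreover have "q s n ^ l \<le> 1" using q_le_1[of n] by (intro power_le_one) auto
  ultimately show ?thesis using hit_fun_bounds[of n z] hit_fun_bounds[of n "shift_by l z"] by linarith
next
  case False
  then have "Pass n (ennreal (q s n)) (K n) z = ennreal (q s n) ^ l * Pass n (ennreal (q s n)) (K n) (shift_by l z)"
    by (intro Pass_shift_by) auto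
  then have "hit_fun n z = q s n ^ l * hit_fun n (shift_by l z)"
    using q_le_1[of n] by (simp add: hit_fun_def enn2real_mult ennreal_power)
  then have eq: "hit_fun n z - hit_fun n (shift_by l z) = - ((1 - q s n ^ l) * hit_fun n (shift_by l z))" by (simp add: algebra_simps)
  have "q s n ^ l \<le> 1" using q_le_1[of n] by (intro power_le_one) auto
  then have "\<bar>hit_fun n z - hit_fun n (shift_by l z)\<bar> \<le> 1 - q s n ^ l"
    using hit_fun_bounds[of n "shift_by l z"] unfolding eq by (simp add: abs_mult mult_left_le)
  moreover have "0 \<le> (\<Sum>k<l. indicator (shift_by k -` B n) z :: real)" by (intro sum_nonneg) simp
  ultimately show ?thesis by linarith
qed

text \<open>The asymptotic mean concerns the future after the past \<open>D\<close>. Restarting at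
  time 0 costs the discount over \<open>N\<close> steps and possible early hits, and both vanish in
  the limit.\<close>

lemma good_detv:
  assumes D: "detv N D"
  shows "good (indicator D)"
proof -
  note [measurable] = detv_sets[OF D]
  have fin: "emeasure M D < \<infinity>" and int_D: "integrable M (indicator D :: _ \<Rightarrow> real)"
    using D by (auto simp: detv_def intro!: integrable_real_indicator)
  have mD: "emeasure M D = ennreal (measure M D)"
    using fin by (intro emeasure_eq_ennreal_measure) auto
  have [measurable]: "(\<lambda>z. hit_fun n (shift_by N z)) \<in> borel_measurable M" for n
    by (rule measurable_compose[OF measurable_shift_by_M hit_fun_measurable])
  define I where "I n = (\<integral>z. indicator D z * hit_fun n (shift_by N z) \<partial>M)" for n
  have int: "integrable M (\<lambda>z. indicator D z * hit_fun n (shift_by N z))" for n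
    using hit_fun_bounds by (intro Bochner_Integration.integrable_bound[OF int_D]) (auto split: split_indicator)
  have I_nn: "past N D (Pass n (ennreal (q s n)) (K n)) = ennreal (I n)" for n
    unfolding I_def using hit_fun_bounds
    by (subst nn_integral_eq_integral[OF int, symmetric])
      (auto intro!: nn_integral_cong simp: ennreal_hit_fun split: split_indicator)
  obtain l u where lu: "\<And>n. 0 \<le> l n" "\<And>n. 0 \<le> u n" and lim: "(\<lambda>n. l n - c n) \<longlonglongrightarrow> 0" "(\<lambda>n. u n - c n) \<longlonglongrightarrow> 0"
    and ev: "eventually (\<lambda>n. mean_between UNIV (ennreal (l n)) (ennreal (u n)) (Pass n (ennreal (q s n)) (K n))) sequentially"
    using H unfolding asymp_mean_def by auto
  have "eventually (\<lambda>n. l n * measure M D \<le> I n \<and> I n \<le> u n * measure M D) sequentially"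
    using ev
  proof eventually_elim
    case (elim n)
    have "0 \<le> I n" unfolding I_def using hit_fun_bounds by (intro Bochner_Integration.integral_nonneg) auto
    then show ?case using elim[unfolded mean_between_UNIV, rule_format, OF D] lu[of n] unfolding I_nn mD by (simp add: ennreal_mult[symmetric])
  qed
  moreover have "(\<lambda>n. l n * measure M D) \<longlonglongrightarrow> c0 * measure M D" "(\<lambda>n. u n * measure M D) \<longlonglongrightarrow> c0 * measure M D"
    using tendsto_add[OF lim(1) c] tendsto_add[OF lim(2) c] by (auto intro!: tendsto_mult_right)
  ultimately have "I \<longlonglongrightarrow> c0 * measure M D"
    by (intro tendsto_sandwich[of "\<lambda>n. l n * measure M D" I sequentially "\<lambda>n. u n * measure M D"]) (auto elim: eventually_mono)
  then have I0: "(\<lambda>n. I n - c0 * measure M D) \<longlonglongrightarrow> 0" by (simp add: LIM_zero)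
  define e where "e n = (1 - q s n ^ N) * measure M D + (\<Sum>k<N. measure M (D \<inter> shift_by k -` B n))" for n
  have "(\<lambda>n. s * inverse (real (\<N> n))) \<longlonglongrightarrow> s * 0"
    by (intro tendsto_mult tendsto_const filterlim_compose[OF tendsto_inverse_0_at_top[OF filterlim_real_sequentially] scale(1)])
  from tendsto_exp[OF tendsto_minus[OF this]] have q_lim: "(\<lambda>n. q s n) \<longlonglongrightarrow> 1" by (simp add: q_def[abs_def] divide_inverse)
  have "e \<longlonglongrightarrow> (1 - 1 ^ N) * measure M D + (\<Sum>k<N. 0)"
    unfolding e_def[abs_def] by (intro tendsto_intros early_hit_0[OF D] q_lim)
  then have e0: "e \<longlonglongrightarrow> 0" by simp
  have "(\<lambda>n. (\<integral>z. indicator D z * (hit_fun n z - c0) \<partial>M) - (I n - c0 * measure M D)) \<longlonglongrightarrow> 0"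
  proof (rule Lim_null_comparison[OF _ e0])
    show "eventually (\<lambda>n. norm ((\<integral>z. indicator D z * (hit_fun n z - c0) \<partial>M) - (I n - c0 * measure M D)) \<le> e n) sequentially"
      using eventually_ge_at_top[of 1]
    proof eventually_elim
      case (elim n)
      let ?v = "\<lambda>z. (1 - q s n ^ N) * indicator D z + (\<Sum>k<N. indicator (D \<inter> shift_by k -` B n) z)"
      have iv: "integrable M (indicator (D \<inter> shift_by k -` B n) :: _ \<Rightarrow> real)" for k
        using finite_subset_detv[OF D, of "D \<inter> shift_by k -` B n"] by (auto intro!: integrable_real_indicator simp: less_top)
      have "(\<integral>z. indicator D z * (hit_fun n z - c0) \<partial>M) - (I n - c0 * measure M D)
          = (\<integral>z. indicator D z * (hit_fun n z - c0) - (indicator D z * hit_fun n (shift_by N z) - c0 * indicator D z) \<partial>M)"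
        using int[of n] int_D integrable_mult_g[OF int_D, of n] by (simp add: I_def)
      moreover have "\<bar>\<dots>\<bar> \<le> (\<integral>z. ?v z \<partial>M)"
      proof (rule abs_integral_le)
        show "integrable M ?v" using iv int_D by (auto intro!: Bochner_Integration.integrable_add integrable_mult_right)
        show "AE z in M. \<bar>indicator D z * (hit_fun n z - c0) - (indicator D z * hit_fun n (shift_by N z) - c0 * indicator D z)\<bar> \<le> ?v z"
        proof (rule AE_I2)
          fix z
          have "?v z = indicator D z * ((1 - q s n ^ N) + (\<Sum>k<N. indicator (shift_by k -` B n) z))"
            by (simp add: indicator_inter_arith sum_distrib_left distrib_left)
          moreover have "\<bar>indicator D z * (hit_fun n z - c0) - (indicator D z * hit_fun n (shift_by N z) - c0 * indicator D z)\<bar>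
              = indicator D z * \<bar>hit_fun n z - hit_fun n (shift_by N z)\<bar>"
            by (simp split: split_indicator)
          ultimately show "\<bar>indicator D z * (hit_fun n z - c0) - (indicator D z * hit_fun n (shift_by N z) - c0 * indicator D z)\<bar> \<le> ?v z"
            using mult_left_mono[OF hit_fun_shift_by[OF elim, of z N], of "indicator D z"] by (simp only:) simp
        qed
      qed
      moreover have "(\<integral>z. ?v z \<partial>M) = e n"
        using iv int_D by (simp add: e_def Bochner_Integration.integral_sum)
      ultimately show ?case by simp
    qed
  qed
  from tendsto_add[OF this I0] show ?thesis using int_D by (simp add: good_def)
qed

text \<open>Almost every point visits \<open>x 0\<close> after time \<open>d\<close>, so the set is
  a disjoint union of pasts up to a null set.\<close>

lemma good_determined:
  assumes E: "determined d E" "emeasure M E < \<infinity>"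
  shows "good (indicator E)"
proof -
  define F where "F l = E \<inter> visit_from d l" for l
  have E_sets [measurable]: "E \<in> sets M" by (rule determined_sets_M[OF E(1)])
  have F: "detv l (F l)" for l
  proof -
    have "determined l (F l)"
    proof (cases "d \<le> l")
      case True
      then show ?thesis unfolding F_def by (intro determined_Int determined_visit_from determined_mono[OF E(1)])
    next
      case False
      then have "F l = {}" by (auto simp: F_def visit_from_def)
      then show ?thesis by (simp add: determined_def)
    qed
    moreover have "emeasure M (F l) \<le> emeasure M E" by (intro emeasure_mono E_sets) (auto simp: F_def)
    ultimately show ?thesis using E(2) by (auto simp: detv_def F_def visit_from_def le_less_trans)
  qed
  have "emeasure M (\<Union>l. F l) \<le> emeasure M E" by (intro emeasure_mono E_sets) (auto simp: F_def)
  then have "good (indicator (\<Union>l. F l))"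
    using F detv_sets E(2) visit_from_unique
    by (intro good_indicator_UN good_detv) (auto simp: disjoint_family_on_def F_def intro: le_less_trans)
  then show ?thesis
  proof (rule good_AE)
    show "AE z in M. indicator (\<Union>l. F l) z = (indicator E z :: real)"
      using visit_from_AE[of d] by eventually_elim (auto simp: F_def indicator_def)
  qed measurable
qed

text \<open>A Dynkin argument inside one letter cylinder: the ambient measure may be infinite, but
  there complements become differences of integrable indicators.\<close>

lemma hit_fun_measurable_set:
  assumes "E \<in> sets M"
  shows "good (indicator (E \<inter> cyl 1 p))"
proof -
  let ?G = "{D :: 'v seq set. \<exists>N. determined N D}"
  have fin: "emeasure M (E \<inter> cyl 1 p) < \<infinity>" if "E \<in> sets M" for E
    using emeasure_mono[of "E \<inter> cyl 1 p" "cyl 1 p" M] finite_letters[of p] by (auto intro: le_less_trans)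
  have sig: "sigma_sets UNIV ?G = sets M" unfolding sets_M sets_seq_algebra_determined ..
  have stable: "Int_stable ?G"
  proof (rule Int_stableI)
    fix D E :: "'v seq set" assume "D \<in> ?G" "E \<in> ?G"
    then obtain i k where "determined i D" "determined k E" by blast
    then have "determined (max i k) (D \<inter> E)" by (intro determined_Int) (auto elim: determined_mono)
    then show "D \<inter> E \<in> ?G" by blast
  qed
  have basic: "good (indicator (A \<inter> cyl 1 p))" if A: "A \<in> ?G" for A
  proof -
    obtain N where N: "determined N A" using A by blast
    then show ?thesis
      by (intro good_determined[of N] determined_Int determined_cyl fin determined_sets_M[OF N]) auto
  qed
  have "E \<in> sigma_sets UNIV ?G" using assms sig by simp
  from stable _ this show ?thesis
  proof (rule sigma_sets_induct_disjoint)
    show "good (indicator (A \<inter> cyl 1 p))" if "A \<in> ?G" for A using that by (rule basic)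
    have "determined 0 ({} :: 'v seq set)" by (simp add: determined_def)
    then show "good (indicator ({} \<inter> cyl 1 p))" by (intro basic) blast
  next
    fix A assume A: "A \<in> sigma_sets UNIV ?G" "good (indicator (A \<inter> cyl 1 p))"
    have "determined 0 (UNIV :: 'v seq set)" by (simp add: determined_def)
    then have "good (indicator (UNIV \<inter> cyl 1 p))" by (intro basic) blast
    moreover have "(indicator ((UNIV - A) \<inter> cyl 1 p) :: _ \<Rightarrow> real) = (\<lambda>z. indicator (UNIV \<inter> cyl 1 p) z - indicator (A \<inter> cyl 1 p) z)"
      by (auto simp: fun_eq_iff indicator_def)
    ultimately show "good (indicator ((UNIV - A) \<inter> cyl 1 p))" using good_diff A(2) by simp
  next
    fix A :: "nat \<Rightarrow> 'v seq set"
    assume A: "disjoint_family A" "range A \<subseteq> sigma_sets UNIV ?G" "\<And>i. good (indicator (A i \<inter> cyl 1 p))"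
    have Ai: "A i \<in> sets M" for i using A(2) sig by auto
    have "good (indicator (\<Union>i. A i \<inter> cyl 1 p))"
    proof (rule good_indicator_UN)
      show "disjoint_family (\<lambda>i. A i \<inter> cyl 1 p)"
        using A(1) unfolding disjoint_family_on_def by blast
      have "(\<Union>i. A i \<inter> cyl 1 p) = (\<Union>i. A i) \<inter> cyl 1 p" by blast
      then show "emeasure M (\<Union>i. A i \<inter> cyl 1 p) < \<infinity>" using fin[of "\<Union>i. A i"] Ai by auto
    qed (use A(3) Ai in auto)
    then show "good (indicator (\<Union> (range A) \<inter> cyl 1 p))" by (simp add: Int_UN_distrib2 image_image)
  qed simp
qed

lemma hit_fun_all:
  assumes "integrable M f"
  shows "good f"
proof (rule good_all[OF _ assms])
  fix A assume A: "A \<in> sets M" "emeasure M A < \<infinity>"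
  \<comment> \<open>The pieces with prescribed first letter, indexed by letter codes; each is empty
    or is covered by the preceding lemma.\<close>
  define E where "E i = A \<inter> {z. to_nat (z 0) = i}" for i
  have E: "E i \<in> sets M \<and> good (indicator (E i))" for i
  proof (cases "E i = {}")
    case False
    then obtain p where "p \<in> E i" by blast
    then have "E i = A \<inter> cyl 1 p" by (auto simp: E_def cyl_def)
    then show ?thesis using A(1) hit_fun_measurable_set[OF A(1)] by auto
  qed (simp add: good_def)
  have UN: "(\<Union>i. E i) = A" by (auto simp: E_def)
  have "good (indicator (\<Union>i. E i))"
    by (rule good_indicator_UN) (use E A(2) UN in \<open>auto simp: disjoint_family_on_def E_def\<close>)
  then show "good (indicator A)" unfolding UN .
qed

end

lemma sigma_finite_M: "sigma_finite_measure M"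
proof
  show "\<exists>A. countable A \<and> A \<subseteq> sets M \<and> \<Union> A = space M \<and> (\<forall>a\<in>A. emeasure M a \<noteq> \<infinity>)"
  proof (intro exI[of _ "range (\<lambda>v. cyl 1 (\<lambda>_. v))"] conjI)
    show "\<Union> (range (\<lambda>v. cyl 1 (\<lambda>_. v))) = space M" by (auto simp: cyl_def)
    show "\<forall>a\<in>range (\<lambda>v. cyl 1 (\<lambda>_. v)). emeasure M a \<noteq> \<infinity>"
      using finite_letters by (auto simp: less_top)
  qed auto
qed

text \<open>The starting law enters only through its Radon-Nikodym density, an integrable weight of
  integral 1, so the limit does not depend on it.\<close>

lemma Pass_integral_limit:
  assumes P: "prob_space P" "sets P = sets M" "absolutely_continuous M P"
    and s: "0 < s" and H: "asymp_mean (\<lambda>n. Pass n (ennreal (q s n)) (K n)) c" and c: "c \<longlonglongrightarrow> c0"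
    and K_meas: "\<And>n. K n \<in> borel_measurable M" and K_le: "\<And>n z. K n z \<le> 1"
  shows "(\<lambda>n. \<integral>z. enn2real (Pass n (ennreal (q s n)) (K n) z) \<partial>P) \<longlonglongrightarrow> c0"
proof -
  interpret P: prob_space P by fact
  interpret sigma_finite_measure M by (rule sigma_finite_M)
  have h_eq: "hit_fun s K n z = enn2real (Pass n (ennreal (q s n)) (K n) z)" for n z
    using hit_fun_def[OF s H c K_meas K_le] .
  interpret bounded_functionals M "\<lambda>n z. hit_fun s K n z - c0" "1 + \<bar>c0\<bar>"
    by (rule functionals[OF s H c K_meas K_le])
  obtain D where D: "D \<in> borel_measurable M" "AE z in M. RN_deriv M P z = ennreal (D z)" "\<And>z. 0 \<le> D z"
    using real_RN_deriv[OF P.finite_measure_axioms P(3,2)] by blast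
  have dens: "P = density M (\<lambda>z. ennreal (D z))"
  proof -
    have "density M (RN_deriv M P) = density M (\<lambda>z. ennreal (D z))"
      using D by (intro density_cong) auto
    then show ?thesis using density_RN_deriv[OF P(3,2)] by simp
  qed
  have one: "(\<integral>\<^sup>+z. ennreal (D z) \<partial>M) = 1"
    using P.emeasure_space_1 sets_eq_imp_space_eq[OF P(2)] D(1) unfolding dens
    using sets.top[of M] by (subst (asm) emeasure_density) auto
  then have D_int: "integrable M D" using D by (intro integrableI_nonneg) auto
  have "(\<integral>z. D z \<partial>M) = 1"
    using one D by (subst integral_eq_nn_integral) auto
  then have "(\<integral>z. D z * (hit_fun s K n z - c0) \<partial>M) = (\<integral>z. D z * hit_fun s K n z \<partial>M) - c0" for n
    using integrable_mult_g[OF D_int, of n] D_int Bochner_Integration.integrable_add[of M "\<lambda>z. D z * (hit_fun s K n z - c0)" "\<lambda>z. D z * c0"]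
    by (simp add: right_diff_distrib)
  then have "(\<lambda>n. \<integral>z. D z * hit_fun s K n z \<partial>M) \<longlonglongrightarrow> c0"
    using hit_fun_all[OF s H c K_meas K_le D_int] unfolding good_def by (simp add: LIM_zero_cancel)
  moreover have "(\<integral>z. enn2real (Pass n (ennreal (q s n)) (K n) z) \<partial>P) = (\<integral>z. D z * hit_fun s K n z \<partial>M)" for n
    unfolding dens h_eq[symmetric] using D hit_fun_measurable[OF s H c K_meas K_le] by (subst integral_real_density) auto
  ultimately show ?thesis by simp
qed

lemma Gaps_le_1:
  assumes "\<forall>r\<in>set rs. r \<le> 1"
  shows "Gaps n rs z \<le> 1"
  using assms
proof (induction rs arbitrary: z)
  case (Cons r rs)
  have r: "r \<le> 1" using Cons.prems by simp
  have pow: "r ^ l \<le> 1" for l using r by (induction l) (auto intro: mult_le_one)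
  have "Pass n r (Gaps n rs) (shift_by 1 z) \<le> 1"
  proof (cases "\<exists>l. shift_by 1 z \<in> first_hit n l")
    case True
    then obtain l where l: "shift_by 1 z \<in> first_hit n l" by blast
    have "Gaps n rs (shift_by l (shift_by 1 z)) \<le> 1" using Cons by simp
    then have "r ^ l * Gaps n rs (shift_by l (shift_by 1 z)) \<le> 1 * 1" using pow by (intro mult_mono) auto
    then show ?thesis by (simp only: Pass_eq[OF l] mult_1_right)
  qed (simp add: Pass_eq_0)
  then have "r * Pass n r (Gaps n rs) (shift_by 1 z) \<le> 1 * 1" using r by (intro mult_mono) auto
  then show ?case by simp
qed simp

text \<open>\<open>Gaps\<close> ignores a hit at time 0 while \<open>Pass\<close> counts it. The two
  differ only on \<open>B n\<close>, whose probability tends to that of the null set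
  \<open>{x}\<close>.\<close>

theorem gaps_from_P:
  assumes P: "prob_space P" "sets P = sets M" "absolutely_continuous M P"
    and ss: "\<forall>t\<in>set ss. 0 < t" "0 < s" and c: "(\<lambda>n. J s n * gap_product ss n) \<longlonglongrightarrow> c0"
  shows "(\<lambda>n. \<integral>z. enn2real (Gaps n (gaps (s # ss) n) z) \<partial>P) \<longlonglongrightarrow> c0"
proof -
  interpret P: prob_space P by fact
  have q1: "ennreal (q t n) \<le> 1" if "0 < t" for t n using that by (simp add: q_def)
  have gaps_le: "Gaps n (gaps ts n) z \<le> 1" if "\<forall>t\<in>set ts. 0 < t" for ts n z
    using that q1 by (intro Gaps_le_1) (auto simp: gaps_def)
  let ?H = "\<lambda>n z. Pass n (ennreal (q s n)) (Gaps n (gaps ss n)) z"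
  have main: "(\<lambda>n. \<integral>z. enn2real (?H n z) \<partial>P) \<longlonglongrightarrow> c0"
    by (rule Pass_integral_limit[OF P ss(2) pass_gaps_asymp_mean[OF ss(2,1)] c measurable_Gaps gaps_le[OF ss(1)]])
  have meas: "f \<in> borel_measurable M \<Longrightarrow> f \<in> borel_measurable P" for f :: "'v seq \<Rightarrow> ennreal"
    using measurable_cong_sets[OF P(2) refl] by blast
  have meas_G [measurable]: "Gaps n (gaps (s # ss) n) \<in> borel_measurable P" for n by (rule meas) measurable
  have meas_H [measurable]: "?H n \<in> borel_measurable P" for n by (rule meas) measurable
  have H_le: "?H n z \<le> 1" for n z
    by (rule Pass_le_1[OF ss(2) pass_gaps_asymp_mean[OF ss(2,1)] c measurable_Gaps gaps_le[OF ss(1)]])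
  have G_le: "Gaps n (gaps (s # ss) n) z \<le> 1" for n z using ss by (intro gaps_le) auto
  have eq: "Gaps n (gaps (s # ss) n) z = ?H n z" if "z \<notin> B n" for n z
    using Pass_shift_by[of 1 z n "ennreal (q s n)" "Gaps n (gaps ss n)"] that by (simp add: gaps_def)
  have B_P [measurable]: "B n \<in> sets P" for n using P(2) cyl_sets_M by blast
  have diff: "\<bar>(\<integral>z. enn2real (Gaps n (gaps (s # ss) n) z) \<partial>P) - (\<integral>z. enn2real (?H n z) \<partial>P)\<bar> \<le> measure P (B n)" for n
  proof -
    have bd: "enn2real y \<le> 1" if "y \<le> 1" for y using that by (simp add: enn2real_leI)
    have int: "integrable P (\<lambda>z. enn2real (Gaps n (gaps (s # ss) n) z))" "integrable P (\<lambda>z. enn2real (?H n z))"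
      using G_le H_le bd by (auto intro!: P.integrable_const_bound[of _ 1])
    have "\<bar>(\<integral>z. enn2real (Gaps n (gaps (s # ss) n) z) \<partial>P) - (\<integral>z. enn2real (?H n z) \<partial>P)\<bar> =
      \<bar>\<integral>z. enn2real (Gaps n (gaps (s # ss) n) z) - enn2real (?H n z) \<partial>P\<bar>"
      using int by simp
    also have "\<dots> \<le> (\<integral>z. \<bar>enn2real (Gaps n (gaps (s # ss) n) z) - enn2real (?H n z)\<bar> \<partial>P)"
      by (rule integral_abs_bound)
    also have "\<dots> \<le> (\<integral>z. indicator (B n) z \<partial>P)"
    proof (rule integral_mono)
      fix z
      have "\<bar>enn2real (Gaps n (gaps (s # ss) n) z) - enn2real (?H n z)\<bar> \<le> 1"
        using bd[OF G_le[of n z]] bd[OF H_le[of n z]] enn2real_nonneg[of "Gaps n (gaps (s # ss) n) z"] enn2real_nonneg[of "?H n z"]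
        by linarith
      then show "\<bar>enn2real (Gaps n (gaps (s # ss) n) z) - enn2real (?H n z)\<bar> \<le> indicator (B n) z"
        using eq[of z n] by (cases "z \<in> B n") simp_all
    qed (use int in \<open>auto intro!: integrable_real_indicator simp: P.emeasure_eq_measure\<close>)
    also have "\<dots> = measure P (B n)" by simp
    finally show ?thesis .
  qed
  have PB: "(\<lambda>n. measure P (B n)) \<longlonglongrightarrow> 0"
  proof -
    have "(\<lambda>n. measure P (B n)) \<longlonglongrightarrow> measure P (\<Inter>n. B n)"
    proof (rule P.finite_Lim_measure_decseq)
      show "decseq (\<lambda>n. B n)" by (auto simp: cyl_def decseq_def)
    qed (use B_P in blast)
    moreover have "{x} \<in> null_sets P" using null_x P(3) by (auto simp: absolutely_continuous_def)
    ultimately show ?thesis by (simp add: singleton_Inter measure_def null_setsD1)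
  qed
  have "(\<lambda>n. (\<integral>z. enn2real (Gaps n (gaps (s # ss) n) z) \<partial>P) - (\<integral>z. enn2real (?H n z) \<partial>P)) \<longlonglongrightarrow> 0"
    by (rule Lim_null_comparison[OF _ PB]) (use diff in auto)
  from tendsto_add[OF this main] show ?thesis by simp
qed

end

section \<open>Point processes and convergence of moments\<close>

text \<open>Exponents are listed by coordinate. Products of monomials add the lists, so finite
  combinations form the algebra needed for Stone-Weierstrass.\<close>

fun monomial :: "nat list \<Rightarrow> (nat \<Rightarrow> real) \<Rightarrow> real" where
  "monomial [] p = 1"
| "monomial (e # es) p = p 0 ^ e * monomial es (\<lambda>i. p (Suc i))"

fun add_exponents :: "nat list \<Rightarrow> nat list \<Rightarrow> nat list" where
  "add_exponents [] fs = fs"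
| "add_exponents es [] = es"
| "add_exponents (e # es) (f # fs) = (e + f) # add_exponents es fs"

lemma monomial_add_exponents: "monomial (add_exponents es fs) p = monomial es p * monomial fs p"
  by (induction es fs arbitrary: p rule: add_exponents.induct) (auto simp: power_add mult_ac)

lemma monomial_coordinate: "monomial (replicate i 0 @ [Suc 0]) p = p i"
  by (induction i arbitrary: p) auto

lemma continuous_on_monomial: "continuous_on UNIV (monomial es)"
proof -
  have "continuous_on UNIV (\<lambda>p. monomial es (\<lambda>i. p (i + k)))" for k
  proof (induction es arbitrary: k)
    case (Cons e es)
    have "continuous_on UNIV (\<lambda>p :: nat \<Rightarrow> real. p k)"
      by (rule continuous_on_product_coordinates)
    then show ?case using Cons[of "Suc k"] by (auto intro!: continuous_intros)
  qed simp
  from this[of 0] show ?thesis by simp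
qed

definition cube :: "(nat \<Rightarrow> real) set" where
  "cube = {p. \<forall>i. 0 \<le> p i \<and> p i \<le> 1}"

lemma compact_cube: "compact cube"
proof -
  have "compactin (product_topology (\<lambda>_::nat. euclideanreal) UNIV) (PiE UNIV (\<lambda>_. {0..1}))"
    by (subst compactin_PiE) auto
  then have "compact (PiE UNIV (\<lambda>_::nat. {0..1::real}))"
    by (simp add: euclidean_product_topology compactin_euclidean_iff)
  also have "PiE UNIV (\<lambda>_::nat. {0..1::real}) = cube" by (auto simp: cube_def PiE_def Pi_def)
  finally show ?thesis .
qed

lemma monomial_bounds: "p \<in> cube \<Longrightarrow> 0 \<le> monomial es p \<and> monomial es p \<le> 1"
proof (induction es arbitrary: p)
  case (Cons e es)
  then have "0 \<le> monomial es (\<lambda>i. p (Suc i)) \<and> monomial es (\<lambda>i. p (Suc i)) \<le> 1"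
    by (intro Cons.IH) (auto simp: cube_def)
  moreover have "0 \<le> p 0 ^ e" "p 0 ^ e \<le> 1" using Cons.prems by (auto simp: cube_def power_le_one)
  ultimately show ?case by (auto simp: mult_le_one)
qed simp

text \<open>Stone-Weierstrass on the infinite cube, compact by Tychonoff; single coordinates are
  monomials and separate its points.\<close>

lemma polynomials_dense_cube:
  assumes f: "continuous_on cube f" and e: "0 < e"
  obtains cs :: "(real \<times> nat list) list" where "\<And>p. p \<in> cube \<Longrightarrow> \<bar>f p - (\<Sum>(c, es)\<leftarrow>cs. c * monomial es p)\<bar> < e"
proof -
  define ev where "ev cs p = (\<Sum>(c, es)\<leftarrow>cs. c * monomial es p)" for cs :: "(real \<times> nat list) list" and p
  interpret function_ring_on "range ev" cube
  proof
    show "compact cube" by (rule compact_cube)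
    show "continuous_on cube f" if "f \<in> range ev" for f
    proof -
      have "continuous_on cube (ev cs)" for cs
        unfolding ev_def
        by (induction cs) (auto intro!: continuous_intros continuous_on_subset[OF continuous_on_monomial])
      then show ?thesis using that by auto
    qed
    show "(\<lambda>x. f x + g x) \<in> range ev" if fg: "f \<in> range ev" "g \<in> range ev" for f g
    proof -
      obtain cs ds where "f = ev cs" "g = ev ds" using fg by blast
      then have "(\<lambda>x. f x + g x) = ev (cs @ ds)" by (simp add: fun_eq_iff ev_def)
      then show ?thesis by blast
    qed
    show "(\<lambda>x. f x * g x) \<in> range ev" if fg: "f \<in> range ev" "g \<in> range ev" for f g
    proof -
      obtain cs ds where fg: "f = ev cs" "g = ev ds" using fg by blast
      have one: "c * monomial es p * ev ds p = ev (map (\<lambda>(d, fs). (c * d, add_exponents es fs)) ds) p" for c es p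
        unfolding ev_def by (induction ds) (auto simp: monomial_add_exponents algebra_simps)
      have "ev cs p * ev ds p = ev (concat (map (\<lambda>(c, es). map (\<lambda>(d, fs). (c * d, add_exponents es fs)) ds) cs)) p" for p
      proof (induction cs)
        case (Cons a cs)
        obtain c es where a: "a = (c, es)" by fastforce
        have app: "ev (xs @ ys) p = ev xs p + ev ys p" for xs ys by (simp add: ev_def)
        have "ev (a # cs) p * ev ds p = c * monomial es p * ev ds p + ev cs p * ev ds p"
          by (simp add: a ev_def algebra_simps)
        then show ?case by (simp add: a app one Cons)
      qed (simp add: ev_def)
      then have "(\<lambda>x. f x * g x) = ev (concat (map (\<lambda>(c, es). map (\<lambda>(d, fs). (c * d, add_exponents es fs)) ds) cs))"
        unfolding fg by (intro ext)
      then show ?thesis by blast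
    qed
    show "(\<lambda>_. c) \<in> range ev" for c
    proof -
      have "(\<lambda>_. c) = ev [(c, [])]" by (simp add: fun_eq_iff ev_def)
      then show ?thesis by blast
    qed
    show "\<exists>f\<in>range ev. f x \<noteq> f y" if "x \<in> cube" "y \<in> cube" "x \<noteq> y" for x y
    proof -
      obtain i where i: "x i \<noteq> y i" using \<open>x \<noteq> y\<close> by (auto simp: fun_eq_iff)
      have "ev [(1, replicate i 0 @ [Suc 0])] p = p i" for p by (simp add: ev_def monomial_coordinate)
      with i show ?thesis by (intro bexI[of _ "ev [(1, replicate i 0 @ [Suc 0])]"]) auto
    qed
  qed
  obtain g where g: "g \<in> range ev" "\<And>p. p \<in> cube \<Longrightarrow> \<bar>f p - g p\<bar> < e"
    using Stone_Weierstrass_basic[OF f e] by blast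
  then obtain cs where "g = ev cs" by blast
  with g(2) show thesis by (intro that[of cs]) (simp add: ev_def)
qed

definition cube_prob :: "(nat \<Rightarrow> real) measure \<Rightarrow> bool" where
  "cube_prob D \<longleftrightarrow> prob_space D \<and> sets D = sets borel \<and> (AE p in D. p \<in> cube)"

lemma cube_prob_measurable:
  assumes "cube_prob D" "f \<in> measurable borel N"
  shows "f \<in> measurable D N"
  using assms measurable_cong_sets[of D borel N N] by (simp add: cube_prob_def)

lemma cube_prob_integrable:
  assumes D: "cube_prob D" and f: "f \<in> borel_measurable borel" "\<And>p. p \<in> cube \<Longrightarrow> \<bar>f p\<bar> \<le> c"
  shows "integrable D (f :: _ \<Rightarrow> real)"
proof -
  interpret prob_space D using D by (simp add: cube_prob_def)
  have "f \<in> borel_measurable D" using D f(1) by (rule cube_prob_measurable)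
  moreover have "AE p in D. p \<in> cube" using D by (simp add: cube_prob_def)
  then have "AE p in D. norm (f p) \<le> c" by eventually_elim (simp add: f(2))
  ultimately show ?thesis by (rule integrable_const_bound[rotated])
qed

text \<open>The method of moments: polynomials approximate \<open>f\<close> uniformly on the cube,
  where all the laws are concentrated.\<close>

lemma moments_imp_continuous_integrals:
  assumes D: "\<And>n. cube_prob (D n)" and E: "cube_prob E"
    and mom: "\<And>es. (\<lambda>n. \<integral>p. monomial es p \<partial>D n) \<longlonglongrightarrow> (\<integral>p. monomial es p \<partial>E)"
    and f: "continuous_on UNIV (f :: _ \<Rightarrow> real)"
  shows "(\<lambda>n. \<integral>p. f p \<partial>D n) \<longlonglongrightarrow> (\<integral>p. f p \<partial>E)"
proof (rule LIMSEQ_I)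
  fix e :: real assume e: "0 < e"
  obtain cs where cs: "\<And>p. p \<in> cube \<Longrightarrow> \<bar>f p - (\<Sum>(c, es)\<leftarrow>cs. c * monomial es p)\<bar> < e / 3"
    using polynomials_dense_cube[of f "e / 3"] continuous_on_subset[OF f, of cube] e by auto
  define g where "g p = (\<Sum>(c, es)\<leftarrow>cs. c * monomial es p)" for p
  have mono_int: "integrable D' (monomial es)" if "cube_prob D'" for D' es
    using that monomial_bounds
    by (intro cube_prob_integrable[where c = 1]) (auto intro: borel_measurable_continuous_onI[OF continuous_on_monomial])
  have g_int: "integrable D' g \<and> (\<integral>p. g p \<partial>D') = (\<Sum>(c, es)\<leftarrow>cs. c * (\<integral>p. monomial es p \<partial>D'))" if "cube_prob D'" for D'
    unfolding g_def using mono_int[OF that] by (induction cs) auto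
  have "(\<lambda>n. \<Sum>(c, es)\<leftarrow>cs. c * (\<integral>p. monomial es p \<partial>D n)) \<longlonglongrightarrow> (\<Sum>(c, es)\<leftarrow>cs. c * (\<integral>p. monomial es p \<partial>E))"
    by (induction cs) (auto intro!: tendsto_intros mom)
  then have "(\<lambda>n. \<integral>p. g p \<partial>D n) \<longlonglongrightarrow> (\<integral>p. g p \<partial>E)" using g_int[OF D] g_int[OF E] by simp
  then obtain N where N: "\<And>n. N \<le> n \<Longrightarrow> norm ((\<integral>p. g p \<partial>D n) - (\<integral>p. g p \<partial>E)) < e / 3"
    using LIMSEQ_D[of _ _ "e / 3"] e by (metis zero_less_divide_iff zero_less_numeral)
  have f_meas: "f \<in> borel_measurable borel" using f by (rule borel_measurable_continuous_onI)
  have "bounded (f ` cube)"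
    using compact_cube continuous_on_subset[OF f] by (intro compact_imp_bounded compact_continuous_image) auto
  then obtain c where c: "\<And>p. p \<in> cube \<Longrightarrow> \<bar>f p\<bar> \<le> c" by (auto simp: bounded_iff)
  have fg: "\<bar>(\<integral>p. f p \<partial>D') - (\<integral>p. g p \<partial>D')\<bar> \<le> e / 3" if D': "cube_prob D'" for D'
  proof -
    interpret prob_space D' using D' by (simp add: cube_prob_def)
    have fi: "integrable D' f" by (rule cube_prob_integrable[OF D' f_meas c])
    have "\<bar>(\<integral>p. f p \<partial>D') - (\<integral>p. g p \<partial>D')\<bar> = \<bar>\<integral>p. f p - g p \<partial>D'\<bar>"
      using fi g_int[OF D'] by simp
    also have "\<dots> \<le> (\<integral>p. \<bar>f p - g p\<bar> \<partial>D')" by (rule integral_abs_bound)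
    also have "\<dots> \<le> (\<integral>p. e / 3 \<partial>D')"
    proof (intro integral_mono_AE)
      have "AE p in D'. p \<in> cube" using D' by (simp add: cube_prob_def)
      then show "AE p in D'. \<bar>f p - g p\<bar> \<le> e / 3"
        by eventually_elim (use cs in \<open>auto simp: g_def intro: less_imp_le\<close>)
    qed (use fi g_int[OF D'] in auto)
    finally show ?thesis by (simp add: prob_space)
  qed
  show "\<exists>N. \<forall>n\<ge>N. norm ((\<integral>p. f p \<partial>D n) - (\<integral>p. f p \<partial>E)) < e"
  proof (intro exI allI impI)
    fix n assume "N \<le> n"
    then show "norm ((\<integral>p. f p \<partial>D n) - (\<integral>p. f p \<partial>E)) < e"
      using N[of n] fg[OF D, of n] fg[OF E] unfolding real_norm_def by linarith
  qed
qed

text \<open>A point \<open>t \<in> [0, \<infinity>]\<close> is encoded by \<open>exp (- t) \<in> [0, 1]\<close>.\<close>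

definition decode :: "(nat \<Rightarrow> real) \<Rightarrow> real measure" where
  "decode p = point_measure (\<lambda>k. if 0 < p k then ereal (- ln (p k)) else \<infinity>)"

text \<open>Decreasing codes list the points in increasing order; convergence to 0 says that the
  points, if infinitely many, run off to infinity. A code 0 stands for a missing point.\<close>

definition codes :: "(nat \<Rightarrow> real) set" where
  "codes = {p \<in> cube. decseq p \<and> p \<longlonglongrightarrow> 0}"

lemma decode_set:
  assumes "p \<in> codes"
  shows "{k. 0 \<le> (if 0 < p k then ereal (- ln (p k)) else \<infinity>) \<and> (if 0 < p k then ereal (- ln (p k)) else \<infinity>) < \<infinity>} = {k. 0 < p k}"
  using assms by (auto simp: codes_def cube_def)

lemma decode_eq:
  assumes "p \<in> codes"
  shows "decode p = distr (count_space {k. 0 < p k}) borel_nonneg (\<lambda>k. - ln (p k))"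
  unfolding decode_def point_measure_def decode_set[OF assms]
  by (intro distr_cong) auto

lemma decode_measurable: "p \<in> codes \<Longrightarrow> (\<lambda>k. - ln (p k)) \<in> measurable (count_space {k. 0 < p k}) borel_nonneg"
  by (auto simp: codes_def cube_def space_restrict_space)

lemma decode_counting:
  assumes p: "p \<in> codes"
  shows "decode p \<in> counting_measures"
proof -
  have "emeasure (decode p) B \<in> \<nat>" if B: "B \<in> sets borel_nonneg" "bounded B" for B
  proof -
    obtain K where K: "\<And>t. t \<in> B \<Longrightarrow> \<bar>t\<bar> \<le> K" using B(2) by (auto simp: bounded_iff)
    let ?A = "(\<lambda>k. - ln (p k)) -` B \<inter> {k. 0 < p k}"
    have "eventually (\<lambda>k. p k < exp (- K)) sequentially"
      using p by (intro order_tendstoD(2)[of p 0]) (auto simp: codes_def)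
    then obtain m where m: "\<And>k. m \<le> k \<Longrightarrow> p k < exp (- K)" by (auto simp: eventually_sequentially)
    have "?A \<subseteq> {..<m}"
    proof
      fix k assume k: "k \<in> ?A"
      then have "- ln (p k) \<le> K" using K[of "- ln (p k)"] by auto
      then have "exp (- K) \<le> p k" using k by (simp add: ln_ge_iff[symmetric] minus_le_iff)
      then show "k \<in> {..<m}" using m[of k] by (auto simp: not_le[symmetric])
    qed
    then have fin: "finite ?A" using finite_subset by blast
    have "emeasure (decode p) B = emeasure (count_space {k. 0 < p k}) ?A"
      unfolding decode_eq[OF p] using B decode_measurable[OF p] by (subst emeasure_distr) auto
    also have "\<dots> = of_nat (card ?A)" using fin by (intro emeasure_count_space_finite) auto
    finally show ?thesis by simp
  qed
  then show ?thesis by (auto simp: counting_measures_def decode_eq[OF p])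
qed

lemma decode_integral:
  assumes p: "p \<in> codes" and f: "f \<in> vague_test_functions" and K: "\<And>t. K < t \<Longrightarrow> f t = 0" and m: "p m < exp (- K)"
  shows "(\<integral>t. f t \<partial>decode p) = (\<Sum>i<m. if 0 < p i then f (max 0 (- ln (p i))) else 0)"
proof -
  have f_meas: "f \<in> borel_measurable borel_nonneg"
    using f by (auto simp: vague_test_functions_def intro: borel_measurable_continuous_on_restrict)
  have "(\<integral>t. f t \<partial>decode p) = (\<integral>k. f (- ln (p k)) \<partial>count_space {k. 0 < p k})"
    unfolding decode_eq[OF p] by (rule integral_distr[OF decode_measurable[OF p] f_meas])
  have small: "f (- ln (p k)) = 0" if "0 < p k" "m \<le> k" for k
  proof (rule K)
    have "p k \<le> p m" using p that(2) by (auto simp: codes_def decseq_def)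
    then have "p k < exp (- K)" using m by simp
    then have "ln (p k) < - K" using that(1) by (metis exp_gt_zero ln_exp ln_less_cancel_iff)
    then show "K < - ln (p k)" by simp
  qed
  have max: "max 0 (- ln (p k)) = - ln (p k)" if "0 < p k" for k
    using p that by (auto simp: codes_def cube_def max_def)
  have sub: "{k. k \<in> {k. 0 < p k} \<and> f (- ln (p k)) \<noteq> 0} \<subseteq> {..<m}"
    using small by (auto simp: not_le[symmetric])
  then have "(\<integral>k. f (- ln (p k)) \<partial>count_space {k. 0 < p k}) = (\<Sum>k | k \<in> {k. 0 < p k} \<and> f (- ln (p k)) \<noteq> 0. f (- ln (p k)))"
    by (intro lebesgue_integral_count_space_finite_support finite_subset[OF _ finite_lessThan])
  also have "\<dots> = (\<Sum>i<m. if 0 < p i then f (max 0 (- ln (p i))) else 0)"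
    using sub by (intro sum.mono_neutral_cong_left) (auto simp: max)
  finally show ?thesis using \<open>(\<integral>t. f t \<partial>decode p) = _\<close> by simp
qed

text \<open>Bounded support makes the decoded function vanish near 0, and away from 0 the logarithm
  is continuous; two open sets cover the line.\<close>

lemma continuous_on_decoded_test:
  assumes f: "f \<in> vague_test_functions"
  shows "continuous_on UNIV (\<lambda>u. if 0 < u then f (max 0 (- ln u)) else 0)" (is "continuous_on UNIV ?g")
proof -
  obtain K where K: "\<And>t. K < t \<Longrightarrow> f t = 0" using f by (auto simp: vague_test_functions_def)
  have fc: "continuous_on {0..} f" using f by (simp add: vague_test_functions_def)
  have 1: "continuous_on {..<exp (- K)} ?g"
  proof -
    have "?g u = 0" if "u < exp (- K)" for u
    proof (cases "0 < u")
      case True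
      then have "ln u < - K" using that by (metis exp_gt_zero ln_exp ln_less_cancel_iff)
      then have "K < max 0 (- ln u)" by simp
      then show ?thesis using K by simp
    qed simp
    then have "continuous_on {..<exp (- K)} ?g \<longleftrightarrow> continuous_on {..<exp (- K)} (\<lambda>_. 0 :: real)"
      by (intro continuous_on_cong) auto
    then show ?thesis by simp
  qed
  have 2: "continuous_on {0<..} ?g"
  proof -
    have "continuous_on {0<..} (\<lambda>u. f (max 0 (- ln u)))"
      by (rule continuous_on_compose2[OF fc]) (auto intro!: continuous_intros)
    then show ?thesis by (subst continuous_on_cong[of _ "{0<..}" _ "\<lambda>u. f (max 0 (- ln u))"]) auto
  qed
  have "continuous_on ({..<exp (- K)} \<union> {0<..}) ?g"
    using 1 2 by (intro continuous_on_open_Un) auto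
  moreover have "{..<exp (- K)} \<union> {0<..} = (UNIV :: real set)"
  proof -
    have "u < exp (- K) \<or> 0 < u" for u :: real using exp_gt_zero[of "- K"] by linarith
    then show ?thesis by auto
  qed
  ultimately show ?thesis by simp
qed

text \<open>Makes decoding continuous on \<open>codes\<close>, by induction over the generation of
  the topology. A test integral involves only points up to \<open>K\<close>, hence finitely many
  coordinates; their number varies with \<open>p\<close>, hence the union over
  \<open>m\<close>.\<close>

lemma vague_open_decode:
  assumes "openin vague_topology U"
  shows "\<exists>S. open S \<and> (\<forall>p\<in>codes. decode p \<in> U \<longleftrightarrow> p \<in> S)"
  using assms[unfolded vague_topology_def, THEN openin_topology_generated_by]
proof (induction rule: generate_topology_on.induct)
  case Empty
  then show ?case by (intro exI[of _ "{}"]) auto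
next
  case (Int a b)
  then obtain S T where "open S" "\<forall>p\<in>codes. decode p \<in> a \<longleftrightarrow> p \<in> S" "open T" "\<forall>p\<in>codes. decode p \<in> b \<longleftrightarrow> p \<in> T" by blast
  then show ?case by (intro exI[of _ "S \<inter> T"]) auto
next
  case (UN K)
  then have "\<forall>k. \<exists>S. k \<in> K \<longrightarrow> open S \<and> (\<forall>p\<in>codes. decode p \<in> k \<longleftrightarrow> p \<in> S)" by blast
  from choice[OF this] obtain S where S: "\<And>k. k \<in> K \<Longrightarrow> open (S k) \<and> (\<forall>p\<in>codes. decode p \<in> k \<longleftrightarrow> p \<in> S k)" by blast
  show ?case
  proof (intro exI[of _ "\<Union>k\<in>K. S k"] conjI ballI)
    show "open (\<Union>k\<in>K. S k)" using S by blast
    show "decode p \<in> \<Union>K \<longleftrightarrow> p \<in> (\<Union>k\<in>K. S k)" if "p \<in> codes" for p using S that by blast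
  qed
next
  case (Basis s)
  then obtain f V where s: "s = {m \<in> counting_measures. (\<integral>t. f t \<partial>m) \<in> V}" and f: "f \<in> vague_test_functions" and V: "open V"
    by blast
  obtain K where K: "\<And>t. K < t \<Longrightarrow> f t = 0" using f by (auto simp: vague_test_functions_def)
  define g where "g u = (if 0 < u then f (max 0 (- ln u)) else 0)" for u
  have g: "continuous_on UNIV g" unfolding g_def by (rule continuous_on_decoded_test[OF f])
  define S where "S m = {p :: nat \<Rightarrow> real. p m < exp (- K)} \<inter> (\<lambda>p. \<Sum>i<m. g (p i)) -` V" for m
  have coord: "continuous_on UNIV (\<lambda>p :: nat \<Rightarrow> real. p i)" for i by (rule continuous_on_product_coordinates)
  have "open (S m)" for m
    unfolding S_def
  proof (rule open_Int)
    show "open {p :: nat \<Rightarrow> real. p m < exp (- K)}"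
      using coord by (intro open_Collect_less continuous_intros)
    have "continuous_on UNIV (\<lambda>p :: nat \<Rightarrow> real. g (p i))" for i
      by (rule continuous_on_compose2[OF g coord]) simp
    then have "continuous_on UNIV (\<lambda>p :: nat \<Rightarrow> real. \<Sum>i<m. g (p i))" by (intro continuous_on_sum)
    then show "open ((\<lambda>p. \<Sum>i<m. g (p i)) -` V)" by (intro open_vimage[OF V])
  qed
  moreover have "decode p \<in> s \<longleftrightarrow> p \<in> (\<Union>m. S m)" if p: "p \<in> codes" for p
  proof -
    have int: "(\<integral>t. f t \<partial>decode p) = (\<Sum>i<m. g (p i))" if "p m < exp (- K)" for m
      unfolding g_def by (rule decode_integral[OF p f K that])
    have "eventually (\<lambda>k. p k < exp (- K)) sequentially"
      using p by (intro order_tendstoD(2)[of p 0]) (auto simp: codes_def)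
    then obtain m0 where "p m0 < exp (- K)" by (auto simp: eventually_sequentially)
    moreover have "p \<in> S m \<longleftrightarrow> p m < exp (- K) \<and> (\<integral>t. f t \<partial>decode p) \<in> V" for m
      using int[of m] by (auto simp: S_def)
    ultimately show ?thesis using decode_counting[OF p] by (auto simp: s)
  qed
  ultimately show ?case by (intro exI[of _ "\<Union>m. S m"]) auto
qed

text \<open>The Lipschitz envelope (Pasch-Hausdorff). It is defined and continuous on the whole
  space though \<open>G\<close> matters only on \<open>C\<close>; this extends functionals from the
  codes, where moments cannot be used directly.\<close>

definition minorant :: "'a::metric_space set \<Rightarrow> ('a \<Rightarrow> real) \<Rightarrow> nat \<Rightarrow> 'a \<Rightarrow> real" where
  "minorant C G k p = (INF c\<in>C. G c + real k * dist p c)"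

context
  fixes C :: "'a::metric_space set" and G :: "'a \<Rightarrow> real"
  assumes C: "C \<noteq> {}" and G: "\<And>c. c \<in> C \<Longrightarrow> 0 \<le> G c"
begin

lemma minorant_bdd_below: "bdd_below ((\<lambda>c. G c + real k * dist p c) ` C)"
  using G by (intro bdd_belowI[of _ 0]) auto

lemma minorant_bounds: "0 \<le> minorant C G k p" "p \<in> C \<Longrightarrow> minorant C G k p \<le> G p"
proof -
  show "0 \<le> minorant C G k p" unfolding minorant_def using C G by (intro cINF_greatest) auto
  assume "p \<in> C"
  from cINF_lower[OF minorant_bdd_below[of k p] this] show "minorant C G k p \<le> G p" unfolding minorant_def by simp
qed

lemma minorant_lipschitz: "minorant C G k p \<le> minorant C G k p' + real k * dist p p'"
proof -
  have "minorant C G k p - real k * dist p p' \<le> G c + real k * dist p' c" if "c \<in> C" for c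
  proof -
    have "minorant C G k p \<le> G c + real k * dist p c"
      unfolding minorant_def by (rule cINF_lower[OF minorant_bdd_below that])
    also have "real k * dist p c \<le> real k * (dist p p' + dist p' c)" by (intro mult_left_mono dist_triangle) simp
    finally show ?thesis by (simp add: distrib_left)
  qed
  then have "minorant C G k p - real k * dist p p' \<le> minorant C G k p'"
    unfolding minorant_def[of C G k p'] using C by (intro cINF_greatest) auto
  then show ?thesis by simp
qed

lemma continuous_on_minorant: "continuous_on UNIV (minorant C G k)"
proof -
  have "dist (minorant C G k p') (minorant C G k p) \<le> real k * dist p' p" for p p'
    using minorant_lipschitz[of k p p'] minorant_lipschitz[of k p' p] by (simp add: dist_real_def dist_commute abs_le_iff)
  then have "(real k)-lipschitz_on UNIV (minorant C G k)" by (intro lipschitz_onI) auto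
  then show ?thesis by (rule lipschitz_on_continuous_on)
qed

text \<open>Near \<open>p\<close>, lower semicontinuity along \<open>C\<close> keeps
  \<open>G\<close> above \<open>y'\<close>; farther away the penalty \<open>k\<close> times the
  distance takes over.\<close>

lemma minorant_tendsto:
  assumes p: "p \<in> C" and lsc: "\<And>y. y < G p \<Longrightarrow> \<exists>S. open S \<and> p \<in> S \<and> (\<forall>c\<in>C \<inter> S. y < G c)"
  shows "(\<lambda>k. minorant C G k p) \<longlonglongrightarrow> G p"
proof (rule order_tendstoI)
  fix y assume "y < G p"
  then obtain y' where y': "y < y'" "y' < G p" using dense by blast
  obtain S where S: "open S" "p \<in> S" "\<And>c. c \<in> C \<Longrightarrow> c \<in> S \<Longrightarrow> y' < G c" using lsc[OF y'(2)] by blast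
  obtain \<delta> where \<delta>: "0 < \<delta>" "ball p \<delta> \<subseteq> S" using S(1,2) by (auto simp: open_contains_ball)
  \<comment> \<open>Large enough that distance \<open>\<delta>\<close> alone already costs
    \<open>y'\<close>.\<close>
  obtain k0 :: nat where k0: "y' / \<delta> < real k0" using reals_Archimedean2 by blast
  have "y' \<le> minorant C G k p" if k: "k0 \<le> k" for k
    unfolding minorant_def
  proof (rule cINF_greatest[OF C])
    fix c assume c: "c \<in> C"
    show "y' \<le> G c + real k * dist p c"
    proof (cases "dist p c < \<delta>")
      case True
      then have "y' < G c" using S(3)[OF c] \<delta>(2) by auto
      moreover have "0 \<le> real k * dist p c" by simp
      ultimately show ?thesis by linarith
    next
      case False
      have "y' \<le> real k0 * \<delta>" using k0 \<delta>(1) by (simp add: field_simps)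
      also have "\<dots> \<le> real k * dist p c" using k False \<delta>(1) by (intro mult_mono) auto
      finally show ?thesis using G[OF c] by simp
    qed
  qed
  then show "eventually (\<lambda>k. y < minorant C G k p) sequentially"
    by (intro eventually_sequentiallyI[of k0] less_le_trans[OF y'(1)])
next
  fix y assume "G p < y"
  then show "eventually (\<lambda>k. minorant C G k p < y) sequentially"
    using minorant_bounds(2)[OF p] by (intro always_eventually allI) (rule le_less_trans)
qed

end

section \<open>Random point processes given by codes\<close>

locale coded_process =
  fixes P :: "'a measure" and X :: "'a \<Rightarrow> nat \<Rightarrow> real" and N :: "'a \<Rightarrow> real measure"
  assumes prob: "prob_space P" and X_meas [measurable]: "X \<in> borel_measurable P"
    and X_codes: "AE z in P. X z \<in> codes" and N_decode: "AE z in P. N z = decode (X z)"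
begin

sublocale prob_space P by (rule prob)

lemma N_counting: "AE z in P. N z \<in> topspace vague_topology"
  using X_codes N_decode by eventually_elim (simp add: topspace_vague_topology decode_counting)

lemma N_open:
  assumes "openin vague_topology U"
  obtains S where "open S" "AE z in P. N z \<in> U \<longleftrightarrow> X z \<in> S"
proof -
  obtain S where S: "open S" "\<And>p. p \<in> codes \<Longrightarrow> decode p \<in> U \<longleftrightarrow> p \<in> S"
    using vague_open_decode[OF assms] by blast
  have "AE z in P. N z \<in> U \<longleftrightarrow> X z \<in> S"
    using X_codes N_decode by eventually_elim (simp add: S(2))
  with S(1) show thesis by (rule that)
qed

text \<open>The event agrees almost surely with the preimage of an open set under the measurable
  code, so it is measurable for the completion.\<close>

lemma N_open_sets:
  assumes "openin vague_topology U"
  shows "{z \<in> space P. N z \<in> U} \<in> sets (completion P)"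
proof -
  obtain S where S: "open S" "AE z in P. N z \<in> U \<longleftrightarrow> X z \<in> S" using N_open[OF assms] by blast
  show ?thesis
  proof (rule completion.in_sets_AE)
    have "AE z in P. z \<in> X -` S \<inter> space P \<longleftrightarrow> z \<in> {z \<in> space P. N z \<in> U}"
      using S(2) by eventually_elim auto
    then show "AE z in completion P. z \<in> X -` S \<inter> space P \<longleftrightarrow> z \<in> {z \<in> space P. N z \<in> U}"
      by (rule AE_completion)
    show "X -` S \<inter> space P \<in> sets (completion P)"
      using measurable_sets[OF X_meas, of S] S(1) by (intro sets_completionI_sets) auto
  qed auto
qed

lemma random_element_N: "random_element vague_topology P N"
  unfolding random_element_def using prob N_counting N_open_sets by auto

lemma F_measurable:
  assumes F: "continuous_map vague_topology euclideanreal F"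
  shows "(\<lambda>z. F (N z)) \<in> borel_measurable (completion P)"
proof (rule borel_measurableI)
  fix S :: "real set" assume S: "open S"
  let ?U = "{m \<in> topspace vague_topology. F m \<in> S}"
  have U: "openin vague_topology ?U" using F S by (simp add: continuous_map_def)
  show "(\<lambda>z. F (N z)) -` S \<inter> space (completion P) \<in> sets (completion P)"
  proof (rule completion.in_sets_AE)
    have "AE z in P. z \<in> {z \<in> space P. N z \<in> ?U} \<longleftrightarrow> z \<in> (\<lambda>z. F (N z)) -` S \<inter> space (completion P)"
      using N_counting AE_space by eventually_elim auto
    then show "AE z in completion P. z \<in> {z \<in> space P. N z \<in> ?U} \<longleftrightarrow> z \<in> (\<lambda>z. F (N z)) -` S \<inter> space (completion P)"
      by (rule AE_completion)
  qed (use N_open_sets[OF U] in auto)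
qed

lemma prob_completion: "prob_space (completion P)"
  using prob_space_completion by blast

lemma F_integrable:
  assumes F: "continuous_map vague_topology euclideanreal F" and bd: "\<And>m. m \<in> topspace vague_topology \<Longrightarrow> \<bar>F m\<bar> \<le> c"
  shows "integrable (completion P) (\<lambda>z. F (N z))"
proof -
  interpret C: prob_space "completion P" by (rule prob_completion)
  have "AE z in completion P. norm (F (N z)) \<le> c"
    using AE_completion[OF N_counting] by eventually_elim (simp add: bd)
  then show ?thesis using F_measurable[OF F] by (rule C.integrable_const_bound)
qed

lemma cube_prob_X: "cube_prob (distr P borel X)"
proof -
  have "{p \<in> space borel. p \<in> cube} \<in> sets borel" using compact_imp_closed[OF compact_cube] by simp
  moreover have "AE z in P. X z \<in> cube" using X_codes by eventually_elim (simp add: codes_def)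
  ultimately have "AE p in distr P borel X. p \<in> cube" by (subst AE_distr_iff) auto
  then show ?thesis unfolding cube_prob_def by (simp add: prob_space_distr)
qed

lemma continuous_integral:
  assumes f: "continuous_on UNIV (f :: _ \<Rightarrow> real)"
  shows "(\<lambda>z. f (X z)) \<in> borel_measurable P" "(\<integral>z. f (X z) \<partial>completion P) = (\<integral>p. f p \<partial>distr P borel X)"
proof -
  have "f \<in> borel_measurable borel" using f by (rule borel_measurable_continuous_onI)
  from measurable_compose[OF X_meas this] show m: "(\<lambda>z. f (X z)) \<in> borel_measurable P" .
  show "(\<integral>z. f (X z) \<partial>completion P) = (\<integral>p. f p \<partial>distr P borel X)"
    using integral_completion[OF m] integral_distr[OF X_meas \<open>f \<in> borel_measurable borel\<close>] by simp
qed

end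

lemma codes_nonempty: "codes \<noteq> {}"
proof -
  have "(\<lambda>_. 0) \<in> codes" by (auto simp: codes_def cube_def decseq_def)
  then show ?thesis by blast
qed

text \<open>The functional \<open>F\<close> is continuous along the codes, so its minorants on the cube exhaust it there; their
  integrals converge because they are determined by the moments.\<close>

theorem moments_imp_converges_in_law:
  assumes cp: "eventually (\<lambda>n. coded_process (P n) (X n) (N n)) sequentially" and cq: "coded_process Q Y Z"
    and mom: "\<And>es. (\<lambda>n. \<integral>z. monomial es (X n z) \<partial>P n) \<longlonglongrightarrow> (\<integral>y. monomial es (Y y) \<partial>Q)"
  shows "converges_in_law vague_topology P N Q Z"
proof -
  interpret Q: coded_process Q Y Z by (rule cq)
  obtain n0 where n0: "\<And>n. n0 \<le> n \<Longrightarrow> coded_process (P n) (X n) (N n)"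
    using cp by (auto simp: eventually_sequentially)
  define D where "D n = distr (P (n + n0)) borel (X (n + n0))" for n
  define E where "E = distr Q borel Y"
  have cpn: "coded_process (P (n + n0)) (X (n + n0)) (N (n + n0))" for n by (rule n0) simp
  have D: "cube_prob (D n)" for n unfolding D_def by (rule coded_process.cube_prob_X[OF cpn])
  have E: "cube_prob E" unfolding E_def by (rule Q.cube_prob_X)
  have momD: "(\<lambda>n. \<integral>p. monomial es p \<partial>D n) \<longlonglongrightarrow> (\<integral>p. monomial es p \<partial>E)" for es
  proof -
    have mono_meas: "monomial es \<in> borel_measurable borel"
      by (rule borel_measurable_continuous_onI[OF continuous_on_monomial])
    show ?thesis unfolding D_def E_def integral_distr[OF coded_process.X_meas[OF cpn] mono_meas] integral_distr[OF Q.X_meas mono_meas]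
      by (rule LIMSEQ_ignore_initial_segment[OF mom])
  qed
  \<comment> \<open>The portmanteau half: continuous minorants that almost exhaust the limit
    integral bound the integrals of \<open>F\<close> from below.\<close>
  have lower: "eventually (\<lambda>n. y < (\<integral>z. F (N (n + n0) z) \<partial>completion (P (n + n0)))) sequentially"
    if F: "continuous_map vague_topology euclideanreal F"
      and bd: "\<And>m. m \<in> topspace vague_topology \<Longrightarrow> 0 \<le> F m \<and> F m \<le> c"
      and y: "y < (\<integral>z. F (Z z) \<partial>completion Q)" for F c y
  proof -
    have bd': "\<bar>F m\<bar> \<le> c" if "m \<in> topspace vague_topology" for m using bd[OF that] by simp
    define f where "f = minorant codes (\<lambda>p. F (decode p))"
    have G: "0 \<le> F (decode p) \<and> F (decode p) \<le> c" if "p \<in> codes" for p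
      by (rule bd) (simp add: topspace_vague_topology decode_counting that)
    have f: "continuous_on UNIV (f k)" "0 \<le> f k p" "p \<in> codes \<Longrightarrow> f k p \<le> F (decode p)" for k p
      unfolding f_def using G by (auto intro!: continuous_on_minorant minorant_bounds codes_nonempty)
    have f_lim: "(\<lambda>k. f k p) \<longlonglongrightarrow> F (decode p)" if p: "p \<in> codes" for p
      unfolding f_def
    proof (rule minorant_tendsto[OF codes_nonempty _ p])
      fix y assume y: "y < F (decode p)"
      have "openin vague_topology {m \<in> topspace vague_topology. F m \<in> {y<..}}"
        by (rule openin_continuous_map_preimage[OF F]) simp
      from vague_open_decode[OF this] obtain S where S: "open S"
        "\<And>p. p \<in> codes \<Longrightarrow> decode p \<in> {m \<in> topspace vague_topology. F m \<in> {y<..}} \<longleftrightarrow> p \<in> S" by blast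
      then show "\<exists>S. open S \<and> p \<in> S \<and> (\<forall>c\<in>codes \<inter> S. y < F (decode c))"
        using p y decode_counting by (intro exI[of _ S]) (auto simp: topspace_vague_topology)
    qed (use G in auto)
    have "(\<lambda>k. \<integral>z. f k (Y z) \<partial>completion Q) \<longlonglongrightarrow> (\<integral>z. F (Z z) \<partial>completion Q)"
    proof (rule integral_dominated_convergence[where w = "\<lambda>_. c"])
      show "integrable (completion Q) (\<lambda>_. c)"
        using prob_space.finite_measure[OF Q.prob_completion] by (rule finite_measure.integrable_const)
      show "(\<lambda>z. f k (Y z)) \<in> borel_measurable (completion Q)" for k
        by (rule measurable_completion[OF Q.continuous_integral(1)[OF f(1)]])
      show "AE z in completion Q. (\<lambda>k. f k (Y z)) \<longlonglongrightarrow> F (Z z)"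
        using AE_completion[OF Q.X_codes] AE_completion[OF Q.N_decode] by eventually_elim (simp add: f_lim)
      show "AE z in completion Q. norm (f k (Y z)) \<le> c" for k
        using AE_completion[OF Q.X_codes]
      proof eventually_elim
        case (elim z)
        then show ?case using f(2)[of k "Y z"] f(3)[OF elim, of k] G[OF elim] by simp
      qed
    qed (rule Q.F_measurable[OF F])
    from order_tendstoD(1)[OF this y] obtain k where "y < (\<integral>z. f k (Y z) \<partial>completion Q)"
      by (auto simp: eventually_sequentially)
    then have "y < (\<integral>p. f k p \<partial>E)" unfolding E_def Q.continuous_integral(2)[OF f(1)] .
    from order_tendstoD(1)[OF moments_imp_continuous_integrals[OF D E momD f(1)] this]
    show ?thesis
    proof eventually_elim
      case (elim n)
      interpret C: coded_process "P (n + n0)" "X (n + n0)" "N (n + n0)" by (rule cpn)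
      have "(\<integral>p. f k p \<partial>D n) \<le> (\<integral>z. F (N (n + n0) z) \<partial>completion (P (n + n0)))"
        unfolding D_def C.continuous_integral(2)[OF f(1), symmetric]
      proof (rule integral_mono_AE'[OF C.F_integrable[OF F bd']])
        show "AE z in completion (P (n + n0)). f k (X (n + n0) z) \<le> F (N (n + n0) z)"
          using AE_completion[OF C.X_codes] AE_completion[OF C.N_decode] by eventually_elim (simp add: f)
        show "AE z in completion (P (n + n0)). 0 \<le> F (N (n + n0) z)"
          using AE_completion[OF C.X_codes] AE_completion[OF C.N_decode] by eventually_elim (simp add: G)
      qed
      then show ?case using elim by simp
    qed
  qed
  have conv: "(\<lambda>n. \<integral>z. F (N n z) \<partial>completion (P n)) \<longlonglongrightarrow> (\<integral>z. F (Z z) \<partial>completion Q)"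
    if F: "continuous_map vague_topology euclideanreal F" and bounded: "bounded (F ` topspace vague_topology)" for F
  proof -
    obtain c where c: "\<And>m. m \<in> topspace vague_topology \<Longrightarrow> \<bar>F m\<bar> \<le> c" using bounded by (auto simp: bounded_iff)
    \<comment> \<open>With \<open>r\<close> equal to 1 and to -1 both functionals are nonnegative,
      and the lower bound applied to each yields the two sides.\<close>
    have cont: "continuous_map vague_topology euclideanreal (\<lambda>m. c + r * F m)" for r
      using F by (auto intro!: continuous_intros)
    have int: "(\<integral>z. c + r * F (N' z) \<partial>completion P') = c + r * (\<integral>z. F (N' z) \<partial>completion P')"
      if cp': "coded_process P' X' N'" for P' :: "'e measure" and X' N' r
    proof -
      interpret C: prob_space "completion P'" by (rule coded_process.prob_completion[OF cp'])
      have "integrable (completion P') (\<lambda>z. F (N' z))" by (rule coded_process.F_integrable[OF cp' F c])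
      then show ?thesis using C.prob_space by simp
    qed
    have bd: "0 \<le> c + r * F m \<and> c + r * F m \<le> 2 * c" if "m \<in> topspace vague_topology" "r = 1 \<or> r = - 1" for m r
      using c[OF that(1)] that(2) by (auto simp: abs_le_iff)
    have "(\<lambda>n. \<integral>z. F (N (n + n0) z) \<partial>completion (P (n + n0))) \<longlonglongrightarrow> (\<integral>z. F (Z z) \<partial>completion Q)"
    proof (rule order_tendstoI)
      fix y assume "y < (\<integral>z. F (Z z) \<partial>completion Q)"
      then show "eventually (\<lambda>n. y < (\<integral>z. F (N (n + n0) z) \<partial>completion (P (n + n0)))) sequentially"
        using lower[OF cont[of 1] bd, of "c + y"] unfolding int[OF cq] int[OF cpn] by simp
    next
      fix y assume "(\<integral>z. F (Z z) \<partial>completion Q) < y"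
      then show "eventually (\<lambda>n. (\<integral>z. F (N (n + n0) z) \<partial>completion (P (n + n0))) < y) sequentially"
        using lower[OF cont[of "- 1"] bd, of "c - y"] unfolding int[OF cq] int[OF cpn] by simp
    qed
    then show ?thesis by (rule LIMSEQ_offset)
  qed
  have "eventually (\<lambda>n. random_element vague_topology (P n) (N n)) sequentially"
    using cp by eventually_elim (rule coded_process.random_element_N)
  then show ?thesis
    unfolding converges_in_law_def using Q.random_element_N conv by blast
qed

section \<open>Recovering the law of the first point\<close>

definition ramp :: "real \<Rightarrow> nat \<Rightarrow> nat \<Rightarrow> real \<Rightarrow> real" where
  "ramp s K i t = min 1 (max 0 (real K * exp (- (s * t)) - real i - 1))"

text \<open>Approximates \<open>exp (- (s * t))\<close> for the first point \<open>t\<close> by a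
  vaguely continuous functional. Cut into \<open>K\<close> layers, a layer counts once however many
  points reach it, so the first point alone decides. Subtracting 1 in \<open>ramp\<close> gives
  every layer bounded support.\<close>

definition first_point_approx :: "real \<Rightarrow> nat \<Rightarrow> real measure \<Rightarrow> real" where
  "first_point_approx s K m = (\<Sum>i<K. min 1 (\<integral>t. ramp s K i t \<partial>m)) / real K"

lemma ramp_eq_0:
  assumes s: "0 < s" and K: "0 < K" and t: "ln (real K) / s < t"
  shows "ramp s K i t = 0"
proof -
  have "ln (real K) < s * t" using s t by (simp add: field_simps)
  then have "real K < exp (s * t)" using K by (metis exp_less_mono exp_ln of_nat_0_less_iff)
  then have "real K * exp (- (s * t)) < 1" by (simp add: exp_minus field_simps)
  then show ?thesis by (simp add: ramp_def)
qed

lemma ramp_test: "0 < s \<Longrightarrow> 0 < K \<Longrightarrow> ramp s K i \<in> vague_test_functions"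
  unfolding vague_test_functions_def using ramp_eq_0[of s K _ i]
  by (auto simp: ramp_def[abs_def] intro!: continuous_intros)

lemma continuous_first_point_approx:
  assumes "0 < s" "0 < K"
  shows "continuous_map vague_topology euclideanreal (first_point_approx s K)"
proof -
  have "continuous_map vague_topology euclideanreal (\<lambda>m. \<integral>t. ramp s K i t \<partial>m)" for i
    unfolding continuous_map_def
  proof (intro conjI allI impI)
    fix U :: "real set" assume "openin euclideanreal U"
    then have "{m \<in> counting_measures. (\<integral>t. ramp s K i t \<partial>m) \<in> U} \<in>
        {{m \<in> counting_measures. (\<integral>t. f t \<partial>m) \<in> U} | f U. f \<in> vague_test_functions \<and> open U}"
      using ramp_test[OF assms] by (intro CollectI exI[of _ "ramp s K i"] exI[of _ U]) simp
    then show "openin vague_topology {m \<in> topspace vague_topology. (\<integral>t. ramp s K i t \<partial>m) \<in> U}"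
      unfolding topspace_vague_topology unfolding vague_topology_def by (rule topology_generated_by_Basis)
  qed simp
  then show ?thesis
    unfolding first_point_approx_def[abs_def] by (intro continuous_intros) (use assms in auto)
qed

lemma first_point_approx_bounds: "0 \<le> first_point_approx s K m" "first_point_approx s K m \<le> 1"
proof -
  have "0 \<le> (\<integral>t. ramp s K i t \<partial>m)" for i by (intro Bochner_Integration.integral_nonneg) (simp add: ramp_def)
  then show "0 \<le> first_point_approx s K m" unfolding first_point_approx_def by (intro divide_nonneg_nonneg sum_nonneg) auto
  have "(\<Sum>i<K. min 1 (\<integral>t. ramp s K i t \<partial>m)) \<le> (\<Sum>i<K. 1)" by (intro sum_mono) simp
  then show "first_point_approx s K m \<le> 1" unfolding first_point_approx_def by (cases "K = 0") auto
qed

lemma sum_clipped: "(\<Sum>i<K. min 1 (max 0 (y - real i))) = min (real K) (max 0 y)"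
  by (induction K) (auto simp: min_def max_def)

text \<open>The layers filled by the first point alone give the lower bound; the upper bound holds
  because no later point reaches a layer which the first one misses. Both sides lie within one layer
  of \<open>K * v 0\<close>.\<close>

lemma first_point_approx_decode:
  assumes s: "0 < s" and K: "0 < K" and p: "p \<in> codes"
  shows "\<bar>first_point_approx s K (decode p) - p 0 powr s\<bar> \<le> 1 / real K"
proof -
  define v where "v j = p j powr s" for j
  define g where "g i j = min 1 (max 0 (real K * v j - real i - 1))" for i j
  have p01: "0 \<le> p j" "p j \<le> 1" "p j \<le> p 0" for j using p by (auto simp: codes_def cube_def decseq_def)
  have v: "0 \<le> v j" "v j \<le> v 0" "v 0 \<le> 1" for j
    using p01 s by (auto simp: v_def powr_mono2 powr_le1)
  have "eventually (\<lambda>m. p m < exp (- (ln (real K) / s))) sequentially"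
    using p by (intro order_tendstoD(2)[of p 0]) (auto simp: codes_def)
  then obtain m0 where m0: "\<And>m. m0 \<le> m \<Longrightarrow> p m < exp (- (ln (real K) / s))" by (auto simp: eventually_sequentially)
  have int: "(\<integral>t. ramp s K i t \<partial>decode p) = (\<Sum>j<Suc m0. g i j)" for i
  proof -
    have "(if 0 < p j then ramp s K i (max 0 (- ln (p j))) else 0) = g i j" for j
    proof (cases "0 < p j")
      case True
      then have "max 0 (- ln (p j)) = - ln (p j)" "v j = exp (- (s * - ln (p j)))"
        using p01(2)[of j] by (auto simp: max_def v_def powr_def)
      then show ?thesis using True by (simp only: ramp_def g_def if_True)
    next
      case False
      then show ?thesis using p01(1)[of j] by (simp add: g_def v_def)
    qed
    then show ?thesis
      using decode_integral[OF p ramp_test[OF s K] ramp_eq_0[OF s K] m0, of "Suc m0" i] by simp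
  qed
  have bounds: "g i 0 \<le> min 1 (\<integral>t. ramp s K i t \<partial>decode p)"
    "min 1 (\<integral>t. ramp s K i t \<partial>decode p) \<le> min 1 (max 0 (real K * v 0 - real i))" for i
  proof -
    have "(\<Sum>j\<in>{0}. g i j) \<le> (\<Sum>j<Suc m0. g i j)" by (intro sum_mono2) (auto simp: g_def)
    then show "g i 0 \<le> min 1 (\<integral>t. ramp s K i t \<partial>decode p)" unfolding int by (simp add: g_def)
    show "min 1 (\<integral>t. ramp s K i t \<partial>decode p) \<le> min 1 (max 0 (real K * v 0 - real i))"
    proof (cases "real K * v 0 \<le> real i + 1")
      case True
      have "g i j = 0" for j using mult_left_mono[OF v(2)[of j], of "real K"] True by (simp add: g_def)
      then show ?thesis unfolding int by simp
    qed simp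
  qed
  let ?S = "\<Sum>i<K. min 1 (\<integral>t. ramp s K i t \<partial>decode p)"
  have Kv: "0 \<le> real K * v 0" "real K * v 0 \<le> real K" using v(1,3) K by (auto simp: mult_left_le)
  have "real K * v 0 - 1 \<le> min (real K) (max 0 (real K * v 0 - 1))" using Kv by simp
  also have "\<dots> = (\<Sum>i<K. g i 0)" unfolding sum_clipped[symmetric] by (simp add: g_def algebra_simps)
  also have "\<dots> \<le> ?S" by (intro sum_mono bounds)
  finally have 1: "real K * v 0 - 1 \<le> ?S" .
  have "?S \<le> (\<Sum>i<K. min 1 (max 0 (real K * v 0 - real i)))" by (intro sum_mono bounds)
  also have "\<dots> = real K * v 0" unfolding sum_clipped using Kv by simp
  finally have "\<bar>?S - real K * v 0\<bar> \<le> 1" using 1 by linarith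
  moreover have "first_point_approx s K (decode p) - v 0 = (?S - real K * v 0) / real K"
    using K by (simp add: first_point_approx_def diff_divide_distrib)
  ultimately show ?thesis using K unfolding v_def by (simp add: divide_right_mono)
qed

context coded_process
begin

lemma first_coordinate:
  "(\<lambda>z. X z 0) \<in> borel_measurable P" "AE z in P. 0 \<le> X z 0 \<and> X z 0 \<le> 1"
proof -
  show "(\<lambda>z. X z 0) \<in> borel_measurable P" by (rule continuous_integral(1)[OF continuous_on_product_coordinates])
  show "AE z in P. 0 \<le> X z 0 \<and> X z 0 \<le> 1"
    using X_codes by eventually_elim (auto simp: codes_def cube_def)
qed

lemma first_point_approx_integral:
  assumes s: "0 < s" and K: "0 < K"
  shows "\<bar>(\<integral>z. first_point_approx s K (N z) \<partial>completion P) - (\<integral>z. X z 0 powr s \<partial>P)\<bar> \<le> 1 / real K"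
proof -
  interpret C: prob_space "completion P" by (rule prob_completion)
  note [measurable] = first_coordinate(1)
  have m: "(\<lambda>z. X z 0 powr s) \<in> borel_measurable P" by measurable
  have int: "integrable (completion P) (\<lambda>z. X z 0 powr s)"
  proof (rule C.integrable_const_bound[OF _ measurable_completion[OF m]])
    show "AE z in completion P. norm (X z 0 powr s) \<le> 1"
      using AE_completion[OF first_coordinate(2)] by eventually_elim (use s in \<open>simp add: powr_le1\<close>)
  qed
  have intF: "integrable (completion P) (\<lambda>z. first_point_approx s K (N z))"
    by (rule F_integrable[OF continuous_first_point_approx[OF s K]]) (use first_point_approx_bounds in auto)
  have "AE z in P. \<bar>first_point_approx s K (N z) - X z 0 powr s\<bar> \<le> 1 / real K"
    using X_codes N_decode by eventually_elim (simp add: first_point_approx_decode[OF s K])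
  then have "\<bar>\<integral>z. first_point_approx s K (N z) - X z 0 powr s \<partial>completion P\<bar> \<le> (\<integral>z. 1 / real K \<partial>completion P)"
    by (intro abs_integral_le AE_completion) auto
  then show ?thesis
    using int intF C.prob_space by (simp add: integral_completion[OF m])
qed

end

text \<open>The layer functional is uniformly close to the wanted power on both sides, with error
  \<open>1 / K\<close>; three thirds make up the tolerance.\<close>

theorem converges_in_law_imp_first_point:
  assumes cp: "eventually (\<lambda>n. coded_process (P n) (X n) (N n)) sequentially" and cq: "coded_process Q Y Z"
    and conv: "converges_in_law vague_topology P N Q Z" and s: "0 < s"
  shows "(\<lambda>n. \<integral>z. X n z 0 powr s \<partial>P n) \<longlonglongrightarrow> (\<integral>y. Y y 0 powr s \<partial>Q)"
proof (rule tendstoI)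
  fix e :: real assume e: "0 < e"
  then obtain k where k: "inverse (real (Suc k)) < e / 3" using reals_Archimedean[of "e / 3"] by auto
  define F where "F = first_point_approx s (Suc k)"
  have "bounded (F ` topspace vague_topology)"
    using first_point_approx_bounds[of s "Suc k"] unfolding F_def by (intro boundedI[of _ 1]) auto
  then have "(\<lambda>n. \<integral>z. F (N n z) \<partial>completion (P n)) \<longlonglongrightarrow> (\<integral>y. F (Z y) \<partial>completion Q)"
    using conv continuous_first_point_approx[OF s] unfolding converges_in_law_def F_def by auto
  then have "eventually (\<lambda>n. \<bar>(\<integral>z. F (N n z) \<partial>completion (P n)) - (\<integral>y. F (Z y) \<partial>completion Q)\<bar> < e / 3) sequentially"
    using e unfolding dist_real_def[symmetric] by (intro tendstoD) auto
  then show "eventually (\<lambda>n. dist (\<integral>z. X n z 0 powr s \<partial>P n) (\<integral>y. Y y 0 powr s \<partial>Q) < e) sequentially"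
    using cp
  proof eventually_elim
    case (elim n)
    show ?case
      using elim(1) coded_process.first_point_approx_integral[OF elim(2) s, of "Suc k"]
        coded_process.first_point_approx_integral[OF cq s, of "Suc k"] k
      unfolding F_def dist_real_def inverse_eq_divide by linarith
  qed
qed

section \<open>Laplace transforms\<close>

lemma nonneg_lawD:
  assumes "nonneg_law \<nu>"
  shows "real_distribution \<nu>" "AE w in \<nu>. 0 \<le> w"
  using assms by (auto simp: nonneg_law_def)

text \<open>The integrand becomes bounded and continuous on the whole line, as tests of weak
  convergence require.\<close>

lemma laplace_transform_max:
  assumes "nonneg_law \<nu>"
  shows "laplace_transform \<nu> s = (\<integral>w. exp (- (s * max 0 w)) \<partial>\<nu>)"
proof -
  interpret real_distribution \<nu> using assms by (rule nonneg_lawD)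
  show ?thesis unfolding laplace_transform_def
  proof (rule integral_cong_AE)
    show "AE w in \<nu>. exp (- (s * w)) = exp (- (s * max 0 w))"
      using nonneg_lawD(2)[OF assms] by eventually_elim simp
  qed measurable
qed

lemma laplace_integrable:
  assumes "nonneg_law \<nu>" "0 \<le> s"
  shows "integrable \<nu> (\<lambda>w. exp (- (s * w)))"
proof -
  interpret real_distribution \<nu> using assms by (intro nonneg_lawD)
  show ?thesis
    using nonneg_lawD(2)[OF assms(1)] assms(2) by (intro integrable_const_bound[of _ 1]) (auto elim!: eventually_mono)
qed

lemma laplace_transform_0:
  assumes "nonneg_law \<nu>"
  shows "laplace_transform \<nu> 0 = 1"
proof -
  interpret real_distribution \<nu> using assms by (intro nonneg_lawD)
  show ?thesis using prob_space by (simp add: laplace_transform_def)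
qed

lemma weak_conv_imp_laplace:
  assumes mu: "\<And>n. nonneg_law (\<mu> n)" and nu: "nonneg_law \<nu>" and conv: "weak_conv_m \<mu> \<nu>" and s: "0 \<le> s"
  shows "(\<lambda>n. laplace_transform (\<mu> n) s) \<longlonglongrightarrow> laplace_transform \<nu> s"
  unfolding laplace_transform_max[OF mu] laplace_transform_max[OF nu]
proof (rule weak_conv_imp_integral_bdd_continuous_conv[OF nonneg_lawD(1)[OF mu] nonneg_lawD(1)[OF nu] conv])
  show "isCont (\<lambda>w. exp (- (s * max 0 w))) w" for w by (intro continuous_intros)
  show "norm (exp (- (s * max 0 w))) \<le> 1" for w using s by simp
qed

text \<open>Embeds the half-line in the cube by constant sequences of \<open>exp (- w)\<close>.
  Every monomial then has the transform at an integer as its mean, so integer arguments determine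
  the integrals of all continuous functions, in particular of the step approximations.\<close>

lemma laplace_imp_weak_conv:
  assumes mu: "\<And>n. nonneg_law (\<mu> n)" and nu: "nonneg_law \<nu>"
    and conv: "\<And>k::nat. 1 \<le> k \<Longrightarrow> (\<lambda>n. laplace_transform (\<mu> n) (real k)) \<longlonglongrightarrow> laplace_transform \<nu> (real k)"
  shows "weak_conv_m \<mu> \<nu>"
proof (rule integral_cts_step_conv_imp_weak_conv[OF nonneg_lawD(1)[OF mu] nonneg_lawD(1)[OF nu]])
  fix x y :: real assume xy: "x < y"
  define u where "u w = (\<lambda>_ :: nat. exp (- max 0 w))" for w :: real
  define D where "D \<mu>' = distr \<mu>' borel u" for \<mu>'
  have u_meas [measurable]: "u \<in> borel_measurable borel"
    unfolding u_def by (rule measurable_coordinatewise_then_product) measurable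
  have D: "cube_prob (D \<mu>')" if "nonneg_law \<mu>'" for \<mu>'
  proof -
    interpret real_distribution \<mu>' using that by (rule nonneg_lawD)
    have "{p \<in> space borel. p \<in> cube} \<in> sets borel" using compact_imp_closed[OF compact_cube] by simp
    then have "AE p in D \<mu>'. p \<in> cube" unfolding D_def by (subst AE_distr_iff) (auto simp: u_def cube_def)
    then show ?thesis unfolding cube_prob_def by (simp add: D_def prob_space_distr)
  qed
  have mono_u: "monomial es (u w) = exp (- (real (sum_list es) * max 0 w))" for es w
  proof (induction es)
    case (Cons e es)
    have "monomial (e # es) (u w) = exp (- max 0 w) ^ e * monomial es (u w)" by (simp add: u_def)
    also have "\<dots> = exp (- (real (sum_list (e # es)) * max 0 w))"
      unfolding Cons by (simp add: exp_of_nat_mult[symmetric] exp_add[symmetric] algebra_simps)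
    finally show ?case .
  qed simp
  have mono_int: "(\<integral>p. monomial es p \<partial>D \<mu>') = laplace_transform \<mu>' (real (sum_list es))" if "nonneg_law \<mu>'" for \<mu>' es
  proof -
    interpret real_distribution \<mu>' using that by (rule nonneg_lawD)
    show ?thesis unfolding D_def laplace_transform_max[OF that]
      using borel_measurable_continuous_onI[OF continuous_on_monomial]
      by (subst integral_distr) (auto simp: mono_u)
  qed
  have mom: "(\<lambda>n. \<integral>p. monomial es p \<partial>D (\<mu> n)) \<longlonglongrightarrow> (\<integral>p. monomial es p \<partial>D \<nu>)" for es
  proof (cases "sum_list es = 0")
    case True
    show ?thesis by (simp only: mono_int[OF mu] mono_int[OF nu] True of_nat_0 laplace_transform_0[OF mu] laplace_transform_0[OF nu] tendsto_const)
  next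
    case False
    then show ?thesis unfolding mono_int[OF mu] mono_int[OF nu] by (intro conv) linarith
  qed
  have test: "cts_step x y \<in> vague_test_functions"
    unfolding vague_test_functions_def
  proof (intro CollectI conjI)
    show "continuous_on {0..} (cts_step x y)"
      by (rule continuous_on_subset[OF uniformly_continuous_imp_continuous[OF cts_step_uniformly_continuous[OF xy]]]) simp
    show "\<exists>K. \<forall>t>K. cts_step x y t = 0" using xy by (intro exI[of _ y]) (auto simp: cts_step_def)
  qed
  define g where "g v = (if 0 < v then cts_step x y (max 0 (- ln v)) else 0)" for v
  have g: "continuous_on UNIV g" unfolding g_def by (rule continuous_on_decoded_test[OF test])
  have g0: "continuous_on UNIV (\<lambda>p :: nat \<Rightarrow> real. g (p 0))"
    by (rule continuous_on_compose2[OF g continuous_on_product_coordinates]) simp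
  have int: "(\<integral>p. g (p 0) \<partial>D \<mu>') = integral\<^sup>L \<mu>' (cts_step x y)" if "nonneg_law \<mu>'" for \<mu>'
  proof -
    interpret real_distribution \<mu>' using that by (rule nonneg_lawD)
    have cts: "cts_step x y \<in> borel_measurable borel"
      by (intro borel_measurable_continuous_onI uniformly_continuous_imp_continuous cts_step_uniformly_continuous xy)
    have "(\<integral>p. g (p 0) \<partial>D \<mu>') = (\<integral>w. g (u w 0) \<partial>\<mu>')"
      unfolding D_def using borel_measurable_continuous_onI[OF g0] by (subst integral_distr) auto
    also have "\<dots> = (\<integral>w. cts_step x y w \<partial>\<mu>')"
    proof (rule integral_cong_AE)
      show "AE w in \<mu>'. g (u w 0) = cts_step x y w"
        using nonneg_lawD(2)[OF that] by eventually_elim (simp add: g_def u_def)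
      show "(\<lambda>w. g (u w 0)) \<in> borel_measurable \<mu>'"
        unfolding u_def using borel_measurable_continuous_onI[OF g] by measurable
    qed (use cts in auto)
    finally show ?thesis .
  qed
  have "(\<lambda>n. \<integral>p. g (p 0) \<partial>D (\<mu> n)) \<longlonglongrightarrow> (\<integral>p. g (p 0) \<partial>D \<nu>)"
    by (rule moments_imp_continuous_integrals[OF D[OF mu] D[OF nu] mom g0])
  then show "(\<lambda>n. integral\<^sup>L (\<mu> n) (cts_step x y)) \<longlonglongrightarrow> integral\<^sup>L \<nu> (cts_step x y)"
    unfolding int[OF mu] int[OF nu] .
qed

text \<open>A continuity theorem. Laws on the unit interval are tight, and a subsequential limit has
  power moments \<open>L\<close>. That \<open>L\<close> tends to 1 at 0 rules out an atom at 0, so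
  the negative logarithm of the limit is a finite random variable with transform
  \<open>L\<close>.\<close>

lemma laplace_limit_law:
  assumes P: "\<And>n. prob_space (P n)" and U: "\<And>n. U n \<in> borel_measurable (P n)" "\<And>n. AE z in P n. 0 \<le> U n z \<and> U n z \<le> 1"
    and L: "\<And>s. 0 < s \<Longrightarrow> (\<lambda>n. \<integral>z. U n z powr s \<partial>P n) \<longlonglongrightarrow> L s" and L0: "(L \<longlongrightarrow> 1) (at_right 0)"
  shows "\<exists>\<rho>. nonneg_law \<rho> \<and> (\<forall>s>0. laplace_transform \<rho> s = L s)"
proof -
  define \<mu> where "\<mu> n = distr (P n) borel (U n)" for n
  have rd: "real_distribution (\<mu> n)" for n
    unfolding \<mu>_def by (rule prob_space.real_distribution_distr[OF P U(1)])
  have ae: "AE u in \<mu> n. 0 \<le> u \<and> u \<le> 1" for n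
    unfolding \<mu>_def using U by (subst AE_distr_iff) auto
  have "tight \<mu>"
    unfolding tight_def
  proof (intro conjI allI impI)
    fix e :: real assume e: "0 < e"
    have "measure (\<mu> n) {-1<..1} = 1" for n
    proof -
      interpret real_distribution "\<mu> n" by (rule rd)
      have "AE u in \<mu> n. u \<in> {-1<..1}" using ae[of n] by eventually_elim auto
      then show ?thesis by (subst prob_eq_1) auto
    qed
    then show "\<exists>a b. a < b \<and> (\<forall>n. 1 - e < measure (\<mu> n) {a<..b})"
      using e by (intro exI[of _ "-1"] exI[of _ 1]) auto
  qed (rule rd)
  from tight_imp_convergent_subsubsequence[OF this, of id]
  obtain r \<kappa> where r: "strict_mono (r :: nat \<Rightarrow> nat)" and \<kappa>: "real_distribution \<kappa>" and conv: "weak_conv_m (\<mu> \<circ> id \<circ> r) \<kappa>"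
    by (auto simp: strict_mono_def)
  interpret \<kappa>: real_distribution \<kappa> by (rule \<kappa>)
  \<comment> \<open>Extends powers on the unit interval to bounded continuous functions on the
    line.\<close>
  define clip where "clip u = max 0 (min 1 u)" for u :: real
  have clip: "0 \<le> clip u" "clip u \<le> 1" for u by (auto simp: clip_def)
  have mom: "(\<integral>u. clip u powr s \<partial>\<kappa>) = L s" if s: "0 < s" for s
  proof -
    have "(\<lambda>n. \<integral>u. clip u powr s \<partial>(\<mu> \<circ> id \<circ> r) n) \<longlonglongrightarrow> (\<integral>u. clip u powr s \<partial>\<kappa>)"
    proof (rule weak_conv_imp_integral_bdd_continuous_conv[OF _ \<kappa> conv])
      show "isCont (\<lambda>u. clip u powr s) u" for u
        unfolding isCont_def clip_def using s by (intro tendsto_powr2 tendsto_const tendsto_max tendsto_min tendsto_ident_at) auto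
      show "norm (clip u powr s) \<le> 1" for u using clip[of u] s by (simp add: powr_le_one_le powr_mono2[of s "clip u" 1, simplified])
    qed (simp add: rd)
    moreover have "(\<integral>u. clip u powr s \<partial>\<mu> n) = (\<integral>z. U n z powr s \<partial>P n)" for n
    proof -
      have "(\<integral>u. clip u powr s \<partial>\<mu> n) = (\<integral>z. clip (U n z) powr s \<partial>P n)"
        unfolding \<mu>_def clip_def by (rule integral_distr[OF U(1)]) measurable
      also have "\<dots> = (\<integral>z. U n z powr s \<partial>P n)"
      proof (rule integral_cong_AE)
        show "AE z in P n. clip (U n z) powr s = U n z powr s"
          using U(2)[of n] by eventually_elim (simp add: clip_def)
      qed (use U(1)[of n] in \<open>simp_all add: clip_def\<close>)
      finally show ?thesis .
    qed
    ultimately have "(\<lambda>n. \<integral>z. U (r n) z powr s \<partial>P (r n)) \<longlonglongrightarrow> (\<integral>u. clip u powr s \<partial>\<kappa>)" by simp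
    moreover have "(\<lambda>n. \<integral>z. U (r n) z powr s \<partial>P (r n)) \<longlonglongrightarrow> L s"
      using LIMSEQ_subseq_LIMSEQ[OF L[OF s] r] by (simp add: o_def)
    ultimately show ?thesis by (rule LIMSEQ_unique)
  qed
  have pos: "AE u in \<kappa>. 0 < u"
  proof -
    \<comment> \<open>Powers with exponent tending to 0 converge to the indicator of the positive
      numbers, so the limit of \<open>L\<close> at 0 is the mass there.\<close>
    have "(\<lambda>n. \<integral>u. clip u powr (1 / real (Suc n)) \<partial>\<kappa>) \<longlonglongrightarrow> (\<integral>u. indicator {0<..} u \<partial>\<kappa>)"
    proof (rule integral_dominated_convergence[where w = "\<lambda>_. 1"])
      show "AE u in \<kappa>. (\<lambda>n. clip u powr (1 / real (Suc n))) \<longlonglongrightarrow> indicator {0<..} u"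
      proof (rule AE_I2)
        fix u :: real
        show "(\<lambda>n. clip u powr (1 / real (Suc n))) \<longlonglongrightarrow> indicator {0<..} u"
        proof (cases "0 < u")
          case True
          have "(\<lambda>n. clip u powr (1 / real (Suc n))) \<longlonglongrightarrow> clip u powr 0"
            using True LIMSEQ_inverse_real_of_nat
            by (intro tendsto_powr tendsto_const) (auto simp: clip_def inverse_eq_divide)
          moreover have "clip u > 0" using True by (simp add: clip_def)
          ultimately show ?thesis using True by simp
        next
          case False
          then show ?thesis by (simp add: clip_def)
        qed
      qed
      show "AE u in \<kappa>. norm (clip u powr (1 / real (Suc n))) \<le> 1" for n
        using clip by (intro AE_I2) (simp add: powr_mono2[of "1 / real (Suc n)" _ 1, simplified])
    qed (simp_all add: clip_def)
    moreover have "filterlim (\<lambda>n. 1 / real (Suc n)) (at_right 0) sequentially"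
      using LIMSEQ_inverse_real_of_nat by (auto simp: filterlim_at inverse_eq_divide)
    from filterlim_compose[OF L0 this]
    have "(\<lambda>n. \<integral>u. clip u powr (1 / real (Suc n)) \<partial>\<kappa>) \<longlonglongrightarrow> 1" by (simp add: mom)
    ultimately have "(\<integral>u. indicator {0<..} u \<partial>\<kappa>) = (1 :: real)" by (rule LIMSEQ_unique)
    then have "measure \<kappa> {0<..} = 1" by simp
    then show ?thesis by (subst (asm) \<kappa>.prob_eq_1) auto
  qed
  define \<rho> where "\<rho> = distr \<kappa> borel (\<lambda>u. max 0 (- ln u))"
  have "nonneg_law \<rho>"
    unfolding nonneg_law_def \<rho>_def
  proof
    show "real_distribution (distr \<kappa> borel (\<lambda>u. max 0 (- ln u)))"
      by (rule \<kappa>.real_distribution_distr) measurable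
    show "AE w in distr \<kappa> borel (\<lambda>u. max 0 (- ln u)). 0 \<le> w"
      by (subst AE_distr_iff) auto
  qed
  moreover have "laplace_transform \<rho> s = L s" if s: "0 < s" for s
  proof -
    have "laplace_transform \<rho> s = (\<integral>u. exp (- (s * max 0 (- ln u))) \<partial>\<kappa>)"
      unfolding laplace_transform_def \<rho>_def by (rule integral_distr) measurable
    also have "\<dots> = (\<integral>u. clip u powr s \<partial>\<kappa>)"
    proof (rule integral_cong_AE)
      show "AE u in \<kappa>. exp (- (s * max 0 (- ln u))) = clip u powr s"
        using pos
      proof eventually_elim
        case (elim u)
        have "max 0 (- ln u) = - ln (clip u)" using elim by (auto simp: clip_def max_def min_def)
        then show ?case using elim by (simp add: powr_def clip_def)
      qed
    qed (simp_all add: clip_def)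
    finally show ?thesis using mom[OF s] by simp
  qed
  ultimately show ?thesis by blast
qed

lemma laplace_transform_bounds:
  assumes "nonneg_law \<nu>" "0 \<le> s"
  shows "0 < laplace_transform \<nu> s" "laplace_transform \<nu> s \<le> 1"
proof -
  interpret real_distribution \<nu> using assms by (intro nonneg_lawD)
  note int = laplace_integrable[OF assms]
  have "(\<integral>w. exp (- (s * w)) \<partial>\<nu>) \<le> (\<integral>w. 1 \<partial>\<nu>)"
    using int nonneg_lawD(2)[OF assms(1)] assms(2) by (intro integral_mono_AE) (auto elim!: eventually_mono)
  then show "laplace_transform \<nu> s \<le> 1" unfolding laplace_transform_def using prob_space by simp
  have "(\<integral>w. exp (- (s * w)) \<partial>\<nu>) \<noteq> 0"
    using int by (subst integral_nonneg_eq_0_iff_AE) auto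
  then show "0 < laplace_transform \<nu> s" unfolding laplace_transform_def by (simp add: less_le)
qed

lemma laplace_transform_at_0:
  assumes "nonneg_law \<nu>"
  shows "(laplace_transform \<nu> \<longlongrightarrow> 1) (at_right 0)"
proof (rule tendsto_at_right_sequentially[of 0 1])
  show "(0::real) < 1" by simp
  fix S :: "nat \<Rightarrow> real" assume S: "\<And>n. 0 < S n" "\<And>n. S n < 1" "decseq S" "S \<longlonglongrightarrow> 0"
  interpret real_distribution \<nu> using assms by (intro nonneg_lawD)
  have "(\<lambda>n. \<integral>w. exp (- (S n * max 0 w)) \<partial>\<nu>) \<longlonglongrightarrow> (\<integral>w. 1 \<partial>\<nu>)"
  proof (rule integral_dominated_convergence[where w = "\<lambda>_. 1"])
    show "AE w in \<nu>. (\<lambda>n. exp (- (S n * max 0 w))) \<longlonglongrightarrow> 1"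
    proof (rule AE_I2)
      fix w
      have "(\<lambda>n. exp (- (S n * max 0 w))) \<longlonglongrightarrow> exp (- (0 * max 0 w))"
        using S(4) by (intro tendsto_intros)
      then show "(\<lambda>n. exp (- (S n * max 0 w))) \<longlonglongrightarrow> 1" by simp
    qed
    show "AE w in \<nu>. norm (exp (- (S n * max 0 w))) \<le> 1" for n
      using S(1)[of n] by (intro AE_I2) simp
  qed simp_all
  then show "(\<lambda>n. laplace_transform \<nu> (S n)) \<longlonglongrightarrow> 1"
    using prob_space by (simp add: laplace_transform_max[OF assms])
qed

section \<open>Moments of renewal and hitting processes\<close>

text \<open>Suffix sums of the exponents. The \<open>i\<close>-th gap occurs in all arrivals from
  the \<open>i\<close>-th on, so its total exponent in a monomial of arrivals is the sum of the
  remaining exponents.\<close>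

fun tails :: "nat list \<Rightarrow> nat list" where
  "tails [] = []"
| "tails (e # es) = (e + sum_list es) # tails es"

lemma length_tails [simp]: "length (tails es) = length es"
  by (induction es) auto

lemma tails_pos: "es = [] \<or> last es \<noteq> 0 \<Longrightarrow> \<forall>t\<in>set (tails es). 0 < t"
proof (induction es)
  case (Cons e es)
  show ?case
  proof (cases "es = []")
    case False
    then have "\<exists>x\<in>set es. x \<noteq> 0" using Cons.prems last_in_set by auto
    then have "0 < e + sum_list es" by (auto simp: sum_list_eq_0_iff simp flip: neq0_conv)
    then show ?thesis using Cons False by auto
  qed (use Cons in auto)
qed simp

text \<open>Trailing zero exponents are removed so that every suffix sum is positive; a rate 0 would
  lie outside the range of the asymptotic results.\<close>

lemma monomial_strip:
  obtains fs where "fs = [] \<or> last fs \<noteq> 0" "\<And>p. monomial es p = monomial fs p"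
proof -
  have snoc: "monomial (es @ [0]) p = monomial es p" for es p
    by (induction es arbitrary: p) auto
  have "\<exists>fs. (fs = [] \<or> last fs \<noteq> 0) \<and> (\<forall>p. monomial es p = monomial fs p)"
  proof (induction es rule: rev_induct)
    case (snoc e es)
    show ?case
    proof (cases "e = 0")
      case True
      then show ?thesis using snoc \<open>\<And>p es. monomial (es @ [0]) p = monomial es p\<close> by simp
    next
      case False
      then show ?thesis by (intro exI[of _ "es @ [e]"]) simp
    qed
  qed (intro exI[of _ "[]"], simp)
  then show thesis using that by blast
qed

lemma monomial_scale: "monomial es (\<lambda>k. d * p k) = d ^ sum_list es * monomial es p"
  by (induction es arbitrary: p) (simp_all add: power_mult_distrib power_add)

abbreviation arrival_code :: "(nat \<Rightarrow> real) \<Rightarrow> nat \<Rightarrow> real" where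
  "arrival_code w k \<equiv> exp (- (\<Sum>i\<le>k. w i))"

lemma monomial_exp_sums:
  "monomial es (arrival_code w) = (\<Prod>i<length es. exp (- (real (tails es ! i) * w i)))"
proof (induction es arbitrary: w)
  case (Cons e es)
  have "exp (- (\<Sum>i\<le>Suc k. w i)) = exp (- w 0) * exp (- (\<Sum>i\<le>k. w (Suc i)))" for k
    unfolding sum.atMost_Suc_shift by (simp add: exp_add[symmetric])
  then have "monomial (e # es) (arrival_code w) =
      exp (- w 0) ^ (e + sum_list es) * (\<Prod>i<length es. exp (- (real (tails es ! i) * w (Suc i))))"
    using Cons.IH[of "\<lambda>i. w (Suc i)"] by (simp add: monomial_scale power_add)
  also have "exp (- w 0) ^ (e + sum_list es) = exp (- (real (e + sum_list es) * w 0))"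
    by (simp only: exp_of_nat_mult[symmetric] mult_minus_right)
  finally show ?case unfolding length_Cons prod.lessThan_Suc_shift by (simp only: tails.simps nth_Cons_0 nth_Cons_Suc)
qed simp

lemma PiM_integral_prod:
  fixes f :: "nat \<Rightarrow> real \<Rightarrow> real"
  assumes law: "\<And>i. nonneg_law (law i)" and f: "\<And>i. integrable (law i) (f i)"
  shows "(\<integral>w. (\<Prod>i<n. f i (w i)) \<partial>PiM UNIV law) = (\<Prod>i<n. integral\<^sup>L (law i) (f i))"
proof -
  have prob: "prob_space (law i)" for i
    using nonneg_lawD(1)[OF law] by (simp add: real_distribution_def)
  interpret product_prob_space law UNIV
    by (simp add: product_prob_space_def product_prob_space_axioms_def product_sigma_finite_def prob prob_space_imp_sigma_finite)
  have [measurable]: "f i \<in> borel_measurable (law i)" for i using f by auto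
  have "(\<integral>w. (\<Prod>i<n. f i (w i)) \<partial>PiM {..<n} law)
      = (\<integral>w. (\<Prod>i<n. f i (w i)) \<partial>distr (PiM UNIV law) (PiM {..<n} law) (\<lambda>x. restrict x {..<n}))"
    by (subst distr_PiM_restrict_finite) auto
  also have "\<dots> = (\<integral>w. (\<Prod>i<n. f i (w i)) \<partial>PiM UNIV law)"
    by (subst integral_distr) auto
  finally show ?thesis
    by (simp add: product_integral_prod[OF _ f])
qed

lemma renewal_moments:
  assumes law: "\<And>i. nonneg_law (law i)"
  shows "(\<integral>w. monomial es (arrival_code w) \<partial>PiM UNIV law)
    = (\<Prod>i<length es. laplace_transform (law i) (real (tails es ! i)))"
  unfolding monomial_exp_sums laplace_transform_def
  by (rule PiM_integral_prod[OF law laplace_integrable[OF law]]) simp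

text \<open>The mean arrival code decays like \<open>c ^ k\<close>, so almost surely the arrivals
  tend to infinity. The law of the first waiting time may be exceptional, hence the restriction to
  \<open>1 \<le> i\<close>.\<close>

lemma renewal_coded:
  assumes law: "\<And>i. nonneg_law (law i)"
    and c: "\<And>i. 1 \<le> i \<Longrightarrow> laplace_transform (law i) 1 \<le> c" "c < 1"
  shows "coded_process (PiM UNIV law) arrival_code renewal_process"
proof (rule coded_process.intro)
  have rd: "real_distribution (law i)" for i by (rule nonneg_lawD(1)[OF law])
  have prob: "prob_space (law i)" and sets_law [measurable_cong]: "sets (law i) = sets borel" for i
    using rd[of i] by (simp_all add: real_distribution_def real_distribution_axioms_def)
  show "prob_space (PiM UNIV law)" by (rule prob_space_PiM[OF prob])
  interpret prob_space "PiM UNIV law" by fact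
  have X [measurable]: "(\<lambda>w. arrival_code w k) \<in> borel_measurable (PiM UNIV law)" for k :: nat
    by measurable
  show "arrival_code \<in> borel_measurable (PiM UNIV law)"
    by (rule measurable_coordinatewise_then_product) (rule X)
  show "AE w in PiM UNIV law. renewal_process w = decode (arrival_code w)"
    by (intro AE_I2) (simp add: renewal_process_def decode_def)
  have "AE w in PiM UNIV law. \<forall>i. 0 \<le> w i"
    unfolding AE_all_countable using prob nonneg_lawD(2)[OF law] by (intro allI AE_PiM_component) auto
  moreover have "AE w in PiM UNIV law. arrival_code w \<longlonglongrightarrow> 0"
  proof -
    \<comment> \<open>The codes decrease, so their limit is their infimum; it is shown to have mean
      0.\<close>
    define g where "g w = (INF k. ennreal (arrival_code w k))" for w :: "nat \<Rightarrow> real"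
    have [measurable]: "g \<in> borel_measurable (PiM UNIV law)" unfolding g_def by measurable
    have up: "(\<integral>\<^sup>+w. g w \<partial>PiM UNIV law) \<le> ennreal (c ^ k)" for k
    proof -
      have "(\<integral>\<^sup>+w. g w \<partial>PiM UNIV law) \<le> (\<integral>\<^sup>+w. ennreal (arrival_code w k) \<partial>PiM UNIV law)"
        unfolding g_def by (intro nn_integral_mono INF_lower) simp
      also have "\<dots> = ennreal (\<integral>w. arrival_code w k \<partial>PiM UNIV law)"
      proof (rule nn_integral_eq_integral)
        show "integrable (PiM UNIV law) (\<lambda>w. arrival_code w k)"
          using \<open>AE w in PiM UNIV law. \<forall>i. 0 \<le> w i\<close>
          by (intro integrable_const_bound[of _ 1]) (auto elim!: eventually_mono intro!: sum_nonneg)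
      qed simp
      also have "(\<integral>w. arrival_code w k \<partial>PiM UNIV law) = (\<integral>w. (\<Prod>i<Suc k. exp (- (1 * w i))) \<partial>PiM UNIV law)"
        by (simp only: exp_sum sum_negf[symmetric] finite_atMost lessThan_Suc_atMost mult_1)
      also have "\<dots> = (\<Prod>i<Suc k. laplace_transform (law i) 1)"
        unfolding laplace_transform_def by (rule PiM_integral_prod[OF law laplace_integrable[OF law]]) simp
      also have "\<dots> \<le> 1 * c ^ k"
        unfolding prod.lessThan_Suc_shift
      proof (rule mult_mono)
        have "(\<Prod>i<k. laplace_transform (law (Suc i)) 1) \<le> (\<Prod>i<k. c)"
          using c laplace_transform_bounds(1)[OF law, of 1] by (intro prod_mono) (auto intro: less_imp_le)
        then show "(\<Prod>i<k. laplace_transform (law (Suc i)) 1) \<le> c ^ k" by simp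
      qed (use laplace_transform_bounds[OF law, of 1] in \<open>auto intro!: prod_pos less_imp_le\<close>)
      finally show ?thesis by (simp add: ennreal_leI)
    qed
    have "0 < c" using c(1)[of 1] laplace_transform_bounds(1)[OF law, of 1 1] by simp
    then have "(\<lambda>k. ennreal (c ^ k)) \<longlonglongrightarrow> ennreal 0"
      using c(2) by (intro tendsto_ennrealI LIMSEQ_realpow_zero) auto
    then have "(\<integral>\<^sup>+w. g w \<partial>PiM UNIV law) \<le> ennreal 0"
      by (rule LIMSEQ_le_const) (use up in auto)
    then have "AE w in PiM UNIV law. g w = 0" by (subst (asm) ennreal_0) (simp add: nn_integral_0_iff_AE)
    with \<open>AE w in PiM UNIV law. \<forall>i. 0 \<le> w i\<close> show ?thesis
    proof eventually_elim
      case (elim w)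
      have "decseq (\<lambda>k. ennreal (arrival_code w k))"
        using elim(1) by (intro decseq_SucI ennreal_leI) simp
      from LIMSEQ_INF[OF this] have "(\<lambda>k. ennreal (arrival_code w k)) \<longlonglongrightarrow> ennreal 0"
        using elim(2) by (simp add: g_def)
      then show ?case by (subst (asm) tendsto_ennreal_iff) auto
    qed
  qed
  ultimately show "AE w in PiM UNIV law. arrival_code w \<in> codes"
  proof eventually_elim
    case (elim w)
    have "decseq (arrival_code w)" using elim(1) by (intro decseq_SucI) simp
    with elim show ?case by (auto simp: codes_def cube_def intro!: sum_nonneg)
  qed
qed

section \<open>Codes of hitting times\<close>

definition hit_code :: "real \<Rightarrow> 'v seq set \<Rightarrow> 'v seq \<Rightarrow> nat \<Rightarrow> real" where
  "hit_code c B z k = (case hit_time B (Suc k) z of enat t \<Rightarrow> c ^ t | \<infinity> \<Rightarrow> 0)"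

lemma hit_time_lower: "enat k \<le> hit_time B k z"
proof (induction k)
  case (Suc k)
  have "enat (Suc k) \<le> enat n" if "hit_time B k z < enat n" for n
    using Suc that by (cases "hit_time B k z") auto
  then show ?case by (auto intro!: Inf_greatest)
qed (simp add: zero_enat_def)

lemma hit_time_mono: "hit_time B k z \<le> hit_time B (Suc k) z"
  unfolding hit_time.simps by (rule Inf_greatest) (auto intro: less_imp_le)

lemma Inf_enat_eq_iff: "Inf (enat ` S) = enat t \<longleftrightarrow> t \<in> S \<and> (\<forall>s<t. s \<notin> S)"
proof
  assume eq: "Inf (enat ` S) = enat t"
  have "S \<noteq> {}"
  proof
    assume "S = {}"
    then show False using eq by (simp add: top_enat_def)
  qed
  then obtain e where "e \<in> enat ` S" by blast
  then have "Inf (enat ` S) \<in> enat ` S"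
    unfolding Inf_enat_def using LeastI[of "\<lambda>e. e \<in> enat ` S" e] by (cases "enat ` S = {}") (simp_all only: if_False, simp)
  then have "t \<in> S" using eq by auto
  moreover have "t \<le> s" if "s \<in> S" for s
  proof -
    have "enat t \<le> enat s" unfolding eq[symmetric] by (intro Inf_lower imageI that)
    then show ?thesis by simp
  qed
  ultimately show "t \<in> S \<and> (\<forall>s<t. s \<notin> S)" by (auto simp: not_less[symmetric])
next
  assume t: "t \<in> S \<and> (\<forall>s<t. s \<notin> S)"
  show "Inf (enat ` S) = enat t"
  proof (rule antisym)
    show "Inf (enat ` S) \<le> enat t" using t by (intro Inf_lower imageI) simp
    show "enat t \<le> Inf (enat ` S)"
    proof (rule Inf_greatest)
      fix e assume "e \<in> enat ` S"
      then obtain s where "e = enat s" "s \<in> S" by (rule imageE)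
      then show "enat t \<le> e" using t by (cases "s < t") auto
    qed
  qed
qed

lemma hit_time_Suc_eq:
  "hit_time B (Suc k) z = enat t \<longleftrightarrow>
    (\<exists>s<t. hit_time B k z = enat s \<and> shift_by t z \<in> B \<and> (\<forall>i. s < i \<and> i < t \<longrightarrow> shift_by i z \<notin> B))"
  by (cases "hit_time B k z") (auto simp: Inf_enat_eq_iff funpow_left_shift top_enat_def)

lemma hit_time_1_eq: "hit_time B (Suc 0) z = enat t \<longleftrightarrow> 0 < t \<and> shift_by t z \<in> B \<and> (\<forall>i. 0 < i \<and> i < t \<longrightarrow> shift_by i z \<notin> B)"
  unfolding hit_time_Suc_eq by (auto simp: zero_enat_def)

text \<open>The definition recurses at the last hit; products of gaps need recursion at the first
  one.\<close>

lemma hit_time_shift: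
  assumes "hit_time B (Suc 0) z = enat r"
  shows "hit_time B (Suc k) z = enat r + hit_time B k (shift_by r z)"
proof (induction k)
  case 0
  then show ?case using assms by simp
next
  case (Suc k)
  show ?case
  proof (cases "hit_time B (Suc (Suc k)) z")
    case (enat t)
    then obtain s where s: "s < t" "hit_time B (Suc k) z = enat s" "shift_by t z \<in> B" "\<And>i. s < i \<Longrightarrow> i < t \<Longrightarrow> shift_by i z \<notin> B"
      unfolding hit_time_Suc_eq[of B "Suc k"] by blast
    then obtain s' where s': "hit_time B k (shift_by r z) = enat s'" "s = r + s'"
      using Suc.IH by (cases "hit_time B k (shift_by r z)") auto
    have "hit_time B (Suc k) (shift_by r z) = enat (t - r)"
      unfolding hit_time_Suc_eq[of B k]
    proof (intro exI[of _ s'] conjI allI impI)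
      show "shift_by (t - r) (shift_by r z) \<in> B" using s s' by simp
      show "shift_by i (shift_by r z) \<notin> B" if "s' < i \<and> i < t - r" for i using s(4)[of "i + r"] s' that by (simp add: less_diff_conv)
    qed (use s s' in auto)
    then show ?thesis using enat s s' by simp
  next
    case infinity
    have "hit_time B (Suc k) (shift_by r z) \<noteq> enat t" for t
    proof
      assume "hit_time B (Suc k) (shift_by r z) = enat t"
      then obtain s where s: "s < t" "hit_time B k (shift_by r z) = enat s" "shift_by t (shift_by r z) \<in> B"
          "\<And>i. s < i \<Longrightarrow> i < t \<Longrightarrow> shift_by i (shift_by r z) \<notin> B"
        unfolding hit_time_Suc_eq[of B k] by blast
      have "hit_time B (Suc (Suc k)) z = enat (t + r)"
        unfolding hit_time_Suc_eq[of B "Suc k"]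
      proof (intro exI[of _ "r + s"] conjI allI impI)
        show "shift_by i z \<notin> B" if "r + s < i \<and> i < t + r" for i
        proof -
          have "s < i - r" "i - r < t" using that by linarith+
          then show ?thesis using s(4)[of "i - r"] that by simp
        qed
      qed (use s Suc.IH in auto)
      then show False using infinity by simp
    qed
    then have "hit_time B (Suc k) (shift_by r z) = \<infinity>" by (cases "hit_time B (Suc k) (shift_by r z)") auto
    then show ?thesis using infinity by (simp del: hit_time.simps)
  qed
qed

lemma hit_time_infinity: "hit_time B (Suc 0) z = \<infinity> \<Longrightarrow> hit_time B (Suc k) z = \<infinity>"
proof (induction k)
  case (Suc k)
  then show ?case using hit_time_mono[of B "Suc k" z] by (simp del: hit_time.simps)
qed

lemma hit_code_codes:
  assumes "0 < c" "c < 1"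
  shows "hit_code c B z \<in> codes"
proof -
  have bd: "0 \<le> hit_code c B z k \<and> hit_code c B z k \<le> c ^ Suc k" for k
    using hit_time_lower[of "Suc k" B z] assms
    by (cases "hit_time B (Suc k) z") (auto simp: hit_code_def simp del: hit_time.simps power_Suc intro!: power_decreasing)
  have "hit_code c B z (Suc k) \<le> hit_code c B z k" for k
    using hit_time_mono[of B "Suc k" z] assms
    by (cases "hit_time B (Suc k) z"; cases "hit_time B (Suc (Suc k)) z")
      (auto simp: hit_code_def simp del: hit_time.simps intro!: power_decreasing)
  then have dec: "decseq (hit_code c B z)" by (rule decseq_SucI)
  have pow: "(\<lambda>k. c ^ Suc k) \<longlonglongrightarrow> 0"
    using assms by (intro LIMSEQ_Suc LIMSEQ_realpow_zero) auto
  have "hit_code c B z \<longlonglongrightarrow> 0"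
    by (rule tendsto_sandwich[OF _ _ tendsto_const pow]) (use bd in auto)
  moreover have "c ^ Suc k \<le> 1" for k using assms by (intro power_le_one) auto
  then have "hit_code c B z k \<le> 1" for k using bd[of k] order_trans by blast
  ultimately show ?thesis using dec bd by (auto simp: codes_def cube_def)
qed

lemma hit_time_measurable:
  assumes B: "\<And>k. shift_by k -` B \<inter> space P \<in> sets P"
  shows "(\<lambda>z. hit_time B (Suc k) z) \<in> measurable P (count_space UNIV)"
proof -
  have *: "{z \<in> space P. hit_time B k z = enat t} \<in> sets P" for k t
  proof (induction k arbitrary: t)
    case (Suc k)
    have [measurable]: "{z \<in> space P. hit_time B k z = enat s} \<in> sets P" for s by (rule Suc)
    have [measurable]: "Measurable.pred P (\<lambda>z. shift_by i z \<in> B)" for i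
      using B[of i] by (simp add: pred_def vimage_def Int_def conj_commute)
    show ?case unfolding hit_time_Suc_eq by measurable
  qed (auto simp: zero_enat_def)
  show ?thesis
  proof (subst measurable_count_space_eq2_countable, intro conjI ballI)
    fix e :: enat
    show "(\<lambda>z. hit_time B (Suc k) z) -` {e} \<inter> space P \<in> sets P"
    proof (cases e)
      case (enat t)
      then show ?thesis using *[of "Suc k" t] by (simp add: vimage_def Int_def conj_commute del: hit_time.simps)
    next
      case infinity
      have "(\<lambda>z. hit_time B (Suc k) z) -` {e} \<inter> space P = space P - (\<Union>t. {z \<in> space P. hit_time B (Suc k) z = enat t})"
        unfolding infinity by (auto simp del: hit_time.simps)
      also have "\<dots> \<in> sets P" using * by (intro sets.Diff sets.top sets.countable_UN) blast
      finally show ?thesis .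
    qed
  qed auto
qed

lemma hit_code_measurable:
  assumes B: "\<And>k. shift_by k -` B \<inter> space P \<in> sets P"
  shows "hit_code c B \<in> borel_measurable P"
proof (rule measurable_coordinatewise_then_product)
  fix k
  have "(\<lambda>z. case hit_time B (Suc k) z of enat t \<Rightarrow> c ^ t | \<infinity> \<Rightarrow> 0) \<in> borel_measurable P"
    by (rule measurable_compose[OF hit_time_measurable[OF B]]) simp
  then show "(\<lambda>z. hit_code c B z k) \<in> borel_measurable P" by (simp add: hit_code_def del: hit_time.simps)
qed

lemma hitting_process_decode:
  assumes "0 < scaling a (measure \<mu> B)" "c = exp (- scaling a (measure \<mu> B))"
  shows "hitting_process a \<mu> B z = decode (hit_code c B z)"
proof -
  have "(if 0 < hit_code c B z k then ereal (- ln (hit_code c B z k)) else \<infinity>) =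
      ereal (scaling a (measure \<mu> B)) * ereal_of_enat (hit_time B (Suc k) z)" for k
    using assms(1) by (cases "hit_time B (Suc k) z")
      (auto simp: hit_code_def assms(2) ln_realpow simp del: hit_time.simps)
  then show ?thesis unfolding hitting_process_def decode_def by simp
qed

lemma hitting_coded:
  assumes "prob_space P" "0 < scaling a (measure \<mu> B)" "c = exp (- scaling a (measure \<mu> B))"
    and "\<And>k. shift_by k -` B \<inter> space P \<in> sets P"
  shows "coded_process P (hit_code c B) (hitting_process a \<mu> B)"
proof (rule coded_process.intro)
  show "hit_code c B \<in> borel_measurable P" by (rule hit_code_measurable) fact
  show "AE z in P. hit_code c B z \<in> codes" using assms by (intro AE_I2 hit_code_codes) auto
  show "AE z in P. hitting_process a \<mu> B z = decode (hit_code c B z)"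
    using assms by (intro AE_I2 hitting_process_decode)
qed fact

context regular_measure
begin

text \<open>Restarting at the first hit peels one rate off \<open>tails\<close>. If there is no hit,
  all codes are 0, and the monomial vanishes because the last exponent, and so their sum, is
  positive.\<close>

lemma monomial_hit_code:
  assumes "0 < c" "c < 1" "es = [] \<or> last es \<noteq> 0"
  shows "monomial es (hit_code c (B n) z) = enn2real (Gaps n (map (\<lambda>t. ennreal (c ^ t)) (tails es)) z)"
  using assms(3)
proof (induction es arbitrary: z)
  case (Cons e es)
  let ?t = "e + sum_list es"
  show ?case
  proof (cases "hit_time (B n) (Suc 0) z")
    case (enat r)
    then have r: "0 < r" "shift_by r z \<in> B n" "\<And>i. 0 < i \<Longrightarrow> i < r \<Longrightarrow> shift_by i z \<notin> B n"
      unfolding hit_time_1_eq by blast+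
    have fh: "shift_by 1 z \<in> first_hit n (r - 1)"
      unfolding first_hit_def
    proof (intro CollectI conjI allI impI)
      show "shift_by (r - 1) (shift_by 1 z) \<in> B n" using r by simp
      show "shift_by k (shift_by 1 z) \<notin> B n" if "k < r - 1" for k using r(3)[of "k + 1"] that by simp
    qed
    have code: "hit_code c (B n) z 0 = c ^ r" "hit_code c (B n) z (Suc k) = c ^ r * hit_code c (B n) (shift_by r z) k" for k
      using hit_time_shift[OF enat, of "Suc k"] enat
      by (auto simp: hit_code_def power_add simp del: hit_time.simps split: enat.split)
    have IH: "monomial es (hit_code c (B n) (shift_by r z)) = enn2real (Gaps n (map (\<lambda>t. ennreal (c ^ t)) (tails es)) (shift_by r z))"
      using Cons.prems by (intro Cons.IH) (auto split: if_splits)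
    have "monomial (e # es) (hit_code c (B n) z) = (c ^ r) ^ ?t * monomial es (hit_code c (B n) (shift_by r z))"
      by (simp add: code monomial_scale power_add)
    also have "(c ^ r) ^ ?t = enn2real (ennreal (c ^ ?t) * ennreal (c ^ ?t) ^ (r - 1))"
      using r(1) assms(1) by (cases r) (simp_all add: ennreal_power ennreal_mult[symmetric] power_mult_distrib power_mult[symmetric] mult.commute)
    finally show ?thesis
      unfolding IH using r(1) by (simp add: Pass_eq[OF fh, simplified] enn2real_mult mult_ac)
  next
    case infinity
    have "shift_by k (shift_by 1 z) \<notin> B n" for k
    proof
      assume "shift_by k (shift_by 1 z) \<in> B n"
      then have "Suc k \<in> {i. hit_time (B n) 0 z < enat i \<and> (left_shift ^^ i) z \<in> B n}"
        by (simp add: funpow_left_shift zero_enat_def)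
      then have "Inf (enat ` {i. hit_time (B n) 0 z < enat i \<and> (left_shift ^^ i) z \<in> B n}) \<le> enat (Suc k)"
        by (intro Inf_lower imageI)
      then show False using infinity by simp
    qed
    then have no: "shift_by 1 z \<notin> first_hit n l" for l by (simp add: first_hit_def)
    \<comment> \<open>The factor 0 is exposed so that \<open>monomial_scale\<close> extracts it with
      the positive total exponent.\<close>
    have zero: "hit_code c (B n) z = (\<lambda>_. 0 * 1)"
      using hit_time_infinity[OF infinity] by (simp add: hit_code_def fun_eq_iff del: hit_time.simps)
    have "0 < ?t" using tails_pos[of "e # es"] Cons.prems by simp
    then have "monomial (e # es) (hit_code c (B n) z) = 0"
      unfolding zero monomial_scale by simp
    then show ?thesis using no by (simp add: Pass_eq_0)
  qed
qed simp

end

section \<open>The Ruelle operator and distortion\<close>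

lemma seq_dist_less:
  assumes "0 < \<eta>" "\<eta> < 1" "seq_dist \<eta> x y < \<eta> ^ k" "i \<le> k"
  shows "x i = y i"
proof (rule ccontr)
  assume ne: "x i \<noteq> y i"
  then have "(LEAST n. x n \<noteq> y n) \<le> i" by (rule Least_le)
  then have "\<eta> ^ k \<le> \<eta> ^ (LEAST n. x n \<noteq> y n)" using assms by (intro power_decreasing) auto
  moreover have "x \<noteq> y" using ne by auto
  ultimately show False using assms(3) by (simp add: seq_dist_def)
qed

lemma seq_dist_le:
  assumes "0 < \<eta>" "\<eta> < 1" "y \<in> cyl k x"
  shows "seq_dist \<eta> x y \<le> \<eta> ^ k"
proof (cases "x = y")
  case False
  then obtain n where "x n \<noteq> y n" by auto
  then have "x (LEAST n. x n \<noteq> y n) \<noteq> y (LEAST n. x n \<noteq> y n)" by (rule LeastI)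
  then have "k \<le> (LEAST n. x n \<noteq> y n)" using assms(3) by (force simp: cyl_def not_less[symmetric])
  then show ?thesis using assms False by (auto simp: seq_dist_def intro: power_decreasing)
qed (use assms in \<open>simp add: seq_dist_def\<close>)

lemma openin_shift_topology:
  assumes "0 < \<eta>" "\<eta> < 1"
  shows "openin (shift_topology A \<eta>) U \<longleftrightarrow> U \<subseteq> shift_space A \<and> (\<forall>x\<in>U. \<exists>k. cyl k x \<inter> shift_space A \<subseteq> U)"
proof -
  interpret Metric_space "shift_space A" "seq_dist \<eta>" by (rule Metric_space_seq_dist[OF assms])
  have "(\<exists>r>0. mball x r \<subseteq> U) \<longleftrightarrow> (\<exists>k. cyl k x \<inter> shift_space A \<subseteq> U)" if x: "x \<in> shift_space A" for x
  proof
    assume "\<exists>r>0. mball x r \<subseteq> U"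
    then obtain r where r: "0 < r" "mball x r \<subseteq> U" by blast
    obtain k where k: "\<eta> ^ k < r" using real_arch_pow_inv[OF r(1) assms(2)] by blast
    have "cyl k x \<inter> shift_space A \<subseteq> mball x r"
      using seq_dist_le[OF assms, of _ k x] k x by (auto simp: mball_def intro: le_less_trans)
    then show "\<exists>k. cyl k x \<inter> shift_space A \<subseteq> U" using r(2) by blast
  next
    assume "\<exists>k. cyl k x \<inter> shift_space A \<subseteq> U"
    then obtain k where k: "cyl k x \<inter> shift_space A \<subseteq> U" by blast
    have "mball x (\<eta> ^ k) \<subseteq> cyl k x \<inter> shift_space A"
      using seq_dist_less[OF assms, of x _ k] by (auto simp: mball_def cyl_def)
    then show "\<exists>r>0. mball x r \<subseteq> U" using k assms by (intro exI[of _ "\<eta> ^ k"]) auto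
  qed
  then show ?thesis unfolding shift_topology_def openin_mtopology by blast
qed

lemma shift_space_sets [measurable]: "shift_space (A :: 'v::countable \<Rightarrow> _) \<in> sets seq_algebra"
proof -
  have "{z. A (z n) (z (Suc n))} \<in> sets seq_algebra" for n
    by (rule determined_sets[of "Suc n"]) (simp add: determined_def)
  then have "(\<Inter>n. {z. A (z n) (z (Suc n))}) \<in> sets seq_algebra"
    by (intro sets.countable_INT) auto
  also have "(\<Inter>n. {z. A (z n) (z (Suc n))}) = shift_space A" by (auto simp: shift_space_def)
  finally show ?thesis .
qed

text \<open>Open sets are unions of cylinders, and over a countable alphabet there are only
  countably many cylinders, so the two \<sigma>-algebras coincide.\<close>

lemma sets_shift_borel:
  fixes A :: "'v::countable \<Rightarrow> 'v \<Rightarrow> bool"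
  assumes "0 < \<eta>" "\<eta> < 1"
  shows "sets (shift_borel A \<eta>) = sets (restrict_space seq_algebra (shift_space A))"
proof
  let ?O = "shift_space A"
  have sub: "{U. openin (shift_topology A \<eta>) U} \<subseteq> Pow ?O"
    unfolding openin_shift_topology[OF assms] by auto
  have space: "space (shift_borel A \<eta>) = ?O"
    unfolding shift_borel_def using sub by (rule space_measure_of)
  have basic: "sets (shift_borel A \<eta>) = sigma_sets ?O {U. openin (shift_topology A \<eta>) U}"
    unfolding shift_borel_def using sub by (rule sets_measure_of)
  show "sets (shift_borel A \<eta>) \<subseteq> sets (restrict_space seq_algebra ?O)"
    unfolding basic
  proof (rule sets.sigma_sets_subset', clarify)
    fix U assume U: "openin (shift_topology A \<eta>) U"
    define \<C> where "\<C> = {C. C \<inter> ?O \<subseteq> U \<and> (\<exists>k z. C = cyl k z)}"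
    have "countable \<C>"
    proof -
      have eq: "cyl k z = {y. map y [0..<k] = map z [0..<k]}" for k and z :: "'v seq"
        by (auto simp: cyl_def map_eq_conv)
      have "\<C> \<subseteq> range (\<lambda>(k, w). {y. map y [0..<k] = w})"
      proof
        fix C assume "C \<in> \<C>"
        then obtain k z where "C = cyl k z" unfolding \<C>_def by blast
        then show "C \<in> range (\<lambda>(k, w). {y. map y [0..<k] = w})"
          by (intro image_eqI[of _ _ "(k, map z [0..<k])"]) (simp_all add: eq)
      qed
      then show ?thesis by (rule countable_subset) auto
    qed
    moreover have "\<C> \<subseteq> sets seq_algebra" by (auto simp: \<C>_def)
    ultimately have "\<Union> \<C> \<in> sets seq_algebra" by (intro sets.countable_Union) auto
    moreover have "U = ?O \<inter> \<Union> \<C>"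
    proof
      show "U \<subseteq> ?O \<inter> \<Union> \<C>"
      proof
        fix z assume z: "z \<in> U"
        then obtain k where "cyl k z \<inter> ?O \<subseteq> U" "z \<in> ?O" using U unfolding openin_shift_topology[OF assms] by blast
        then have "cyl k z \<in> \<C>" "z \<in> ?O" unfolding \<C>_def by auto
        moreover have "z \<in> cyl k z" by (simp add: cyl_def)
        ultimately show "z \<in> ?O \<inter> \<Union> \<C>" by blast
      qed
      show "?O \<inter> \<Union> \<C> \<subseteq> U" unfolding \<C>_def by blast
    qed
    ultimately show "U \<in> sets (restrict_space seq_algebra ?O)"
      by (auto simp: sets_restrict_space)
  qed (use sets.top[of "restrict_space seq_algebra ?O"] in \<open>simp add: space_restrict_space space_PiM\<close>)
  show "sets (restrict_space seq_algebra ?O) \<subseteq> sets (shift_borel A \<eta>)"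
  proof -
    have "(\<lambda>z. z) \<in> measurable (shift_borel A \<eta>) seq_algebra"
    proof (rule measurable_PiM_single')
      fix i :: nat
      show "(\<lambda>z. z i) \<in> measurable (shift_borel A \<eta>) (count_space UNIV)"
      proof (subst measurable_count_space_eq2_countable, intro conjI ballI)
        fix v :: 'v
        have "openin (shift_topology A \<eta>) ((\<lambda>z. z i) -` {v} \<inter> ?O)"
          unfolding openin_shift_topology[OF assms]
        proof (intro conjI ballI)
          show "\<exists>k. cyl k z \<inter> ?O \<subseteq> (\<lambda>z. z i) -` {v} \<inter> ?O" if "z \<in> (\<lambda>z. z i) -` {v} \<inter> ?O" for z
            using that by (intro exI[of _ "Suc i"]) (auto simp: cyl_def)
        qed simp
        then show "(\<lambda>z. z i) -` {v} \<inter> space (shift_borel A \<eta>) \<in> sets (shift_borel A \<eta>)"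
          unfolding basic space by (intro sigma_sets.Basic) simp
      qed auto
    qed (auto simp: space)
    then show ?thesis
      unfolding sets_restrict_space by (auto simp: space Int_commute dest: measurable_sets)
  qed
qed

locale ruelle_system =
  fixes A :: "'v::countable \<Rightarrow> 'v \<Rightarrow> bool" and \<eta> :: real and \<phi> h :: "'v seq \<Rightarrow> real"
    and m :: "'v seq measure"
  assumes eta: "0 < \<eta>" "\<eta> < 1" and mixing: "topologically_mixing A"
    and phi: "\<phi> \<in> borel_measurable (shift_borel A \<eta>)" and walters: "walters_condition A \<phi>"
    and eigen: "ruelle_eigendata A \<eta> \<phi> h m"
begin

text \<open>The conformal measure, transported to all sequences so that cylinders and preimages need
  no intersection with the shift space; it remains concentrated there.\<close>

definition M :: "'v seq measure" where "M = distr m seq_algebra (\<lambda>z. z)"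

definition \<Lambda> :: real where "\<Lambda> = pressure_exp A \<phi>"

definition weight :: "'v seq \<Rightarrow> real" where
  "weight z = (if z \<in> shift_space A then exp (\<phi> z) else 0)"

text \<open>The Ruelle operator on all sequences: preimages are formed by prepending any letter, and
  the weight 0 eliminates inadmissible ones.\<close>

definition L :: "('v seq \<Rightarrow> ennreal) \<Rightarrow> 'v seq \<Rightarrow> ennreal" where
  "L f z = (\<integral>\<^sup>+v. ennreal (weight (case_nat v z)) * f (case_nat v z) \<partial>count_space UNIV)"

lemma Lambda_pos: "0 < \<Lambda>" by (simp add: \<Lambda>_def pressure_exp_def)

lemma space_m: "space m = shift_space A"
  and sets_m: "sets m = sets (restrict_space seq_algebra (shift_space A))"
proof -
  have "space m = shift_space A \<and> sets m = sets (shift_borel A \<eta>)"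
    using eigen unfolding ruelle_eigendata_def by (elim conjE) (intro conjI)
  then show "space m = shift_space A" "sets m = sets (restrict_space seq_algebra (shift_space A))"
    by (simp_all add: sets_shift_borel[OF eta])
qed

lemma measurable_m: "measurable m N = measurable (restrict_space seq_algebra (shift_space A)) N"
  by (rule measurable_cong_sets) (simp_all add: sets_m)

lemma id_measurable: "(\<lambda>z. z) \<in> measurable m seq_algebra"
  unfolding measurable_m by (rule measurable_restrict_space1) simp

lemma borel_measurable_extend:
  fixes f :: "'v seq \<Rightarrow> real"
  assumes "f \<in> borel_measurable m"
  shows "(\<lambda>z. if z \<in> shift_space A then f z else 0) \<in> borel_measurable seq_algebra"
proof -
  have "f \<in> borel_measurable (restrict_space seq_algebra (shift_space A))"
    using assms by (simp only: measurable_m)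
  moreover have "{z \<in> space seq_algebra. z \<in> shift_space A} \<in> sets seq_algebra" by simp
  ultimately show ?thesis by (subst measurable_If_restrict_space_iff) simp_all
qed

lemma sets_M [measurable_cong]: "sets M = sets seq_algebra" by (simp add: M_def)

lemma space_M: "space M = UNIV" by (simp add: M_def space_PiM)

lemma M_integral: "f \<in> borel_measurable seq_algebra \<Longrightarrow> (\<integral>\<^sup>+z. f z \<partial>M) = (\<integral>\<^sup>+z. f z \<partial>m)"
  unfolding M_def by (rule nn_integral_distr[OF id_measurable]) simp

lemma M_AE_shift_space: "AE z in M. z \<in> shift_space A"
  unfolding M_def using shift_space_sets[of A]
  by (subst AE_distr_iff[OF id_measurable]) (auto simp: space_PiM space_m)

lemma weight_measurable [measurable]: "weight \<in> borel_measurable seq_algebra"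
proof -
  have "\<phi> \<in> borel_measurable m"
    using phi by (simp add: measurable_def sets_m space_m sets_shift_borel[OF eta]) (simp add: shift_borel_def openin_shift_topology[OF eta] space_measure_of_conv)
  then have "(\<lambda>z. exp (\<phi> z)) \<in> borel_measurable m" by measurable
  from borel_measurable_extend[OF this] show ?thesis by (simp add: weight_def[abs_def])
qed

lemma case_nat_measurable [measurable]: "case_nat v \<in> measurable seq_algebra (seq_algebra :: 'v seq measure)"
proof (rule measurable_PiM_single')
  fix i
  show "(\<lambda>z. case_nat v z i) \<in> measurable seq_algebra (count_space UNIV)"
    by (cases i) auto
qed (simp add: PiE_def extensional_def)

lemma L_measurable [measurable]:
  assumes [measurable]: "f \<in> borel_measurable seq_algebra"
  shows "L f \<in> borel_measurable seq_algebra"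
proof -
  interpret sigma_finite_measure "count_space (UNIV :: 'v set)"
    by (rule sigma_finite_measure_count_space)
  have "(\<lambda>(v, z). ennreal (weight (case_nat v z)) * f (case_nat v z)) \<in> borel_measurable (count_space UNIV \<Otimes>\<^sub>M seq_algebra)"
    by (rule measurable_pair_measure_countable1) auto
  from measurable_compose[OF measurable_pair_swap' this]
  have "(\<lambda>(z, v). ennreal (weight (case_nat v z)) * f (case_nat v z)) \<in> borel_measurable (seq_algebra \<Otimes>\<^sub>M count_space UNIV)"
    by (simp add: case_prod_beta' comp_def)
  then show ?thesis unfolding L_def[abs_def] by (rule borel_measurable_nn_integral)
qed

lemma case_nat_shift_space: "case_nat v z \<in> shift_space A \<longleftrightarrow> A v (z 0) \<and> z \<in> shift_space A"
proof -
  have "(\<forall>n. A (case_nat v z n) (case_nat v z (Suc n))) \<longleftrightarrow> A v (z 0) \<and> (\<forall>n. A (z n) (z (Suc n)))"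
    by (auto split: nat.split)
  then show ?thesis by (simp add: shift_space_def)
qed

lemma ruelle_L:
  assumes z: "z \<in> shift_space A"
  shows "ruelle_operator A \<phi> f z = L f z"
proof -
  have bij: "bij_betw (\<lambda>v. case_nat v z) {v. A v (z 0)} {y \<in> shift_space A. left_shift y = z}"
  proof (rule bij_betwI')
    show "case_nat v z = case_nat w z \<longleftrightarrow> v = w" for v w by (auto dest: fun_cong[of _ _ 0])
    show "case_nat v z \<in> {y \<in> shift_space A. left_shift y = z}" if "v \<in> {v. A v (z 0)}" for v
      using that z by (auto simp: case_nat_shift_space left_shift_def)
    show "\<exists>v\<in>{v. A v (z 0)}. y = case_nat v z" if y: "y \<in> {y \<in> shift_space A. left_shift y = z}" for y
    proof
      show "y = case_nat (y 0) z" using y by (auto simp: left_shift_def split: nat.split)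
      then show "y 0 \<in> {v. A v (z 0)}" using y case_nat_shift_space[of "y 0" z] by auto
    qed
  qed
  have "ruelle_operator A \<phi> f z = (\<integral>\<^sup>+v. ennreal (exp (\<phi> (case_nat v z))) * f (case_nat v z) \<partial>count_space {v. A v (z 0)})"
    unfolding ruelle_operator_def by (rule nn_integral_bij_count_space[OF bij, symmetric])
  also have "\<dots> = (\<integral>\<^sup>+v. (ennreal (exp (\<phi> (case_nat v z))) * f (case_nat v z)) * indicator {v. A v (z 0)} v \<partial>count_space UNIV)"
    by (rule nn_integral_count_space_indicator) simp
  also have "\<dots> = L f z"
    unfolding L_def using z
    by (intro nn_integral_cong) (auto simp: weight_def case_nat_shift_space split: split_indicator)
  finally show ?thesis .
qed

lemma L_integral:
  assumes [measurable]: "f \<in> borel_measurable seq_algebra"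
  shows "(\<integral>\<^sup>+z. L f z \<partial>M) = ennreal \<Lambda> * (\<integral>\<^sup>+z. f z \<partial>M)"
proof -
  have f: "f \<in> borel_measurable m" by (rule measurable_compose[OF id_measurable assms])
  have eq: "\<forall>f\<in>borel_measurable m. (\<integral>\<^sup>+z. ruelle_operator A \<phi> f z \<partial>m) = ennreal \<Lambda> * (\<integral>\<^sup>+z. f z \<partial>m)"
    using eigen unfolding ruelle_eigendata_def \<Lambda>_def by (elim conjE)
  have "(\<integral>\<^sup>+z. L f z \<partial>M) = (\<integral>\<^sup>+z. L f z \<partial>m)" by (rule M_integral) measurable
  also have "\<dots> = (\<integral>\<^sup>+z. ruelle_operator A \<phi> f z \<partial>m)"
    by (intro nn_integral_cong) (simp add: ruelle_L space_m)
  also have "\<dots> = ennreal \<Lambda> * (\<integral>\<^sup>+z. f z \<partial>m)"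
    using eq f by (rule bspec)
  also have "(\<integral>\<^sup>+z. f z \<partial>m) = (\<integral>\<^sup>+z. f z \<partial>M)" by (rule M_integral[symmetric]) measurable
  finally show ?thesis .
qed

lemma L_comp_shift: "L (\<lambda>z. f z * g (shift_by 1 z)) z = L f z * g z"
proof -
  have "shift_by 1 (case_nat v z) = z" for v by (simp add: shift_by_def)
  then have "L (\<lambda>z. f z * g (shift_by 1 z)) z = (\<integral>\<^sup>+v. (ennreal (weight (case_nat v z)) * f (case_nat v z)) * g z \<partial>count_space UNIV)"
    unfolding L_def by (simp add: mult.assoc)
  also have "\<dots> = L f z * g z" unfolding L_def by (rule nn_integral_multc) simp
  finally show ?thesis .
qed

lemma Lpow_measurable [measurable]:
  assumes f: "f \<in> borel_measurable seq_algebra"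
  shows "(L ^^ N) f \<in> borel_measurable seq_algebra"
proof (induction N)
  case (Suc N)
  from L_measurable[OF this] show ?case by simp
qed (simp add: f)

lemma Lpow_integral:
  assumes "f \<in> borel_measurable seq_algebra"
  shows "(\<integral>\<^sup>+z. (L ^^ N) f z \<partial>M) = ennreal (\<Lambda> ^ N) * (\<integral>\<^sup>+z. f z \<partial>M)"
proof (induction N)
  case (Suc N)
  have "(\<integral>\<^sup>+z. (L ^^ Suc N) f z \<partial>M) = ennreal \<Lambda> * (\<integral>\<^sup>+z. (L ^^ N) f z \<partial>M)"
    using L_integral[OF Lpow_measurable[OF assms, of N]] by simp
  then show ?case unfolding Suc using Lambda_pos by (simp add: ennreal_mult mult.assoc)
qed simp

lemma Lpow_comp_shift: "(L ^^ N) (\<lambda>z. f z * g (shift_by N z)) z = (L ^^ N) f z * g z"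
proof (induction N arbitrary: f z)
  case (Suc N)
  have "L (\<lambda>z. f z * g (shift_by (Suc N) z)) = (\<lambda>z. L f z * g (shift_by N z))"
  proof
    fix z
    show "L (\<lambda>z. f z * g (shift_by (Suc N) z)) z = L f z * g (shift_by N z)"
      using L_comp_shift[of f "\<lambda>z. g (shift_by N z)" z] by simp
  qed
  then show ?case by (simp add: funpow_Suc_right Suc.IH del: funpow.simps)
qed simp

text \<open>Equal first letters admit the same prepended words, so the preimages of the two points
  are paired word by word; an inequality between paired terms passes to the sums.\<close>

lemma Lpow_compare:
  assumes "z \<in> shift_space A" "z' \<in> shift_space A" "z 0 = z' 0" "0 \<le> C"
    and "\<And>y y'. y \<in> shift_space A \<Longrightarrow> y' \<in> shift_space A \<Longrightarrow> shift_by N y = z \<Longrightarrow> shift_by N y' = z' \<Longrightarrow>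
      (\<And>i. i \<le> N \<Longrightarrow> y i = y' i) \<Longrightarrow>
      ennreal (exp (birkhoff_sum \<phi> N y)) * u y \<le> ennreal C * (ennreal (exp (birkhoff_sum \<phi> N y')) * u' y')"
  shows "(L ^^ N) u z \<le> ennreal C * (L ^^ N) u' z'"
  using assms(5)
proof (induction N arbitrary: u u')
  case 0
  show ?case using 0[of z z'] assms by (simp add: birkhoff_sum_def)
next
  case (Suc N)
  have "(L ^^ N) (L u) z \<le> ennreal C * (L ^^ N) (L u') z'"
  proof (rule Suc.IH)
    fix y y' assume y: "y \<in> shift_space A" "y' \<in> shift_space A" "shift_by N y = z" "shift_by N y' = z'"
      and eq: "\<And>i. i \<le> N \<Longrightarrow> y i = y' i"
    let ?E = "\<lambda>y v. ennreal (exp (birkhoff_sum \<phi> N y)) * (ennreal (weight (case_nat v y)))"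
    have bs: "?E y v = (if A v (y 0) then ennreal (exp (birkhoff_sum \<phi> (Suc N) (case_nat v y))) else 0)"
      if "y \<in> shift_space A" for y v
    proof -
      have "shift_by (Suc k) (case_nat v y) = shift_by k y" for k by (simp add: shift_by_def)
      then have "birkhoff_sum \<phi> (Suc N) (case_nat v y) = \<phi> (case_nat v y) + birkhoff_sum \<phi> N y"
        unfolding birkhoff_sum_def sum.lessThan_Suc_shift funpow_left_shift by simp
      then show ?thesis using that
        by (simp add: weight_def case_nat_shift_space exp_add ennreal_mult mult.commute)
    qed
    have "ennreal (exp (birkhoff_sum \<phi> N y)) * L u y = (\<integral>\<^sup>+v. ?E y v * u (case_nat v y) \<partial>count_space UNIV)"
      unfolding L_def by (subst nn_integral_cmult[symmetric]) (simp_all add: mult.assoc)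
    also have "\<dots> \<le> (\<integral>\<^sup>+v. ennreal C * (?E y' v * u' (case_nat v y')) \<partial>count_space UNIV)"
    proof (intro nn_integral_mono)
      fix v
      have "y 0 = y' 0" using eq by simp
      moreover have "ennreal (exp (birkhoff_sum \<phi> (Suc N) (case_nat v y))) * u (case_nat v y) \<le>
        ennreal C * (ennreal (exp (birkhoff_sum \<phi> (Suc N) (case_nat v y'))) * u' (case_nat v y'))"
        if "A v (y 0)"
      proof (rule Suc.prems)
        have sh: "shift_by (Suc N) (case_nat v y) = shift_by N y" for y by (simp add: shift_by_def)
        show "case_nat v y i = case_nat v y' i" if "i \<le> Suc N" for i using that eq by (cases i) auto
      qed (use y that \<open>y 0 = y' 0\<close> in \<open>simp_all add: case_nat_shift_space shift_by_def\<close>)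
      ultimately show "?E y v * u (case_nat v y) \<le> ennreal C * (?E y' v * u' (case_nat v y'))"
        by (simp add: bs y)
    qed
    also have "\<dots> = ennreal C * (ennreal (exp (birkhoff_sum \<phi> N y')) * L u' y')"
      unfolding L_def by (subst nn_integral_cmult, simp, subst nn_integral_cmult[symmetric], simp) (simp add: mult.assoc)
    finally show "ennreal (exp (birkhoff_sum \<phi> N y)) * L u y \<le> ennreal C * (ennreal (exp (birkhoff_sum \<phi> N y')) * L u' y')" .
  qed
  then show ?case by (simp add: funpow_Suc_right del: funpow.simps)
qed

definition \<omega> :: "nat \<Rightarrow> real" where "\<omega> k = enn2real (walters_var A \<phi> k)"

lemma oscillation: "\<omega> \<longlonglongrightarrow> 0"
proof -
  have "walters_var A \<phi> \<longlonglongrightarrow> ennreal 0" using walters by (simp add: walters_condition_def)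
  then have "(\<lambda>k. enn2real (walters_var A \<phi> k)) \<longlonglongrightarrow> 0" by (rule tendsto_enn2real) simp
  then show ?thesis by (simp add: \<omega>_def[abs_def])
qed

text \<open>Walters' condition speaks of at least one step, so the empty sum is treated
  apart.\<close>

lemma birkhoff_variation:
  assumes "y \<in> shift_space A" "y' \<in> shift_space A" "1 \<le> k" "\<And>i. i < N + k \<Longrightarrow> y i = y' i"
  shows "birkhoff_sum \<phi> N y \<le> \<omega> k + birkhoff_sum \<phi> N y'"
proof (cases "N = 0")
  case False
  have "ennreal \<bar>birkhoff_sum \<phi> N y - birkhoff_sum \<phi> N y'\<bar> \<le> variation A (N + k) (birkhoff_sum \<phi> N)"
    unfolding variation_def using assms by (intro SUP_upper2[of "(y, y')"]) auto
  also have "\<dots> \<le> walters_var A \<phi> k"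
    unfolding walters_var_def using False by (intro SUP_upper) auto
  also have "\<dots> = ennreal (\<omega> k)"
    using walters assms(3) by (auto simp: walters_condition_def \<omega>_def ennreal_enn2real_if less_top[symmetric])
  finally have "\<bar>birkhoff_sum \<phi> N y - birkhoff_sum \<phi> N y'\<bar> \<le> \<omega> k"
    by (subst (asm) ennreal_le_iff) (simp_all add: \<omega>_def)
  then show ?thesis by linarith
qed (simp add: birkhoff_sum_def \<omega>_def)

text \<open>By duality the past acts on the future only through the weight \<open>\<psi>\<close>.
  Preimages with a common past share \<open>N + k\<close> letters, so \<open>\<psi>\<close> varies
  on the cylinder by at most \<open>exp (\<omega> k)\<close>; integrating this over both variables
  gives the crossed products.\<close>

lemma distortion:
  assumes k: "1 \<le> k" and D: "determined N D"
    and f [measurable]: "f \<in> borel_measurable M" and g [measurable]: "g \<in> borel_measurable M"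
  shows "(\<integral>\<^sup>+z\<in>D \<inter> shift_by N -` cyl k p. f (shift_by N z) \<partial>M) * (\<integral>\<^sup>+z\<in>cyl k p. g z \<partial>M) \<le>
    ennreal (exp (\<omega> k)) * ((\<integral>\<^sup>+z\<in>D \<inter> shift_by N -` cyl k p. g (shift_by N z) \<partial>M) * (\<integral>\<^sup>+z\<in>cyl k p. f z \<partial>M))"
proof -
  define \<psi> where "\<psi> = (L ^^ N) (indicator D)"
  have [measurable]: "D \<in> sets seq_algebra" by (rule determined_sets[OF D])
  have [measurable]: "\<psi> \<in> borel_measurable seq_algebra" unfolding \<psi>_def by measurable
  have psi: "\<psi> z \<le> ennreal (exp (\<omega> k)) * \<psi> z'"
    if z: "z \<in> shift_space A" "z' \<in> shift_space A" "z \<in> cyl k p" "z' \<in> cyl k p" for z z'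
    unfolding \<psi>_def
  proof (rule Lpow_compare)
    show "z 0 = z' 0" using z k by (auto simp: cyl_def)
    fix y y' assume y: "y \<in> shift_space A" "y' \<in> shift_space A" "shift_by N y = z" "shift_by N y' = z'"
      and eq: "\<And>i. i \<le> N \<Longrightarrow> y i = y' i"
    have "y i = y' i" if "i < N + k" for i
    proof (cases "i \<le> N")
      case False
      then have "shift_by N y (i - N) = shift_by N y' (i - N)" using z that unfolding y(3,4) by (auto simp: cyl_def)
      then show ?thesis using False by (simp add: shift_by_apply)
    qed (rule eq)
    from birkhoff_variation[OF y(1,2) k this]
    have "exp (birkhoff_sum \<phi> N y) \<le> exp (\<omega> k) * exp (birkhoff_sum \<phi> N y')" by (simp add: exp_add[symmetric])
    then have "ennreal (exp (birkhoff_sum \<phi> N y)) \<le> ennreal (exp (\<omega> k)) * ennreal (exp (birkhoff_sum \<phi> N y'))"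
      by (simp add: ennreal_mult[symmetric] ennreal_leI)
    moreover have "indicator D y = (indicator D y' :: ennreal)"
      using determinedD[OF D eq] by (simp add: indicator_def)
    ultimately show "ennreal (exp (birkhoff_sum \<phi> N y)) * indicator D y \<le>
        ennreal (exp (\<omega> k)) * (ennreal (exp (birkhoff_sum \<phi> N y')) * indicator D y')"
      by (simp split: split_indicator)
  qed (use z in auto)
  have int: "ennreal (\<Lambda> ^ N) * (\<integral>\<^sup>+z\<in>D \<inter> shift_by N -` cyl k p. f (shift_by N z) \<partial>M) = (\<integral>\<^sup>+z\<in>cyl k p. \<psi> z * f z \<partial>M)"
    if [measurable]: "f \<in> borel_measurable M" for f
  proof -
    let ?u = "\<lambda>z. indicator D z * (\<lambda>z. f z * indicator (cyl k p) z) (shift_by N z)"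
    have u: "?u \<in> borel_measurable seq_algebra" by measurable
    have "(\<integral>\<^sup>+z\<in>D \<inter> shift_by N -` cyl k p. f (shift_by N z) \<partial>M) = (\<integral>\<^sup>+z. ?u z \<partial>M)"
      by (intro nn_integral_cong) (auto split: split_indicator)
    then have "ennreal (\<Lambda> ^ N) * (\<integral>\<^sup>+z\<in>D \<inter> shift_by N -` cyl k p. f (shift_by N z) \<partial>M) = (\<integral>\<^sup>+z. (L ^^ N) ?u z \<partial>M)"
      using Lpow_integral[OF u, of N] by simp
    also have "\<dots> = (\<integral>\<^sup>+z\<in>cyl k p. \<psi> z * f z \<partial>M)"
      unfolding \<psi>_def Lpow_comp_shift[of N "indicator D" "\<lambda>z. f z * indicator (cyl k p) z"] by (simp add: mult.assoc)
    finally show ?thesis .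
  qed
  \<comment> \<open>Integrates the oscillation bound in the second variable with the first one
    frozen; the integration in the first variable follows.\<close>
  have fixed: "\<psi> z * (\<integral>\<^sup>+z\<in>cyl k p. g z \<partial>M) \<le> ennreal (exp (\<omega> k)) * (\<integral>\<^sup>+z\<in>cyl k p. \<psi> z * g z \<partial>M)"
    if z: "z \<in> shift_space A" "z \<in> cyl k p" for z
  proof -
    have "\<psi> z * (\<integral>\<^sup>+z\<in>cyl k p. g z \<partial>M) = (\<integral>\<^sup>+z'. \<psi> z * (g z' * indicator (cyl k p) z') \<partial>M)"
      by (rule nn_integral_cmult[symmetric]) measurable
    also have "\<dots> \<le> (\<integral>\<^sup>+z'. ennreal (exp (\<omega> k)) * (\<psi> z' * g z' * indicator (cyl k p) z') \<partial>M)"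
    proof (rule nn_integral_mono_AE)
      show "AE z' in M. \<psi> z * (g z' * indicator (cyl k p) z') \<le> ennreal (exp (\<omega> k)) * (\<psi> z' * g z' * indicator (cyl k p) z')"
        using M_AE_shift_space
      proof eventually_elim
        case (elim z')
        then show ?case
          using mult_right_mono[OF psi[OF z(1) elim z(2)], of "g z'"] by (auto simp: mult.assoc split: split_indicator)
      qed
    qed
    also have "\<dots> = ennreal (exp (\<omega> k)) * (\<integral>\<^sup>+z\<in>cyl k p. \<psi> z * g z \<partial>M)"
      by (rule nn_integral_cmult) measurable
    finally show ?thesis .
  qed
  have "(\<integral>\<^sup>+z\<in>cyl k p. \<psi> z * f z \<partial>M) * (\<integral>\<^sup>+z\<in>cyl k p. g z \<partial>M)
      = (\<integral>\<^sup>+z. (\<psi> z * f z * indicator (cyl k p) z) * (\<integral>\<^sup>+z\<in>cyl k p. g z \<partial>M) \<partial>M)"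
    by (rule nn_integral_multc[symmetric]) measurable
  also have "\<dots> \<le> (\<integral>\<^sup>+z. ennreal (exp (\<omega> k)) * (\<integral>\<^sup>+z\<in>cyl k p. \<psi> z * g z \<partial>M) * (f z * indicator (cyl k p) z) \<partial>M)"
  proof (rule nn_integral_mono_AE)
    show "AE z in M. (\<psi> z * f z * indicator (cyl k p) z) * (\<integral>\<^sup>+z\<in>cyl k p. g z \<partial>M) \<le>
        ennreal (exp (\<omega> k)) * (\<integral>\<^sup>+z\<in>cyl k p. \<psi> z * g z \<partial>M) * (f z * indicator (cyl k p) z)"
      using M_AE_shift_space
    proof eventually_elim
      case (elim z)
      then show ?case using mult_right_mono[OF fixed[OF elim], of "f z"] by (auto simp: mult_ac split: split_indicator)
    qed
  qed
  also have "\<dots> = ennreal (exp (\<omega> k)) * (\<integral>\<^sup>+z\<in>cyl k p. \<psi> z * g z \<partial>M) * (\<integral>\<^sup>+z\<in>cyl k p. f z \<partial>M)"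
    by (rule nn_integral_cmult) measurable
  finally have "ennreal (\<Lambda> ^ N) * ((\<integral>\<^sup>+z\<in>D \<inter> shift_by N -` cyl k p. f (shift_by N z) \<partial>M) * (\<integral>\<^sup>+z\<in>cyl k p. g z \<partial>M)) \<le>
    ennreal (\<Lambda> ^ N) * (ennreal (exp (\<omega> k)) * ((\<integral>\<^sup>+z\<in>D \<inter> shift_by N -` cyl k p. g (shift_by N z) \<partial>M) * (\<integral>\<^sup>+z\<in>cyl k p. f z \<partial>M)))"
    unfolding int[OF f, symmetric] int[OF g, symmetric] by (simp add: mult_ac)
  moreover have "ennreal (\<Lambda> ^ N) \<noteq> 0" "ennreal (\<Lambda> ^ N) \<noteq> top" using Lambda_pos by (simp_all add: ennreal_eq_0_iff not_le)
  ultimately show ?thesis by (simp add: ennreal_mult_le_mult_iff)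
qed

end

section \<open>Positivity, recurrence and null sets of the conformal measure\<close>

context ruelle_system
begin

text \<open>The eigenmeasure equation expresses the measure of the preimage, up to the positive
  factor \<open>\<Lambda> ^ k\<close>, as an integral over \<open>E\<close>.\<close>

lemma shift_nonsingular:
  assumes "E \<in> null_sets M"
  shows "shift_by k -` E \<in> null_sets M"
proof -
  have [measurable]: "E \<in> sets seq_algebra" using assms by (auto simp: sets_M)
  have mz: "shift_by k -` E \<in> sets seq_algebra"
    using measurable_sets[OF measurable_shift_by[of k], of E] by (simp add: space_PiM)
  have AE: "AE z in M. z \<notin> E" using assms by (rule AE_not_in)
  have "ennreal (\<Lambda> ^ k) * (\<integral>\<^sup>+z. 1 * indicator E (shift_by k z) \<partial>M) = (\<integral>\<^sup>+z. (L ^^ k) (\<lambda>z. 1 * indicator E (shift_by k z)) z \<partial>M)"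
    by (rule Lpow_integral[symmetric]) measurable
  also have "\<dots> = (\<integral>\<^sup>+z. (L ^^ k) (\<lambda>_. 1) z * indicator E z \<partial>M)"
    unfolding Lpow_comp_shift[of k "\<lambda>_. 1" "indicator E"] ..
  also have "\<dots> = (\<integral>\<^sup>+z. 0 \<partial>M)"
    by (rule nn_integral_cong_AE) (use AE in \<open>eventually_elim, simp\<close>)
  finally have "ennreal (\<Lambda> ^ k) * (\<integral>\<^sup>+z. indicator (shift_by k -` E) z \<partial>M) = 0"
    by (simp add: indicator_def)
  then have "emeasure M (shift_by k -` E) = 0"
    using Lambda_pos mz zero_less_power[OF Lambda_pos, of k] by (simp add: sets_M ennreal_eq_0_iff)
  then show ?thesis using mz by (auto simp: null_sets_def sets_M)
qed

text \<open>All admissible weights are positive, so mass propagates backwards along an admissible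
  transition.\<close>

lemma prepend_positive:
  assumes [measurable]: "E \<in> sets seq_algebra" and pos: "emeasure M E \<noteq> 0" and adm: "\<And>z. z \<in> E \<Longrightarrow> A v (z 0)"
  shows "emeasure M {z. z 0 = v \<and> shift_by 1 z \<in> E} \<noteq> 0"
proof
  assume null: "emeasure M {z. z 0 = v \<and> shift_by 1 z \<in> E} = 0"
  have [measurable]: "{z. z 0 = v} \<in> sets seq_algebra"
    by (rule determined_sets[of 0]) (simp add: determined_def)
  have "{z. z 0 = v \<and> shift_by 1 z \<in> E} = {z. z 0 = v} \<inter> (shift_by 1 -` E \<inter> space seq_algebra)"
    by (auto simp: space_PiM)
  also have "\<dots> \<in> sets seq_algebra" by measurable
  finally have mz: "{z. z 0 = v \<and> shift_by 1 z \<in> E} \<in> sets M" by (simp add: sets_M)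
  have "(\<integral>\<^sup>+z. L (\<lambda>z. indicator {z. z 0 = v} z * indicator E (shift_by 1 z)) z \<partial>M)
      = ennreal \<Lambda> * (\<integral>\<^sup>+z. indicator {z. z 0 = v} z * indicator E (shift_by 1 z) \<partial>M)"
    by (rule L_integral) measurable
  also have "(\<integral>\<^sup>+z. indicator {z. z 0 = v} z * indicator E (shift_by 1 z) \<partial>M) = (\<integral>\<^sup>+z. indicator {z. z 0 = v \<and> shift_by 1 z \<in> E} z \<partial>M)"
    by (intro nn_integral_cong) (simp split: split_indicator)
  also have "\<dots> = 0" using null mz by simp
  finally have "(\<integral>\<^sup>+z. L (indicator {z. z 0 = v}) z * indicator E z \<partial>M) = 0"
    unfolding L_comp_shift by simp
  then have "AE z in M. L (indicator {z. z 0 = v}) z * indicator E z = 0"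
    by (subst (asm) nn_integral_0_iff_AE) auto
  with M_AE_shift_space have "AE z in M. z \<notin> E"
  proof eventually_elim
    case (elim z)
    have "ennreal (weight (case_nat v z)) \<le> L (indicator {z. z 0 = v}) z"
      using nn_integral_ge_point[of v UNIV "\<lambda>w. ennreal (weight (case_nat w z)) * indicator {z. z 0 = v} (case_nat w z)"]
      by (simp add: L_def)
    moreover have "0 < weight (case_nat v z)" if "z \<in> E"
      using adm[OF that] elim(1) by (simp add: weight_def case_nat_shift_space)
    ultimately show ?case using elim(2) by (auto split: split_indicator)
  qed
  then have "E \<in> null_sets M" by (subst AE_iff_null_sets) (simp_all add: sets_M)
  then show False using pos by auto
qed

lemma letter_sets [measurable]: "{z. z i = (v :: 'v)} \<in> sets seq_algebra"
  by (rule determined_sets[of i]) (simp add: determined_def)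

lemma emeasure_M: "E \<in> sets seq_algebra \<Longrightarrow> emeasure M E = emeasure m (E \<inter> shift_space A)"
  unfolding M_def by (subst emeasure_distr[OF id_measurable]) (auto simp: space_m)

text \<open>Some letter has mass, since \<open>h\<close> has infinite integral; mixing supplies a
  path to it from \<open>v\<close>, along which \<open>prepend_positive\<close> carries the mass
  back.\<close>

lemma letter_positive: "emeasure M {z. z 0 = v} \<noteq> 0"
proof -
  have "\<exists>v. emeasure M {z. z 0 = v} \<noteq> 0"
  proof (rule ccontr)
    assume "\<not> ?thesis"
    then have "{z. z 0 = v} \<in> null_sets M" for v by (auto simp: null_sets_def sets_M)
    then have "(\<Union>v. {z. z 0 = v}) \<in> null_sets M" by (intro null_sets_UN') auto
    also have "(\<Union>v. {z. z 0 = v}) = UNIV" by auto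
    finally have "emeasure M UNIV = 0" by auto
    then have "space m \<in> null_sets m" using emeasure_M[of UNIV] sets.top[of seq_algebra] by (auto simp: space_m space_PiM null_sets_def sets.top[of m, unfolded space_m])
    then have "(\<integral>\<^sup>+z\<in>space m. ennreal (h z) \<partial>m) = 0" by (rule nn_integral_null_set)
    moreover have "(\<integral>\<^sup>+z. ennreal (h z) \<partial>m) = \<infinity>"
      using eigen unfolding ruelle_eigendata_def by (elim conjE)
    moreover have "(\<integral>\<^sup>+z. ennreal (h z) \<partial>m) = (\<integral>\<^sup>+z\<in>space m. ennreal (h z) \<partial>m)"
      by (intro nn_integral_cong) simp
    ultimately show False by (metis ennreal_zero_neq_top infinity_ennreal_def)
  qed
  then obtain w where w: "emeasure M {z. z 0 = w} \<noteq> 0" by blast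
  obtain N where "(A ^^ N) v w" using mixing unfolding topologically_mixing_def by blast
  then show ?thesis
  proof (induction N arbitrary: v)
    case 0
    then show ?case using w by simp
  next
    case (Suc N)
    from Suc.prems obtain u where u: "A v u" "(A ^^ N) u w" by (rule relpowp_Suc_E2)
    have "emeasure M {z. z 0 = v \<and> shift_by 1 z \<in> {z. z 0 = u}} \<noteq> 0"
      by (rule prepend_positive[OF _ Suc.IH[OF u(2)]]) (use u in auto)
    moreover have "emeasure M {z. z 0 = v \<and> shift_by 1 z \<in> {z. z 0 = u}} \<le> emeasure M {z. z 0 = v}"
      by (intro emeasure_mono) (auto simp: sets_M)
    ultimately show ?case by (auto simp: le_zero_eq)
  qed
qed

lemma cyl_positive:
  assumes "p \<in> shift_space A"
  shows "0 < emeasure M (cyl n p)"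
proof -
  have "emeasure M (cyl (Suc n) p) \<noteq> 0"
    using assms
  proof (induction n arbitrary: p)
    case 0
    then show ?case using letter_positive[of "p 0"] by (simp add: cyl_def)
  next
    case (Suc n)
    have "emeasure M {z. z 0 = p 0 \<and> shift_by 1 z \<in> cyl (Suc n) (shift_by 1 p)} \<noteq> 0"
    proof (rule prepend_positive)
      show "emeasure M (cyl (Suc n) (shift_by 1 p)) \<noteq> 0"
        using Suc.prems by (intro Suc.IH) (simp add: shift_space_def shift_by_def)
      show "A (p 0) (z 0)" if "z \<in> cyl (Suc n) (shift_by 1 p)" for z
        using that Suc.prems by (simp add: cyl_def shift_by_def shift_space_def)
    qed measurable
    also have "{z. z 0 = p 0 \<and> shift_by 1 z \<in> cyl (Suc n) (shift_by 1 p)} = cyl (Suc (Suc n)) p"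
      unfolding cyl_def shift_by_def by (simp add: All_less_Suc2 del: All_less_Suc)
    finally show ?case .
  qed
  moreover have "emeasure M (cyl (Suc n) p) \<le> emeasure M (cyl n p)"
    by (intro emeasure_mono) (auto simp: cyl_def sets_M intro: cyl_sets[unfolded cyl_def])
  ultimately show ?thesis by (metis zero_less_iff_neq_zero less_le_trans)
qed

lemma letter_finite: "emeasure M (cyl 1 p) < \<infinity>"
proof -
  have "\<forall>w. w \<noteq> [] \<longrightarrow> emeasure m (cylinder A w) < \<infinity>"
    using eigen unfolding ruelle_eigendata_def by (elim conjE)
  then have "emeasure m (cylinder A [p 0]) < \<infinity>" by simp
  moreover have "cylinder A [p 0] = cyl 1 p \<inter> shift_space A" by (auto simp: cylinder_def cyl_def)
  ultimately show ?thesis by (simp add: emeasure_M)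
qed

definition last_visits :: "'v \<Rightarrow> 'v seq set" where
  "last_visits v = {z. z 0 = v \<and> (\<forall>l\<ge>1. z l \<noteq> v)}"

text \<open>A point has at most one last visit to \<open>v\<close>, so these sets are wandering, and
  conservativity makes them null.\<close>

lemma last_visits_null: "last_visits v \<in> null_sets M"
proof -
  have "last_visits v = {z. z 0 = v} \<inter> (\<Inter>l\<in>{1..}. UNIV - {z. z l = v})" by (auto simp: last_visits_def)
  also have "\<dots> \<in> sets seq_algebra"
    using sets.top[of seq_algebra] by (intro sets.Int sets.countable_INT'' sets.Diff letter_sets) (auto simp: space_PiM)
  finally have mz: "last_visits v \<in> sets seq_algebra" .
  have "emeasure m (last_visits v \<inter> shift_space A) = 0"
  proof -
    have "conservative m left_shift" using eigen unfolding ruelle_eigendata_def by (elim conjE)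
    moreover have "last_visits v \<inter> shift_space A \<in> sets m"
      using mz by (auto simp: sets_m sets_restrict_space)
    moreover have "disjoint_family (\<lambda>n. (left_shift ^^ n) -` (last_visits v \<inter> shift_space A) \<inter> space m)"
      unfolding disjoint_family_on_def
    proof (intro ballI impI)
      fix n n' :: nat assume "n \<noteq> n'"
      have False if "n < n'" "shift_by n z \<in> last_visits v" "shift_by n' z \<in> last_visits v" for n n' z
      proof -
        have "shift_by n z (n' - n) \<noteq> v" using that by (auto simp: last_visits_def)
        moreover have "shift_by n z (n' - n) = shift_by n' z 0" using that(1) by (simp add: shift_by_def)
        ultimately show False using that(3) by (simp add: last_visits_def)
      qed
      from this[of n n'] this[of n' n] \<open>n \<noteq> n'\<close>
      show "(left_shift ^^ n) -` (last_visits v \<inter> shift_space A) \<inter> space m \<inter> ((left_shift ^^ n') -` (last_visits v \<inter> shift_space A) \<inter> space m) = {}"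
        by (cases "n < n'") (auto simp: funpow_left_shift)
    qed
    ultimately show ?thesis unfolding conservative_def by (elim ballE) auto
  qed
  then show ?thesis using mz emeasure_M[OF mz] by (auto simp: null_sets_def sets_M)
qed

lemma visits_again: "AE z in M. \<forall>k. z k = v \<longrightarrow> (\<exists>l>k. z l = v)"
  unfolding AE_all_countable
proof
  fix k
  have "AE z in M. z \<notin> shift_by k -` last_visits v"
    by (intro AE_not_in shift_nonsingular last_visits_null)
  then show "AE z in M. z k = v \<longrightarrow> (\<exists>l>k. z l = v)"
  proof eventually_elim
    case (elim z)
    show ?case
    proof
      assume "z k = v"
      then obtain l where "1 \<le> l" "z (l + k) = v" using elim by (auto simp: last_visits_def shift_by_def)
      then show "\<exists>l>k. z l = v" by (intro exI[of _ "l + k"]) auto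
    qed
  qed
qed

lemma visits_unbounded: "AE z in M. z k = v \<longrightarrow> (\<forall>n. \<exists>l\<ge>n. z l = v)"
  using visits_again[of v]
proof eventually_elim
  case (elim z)
  show ?case
  proof (intro impI allI)
    fix n assume "z k = v"
    show "\<exists>l\<ge>n. z l = v"
    proof (induction n)
      case 0
      then show ?case using \<open>z k = v\<close> by blast
    next
      case (Suc n)
      then obtain l where "n \<le> l" "z l = v" by blast
      moreover from elim this(2) obtain l' where "l < l'" "z l' = v" by blast
      ultimately show ?case by (intro exI[of _ l']) auto
    qed
  qed
qed

text \<open>At time \<open>j\<close> the orbit of \<open>x\<close> makes its last visit to
  \<open>x 0\<close>, so \<open>{x}\<close> lies in the preimage of a null set. Cylinders start at
  length 1 since the empty word may have infinite measure.\<close>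

lemma singleton_null:
  assumes "x j = x 0" "\<And>i. j < i \<Longrightarrow> x i \<noteq> x 0"
  shows "(\<lambda>n. measure M (cyl n x)) \<longlonglongrightarrow> 0"
proof -
  have "shift_by j x \<in> last_visits (x 0)" using assms by (auto simp: last_visits_def shift_by_def)
  moreover have "shift_by j -` last_visits (x 0) \<in> null_sets M" by (intro shift_nonsingular last_visits_null)
  ultimately have "emeasure M {x} \<le> 0"
    using emeasure_mono[of "{x}" "shift_by j -` last_visits (x 0)" M] by (auto simp: null_sets_def)
  moreover have "(\<Inter>n. cyl n x) = {x}" by (auto simp: cyl_def fun_eq_iff)
  moreover have "(\<lambda>n. emeasure M (cyl (n + 1) x)) \<longlonglongrightarrow> emeasure M (\<Inter>n. cyl (n + 1) x)"
  proof (rule Lim_emeasure_decseq)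
    show "decseq (\<lambda>n. cyl (n + 1) x)" by (rule decseq_SucI) (auto simp: cyl_def)
    fix n
    have "emeasure M (cyl (n + 1) x) \<le> emeasure M (cyl 1 x)"
      by (intro emeasure_mono) (auto simp: cyl_def sets_M)
    then show "emeasure M (cyl (n + 1) x) \<noteq> \<infinity>" using letter_finite[of x] by (auto simp: top_unique)
  qed (auto simp: sets_M)
  moreover have "(\<Inter>n. cyl (n + 1) x) = (\<Inter>n. cyl n x)"
  proof (intro equalityI INT_greatest)
    fix n show "(\<Inter>n. cyl (n + 1) x) \<subseteq> cyl n x" by (intro INF_lower2[of n]) (auto simp: cyl_def)
  qed (rule INT_lower, simp)
  ultimately have "(\<lambda>n. emeasure M (cyl (n + 1) x)) \<longlonglongrightarrow> ennreal 0" by simp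
  then have "(\<lambda>n. measure M (cyl (n + 1) x)) \<longlonglongrightarrow> 0"
    unfolding measure_def by (rule tendsto_enn2real) simp
  then show ?thesis by (rule LIMSEQ_offset)
qed

end

section \<open>The invariant measure and its transfer operator\<close>

text \<open>Tested on the set where \<open>F\<close> is negative.\<close>

lemma AE_nonneg_if_integrals_nonneg:
  fixes F :: "'a \<Rightarrow> real"
  assumes F: "integrable N F" and nn: "\<And>E. E \<in> sets N \<Longrightarrow> 0 \<le> (\<integral>z. F z * indicator E z \<partial>N)"
  shows "AE z in N. 0 \<le> F z"
proof -
  define E where "E = {z \<in> space N. F z < 0}"
  have [measurable]: "F \<in> borel_measurable N" using F by auto
  have E: "E \<in> sets N" unfolding E_def by measurable
  have int: "integrable N (\<lambda>z. - (F z * indicator E z))"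
    using integrable_mult_indicator[OF E F] by (simp add: mult.commute)
  have pos: "0 \<le> - (F z * indicator E z)" for z by (auto simp: E_def indicator_def)
  have "(\<integral>z. - (F z * indicator E z) \<partial>N) \<le> 0" using nn[OF E] by simp
  then have "(\<integral>z. - (F z * indicator E z) \<partial>N) = 0"
    using Bochner_Integration.integral_nonneg[of N "\<lambda>z. - (F z * indicator E z)"] pos by (intro antisym) auto
  then have "AE z in N. - (F z * indicator E z) = 0"
    using integral_nonneg_eq_0_iff_AE[OF int] pos by simp
  then show ?thesis using AE_space
    by eventually_elim (auto simp: E_def indicator_def not_less[symmetric] split: if_splits)
qed

context ruelle_system
begin

definition mu :: "'v seq measure" where "mu = density m (\<lambda>z. ennreal (h z))"

text \<open>Agrees with the density \<open>h\<close> on the shift space; the value 0 elsewhere gives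
  a function measurable on all sequences.\<close>

definition H :: "'v seq \<Rightarrow> real" where "H z = (if z \<in> shift_space A then h z else 0)"

lemma h_pos: "z \<in> shift_space A \<Longrightarrow> 0 < h z"
proof -
  have "\<forall>z\<in>shift_space A. 0 < h z" using eigen unfolding ruelle_eigendata_def by (elim conjE)
  then show "z \<in> shift_space A \<Longrightarrow> 0 < h z" by (rule bspec)
qed

lemma openin_h:
  assumes "open U"
  shows "openin (shift_topology A \<eta>) {z \<in> shift_space A. h z \<in> U}"
proof -
  have "continuous_map (shift_topology A \<eta>) euclideanreal h" using eigen unfolding ruelle_eigendata_def by (elim conjE)
  moreover have "topspace (shift_topology A \<eta>) = shift_space A"
  proof -
    interpret Metric_space "shift_space A" "seq_dist \<eta>" by (rule Metric_space_seq_dist[OF eta])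
    show ?thesis by (simp add: shift_topology_def)
  qed
  ultimately show ?thesis using assms by (auto simp: continuous_map_def)
qed

lemma h_continuous:
  assumes p: "p \<in> shift_space A" and e: "0 < e"
  obtains k where "\<And>z. z \<in> cyl k p \<Longrightarrow> z \<in> shift_space A \<Longrightarrow> \<bar>h z - h p\<bar> < e"
proof -
  have "openin (shift_topology A \<eta>) {z \<in> shift_space A. h z \<in> ball (h p) e}" by (rule openin_h) simp
  moreover have "p \<in> {z \<in> shift_space A. h z \<in> ball (h p) e}" using p e by simp
  ultimately obtain k where "cyl k p \<inter> shift_space A \<subseteq> {z \<in> shift_space A. h z \<in> ball (h p) e}"
    unfolding openin_shift_topology[OF eta] by blast
  then show thesis by (intro that[of k]) (auto simp: dist_real_def abs_minus_commute)
qed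

lemma h_measurable: "h \<in> borel_measurable m"
proof (rule borel_measurableI)
  fix U :: "real set" assume "open U"
  then have op: "openin (shift_topology A \<eta>) {z \<in> shift_space A. h z \<in> U}" by (rule openin_h)
  have "{U. openin (shift_topology A \<eta>) U} \<subseteq> Pow (shift_space A)"
    unfolding openin_shift_topology[OF eta] by auto
  then have "{z \<in> shift_space A. h z \<in> U} \<in> sets (shift_borel A \<eta>)"
    unfolding shift_borel_def using op by (simp add: sets_measure_of sigma_sets.Basic)
  also have "{z \<in> shift_space A. h z \<in> U} = h -` U \<inter> space m" by (auto simp: space_m)
  finally show "h -` U \<inter> space m \<in> sets m" by (simp add: sets_m sets_shift_borel[OF eta])
qed

lemma H_measurable [measurable]: "H \<in> borel_measurable seq_algebra"
  using borel_measurable_extend[OF h_measurable] by (simp add: H_def[abs_def])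

lemma space_mu: "space mu = shift_space A" by (simp add: mu_def space_m)

lemma sets_mu: "sets mu = sets (restrict_space seq_algebra (shift_space A))" by (simp add: mu_def sets_m)

lemma measurable_mu: "measurable mu N = measurable m N"
  by (rule measurable_cong_sets) (simp_all add: sets_mu sets_m)

lemma id_mu: "f \<in> measurable seq_algebra N \<Longrightarrow> f \<in> measurable mu N"
  unfolding measurable_mu by (rule measurable_compose[OF id_measurable])

lemma sets_mu_seq: "E \<in> sets mu \<Longrightarrow> E \<in> sets seq_algebra"
  using shift_space_sets[of A] by (auto simp: sets_mu sets_restrict_space)

lemma mu_nn_integral:
  assumes [measurable]: "F \<in> borel_measurable seq_algebra"
  shows "(\<integral>\<^sup>+z. F z \<partial>mu) = (\<integral>\<^sup>+z. ennreal (H z) * F z \<partial>M)"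
proof -
  have "(\<integral>\<^sup>+z. F z \<partial>mu) = (\<integral>\<^sup>+z. ennreal (h z) * F z \<partial>m)"
    unfolding mu_def using h_measurable measurable_compose[OF id_measurable assms]
    by (intro nn_integral_density) auto
  also have "\<dots> = (\<integral>\<^sup>+z. ennreal (H z) * F z \<partial>m)"
    by (intro nn_integral_cong) (simp add: H_def space_m)
  also have "\<dots> = (\<integral>\<^sup>+z. ennreal (H z) * F z \<partial>M)" by (rule M_integral[symmetric]) measurable
  finally show ?thesis .
qed

lemma mu_integral:
  fixes F :: "'v seq \<Rightarrow> real"
  assumes [measurable]: "F \<in> borel_measurable seq_algebra"
  shows "integrable mu F \<longleftrightarrow> integrable M (\<lambda>z. H z * F z)" "(\<integral>z. F z \<partial>mu) = (\<integral>z. H z * F z \<partial>M)"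
proof -
  have meas: "F \<in> borel_measurable m" "AE z in m. 0 \<le> h z"
    using measurable_compose[OF id_measurable assms] h_pos by (auto simp: space_m less_imp_le)
  have HF: "(\<lambda>z. H z * F z) \<in> borel_measurable seq_algebra" by measurable
  have "integrable mu F \<longleftrightarrow> integrable m (\<lambda>z. h z * F z)"
    unfolding mu_def by (rule integrable_real_density[OF h_measurable meas(2,1)])
  also have "\<dots> \<longleftrightarrow> integrable m (\<lambda>z. H z * F z)"
    by (intro Bochner_Integration.integrable_cong) (simp_all add: H_def space_m)
  finally show "integrable mu F \<longleftrightarrow> integrable M (\<lambda>z. H z * F z)"
    unfolding M_def integrable_distr_eq[OF id_measurable HF] .
  have "(\<integral>z. F z \<partial>mu) = (\<integral>z. h z * F z \<partial>m)"
    unfolding mu_def by (rule integral_real_density[OF h_measurable meas(2,1)])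
  also have "\<dots> = (\<integral>z. H z * F z \<partial>m)"
    by (intro Bochner_Integration.integral_cong) (simp_all add: H_def space_m)
  finally show "(\<integral>z. F z \<partial>mu) = (\<integral>z. H z * F z \<partial>M)"
    unfolding M_def integral_distr[OF id_measurable HF] .
qed

text \<open>The explicit transfer operator of the invariant measure: the normalised Ruelle operator
  conjugated by the eigenfunction.\<close>

definition dual :: "('v seq \<Rightarrow> ennreal) \<Rightarrow> 'v seq \<Rightarrow> ennreal" where
  "dual F z = ennreal (1 / (\<Lambda> * H z)) * L (\<lambda>y. ennreal (H y) * F y) z"

lemma dual_measurable [measurable]: "F \<in> borel_measurable seq_algebra \<Longrightarrow> dual F \<in> borel_measurable seq_algebra"
  unfolding dual_def[abs_def] by measurable

lemma dual_integral:
  assumes [measurable]: "F \<in> borel_measurable seq_algebra" "G \<in> borel_measurable seq_algebra"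
  shows "(\<integral>\<^sup>+z. F z * G (shift_by 1 z) \<partial>mu) = (\<integral>\<^sup>+z. dual F z * G z \<partial>mu)"
proof -
  have HFG: "(\<lambda>z. (ennreal (H z) * F z) * G (shift_by 1 z)) \<in> borel_measurable seq_algebra" by measurable
  have LHFG: "L (\<lambda>z. (ennreal (H z) * F z) * G (shift_by 1 z)) \<in> borel_measurable M"
    using L_measurable[OF HFG] by (simp add: measurable_cong_sets[OF sets_M refl])
  have "(\<integral>\<^sup>+z. dual F z * G z \<partial>mu) = (\<integral>\<^sup>+z. ennreal (H z) * (dual F z * G z) \<partial>M)"
    by (rule mu_nn_integral) measurable
  also have "\<dots> = (\<integral>\<^sup>+z. ennreal (1 / \<Lambda>) * L (\<lambda>z. (ennreal (H z) * F z) * G (shift_by 1 z)) z \<partial>M)"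
  proof (rule nn_integral_cong_AE)
    show "AE z in M. ennreal (H z) * (dual F z * G z) = ennreal (1 / \<Lambda>) * L (\<lambda>z. (ennreal (H z) * F z) * G (shift_by 1 z)) z"
      using M_AE_shift_space
    proof eventually_elim
      case (elim z)
      have "ennreal (H z) * ennreal (1 / (\<Lambda> * H z)) = ennreal (1 / \<Lambda>)"
        using h_pos[OF elim] Lambda_pos elim by (simp add: H_def ennreal_mult[symmetric])
      then have "ennreal (H z) * (dual F z * G z) = ennreal (1 / \<Lambda>) * (L (\<lambda>y. ennreal (H y) * F y) z * G z)"
        unfolding dual_def by (simp only: mult.assoc[symmetric])
      then show ?case unfolding L_comp_shift[of "\<lambda>z. ennreal (H z) * F z" G] .
    qed
  qed
  also have "\<dots> = ennreal (1 / \<Lambda>) * (\<integral>\<^sup>+z. L (\<lambda>z. (ennreal (H z) * F z) * G (shift_by 1 z)) z \<partial>M)"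
    by (rule nn_integral_cmult[OF LHFG])
  also have "\<dots> = ennreal (1 / \<Lambda>) * (ennreal \<Lambda> * (\<integral>\<^sup>+z. (ennreal (H z) * F z) * G (shift_by 1 z) \<partial>M))"
    unfolding L_integral[OF HFG] ..
  also have "\<dots> = (\<integral>\<^sup>+z. ennreal (H z) * (F z * G (shift_by 1 z)) \<partial>M)"
    using Lambda_pos by (simp add: mult.assoc[symmetric] ennreal_mult[symmetric])
  also have "\<dots> = (\<integral>\<^sup>+z. F z * G (shift_by 1 z) \<partial>mu)" by (rule mu_nn_integral[symmetric]) measurable
  finally show ?thesis ..
qed

lemma left_shift_mu: "left_shift \<in> measurable mu mu"
proof -
  have "shift_by 1 \<in> measurable (restrict_space seq_algebra (shift_space A)) (restrict_space seq_algebra (shift_space A))"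
  proof (rule measurable_restrict_space2)
    show "shift_by 1 \<in> space (restrict_space seq_algebra (shift_space A)) \<rightarrow> shift_space A"
      by (auto simp: space_restrict_space shift_space_def shift_by_def)
    show "shift_by 1 \<in> measurable (restrict_space seq_algebra (shift_space A)) seq_algebra"
      by (intro measurable_restrict_space1 measurable_shift_by)
  qed
  moreover have "left_shift = (shift_by 1 :: 'v seq \<Rightarrow> _)" by (simp add: left_shift_def shift_by_def fun_eq_iff)
  moreover have "measurable mu mu = measurable (restrict_space seq_algebra (shift_space A)) (restrict_space seq_algebra (shift_space A))"
    by (rule measurable_cong_sets) (simp_all add: sets_mu)
  ultimately show ?thesis by simp
qed

lemma integrable_bounded_mult:
  assumes "integrable mu f" "g \<in> borel_measurable mu" "\<And>z. z \<in> shift_space A \<Longrightarrow> \<bar>g z\<bar> \<le> c"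
  shows "integrable mu (\<lambda>z. f z * g z :: real)"
proof (rule Bochner_Integration.integrable_bound)
  show "integrable mu (\<lambda>z. c * f z)" using assms(1) by simp
  show "(\<lambda>z. f z * g z) \<in> borel_measurable mu" using assms(1,2) by auto
  show "AE z in mu. norm (f z * g z) \<le> norm (c * f z)"
  proof (rule AE_I2)
    fix z assume "z \<in> space mu"
    then have "\<bar>g z\<bar> \<le> c" by (intro assms) (simp add: space_mu)
    then have "\<bar>g z\<bar> * \<bar>f z\<bar> \<le> \<bar>c\<bar> * \<bar>f z\<bar>" by (intro mult_right_mono) auto
    then show "norm (f z * g z) \<le> norm (c * f z)" by (simp add: abs_mult mult.commute)
  qed
qed

lemma left_shift_shift_space: "z \<in> shift_space A \<Longrightarrow> left_shift z \<in> shift_space A"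
  by (simp add: shift_space_def left_shift_def)

text \<open>The transfer operator is defined by a choice, so a function with the dual property has
  to be exhibited: \<open>dual\<close> applied to \<open>f\<close>, finite almost everywhere because
  it preserves the integral.\<close>

lemma transfer_exists:
  assumes f: "integrable mu f" and nn: "AE z in mu. 0 \<le> f z"
  shows "\<exists>u. integrable mu u \<and> (\<forall>g\<in>borel_measurable mu. bounded (g ` space mu) \<longrightarrow>
      (\<integral>z. f z * g (left_shift z) \<partial>mu) = (\<integral>z. u z * g z \<partial>mu :: real))"
proof -
  define ext where "ext g z = (if z \<in> shift_space A then g z else 0)" for g :: "'v seq \<Rightarrow> real" and z
  have ext: "ext g \<in> borel_measurable seq_algebra" if "g \<in> borel_measurable mu" for g
    unfolding ext_def[abs_def] using that by (intro borel_measurable_extend) (simp add: measurable_mu)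
  define F where "F z = ennreal (ext f z)" for z
  have f_meas: "f \<in> borel_measurable mu" using f by auto
  have [measurable]: "F \<in> borel_measurable seq_algebra" unfolding F_def[abs_def] using ext[OF f_meas] by measurable
  define u where "u z = enn2real (dual F z)" for z
  have u_nn: "0 \<le> u z" for z by (simp add: u_def)
  have u_meas: "u \<in> borel_measurable mu" unfolding u_def[abs_def] by (intro id_mu) measurable
  have "(\<integral>\<^sup>+z. dual F z \<partial>mu) = (\<integral>\<^sup>+z. F z \<partial>mu)"
    using dual_integral[of F "\<lambda>_. 1"] by simp
  also have "\<dots> = (\<integral>\<^sup>+z. ennreal (f z) \<partial>mu)" by (intro nn_integral_cong) (simp add: F_def ext_def space_mu)
  also have "\<dots> < \<infinity>" using f nn by (simp add: nn_integral_eq_integral)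
  finally have fin: "(\<integral>\<^sup>+z. dual F z \<partial>mu) < \<infinity>" .
  have "AE z in mu. dual F z \<noteq> \<infinity>"
    using fin by (intro nn_integral_PInf_AE id_mu dual_measurable) auto
  then have AE_fin: "AE z in mu. ennreal (u z) = dual F z"
    by eventually_elim (simp add: u_def less_top)
  have u: "integrable mu u"
  proof (rule integrableI_nonneg)
    show "AE z in mu. 0 \<le> u z" by (simp add: u_def)
    have "(\<integral>\<^sup>+z. ennreal (u z) \<partial>mu) = (\<integral>\<^sup>+z. dual F z \<partial>mu)" by (rule nn_integral_cong_AE[OF AE_fin])
    then show "(\<integral>\<^sup>+z. ennreal (u z) \<partial>mu) < \<infinity>" using fin by simp
  qed (rule u_meas)
  have pos: "(\<integral>z. f z * g (left_shift z) \<partial>mu) = (\<integral>z. u z * g z \<partial>mu)"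
    if g: "g \<in> borel_measurable mu" and g0: "\<And>z. z \<in> shift_space A \<Longrightarrow> 0 \<le> g z" for g
  proof -
    have gT: "(\<lambda>z. g (left_shift z)) \<in> borel_measurable mu" by (rule measurable_compose[OF left_shift_mu g])
    have "(\<integral>z. f z * g (left_shift z) \<partial>mu) = enn2real (\<integral>\<^sup>+z. ennreal (f z * g (left_shift z)) \<partial>mu)"
    proof (intro integral_eq_nn_integral borel_measurable_times f_meas gT)
      show "AE z in mu. 0 \<le> f z * g (left_shift z)"
        using nn AE_space by eventually_elim (auto simp: space_mu left_shift_shift_space g0)
    qed
    also have "(\<integral>\<^sup>+z. ennreal (f z * g (left_shift z)) \<partial>mu) = (\<integral>\<^sup>+z. F z * (\<lambda>z. ennreal (ext g z)) (shift_by 1 z) \<partial>mu)"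
    proof (intro nn_integral_cong)
      fix z assume "z \<in> space mu"
      moreover from this have "shift_by 1 z \<in> shift_space A" by (simp add: space_mu shift_space_def shift_by_def)
      moreover have "left_shift z = shift_by 1 z" by (simp add: left_shift_def shift_by_def)
      ultimately show "ennreal (f z * g (left_shift z)) = F z * (\<lambda>z. ennreal (ext g z)) (shift_by 1 z)"
        using g0 by (simp add: F_def ext_def space_mu ennreal_mult'')
    qed
    also have "\<dots> = (\<integral>\<^sup>+z. dual F z * ennreal (ext g z) \<partial>mu)"
      by (intro dual_integral measurable_compose[OF ext[OF g]]) simp_all
    also have "\<dots> = (\<integral>\<^sup>+z. ennreal (u z * g z) \<partial>mu)"
    proof (rule nn_integral_cong_AE)
      show "AE z in mu. dual F z * ennreal (ext g z) = ennreal (u z * g z)"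
        using AE_fin AE_space
      proof eventually_elim
        case (elim z)
        have "dual F z * ennreal (ext g z) = ennreal (u z) * ennreal (g z)"
          using elim by (simp add: ext_def space_mu)
        then show ?case using g0[of z] elim by (simp add: ennreal_mult u_def space_mu)
      qed
    qed
    also have "enn2real \<dots> = (\<integral>z. u z * g z \<partial>mu)"
      using u_meas g g0 by (intro integral_eq_nn_integral[symmetric] borel_measurable_times AE_I2)
        (auto simp: space_mu u_nn)
    finally show ?thesis .
  qed
  show ?thesis
  proof (intro exI[of _ u] conjI ballI impI u)
    fix g :: "'v seq \<Rightarrow> real" assume g: "g \<in> borel_measurable mu" and "bounded (g ` space mu)"
    then obtain c where bd: "\<And>z. z \<in> shift_space A \<Longrightarrow> \<bar>g z\<bar> \<le> c" by (auto simp: bounded_iff space_mu)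
    have gT: "(\<lambda>z. g (left_shift z)) \<in> borel_measurable mu" by (rule measurable_compose[OF left_shift_mu g])
    have i1: "integrable mu (\<lambda>z. f z * g (left_shift z))"
      by (rule integrable_bounded_mult[OF f gT, of c]) (simp add: bd left_shift_shift_space)
    have i2: "integrable mu (\<lambda>z. u z * g z)" by (rule integrable_bounded_mult[OF u g bd])
    \<comment> \<open>Adding a constant reduces a bounded function to a nonnegative one; the
      constant itself is another nonnegative case.\<close>
    have g_nn: "0 \<le> g z + \<bar>c\<bar>" if "z \<in> shift_space A" for z using bd[OF that] by linarith
    have "(\<integral>z. f z * (g (left_shift z) + \<bar>c\<bar>) \<partial>mu) = (\<integral>z. u z * (g z + \<bar>c\<bar>) \<partial>mu)"
      using g by (intro pos g_nn) auto
    moreover have "(\<integral>z. f z * \<bar>c\<bar> \<partial>mu) = (\<integral>z. u z * \<bar>c\<bar> \<partial>mu)" by (rule pos) auto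
    ultimately show "(\<integral>z. f z * g (left_shift z) \<partial>mu) = (\<integral>z. u z * g z \<partial>mu)"
      using i1 i2 f u by (auto simp: distrib_left Bochner_Integration.integral_add)
  qed
qed

text \<open>Whatever function the choice returns, duality against indicators forces it to be
  nonnegative almost everywhere, so the operator can be iterated.\<close>

lemma transfer_operator_dual:
  assumes f: "integrable mu f" "AE z in mu. 0 \<le> f z"
  defines "u \<equiv> transfer_operator mu left_shift f"
  shows "integrable mu u \<and> (AE z in mu. 0 \<le> u z) \<and> (\<forall>g\<in>borel_measurable mu. bounded (g ` space mu) \<longrightarrow>
      (\<integral>z. f z * g (left_shift z) \<partial>mu) = (\<integral>z. u z * g z \<partial>mu))"
proof -
  have u: "integrable mu u" and dual: "\<And>g. g \<in> borel_measurable mu \<Longrightarrow> bounded (g ` space mu) \<Longrightarrow>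
      (\<integral>z. f z * g (left_shift z) \<partial>mu) = (\<integral>z. u z * g z \<partial>mu)"
    using someI_ex[OF transfer_exists[OF f], folded transfer_operator_def] unfolding u_def by blast+
  have "AE z in mu. 0 \<le> u z"
  proof (rule AE_nonneg_if_integrals_nonneg[OF u])
    fix E assume E: "E \<in> sets mu"
    have "0 \<le> (\<integral>z. f z * indicator E (left_shift z) \<partial>mu)"
      using f(2) by (intro integral_nonneg_AE) (auto elim!: eventually_mono)
    also have "\<dots> = (\<integral>z. u z * indicator E z \<partial>mu)"
      using E by (intro dual boundedI[of _ 1]) (auto split: split_indicator)
    finally show "0 \<le> (\<integral>z. u z * indicator E z \<partial>mu)" .
  qed
  with u dual show ?thesis by blast
qed

lemma transfer_power_dual:
  fixes f :: "'v seq \<Rightarrow> real" and k :: nat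
  defines "u \<equiv> (transfer_operator mu left_shift ^^ k) f"
  assumes f: "integrable mu f" "AE z in mu. 0 \<le> f z"
  shows "integrable mu u \<and> (AE z in mu. 0 \<le> u z) \<and> (\<forall>g\<in>borel_measurable mu. bounded (g ` space mu) \<longrightarrow>
      (\<integral>z. f z * g (shift_by k z) \<partial>mu) = (\<integral>z. u z * g z \<partial>mu))"
  unfolding u_def
proof (induction k)
  case 0
  then show ?case using f by simp
next
  case (Suc k)
  let ?u = "(transfer_operator mu left_shift ^^ k) f"
  have u: "integrable mu ?u" "AE z in mu. 0 \<le> ?u z" using Suc by auto
  have "(\<integral>z. f z * g (shift_by (Suc k) z) \<partial>mu) = (\<integral>z. transfer_operator mu left_shift ?u z * g z \<partial>mu)"
    if g: "g \<in> borel_measurable mu" "bounded (g ` space mu)" for g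
  proof -
    have "(\<lambda>z. g (left_shift z)) ` space mu \<subseteq> g ` space mu"
      by (auto simp: space_mu intro!: imageI left_shift_shift_space)
    then have gb: "bounded ((\<lambda>z. g (left_shift z)) ` space mu)" using g(2) by (rule bounded_subset[rotated])
    have "shift_by (Suc k) z = left_shift (shift_by k z)" for z :: "'v seq" by (simp add: shift_by_def left_shift_def)
    then have "(\<integral>z. f z * g (shift_by (Suc k) z) \<partial>mu) = (\<integral>z. ?u z * g (left_shift z) \<partial>mu)"
      using conjunct2[OF conjunct2[OF Suc], rule_format, OF measurable_compose[OF left_shift_mu g(1)] gb] by simp
    also have "\<dots> = (\<integral>z. transfer_operator mu left_shift ?u z * g z \<partial>mu)"
      using conjunct2[OF conjunct2[OF transfer_operator_dual[OF u]], rule_format, OF g] .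
    finally show ?thesis .
  qed
  with transfer_operator_dual[OF u] show ?case by simp
qed

end

section \<open>From averages of transfer iterates to return sums\<close>

locale normalized_ruelle = ruelle_system A \<eta> \<phi> h m
  for A :: "'v::countable \<Rightarrow> 'v \<Rightarrow> bool" and \<eta> \<phi> h m +
  fixes x :: "'v seq" and a :: "nat \<Rightarrow> real"
  assumes x: "x \<in> shift_space A" and normalizing: "normalizing_sequence mu left_shift a"
begin

abbreviation Y :: "'v seq set" where "Y \<equiv> cyl 1 x"

abbreviation returns :: "nat \<Rightarrow> real" where "returns k \<equiv> measure M (Y \<inter> shift_by k -` Y)"

text \<open>Dividing by the density makes the integral of the initial function over a set the
  conformal measure of its part in \<open>C\<close>. Integrals of the iterates are then return
  measures of \<open>M\<close>.\<close>

definition iterate :: "'v seq set \<Rightarrow> nat \<Rightarrow> 'v seq \<Rightarrow> real" where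
  "iterate C k = (transfer_operator mu left_shift ^^ k) (\<lambda>z. indicator C z / H z)"

lemma shift_sets [measurable]: "E \<in> sets seq_algebra \<Longrightarrow> shift_by k -` E \<in> sets (seq_algebra :: 'v seq measure)"
  using measurable_sets[OF measurable_shift_by[of k], of E] by (simp add: space_PiM)

lemma finite_in_Y: "E \<subseteq> Y \<Longrightarrow> emeasure M E < \<infinity>"
  using emeasure_mono[of E Y M] letter_finite[of x] by (simp add: sets_M) 

lemma measure_mono_Y: "E \<subseteq> F \<Longrightarrow> F \<subseteq> Y \<Longrightarrow> F \<in> sets seq_algebra \<Longrightarrow> measure M E \<le> measure M F"
  using finite_in_Y[of F] emeasure_mono[of E F M]
  by (auto simp: measure_def sets_M intro!: enn2real_mono)

lemma Y_pos: "0 < measure M Y"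
  using cyl_positive[OF x, of 1] letter_finite[of x] by (simp add: measure_def enn2real_positive_iff)

lemma indicator_mu: "E \<in> sets seq_algebra \<Longrightarrow> (indicator E :: _ \<Rightarrow> real) \<in> borel_measurable mu"
  by (intro id_mu borel_measurable_indicator)

lemma H_pos: "z \<in> shift_space A \<Longrightarrow> 0 < H z"
  by (simp add: H_def h_pos)

lemma indicator_div_H:
  assumes [measurable]: "C \<in> sets seq_algebra" "E \<in> sets seq_algebra" and C: "C \<subseteq> Y"
  shows "integrable mu (\<lambda>z. indicator C z / H z * indicator E z)"
    "(\<integral>z. indicator C z / H z * indicator E z \<partial>mu) = measure M (C \<inter> E)"
proof -
  have meas: "(\<lambda>z. indicator C z / H z * indicator E z) \<in> borel_measurable seq_algebra" by measurable
  have CE: "C \<inter> E \<in> sets M" by (simp add: sets_M)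
  have eq: "AE z in M. H z * (indicator C z / H z * indicator E z) = indicator (C \<inter> E) z"
    using M_AE_shift_space by eventually_elim (auto dest: H_pos split: split_indicator)
  have "integrable M (indicator (C \<inter> E) :: _ \<Rightarrow> real)"
    using finite_in_Y[of "C \<inter> E"] C CE by (intro integrable_real_indicator) auto
  then show "integrable mu (\<lambda>z. indicator C z / H z * indicator E z)"
    unfolding mu_integral(1)[OF meas] by (rule integrable_cong_AE_imp) (use eq in \<open>auto elim: eventually_mono\<close>)
  have "(\<integral>z. H z * (indicator C z / H z * indicator E z) \<partial>M) = (\<integral>z. indicator (C \<inter> E) z \<partial>M)"
    using eq CE by (intro integral_cong_AE) auto
  then show "(\<integral>z. indicator C z / H z * indicator E z \<partial>mu) = measure M (C \<inter> E)"
    unfolding mu_integral(2)[OF meas] by (simp add: space_M)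
qed

lemma iterate_integral:
  assumes C: "C \<in> sets seq_algebra" "C \<subseteq> Y"
  shows "integrable mu (iterate C k)" "AE z in mu. 0 \<le> iterate C k z"
    "E \<in> sets seq_algebra \<Longrightarrow> (\<integral>z. iterate C k z * indicator E z \<partial>mu) = measure M (C \<inter> shift_by k -` E)"
proof -
  have f: "integrable mu (\<lambda>z. indicator C z / H z)"
    using indicator_div_H(1)[OF C(1) _ C(2), of UNIV] sets.top[of seq_algebra] by (simp add: space_PiM)
  have "AE z in mu. 0 \<le> indicator C z / H z" using H_pos by (intro AE_I2) (simp add: space_mu less_imp_le)
  note dual = transfer_power_dual[OF f this, of k, folded iterate_def]
  show "integrable mu (iterate C k)" "AE z in mu. 0 \<le> iterate C k z" using dual by simp_all
  assume E: "E \<in> sets seq_algebra"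
  have "bounded ((indicator E :: _ \<Rightarrow> real) ` space mu)"
    by (rule boundedI[of _ 1]) (auto split: split_indicator)
  then have "(\<integral>z. iterate C k z * indicator E z \<partial>mu) = (\<integral>z. indicator C z / H z * indicator E (shift_by k z) \<partial>mu)"
    using dual indicator_mu[OF E] by simp
  also have "\<dots> = (\<integral>z. indicator C z / H z * indicator (shift_by k -` E) z \<partial>mu)"
    by (simp add: indicator_def)
  also have "\<dots> = measure M (C \<inter> shift_by k -` E)"
    by (rule indicator_div_H(2)[OF C(1) shift_sets[OF E] C(2)])
  finally show "(\<integral>z. iterate C k z * indicator E z \<partial>mu) = measure M (C \<inter> shift_by k -` E)" .
qed

lemma returns_to_subset:
  assumes E: "E \<in> sets seq_algebra" "E \<subseteq> Y"
  shows "measure M (Y \<inter> shift_by k -` E) * measure M Y \<le> exp (\<omega> 1) * (returns k * measure M E)"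
    "returns k * measure M E \<le> exp (\<omega> 1) * (measure M (Y \<inter> shift_by k -` E) * measure M Y)"
proof -
  have Y: "determined k Y" by (rule determined_cyl) simp
  have [measurable]: "E \<in> sets M" "Y \<in> sets M" "shift_by k -` Y \<in> sets M" "shift_by k -` E \<in> sets M"
    using E(1) by (simp_all add: sets_M shift_sets)
  have m: "emeasure M S = ennreal (measure M S)" if "S \<subseteq> Y" for S
    using finite_in_Y[OF that] by (simp add: emeasure_eq_ennreal_measure)
  have "(\<integral>\<^sup>+z\<in>Y \<inter> shift_by k -` Y. indicator E (shift_by k z) \<partial>M) = (\<integral>\<^sup>+z. indicator (Y \<inter> shift_by k -` E) z \<partial>M)"
    "(\<integral>\<^sup>+z\<in>Y. indicator E z \<partial>M) = (\<integral>\<^sup>+z. indicator E z \<partial>M)"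
    by (rule nn_integral_cong, use E(2) in \<open>force split: split_indicator\<close>)+
  then have int: "(\<integral>\<^sup>+z\<in>Y \<inter> shift_by k -` Y. indicator E (shift_by k z) \<partial>M) = ennreal (measure M (Y \<inter> shift_by k -` E))"
    "(\<integral>\<^sup>+z\<in>Y \<inter> shift_by k -` Y. 1 \<partial>M) = ennreal (returns k)"
    "(\<integral>\<^sup>+z\<in>Y. indicator E z \<partial>M) = ennreal (measure M E)" "(\<integral>\<^sup>+z\<in>Y. 1 \<partial>M) = ennreal (measure M Y)"
    using E(2) by (simp_all add: m)
  show "measure M (Y \<inter> shift_by k -` E) * measure M Y \<le> exp (\<omega> 1) * (returns k * measure M E)"
    using distortion[OF order_refl Y, of "indicator E" "\<lambda>_. 1" x] unfolding int by (simp add: ennreal_mult[symmetric])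
  show "returns k * measure M E \<le> exp (\<omega> 1) * (measure M (Y \<inter> shift_by k -` E) * measure M Y)"
    using distortion[OF order_refl Y, of "\<lambda>_. 1" "indicator E" x] unfolding int by (simp add: ennreal_mult[symmetric])
qed

text \<open>Inequalities between return measures to all subsets of \<open>Y\<close> become pointwise
  ones for the iterates. The sign \<open>s\<close> covers upper and lower bounds in one
  statement.\<close>

lemma iterate_compare:
  assumes C: "C \<in> sets seq_algebra" "C \<subseteq> Y"
    and nn: "\<And>E. E \<in> sets seq_algebra \<Longrightarrow> E \<subseteq> Y \<Longrightarrow> 0 \<le> s * (c * measure M E - measure M (C \<inter> shift_by k -` E))"
  shows "AE z in mu. z \<in> Y \<longrightarrow> 0 \<le> s * (c / H z - iterate C k z)"
proof -
  let ?F = "\<lambda>z. s * (c * (indicator Y z / H z * indicator UNIV z) - iterate C k z * indicator Y z)"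
  have Yseq: "Y \<in> sets seq_algebra" by measurable
  have U: "UNIV \<in> sets (seq_algebra :: 'v seq measure)" using sets.top[of "seq_algebra :: 'v seq measure"] by (simp add: space_PiM)
  have Ymu: "(indicator Y :: _ \<Rightarrow> real) \<in> borel_measurable mu" by (rule indicator_mu[OF Yseq])
  have iY: "integrable mu (\<lambda>z. iterate C k z * indicator Y z)"
    by (rule integrable_bounded_mult[OF iterate_integral(1)[OF C] Ymu, of 1]) (simp split: split_indicator)
  have F: "integrable mu ?F" using iY indicator_div_H(1)[OF Yseq U order_refl] by (intro integrable_mult_right Bochner_Integration.integrable_diff)
  have "AE z in mu. 0 \<le> ?F z"
  proof (rule AE_nonneg_if_integrals_nonneg[OF F])
    fix E assume "E \<in> sets mu"
    then have E: "E \<in> sets seq_algebra" by (rule sets_mu_seq)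
    have EY: "Y \<inter> E \<in> sets seq_algebra" using Yseq E by auto
    have i1: "integrable mu (\<lambda>z. indicator Y z / H z * indicator E z)" by (rule indicator_div_H(1)[OF Yseq E order_refl])
    have "(indicator (Y \<inter> E) :: _ \<Rightarrow> real) \<in> borel_measurable mu" using EY by (rule indicator_mu)
    then have i2: "integrable mu (\<lambda>z. iterate C k z * indicator (Y \<inter> E) z)"
      by (rule integrable_bounded_mult[OF iterate_integral(1)[OF C], of _ 1]) (simp split: split_indicator)
    have "(\<integral>z. ?F z * indicator E z \<partial>mu) = (\<integral>z. s * (c * (indicator Y z / H z * indicator E z) - iterate C k z * indicator (Y \<inter> E) z) \<partial>mu)"
      by (intro Bochner_Integration.integral_cong) (simp_all split: split_indicator)
    also have "\<dots> = s * (c * measure M (Y \<inter> E) - measure M (C \<inter> shift_by k -` (Y \<inter> E)))"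
      by (simp only: integral_mult_right_zero Bochner_Integration.integral_diff[OF integrable_mult_right[OF i1] i2]
        indicator_div_H(2)[OF Yseq E order_refl] iterate_integral(3)[OF C EY])
    also have "0 \<le> \<dots>" by (rule nn[OF EY]) simp
    finally show "0 \<le> (\<integral>z. ?F z * indicator E z \<partial>mu)" .
  qed
  then show ?thesis by eventually_elim (simp split: split_indicator_asm)
qed

text \<open>One letter of distortion shows that the iterate is comparable on \<open>Y\<close> with
  the return measure divided by the density, and so supplies an integrable majorant.\<close>

lemma iterate_upper:
  assumes C: "C \<in> sets seq_algebra" "C \<subseteq> Y"
  shows "AE z in mu. z \<in> Y \<longrightarrow> iterate C k z \<le> exp (\<omega> 1) * returns k / measure M Y / H z"
proof -
  have "AE z in mu. z \<in> Y \<longrightarrow> 0 \<le> 1 * (exp (\<omega> 1) * returns k / measure M Y / H z - iterate C k z)"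
  proof (rule iterate_compare[OF C])
    fix E assume E: "E \<in> sets seq_algebra" "E \<subseteq> Y"
    have "measure M (C \<inter> shift_by k -` E) \<le> measure M (Y \<inter> shift_by k -` E)"
      using C E by (intro measure_mono_Y) (auto intro!: sets.Int shift_sets)
    also have "\<dots> \<le> exp (\<omega> 1) * returns k / measure M Y * measure M E"
      using returns_to_subset(1)[OF E, of k] Y_pos by (simp add: field_simps)
    finally show "0 \<le> 1 * (exp (\<omega> 1) * returns k / measure M Y * measure M E - measure M (C \<inter> shift_by k -` E))" by simp
  qed
  then show ?thesis by eventually_elim simp
qed

lemma iterate_lower: "AE z in mu. z \<in> Y \<longrightarrow> exp (- \<omega> 1) * returns k / measure M Y / H z \<le> iterate Y k z"
proof -
  have "AE z in mu. z \<in> Y \<longrightarrow> 0 \<le> - 1 * (exp (- \<omega> 1) * returns k / measure M Y / H z - iterate Y k z)"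
  proof (rule iterate_compare)
    fix E assume E: "E \<in> sets seq_algebra" "E \<subseteq> Y"
    have "exp (- \<omega> 1) * returns k / measure M Y * measure M E \<le> measure M (Y \<inter> shift_by k -` E)"
      using returns_to_subset(2)[OF E, of k] Y_pos by (simp add: field_simps exp_minus)
    then show "0 \<le> - 1 * (exp (- \<omega> 1) * returns k / measure M Y * measure M E - measure M (Y \<inter> shift_by k -` E))" by simp
  qed simp_all
  then show ?thesis by eventually_elim simp
qed

lemma iterate_averages:
  assumes C: "C \<in> sets seq_algebra" "C \<subseteq> Y"
  shows "AE z in mu. (\<lambda>K. 1 / a K * (\<Sum>k<K. iterate C k z)) \<longlonglongrightarrow> measure M C"
proof -
  have U: "UNIV \<in> sets (seq_algebra :: 'v seq measure)" using sets.top[of "seq_algebra :: 'v seq measure"] by (simp add: space_PiM)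
  have f: "integrable mu (\<lambda>z. indicator C z / H z)" "(\<integral>z. indicator C z / H z \<partial>mu) = measure M C"
    using indicator_div_H[OF C(1) U C(2)] by simp_all
  from normalizing[unfolded normalizing_sequence_def, rule_format, OF f(1)]
  show ?thesis unfolding iterate_def f(2) .
qed

lemma mu_null_iff: "E \<in> sets seq_algebra \<Longrightarrow> (AE z in mu. z \<notin> E) \<longleftrightarrow> E \<in> null_sets M"
proof -
  assume E [measurable]: "E \<in> sets seq_algebra"
  have hm: "(\<lambda>z. ennreal (h z)) \<in> borel_measurable m" using h_measurable by measurable
  have "(AE z in mu. z \<notin> E) \<longleftrightarrow> (AE z in m. 0 < ennreal (h z) \<longrightarrow> z \<notin> E)"
    unfolding mu_def by (rule AE_density[OF hm])
  also have "\<dots> \<longleftrightarrow> (AE z in m. z \<notin> E)"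
    using h_pos by (intro AE_cong) (simp add: space_m)
  also have "\<dots> \<longleftrightarrow> (AE z in M. z \<notin> E)"
    unfolding M_def by (subst AE_distr_iff[OF id_measurable]) auto
  also have "\<dots> \<longleftrightarrow> E \<in> null_sets M" by (rule AE_iff_null_sets[symmetric]) (simp add: sets_M)
  finally show ?thesis .
qed

text \<open>The return measures do not depend on the point. Since \<open>Y\<close> has positive
  measure, some point of it satisfies both the convergence of averages and the lower bounds, and
  this single point bounds all averaged returns.\<close>

lemma returns_bounded: "\<exists>c. \<forall>K. \<bar>1 / a K\<bar> * (\<Sum>k<K. returns k) \<le> c"
proof -
  have Yseq: "Y \<in> sets seq_algebra" by measurable
  have "AE z in mu. \<forall>k. z \<in> Y \<longrightarrow> exp (- \<omega> 1) * returns k / measure M Y / H z \<le> iterate Y k z"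
    unfolding AE_all_countable using iterate_lower by blast
  with iterate_averages[OF Yseq order_refl]
  have ae: "AE z in mu. (\<lambda>K. 1 / a K * (\<Sum>k<K. iterate Y k z)) \<longlonglongrightarrow> measure M Y \<and>
      (\<forall>k. z \<in> Y \<longrightarrow> exp (- \<omega> 1) * returns k / measure M Y / H z \<le> iterate Y k z)"
    by eventually_elim blast
  have "\<not> (AE z in mu. z \<notin> Y)"
    unfolding mu_null_iff[OF Yseq] using Y_pos by (auto simp: null_sets_def measure_def)
  then have "\<exists>z\<in>space mu. z \<in> Y \<and> (\<lambda>K. 1 / a K * (\<Sum>k<K. iterate Y k z)) \<longlonglongrightarrow> measure M Y \<and>
      (\<forall>k. exp (- \<omega> 1) * returns k / measure M Y / H z \<le> iterate Y k z)"
  proof (rule contrapos_np)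
    assume *: "\<not> ?thesis"
    show "AE z in mu. z \<notin> Y" using ae AE_space
    proof eventually_elim
      case (elim z)
      then show ?case using * by blast
    qed
  qed
  then obtain z where z: "z \<in> shift_space A" and conv: "(\<lambda>K. 1 / a K * (\<Sum>k<K. iterate Y k z)) \<longlonglongrightarrow> measure M Y"
    and low: "\<And>k. exp (- \<omega> 1) * returns k / measure M Y / H z \<le> iterate Y k z"
    unfolding space_mu by blast
  obtain B where B: "\<And>K. norm (1 / a K * (\<Sum>k<K. iterate Y k z)) \<le> B"
    using convergent_imp_Bseq[OF convergentI[OF conv]] unfolding Bseq_def by blast
  define d where "d = exp (- \<omega> 1) / measure M Y / H z"
  have d: "0 < d" using Y_pos H_pos[OF z] by (simp add: d_def)
  have "\<bar>1 / a K\<bar> * (\<Sum>k<K. returns k) \<le> B / d" for K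
  proof -
    have low': "d * returns k \<le> iterate Y k z" for k using low[of k] by (simp add: d_def)
    have "d * (\<bar>1 / a K\<bar> * (\<Sum>k<K. returns k)) = \<bar>1 / a K\<bar> * (\<Sum>k<K. d * returns k)"
      by (simp add: sum_distrib_left mult.left_commute)
    also have "\<dots> \<le> \<bar>1 / a K\<bar> * (\<Sum>k<K. iterate Y k z)"
      by (intro mult_left_mono sum_mono low') auto
    also have "\<dots> \<le> \<bar>1 / a K * (\<Sum>k<K. iterate Y k z)\<bar>" unfolding abs_mult by (intro mult_left_mono) auto
    also have "\<dots> \<le> B" using B[of K] by simp
    finally show ?thesis using d by (simp add: field_simps)
  qed
  then show ?thesis by blast
qed

text \<open>Integrates the almost everywhere convergence over \<open>E\<close>. Domination combines
  the upper bound for the iterates with the bounded averages of the returns, leaving a multiple of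
  the indicator of \<open>E\<close> over the density.\<close>

lemma return_sums:
  assumes C: "C \<in> sets seq_algebra" "C \<subseteq> Y" and E: "E \<in> sets seq_algebra" "E \<subseteq> Y"
  shows "(\<lambda>K. (\<Sum>k<K. measure M (C \<inter> shift_by k -` E)) / a K) \<longlonglongrightarrow> measure mu (E \<inter> shift_space A) * measure M C"
proof -
  obtain c where c: "\<And>K. \<bar>1 / a K\<bar> * (\<Sum>k<K. returns k) \<le> c" using returns_bounded by blast
  let ?s = "\<lambda>K z. 1 / a K * (\<Sum>k<K. iterate C k z * indicator E z)"
  define e where "e = exp (\<omega> 1) / measure M Y"
  have e: "0 < e" using Y_pos by (simp add: e_def)
  have U: "UNIV \<in> sets (seq_algebra :: 'v seq measure)" using sets.top[of "seq_algebra :: 'v seq measure"] by (simp add: space_PiM)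
  have Emu: "(indicator E :: _ \<Rightarrow> real) \<in> borel_measurable mu" using E by (intro indicator_mu) auto
  have iE: "integrable mu (\<lambda>z. iterate C k z * indicator E z)" for k
    by (rule integrable_bounded_mult[OF iterate_integral(1)[OF C] Emu, of 1]) (simp split: split_indicator)
  have "AE z in mu. \<forall>k. z \<in> Y \<longrightarrow> iterate C k z \<le> exp (\<omega> 1) * returns k / measure M Y / H z"
    unfolding AE_all_countable using iterate_upper[OF C] by blast
  moreover have "AE z in mu. \<forall>k. 0 \<le> iterate C k z"
    unfolding AE_all_countable using iterate_integral(2)[OF C] by blast
  ultimately have bound: "AE z in mu. \<forall>k. 0 \<le> iterate C k z \<and> (z \<in> Y \<longrightarrow> iterate C k z \<le> e * returns k / H z)"
    by eventually_elim (simp add: e_def mult.commute)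
  have "(\<lambda>K. \<integral>z. ?s K z \<partial>mu) \<longlonglongrightarrow> (\<integral>z. measure M C * indicator E z \<partial>mu)"
  proof (rule integral_dominated_convergence[where w = "\<lambda>z. e * c * (indicator E z / H z * indicator UNIV z)"])
    show "(\<lambda>z. measure M C * indicator E z) \<in> borel_measurable mu" using Emu by measurable
    show "?s K \<in> borel_measurable mu" for K using borel_measurable_integrable[OF iE] by measurable
    show "integrable mu (\<lambda>z. e * c * (indicator E z / H z * indicator UNIV z))"
      by (rule integrable_mult_right[OF indicator_div_H(1)[OF E(1) U E(2)]])
    show "AE z in mu. (\<lambda>K. ?s K z) \<longlonglongrightarrow> measure M C * indicator E z"
      using iterate_averages[OF C]
    proof eventually_elim
      case (elim z)
      from tendsto_mult_right[OF elim, of "indicator E z"] show ?case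
        by (simp add: sum_distrib_right mult.assoc)
    qed
    show "AE z in mu. norm (?s K z) \<le> e * c * (indicator E z / H z * indicator UNIV z)" for K
      using bound AE_space
    proof eventually_elim
      case (elim z)
      show ?case
      proof (cases "z \<in> E")
        case True
        have hz: "0 < H z" using elim H_pos by (simp add: space_mu)
        have "norm (?s K z) = \<bar>1 / a K\<bar> * (\<Sum>k<K. iterate C k z)"
          using True elim(1) unfolding norm_mult by (simp add: sum_nonneg)
        also have "\<dots> \<le> \<bar>1 / a K\<bar> * (\<Sum>k<K. e * returns k / H z)"
          using True elim(1) E(2) by (intro mult_left_mono sum_mono) auto
        also have "\<dots> = e / H z * (\<bar>1 / a K\<bar> * (\<Sum>k<K. returns k))"
          by (simp add: sum_distrib_left sum_divide_distrib mult_ac)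
        also have "\<dots> \<le> e / H z * c" using e hz by (intro mult_left_mono c) auto
        finally show ?thesis using True by (simp add: mult_ac)
      qed simp
    qed
  qed
  moreover have "(\<integral>z. ?s K z \<partial>mu) = (\<Sum>k<K. measure M (C \<inter> shift_by k -` E)) / a K" for K
    unfolding integral_mult_right_zero Bochner_Integration.integral_sum[OF iE] iterate_integral(3)[OF C E(1)] by simp
  moreover have "(\<integral>z. measure M C * indicator E z \<partial>mu) = measure mu (E \<inter> shift_space A) * measure M C"
    by (simp add: space_mu)
  ultimately show ?thesis by (simp only:)
qed

text \<open>Where the orbit never meets \<open>x 0\<close>, all iterates of \<open>Y\<close> vanish:
  points of \<open>Y\<close> return to their letter infinitely often and cannot enter this set. The
  averages would then tend to 0 instead of the positive measure of \<open>Y\<close>.\<close>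

lemma visit_AE: "AE z in M. \<exists>l. z l = x 0"
proof -
  define E where "E = {z :: 'v seq. \<forall>l. z l \<noteq> x 0}"
  have "E = (\<Inter>l. UNIV - {z. z l = x 0})" by (auto simp: E_def)
  also have "\<dots> \<in> sets seq_algebra"
    using sets.top[of "seq_algebra :: 'v seq measure"]
    by (intro sets.countable_INT sets.Diff letter_sets) (auto simp: space_PiM)
  finally have E: "E \<in> sets seq_algebra" .
  have Yseq: "Y \<in> sets seq_algebra" by measurable
  have zero: "measure M (Y \<inter> shift_by k -` E) = 0" for k
  proof -
    have "AE z in M. z \<notin> Y \<inter> shift_by k -` E"
      using visits_unbounded[of 0 "x 0"]
    proof eventually_elim
      case (elim z)
      show ?case
      proof
        assume z: "z \<in> Y \<inter> shift_by k -` E"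
        then obtain l where l: "k \<le> l" "z l = x 0" using elim by (auto simp: cyl_def)
        have "shift_by k z (l - k) \<noteq> x 0" using z by (simp add: E_def)
        then show False using l by (simp add: shift_by_def)
      qed
    qed
    then have "emeasure M (Y \<inter> shift_by k -` E) = 0"
      using AE_iff_null_sets[of "Y \<inter> shift_by k -` E" M] Yseq shift_sets[OF E] by (auto simp: sets_M)
    then show ?thesis by (simp add: measure_def)
  qed
  have Emu: "(indicator E :: _ \<Rightarrow> real) \<in> borel_measurable mu" using E by (intro indicator_mu) auto
  have "AE z in mu. \<forall>k. iterate Y k z * indicator E z = 0"
    unfolding AE_all_countable
  proof
    fix k
    have "integrable mu (\<lambda>z. iterate Y k z * indicator E z)"
      by (rule integrable_bounded_mult[OF iterate_integral(1)[OF Yseq order_refl] Emu, of 1]) (simp split: split_indicator)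
    moreover have "AE z in mu. 0 \<le> iterate Y k z * indicator E z"
      using iterate_integral(2)[OF Yseq order_refl, of k] by eventually_elim simp
    ultimately show "AE z in mu. iterate Y k z * indicator E z = 0"
      using iterate_integral(3)[OF Yseq order_refl E, of k] zero[of k] by (simp add: integral_nonneg_eq_0_iff_AE)
  qed
  with iterate_averages[OF Yseq order_refl] have "AE z in mu. z \<notin> E"
  proof eventually_elim
    case (elim z)
    show ?case
    proof
      assume "z \<in> E"
      then have "iterate Y k z = 0" for k using elim(2) by simp
      then have "(\<lambda>K. 0) \<longlonglongrightarrow> measure M Y" using elim(1) by simp
      then show False using Y_pos by (simp add: LIMSEQ_const_iff)
    qed
  qed
  then have "E \<in> null_sets M" using mu_null_iff[OF E] by simp
  then have "AE z in M. z \<notin> E" by (rule AE_not_in)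
  then show ?thesis by eventually_elim (simp add: E_def)
qed

end

section \<open>Hitting processes of the Markov shift\<close>

locale orbit_renewal = normalized_ruelle A \<eta> \<phi> h m x a
  for A :: "'v::countable \<Rightarrow> 'v \<Rightarrow> bool" and \<eta> \<phi> h m x a +
  fixes \<alpha> :: real and j :: nat
  assumes a: "mono a" "regularly_varying_seq a \<alpha>" "0 < \<alpha>" "\<alpha> \<le> 1"
    and last_visit: "x j = x 0" "\<And>i. j < i \<Longrightarrow> x i \<noteq> x 0"
begin

definition target :: "nat \<Rightarrow> 'v seq set" where "target n = cyl n x \<inter> shift_space A"

lemma target_seq [measurable]: "target n \<in> sets seq_algebra" unfolding target_def by measurable

lemma target_mu: "target n \<in> sets mu"
  by (auto simp: sets_mu sets_restrict_space target_def)

abbreviation \<beta> :: "nat \<Rightarrow> real" where "\<beta> n \<equiv> measure mu (target n)"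

abbreviation b :: "nat \<Rightarrow> real" where "b n \<equiv> measure M (cyl n x)"

lemma cyl_finite: "1 \<le> n \<Longrightarrow> emeasure M (cyl n x) < \<infinity>"
  by (rule finite_in_Y) (auto simp: cyl_def)

lemma b_pos: "1 \<le> n \<Longrightarrow> 0 < b n"
  using cyl_positive[OF x, of n] cyl_finite[of n] by (simp add: measure_def enn2real_positive_iff)

text \<open>Continuity of \<open>h\<close> at \<open>x\<close> makes the invariant measure on a
  small target nearly \<open>h x\<close> times the conformal one, uniformly over integrands with
  values in the unit interval.\<close>

lemma mu_near:
  assumes e: "0 < e"
  shows "\<exists>k\<ge>1. \<forall>n\<ge>k. emeasure mu (target n) < \<infinity> \<and>
    (\<forall>F. F \<in> borel_measurable seq_algebra \<longrightarrow> (\<forall>z. 0 \<le> F z \<and> F z \<le> 1) \<longrightarrow>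
      \<bar>(\<integral>z. F z * indicator (target n) z \<partial>mu) - h x * (\<integral>z. F z * indicator (cyl n x) z \<partial>M)\<bar> \<le> e * b n)"
proof -
  obtain k0 where k0: "\<And>z. z \<in> cyl k0 x \<Longrightarrow> z \<in> shift_space A \<Longrightarrow> \<bar>h z - h x\<bar> < e"
    using h_continuous[OF x e] by blast
  have "emeasure mu (target n) < \<infinity> \<and>
    (\<forall>F. F \<in> borel_measurable seq_algebra \<longrightarrow> (\<forall>z. 0 \<le> F z \<and> F z \<le> 1) \<longrightarrow>
      \<bar>(\<integral>z. F z * indicator (target n) z \<partial>mu) - h x * (\<integral>z. F z * indicator (cyl n x) z \<partial>M)\<bar> \<le> e * b n)"
    if n: "max 1 k0 \<le> n" for n
  proof -
    have near: "AE z in M. z \<in> cyl n x \<longrightarrow> \<bar>H z - h x\<bar> \<le> e"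
      using M_AE_shift_space
    proof eventually_elim
      case (elim z)
      show ?case
      proof
        assume "z \<in> cyl n x"
        then have "z \<in> cyl k0 x" using n by (auto simp: cyl_def)
        then show "\<bar>H z - h x\<bar> \<le> e" using k0[of z] elim by (simp add: H_def)
      qed
    qed
    have fin: "emeasure M (cyl n x) < \<infinity>" using n by (intro cyl_finite) simp
    have "emeasure mu (target n) = (\<integral>\<^sup>+z. indicator (target n) z \<partial>mu)"
      by (rule nn_integral_indicator[symmetric]) (rule target_mu)
    also have "\<dots> = (\<integral>\<^sup>+z. ennreal (H z) * indicator (target n) z \<partial>M)" by (rule mu_nn_integral) measurable
    also have "\<dots> \<le> (\<integral>\<^sup>+z. ennreal (h x + e) * indicator (cyl n x) z \<partial>M)"
    proof (rule nn_integral_mono_AE)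
      show "AE z in M. ennreal (H z) * indicator (target n) z \<le> ennreal (h x + e) * indicator (cyl n x) z"
        using near by eventually_elim (auto simp: target_def intro!: ennreal_leI split: split_indicator)
    qed
    also have "\<dots> = ennreal (h x + e) * emeasure M (cyl n x)"
      by (rule nn_integral_cmult_indicator) (simp add: sets_M)
    also have "\<dots> < \<infinity>" using fin by (simp add: ennreal_mult_less_top)
    finally have 1: "emeasure mu (target n) < \<infinity>" .
    have 2: "\<bar>(\<integral>z. F z * indicator (target n) z \<partial>mu) - h x * (\<integral>z. F z * indicator (cyl n x) z \<partial>M)\<bar> \<le> e * b n"
      if F [measurable]: "F \<in> borel_measurable seq_algebra" and bd: "\<And>z. 0 \<le> F z \<and> F z \<le> 1" for F
    proof -
      have ind: "integrable M (\<lambda>z. c * indicator (cyl n x) z :: real)" for c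
        using fin by (intro integrable_mult_right integrable_real_indicator) (auto simp: sets_M)
      have i1: "integrable M (\<lambda>z. h x * (F z * indicator (cyl n x) z))"
        using bd by (intro integrable_mult_right Bochner_Integration.integrable_bound[OF ind[of 1]]) (auto split: split_indicator)
      have AE: "AE z in M. \<bar>H z * (F z * indicator (target n) z) - h x * (F z * indicator (cyl n x) z)\<bar> \<le> e * indicator (cyl n x) z"
        using near M_AE_shift_space
      proof eventually_elim
        case (elim z)
        have "\<bar>H z - h x\<bar> * F z \<le> e * 1" if "z \<in> cyl n x" using elim bd[of z] that by (intro mult_mono) auto
        moreover have "\<bar>H z * F z - h x * F z\<bar> = \<bar>H z - h x\<bar> * F z"
          using bd[of z] by (simp add: left_diff_distrib[symmetric] abs_mult)
        ultimately show ?case using elim(2) by (cases "z \<in> cyl n x") (simp_all add: target_def)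
      qed
      have i2: "integrable M (\<lambda>z. H z * (F z * indicator (target n) z) - h x * (F z * indicator (cyl n x) z))"
        using AE e by (intro Bochner_Integration.integrable_bound[OF ind[of e]]) (auto elim!: eventually_mono)
      have i3: "integrable M (\<lambda>z. H z * (F z * indicator (target n) z))"
        using Bochner_Integration.integrable_add[OF i2 i1] by simp
      have "(\<integral>z. F z * indicator (target n) z \<partial>mu) = (\<integral>z. H z * (F z * indicator (target n) z) \<partial>M)"
        by (rule mu_integral(2)) measurable
      then have eq: "(\<integral>z. F z * indicator (target n) z \<partial>mu) - h x * (\<integral>z. F z * indicator (cyl n x) z \<partial>M)
          = (\<integral>z. H z * (F z * indicator (target n) z) - h x * (F z * indicator (cyl n x) z) \<partial>M)"
        unfolding Bochner_Integration.integral_diff[OF i3 i1] by simp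
      show ?thesis unfolding eq using abs_integral_le[OF ind AE] by (simp add: space_M)
    qed
    show ?thesis using 1 2 by blast
  qed
  then show ?thesis by (intro exI[of _ "max 1 k0"]) simp
qed

abbreviation start :: "nat \<Rightarrow> 'v seq measure" where "start n \<equiv> uniform_measure mu (target n)"

lemma beta_near:
  assumes e: "0 < e"
  shows "eventually (\<lambda>n. emeasure mu (target n) < \<infinity> \<and> \<bar>\<beta> n - h x * b n\<bar> \<le> e * b n) sequentially"
proof -
  obtain k where k: "1 \<le> k" and near: "\<And>n. k \<le> n \<Longrightarrow> emeasure mu (target n) < \<infinity> \<and>
    (\<forall>F. F \<in> borel_measurable seq_algebra \<longrightarrow> (\<forall>z. 0 \<le> F z \<and> F z \<le> 1) \<longrightarrow>
      \<bar>(\<integral>z. F z * indicator (target n) z \<partial>mu) - h x * (\<integral>z. F z * indicator (cyl n x) z \<partial>M)\<bar> \<le> e * b n)"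
    using mu_near[OF e] by blast
  have "emeasure mu (target n) < \<infinity> \<and> \<bar>\<beta> n - h x * b n\<bar> \<le> e * b n" if "k \<le> n" for n
  proof -
    have "target n \<inter> shift_space A = target n" by (auto simp: target_def)
    then show ?thesis using near[OF that] by (auto dest!: spec[of _ "\<lambda>_. 1"] simp: space_mu space_M)
  qed
  then show ?thesis unfolding eventually_sequentially by blast
qed

lemma density: "(\<lambda>n. \<beta> n / b n) \<longlonglongrightarrow> h x"
proof (rule LIMSEQ_I)
  fix r :: real assume r: "0 < r"
  have "eventually (\<lambda>n. norm (\<beta> n / b n - h x) < r) sequentially"
    using beta_near[OF half_gt_zero[OF r]] eventually_ge_at_top[of 1]
  proof eventually_elim
    case (elim n)
    have b: "0 < b n" using elim by (intro b_pos)
    have "\<beta> n / b n - h x = (\<beta> n - h x * b n) / b n" using b by (simp add: field_simps)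
    then have "\<bar>\<beta> n / b n - h x\<bar> = \<bar>\<beta> n - h x * b n\<bar> / b n" using b by (simp add: abs_divide)
    also have "\<dots> \<le> r / 2" using elim b by (simp add: field_simps)
    finally show ?case using r by simp
  qed
  then show "\<exists>no. \<forall>n\<ge>no. norm (\<beta> n / b n - h x) < r" by (simp add: eventually_sequentially)
qed

lemma eventually_beta: "eventually (\<lambda>n. 1 \<le> n \<and> emeasure mu (target n) < \<infinity> \<and> h x / 2 * b n \<le> \<beta> n \<and> 0 < \<beta> n) sequentially"
proof -
  have "0 < h x / 2" using h_pos[OF x] by simp
  from beta_near[OF this] eventually_ge_at_top[of 1] show ?thesis
  proof eventually_elim
    case (elim n)
    have b: "0 < b n" using elim by (intro b_pos)
    have "h x / 2 * b n \<le> \<beta> n" using abs_le_D2[OF conjunct2[OF elim(1)]] by (simp add: field_simps)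
    moreover have "0 < h x / 2 * b n" using b h_pos[OF x] by simp
    ultimately show ?case using elim by auto
  qed
qed

text \<open>The nearly constant density cancels in the normalisation, so conditioning either measure
  on the target gives the same asymptotic means.\<close>

lemma start_compare:
  assumes F: "\<And>n. F n \<in> borel_measurable seq_algebra" "\<And>n z. 0 \<le> F n z \<and> F n z \<le> 1"
  shows "(\<lambda>n. (\<integral>z. F n z \<partial>start n) - (\<integral>z. F n z * indicator (cyl n x) z \<partial>M) / b n) \<longlonglongrightarrow> 0"
proof (rule LIMSEQ_I)
  fix r :: real assume r: "0 < r"
  \<comment> \<open>The two error terms contribute \<open>2 * e\<close>, and
    \<open>\<beta> n\<close> is at least \<open>h x / 2 * b n\<close>; so the total error is
    \<open>4 * e / h x\<close>, half of \<open>r\<close>.\<close>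
  define e where "e = r * h x / 8"
  have h: "0 < h x" by (rule h_pos[OF x])
  have e: "0 < e" using r h by (simp add: e_def)
  obtain k where near: "\<And>n. k \<le> n \<Longrightarrow> emeasure mu (target n) < \<infinity> \<and>
    (\<forall>F. F \<in> borel_measurable seq_algebra \<longrightarrow> (\<forall>z. 0 \<le> F z \<and> F z \<le> 1) \<longrightarrow>
      \<bar>(\<integral>z. F z * indicator (target n) z \<partial>mu) - h x * (\<integral>z. F z * indicator (cyl n x) z \<partial>M)\<bar> \<le> e * b n)"
    using mu_near[OF e] by blast
  have "eventually (\<lambda>n. norm ((\<integral>z. F n z \<partial>start n) - (\<integral>z. F n z * indicator (cyl n x) z \<partial>M) / b n - 0) < r) sequentially"
    using eventually_beta beta_near[OF e] eventually_ge_at_top[of k]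
  proof eventually_elim
    case (elim n)
    define I where "I = (\<integral>z. F n z * indicator (cyl n x) z \<partial>M)"
    define I' where "I' = (\<integral>z. F n z * indicator (target n) z \<partial>mu)"
    have b: "0 < b n" using elim by (intro b_pos) simp
    have I': "\<bar>I' - h x * I\<bar> \<le> e * b n"
      unfolding I_def I'_def using conjunct2[OF near[OF elim(3)], rule_format, OF F(1)[of n] F(2)[of n]] .
    have I: "\<bar>I\<bar> \<le> b n"
    proof -
      have "0 \<le> I" unfolding I_def using F(2) by (intro Bochner_Integration.integral_nonneg) simp
      moreover have "I \<le> (\<integral>z. indicator (cyl n x) z \<partial>M)"
        unfolding I_def using F(2) cyl_finite[of n] elim(1)
        by (intro integral_mono_AE' integrable_real_indicator) (auto simp: sets_M mult_left_le_one_le)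
      ultimately show ?thesis by (simp add: space_M)
    qed
    have "ennreal (indicator (target n) z / \<beta> n) = indicator (target n) z / emeasure mu (target n)" for z
      using elim(1) divide_ennreal[of 1 "\<beta> n"]
      by (cases "z \<in> target n") (simp_all add: emeasure_eq_ennreal_measure less_top[symmetric])
    then have "start n = density mu (\<lambda>z. ennreal (indicator (target n) z / \<beta> n))"
      unfolding uniform_measure_def by simp
    then have "(\<integral>z. F n z \<partial>start n) = (\<integral>z. (indicator (target n) z / \<beta> n) *\<^sub>R F n z \<partial>mu)"
      using target_mu[of n] id_mu[OF F(1)[of n]] by (simp add: integral_density)
    also have "\<dots> = (\<integral>z. (F n z * indicator (target n) z) * inverse (\<beta> n) \<partial>mu)"
      by (simp add: divide_inverse mult_ac)
    also have "\<dots> = I' / \<beta> n" unfolding integral_mult_left_zero I'_def by (simp add: divide_inverse)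
    finally have start: "(\<integral>z. F n z \<partial>start n) = I' / \<beta> n" .
    have beta: "0 < \<beta> n" using elim(1) by simp
    have "I' / \<beta> n - I / b n = ((I' - h x * I) * b n - I * (\<beta> n - h x * b n)) / (\<beta> n * b n)"
      using b beta by (simp add: field_simps)
    then have "\<bar>I' / \<beta> n - I / b n\<bar> = \<bar>(I' - h x * I) * b n - I * (\<beta> n - h x * b n)\<bar> / (\<beta> n * b n)"
      using b beta by (simp add: abs_divide abs_mult)
    also have "\<dots> \<le> (\<bar>(I' - h x * I) * b n\<bar> + \<bar>I * (\<beta> n - h x * b n)\<bar>) / (\<beta> n * b n)"
      using b beta by (intro divide_right_mono abs_triangle_ineq4) simp
    also have "\<dots> \<le> (e * b n * b n + b n * (e * b n)) / (\<beta> n * b n)"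
      using b beta I I' elim(2) unfolding abs_mult by (intro divide_right_mono add_mono mult_mono) auto
    also have "\<dots> = 2 * e * b n / \<beta> n" using b by (simp add: field_simps)
    also have "\<dots> \<le> 2 * e * b n / (h x / 2 * b n)"
      using elim(1) b h e by (intro divide_left_mono) auto
    also have "\<dots> = r / 2" using b h by (simp add: e_def field_simps)
    finally show ?case unfolding start I_def[symmetric] using r by simp
  qed
  then show "\<exists>no. \<forall>n\<ge>no. norm ((\<integral>z. F n z \<partial>start n) - (\<integral>z. F n z * indicator (cyl n x) z \<partial>M) / b n - 0) < r"
    by (simp add: eventually_sequentially)
qed

lemma beta_0: "\<beta> \<longlonglongrightarrow> 0"
proof -
  have b0: "b \<longlonglongrightarrow> 0" by (rule singleton_null[OF last_visit])
  have "(\<lambda>n. \<beta> n / b n * b n) \<longlonglongrightarrow> h x * 0" by (intro tendsto_mult density b0)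
  moreover have "eventually (\<lambda>n. \<beta> n / b n * b n = \<beta> n) sequentially"
    using eventually_ge_at_top[of 1]
  proof eventually_elim
    case (elim n)
    then show ?case using b_pos[of n] by simp
  qed
  ultimately show ?thesis by (auto dest: Lim_transform_eventually)
qed

text \<open>The scale exists because the measures of the targets are eventually positive and tend to
  0.\<close>

lemma scale_exists:
  "\<exists>N :: nat \<Rightarrow> nat. filterlim N at_top sequentially \<and> (\<lambda>n. a (N n) * \<beta> n) \<longlonglongrightarrow> 1 \<and>
    eventually (\<lambda>n. scaling a (\<beta> n) = 1 / real (N n)) sequentially"
proof -
  have "eventually (\<lambda>n. 0 < \<beta> n) sequentially" using eventually_beta by eventually_elim simp
  then obtain N where "filterlim N at_top sequentially" "eventually (\<lambda>n. scaling a (\<beta> n) = 1 / real (N n)) sequentially"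
      "(\<lambda>n. a (N n) * \<beta> n) \<longlonglongrightarrow> 1"
    by (rule scaling_eq_inverse_nat[OF a(1-3) _ beta_0])
  then show ?thesis by (intro exI[of _ N] conjI)
qed

definition \<N> :: "nat \<Rightarrow> nat" where
  "\<N> = (SOME N. filterlim N at_top sequentially \<and> (\<lambda>n. a (N n) * \<beta> n) \<longlonglongrightarrow> 1 \<and>
    eventually (\<lambda>n. scaling a (\<beta> n) = 1 / real (N n)) sequentially)"

lemma scale:
  "filterlim \<N> at_top sequentially" "(\<lambda>n. a (\<N> n) * \<beta> n) \<longlonglongrightarrow> 1"
  "eventually (\<lambda>n. scaling a (\<beta> n) = 1 / real (\<N> n)) sequentially"
  using someI_ex[OF scale_exists, folded \<N>_def] by blast+

sublocale er: ergodic_renewal M x \<omega> j a \<alpha> \<beta> "h x" \<N>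
proof (unfold_locales)
  show "sets M = sets seq_algebra" by (rule sets_M)
  show "emeasure M (cyl 1 x) < \<infinity>" by (rule letter_finite)
  show "0 < emeasure M (cyl n x)" for n by (rule cyl_positive[OF x])
  show "\<omega> \<longlonglongrightarrow> 0" by (rule oscillation)
  show "x j = x 0" by (rule last_visit)
  show "x i \<noteq> x 0" if "j < i" for i using that by (rule last_visit)
  show "mono a" "regularly_varying_seq a \<alpha>" "0 < \<alpha>" "\<alpha> \<le> 1" by (rule a)+
  show "0 < h x" by (rule h_pos[OF x])
  show "(\<lambda>n. \<beta> n / b n) \<longlonglongrightarrow> h x" by (rule density)
  show "eventually (\<lambda>n. \<forall>C\<in>sets M. C \<subseteq> Y \<longrightarrow>
      (\<lambda>K. (\<Sum>k<K. measure M (C \<inter> shift_by k -` cyl n x)) / a K) \<longlonglongrightarrow> \<beta> n * measure M C) sequentially"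
    using eventually_ge_at_top[of 1]
  proof eventually_elim
    case (elim n)
    have sub: "cyl n x \<subseteq> Y" using elim by (auto simp: cyl_def)
    show ?case unfolding target_def using return_sums[OF _ _ cyl_sets sub] by (simp add: sets_M)
  qed
  show "b \<longlonglongrightarrow> 0" by (rule singleton_null[OF last_visit])
  show "filterlim \<N> at_top sequentially" "(\<lambda>n. a (\<N> n) * \<beta> n) \<longlonglongrightarrow> 1" by (rule scale)+
  show "emeasure M (cyl 1 p) < \<infinity>" for p by (rule letter_finite)
  show "shift_by k -` E \<in> null_sets M" if "E \<in> null_sets M" for E k using that by (rule shift_nonsingular)
  show "AE z in M. \<exists>l. z l = x 0" by (rule visit_AE)
qed (rule distortion; assumption)

end

lemma weak_conv_m_offset: "weak_conv_m (\<lambda>n. \<mu> (n + k)) \<nu> \<longleftrightarrow> weak_conv_m \<mu> \<nu>"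
proof -
  have "((\<lambda>n. f (n + k)) \<longlonglongrightarrow> l) \<longleftrightarrow> (f \<longlonglongrightarrow> l)" for f :: "nat \<Rightarrow> real" and l
    using LIMSEQ_ignore_initial_segment[of f l k] LIMSEQ_offset[of f k l] by blast
  from this[of "\<lambda>n. cdf (\<mu> n) _"] show ?thesis unfolding weak_conv_m_def weak_conv_def by simp
qed

section \<open>The scaled return time\<close>

context orbit_renewal
begin

definition return :: "'v seq \<Rightarrow> enat" where
  "return z = hit_time (cylinder A [x 0]) 1 ((left_shift ^^ j) z)"

definition scaled_return :: "nat \<Rightarrow> 'v seq \<Rightarrow> real" where
  "scaled_return n z = scaling a (\<beta> n) * real_of_ereal (ereal_of_enat (return z))"

abbreviation return_law :: "nat \<Rightarrow> real measure" where
  "return_law n \<equiv> distr (start n) borel (scaled_return n)"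

lemma shift_by_mu: "shift_by k \<in> measurable mu mu"
proof (induction k)
  case (Suc k)
  have eq: "shift_by (Suc k) = left_shift \<circ> (shift_by k :: 'v seq \<Rightarrow> _)"
    by (simp add: fun_eq_iff shift_by_def left_shift_def)
  show ?case unfolding eq by (rule measurable_comp[OF Suc left_shift_mu])
qed (simp add: measurable_ident[unfolded id_def] shift_by_def)

lemma cylinder_1: "cylinder A [x 0] = target 1"
  by (auto simp: cylinder_def target_def cyl_def)

lemma visits_mu: "E \<in> sets mu \<Longrightarrow> shift_by k -` E \<inter> space mu \<in> sets mu"
  by (rule measurable_sets[OF shift_by_mu])

lemma return_measurable: "return \<in> measurable mu (count_space UNIV)"
proof -
  have "(\<lambda>z. hit_time (target 1) (Suc 0) z) \<in> measurable mu (count_space UNIV)"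
    by (rule hit_time_measurable) (rule visits_mu[OF target_mu])
  from measurable_compose[OF shift_by_mu this] show ?thesis
    by (simp add: return_def[abs_def] cylinder_1 funpow_left_shift del: hit_time.simps)
qed

lemma scaled_return_measurable: "scaled_return n \<in> borel_measurable (start n)"
proof -
  have "scaled_return n \<in> borel_measurable mu"
    unfolding scaled_return_def[abs_def]
    by (intro borel_measurable_times borel_measurable_const measurable_compose[OF return_measurable]) simp
  then show ?thesis by (simp add: measurable_cong_sets[OF sets_uniform_measure refl])
qed

lemma prob_start: "0 < \<beta> n \<Longrightarrow> prob_space (start n)"
  by (rule prob_space_uniform_measure) (auto simp: measure_def enn2real_positive_iff)

lemma eventually_start:
  "eventually (\<lambda>n. 1 \<le> n \<and> 2 * j < n \<and> 0 < \<beta> n \<and> 0 < \<N> n \<and> scaling a (\<beta> n) = 1 / real (\<N> n)) sequentially"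
  using eventually_beta eventually_gt_at_top[of "2 * j"] er.eventually_scale_pos scale(3)
  by eventually_elim simp

lemma return_law_nonneg:
  assumes "0 < \<beta> n" "0 < \<N> n" "scaling a (\<beta> n) = 1 / real (\<N> n)"
  shows "nonneg_law (return_law n)"
proof -
  interpret prob_space "start n" by (rule prob_start) fact
  have "0 \<le> scaled_return n z" for z
    unfolding scaled_return_def using assms by (cases "return z") auto
  then show ?thesis
    unfolding nonneg_law_def using scaled_return_measurable[of n]
    by (auto simp: AE_distr_iff intro!: real_distribution_distr)
qed

lemma mu_AE: "AE z in M. P z \<Longrightarrow> AE z in mu. P z"
proof -
  assume "AE z in M. P z"
  then have "AE z in m. P z" unfolding M_def by (rule AE_distrD[OF id_measurable])
  then have "AE z in m. 0 < ennreal (h z) \<longrightarrow> P z" by eventually_elim simp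
  moreover have "(\<lambda>z. ennreal (h z)) \<in> borel_measurable m" using h_measurable by measurable
  ultimately show ?thesis unfolding mu_def by (simp add: AE_density)
qed

text \<open>On a target the return time after shifting by \<open>j\<close> is the excursion time
  minus \<open>j\<close>, since the excursion ends at the first visit to \<open>x 0\<close> after
  \<open>j\<close>.\<close>

lemma return_on_target:
  assumes n: "j < n" and z: "z \<in> target n" and inf: "\<And>k. \<exists>l\<ge>k. z l = x 0"
  obtains l where "z \<in> er.excursion l" "return z = enat (l - j)" "j < l"
proof -
  define l where "l = (LEAST l. j < l \<and> z l = x 0)"
  obtain l0 where "Suc j \<le> l0" "z l0 = x 0" using inf[of "Suc j"] by blast
  then have "j < l0 \<and> z l0 = x 0" by simp
  then have "j < l \<and> z l = x 0" unfolding l_def by (rule LeastI)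
  moreover have "z i \<noteq> x 0" if "j < i" "i < l" for i using not_less_Least[of i "\<lambda>l. j < l \<and> z l = x 0", folded l_def] that by simp
  ultimately have l: "j < l" "z l = x 0" "\<And>i. j < i \<Longrightarrow> i < l \<Longrightarrow> z i \<noteq> x 0" by blast+
  have "shift_by k z \<in> shift_space A" for k
    using z by (simp add: target_def shift_space_def shift_by_def)
  then have vis: "shift_by i (shift_by j z) \<in> target 1 \<longleftrightarrow> z (i + j) = x 0" for i
    by (simp add: target_def cyl_def shift_by_apply)
  have "hit_time (target 1) (Suc 0) (shift_by j z) = enat (l - j)"
    unfolding hit_time_1_eq vis
  proof (intro conjI allI impI)
    show "z (i + j) \<noteq> x 0" if "0 < i \<and> i < l - j" for i using that by (intro l(3)) auto
  qed (use l in auto)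
  then have "return z = enat (l - j)" by (simp add: return_def cylinder_1 funpow_left_shift del: hit_time.simps)
  moreover have "z \<in> er.excursion l" using l by (simp add: er.excursion_def)
  ultimately show thesis using l(1) by (intro that)
qed

lemma start_AE: "AE z in start n. z \<in> target n \<and> (1 \<le> n \<longrightarrow> (\<forall>k. \<exists>l\<ge>k. z l = x 0))"
proof (rule AE_uniform_measureI[OF target_mu])
  show "AE z in mu. z \<in> target n \<longrightarrow> z \<in> target n \<and> (1 \<le> n \<longrightarrow> (\<forall>k. \<exists>l\<ge>k. z l = x 0))"
    using mu_AE[OF visits_unbounded[of 0 "x 0"]] by eventually_elim (auto simp: target_def cyl_def)
qed

text \<open>The shift by \<open>j\<close> changes the transform by the factor
  \<open>exp (s * j / N)\<close>, which tends to 1; the remaining comparison of the starting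
  measures is \<open>start_compare\<close>.\<close>

lemma return_laplace:
  assumes s: "0 < s"
  shows "(\<lambda>n. laplace_transform (return_law n) s - er.mean s n) \<longlonglongrightarrow> 0"
proof -
  define F where "F n z = enn2real (er.Exc (ennreal (er.q s n)) (\<lambda>_. 1) z)" for n z
  have q: "ennreal (er.q s n) \<le> 1" for n using s by (simp add: er.q_def)
  have Exc1: "er.Exc (ennreal (er.q s n)) (\<lambda>_. 1) z \<le> 1" for n z
  proof (cases "\<exists>l. z \<in> er.excursion l")
    case True
    then obtain l where l: "z \<in> er.excursion l" by blast
    show ?thesis unfolding er.Exc_eq[OF l] using q[of n] s by (simp add: ennreal_power er.q_def power_le_one)
  next
    case False
    then have "er.Exc (ennreal (er.q s n)) (\<lambda>_. 1) z = 0" by (intro er.Exc_eq_0) blast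
    then show ?thesis by simp
  qed
  have Exc_meas: "er.Exc (ennreal (er.q s n)) (\<lambda>_. 1) \<in> borel_measurable M" for n by measurable
  have F_meas: "F n \<in> borel_measurable seq_algebra" for n
    using Exc_meas[of n] unfolding F_def[abs_def] measurable_cong_sets[OF sets_M refl] by measurable
  have F_Exc: "ennreal (F n z) = er.Exc (ennreal (er.q s n)) (\<lambda>_. 1) z" for n z
    using le_less_trans[OF Exc1[of n z] ennreal_one_less_top] by (simp add: F_def)
  have F_bd: "0 \<le> F n z \<and> F n z \<le> 1" for n z
    using Exc1[of n z] enn2real_mono[of _ 1] by (simp add: F_def)
  have F_M: "(\<integral>z. F n z * indicator (cyl n x) z \<partial>M) / b n = er.mean s n" if "1 \<le> n" "0 < \<N> n" for n
  proof -
    have "(\<integral>z. F n z * indicator (cyl n x) z \<partial>M) = enn2real (\<integral>\<^sup>+z. ennreal (F n z * indicator (cyl n x) z) \<partial>M)"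
      using F_bd F_meas[of n] by (intro integral_eq_nn_integral AE_I2) auto
    also have "(\<integral>\<^sup>+z. ennreal (F n z * indicator (cyl n x) z) \<partial>M) = (\<integral>\<^sup>+z\<in>cyl n x. er.Exc (ennreal (er.q s n)) (\<lambda>_. 1) z \<partial>M)"
      by (intro nn_integral_cong) (simp add: F_Exc split: split_indicator)
    also have "enn2real \<dots> / b n = enn2real (er.exc_mean n (ennreal (er.q s n)))"
      using cyl_finite[OF that(1)] b_pos[OF that(1)]
      by (simp add: er.exc_mean_def divide_ennreal_def emeasure_eq_ennreal_measure less_top[symmetric] inverse_ennreal
        enn2real_mult divide_inverse)
    also have "\<dots> = er.mean s n"
      unfolding er.exc_mean_eq[OF s that(2,1)] by (simp add: er.mean_bounds)
    finally show ?thesis .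
  qed
  define E where "E n = (\<integral>z. F n z \<partial>start n)" for n
  have "(\<lambda>n. E n - (\<integral>z. F n z * indicator (cyl n x) z \<partial>M) / b n) \<longlonglongrightarrow> 0"
    unfolding E_def by (rule start_compare[OF F_meas F_bd])
  moreover have "eventually (\<lambda>n. E n - (\<integral>z. F n z * indicator (cyl n x) z \<partial>M) / b n = E n - er.mean s n) sequentially"
    using eventually_start by eventually_elim (simp add: F_M)
  ultimately have E_mean: "(\<lambda>n. E n - er.mean s n) \<longlonglongrightarrow> 0" by (rule Lim_transform_eventually)
  have E_bd: "eventually (\<lambda>n. norm (E n) \<le> 1) sequentially"
    using eventually_start
  proof eventually_elim
    case (elim n)
    interpret prob_space "start n" using elim by (intro prob_start) simp
    have "F n \<in> borel_measurable (start n)" using id_mu[OF F_meas[of n]] by (simp add: measurable_cong_sets[OF sets_uniform_measure refl])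
    then have "integrable (start n) (F n)" using F_bd by (intro integrable_const_bound[of _ 1]) auto
    then have "E n \<le> 1" unfolding E_def using F_bd by (intro integral_le_const) auto
    moreover have "0 \<le> E n" unfolding E_def using F_bd by (intro Bochner_Integration.integral_nonneg) auto
    ultimately show ?case by simp
  qed
  have lt: "eventually (\<lambda>n. (exp (s * real j / real (\<N> n)) - 1) * E n + (E n - er.mean s n) = laplace_transform (return_law n) s - er.mean s n) sequentially"
    using eventually_start
  proof eventually_elim
    case (elim n)
    have "laplace_transform (return_law n) s = (\<integral>z. exp (- (s * scaled_return n z)) \<partial>start n)"
      unfolding laplace_transform_def by (rule integral_distr[OF scaled_return_measurable]) simp
    also have "\<dots> = (\<integral>z. exp (s * real j / real (\<N> n)) * F n z \<partial>start n)"
    proof (rule integral_cong_AE)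
      show "AE z in start n. exp (- (s * scaled_return n z)) = exp (s * real j / real (\<N> n)) * F n z"
        using start_AE
      proof eventually_elim
        fix z assume z: "z \<in> target n \<and> (1 \<le> n \<longrightarrow> (\<forall>k. \<exists>l\<ge>k. z l = x 0))"
        then obtain l where l: "z \<in> er.excursion l" "return z = enat (l - j)" "j < l"
          using return_on_target[of n z] elim by auto
        have "F n z = exp (- (s / real (\<N> n))) ^ l"
          unfolding F_def er.Exc_eq[OF l(1)] by (simp add: er.q_def ennreal_power)
        also have "\<dots> = exp (- (s * real l / real (\<N> n)))"
          by (simp add: exp_of_nat_mult[symmetric] mult_ac)
        finally have "exp (s * real j / real (\<N> n)) * F n z = exp (s * real j / real (\<N> n) - s * real l / real (\<N> n))"
          by (simp add: exp_add[symmetric])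
        moreover have "- (s * scaled_return n z) = s * real j / real (\<N> n) - s * real l / real (\<N> n)"
          using l(3) elim by (simp add: scaled_return_def l(2) of_nat_diff field_simps)
        ultimately show "exp (- (s * scaled_return n z)) = exp (s * real j / real (\<N> n)) * F n z" by simp
      qed
      have "F n \<in> borel_measurable (start n)" using id_mu[OF F_meas[of n]] by (simp add: measurable_cong_sets[OF sets_uniform_measure refl])
      then show "(\<lambda>z. exp (s * real j / real (\<N> n)) * F n z) \<in> borel_measurable (start n)" by measurable
      show "(\<lambda>z. exp (- (s * scaled_return n z))) \<in> borel_measurable (start n)"
        using scaled_return_measurable[of n] by measurable
    qed
    also have "\<dots> = exp (s * real j / real (\<N> n)) * E n" by (simp add: E_def)
    finally show ?case by (simp add: algebra_simps)
  qed
  have "(\<lambda>n. exp (s * real j / real (\<N> n)) - 1) \<longlonglongrightarrow> exp 0 - 1"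
  proof (intro tendsto_diff tendsto_exp tendsto_const)
    have "filterlim (\<lambda>n. real (\<N> n)) at_top sequentially"
      by (rule filterlim_compose[OF filterlim_real_sequentially scale(1)])
    then show "(\<lambda>n. s * real j / real (\<N> n)) \<longlonglongrightarrow> 0" by (rule tendsto_divide_0[OF tendsto_const filterlim_at_top_imp_at_infinity])
  qed
  then have "(\<lambda>n. (exp (s * real j / real (\<N> n)) - 1) * E n) \<longlonglongrightarrow> 0"
    using E_bd by (intro lim_null_mult_right_bounded) auto
  from Lim_transform_eventually[OF tendsto_add[OF this E_mean] lt] show ?thesis by simp
qed

text \<open>The transform of the return law and \<open>mean\<close> have vanishing difference. An
  initial segment, where conditioning on the target may not give a law, is shifted away before the
  continuity theorem is applied.\<close>

theorem return_law_converges_iff: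
  assumes nu: "nonneg_law \<nu>"
  shows "weak_conv_m return_law \<nu> \<longleftrightarrow> (\<forall>s>0. er.mean s \<longlonglongrightarrow> laplace_transform \<nu> s)"
proof -
  obtain k where k: "\<And>n. k \<le> n \<Longrightarrow> nonneg_law (return_law n)"
    using eventually_start return_law_nonneg unfolding eventually_sequentially by blast
  have nonneg: "nonneg_law (return_law (n + k))" for n by (rule k) simp
  have lim: "((\<lambda>n. laplace_transform (return_law n) s) \<longlonglongrightarrow> c) \<longleftrightarrow> (er.mean s \<longlonglongrightarrow> c)" if "0 < s" for s c
  proof
    assume "(\<lambda>n. laplace_transform (return_law n) s) \<longlonglongrightarrow> c"
    from tendsto_diff[OF this return_laplace[OF that]] show "er.mean s \<longlonglongrightarrow> c" by simp
  next
    assume "er.mean s \<longlonglongrightarrow> c"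
    from tendsto_add[OF this return_laplace[OF that]] show "(\<lambda>n. laplace_transform (return_law n) s) \<longlonglongrightarrow> c" by simp
  qed
  show ?thesis
  proof
    assume "weak_conv_m return_law \<nu>"
    then have "weak_conv_m (\<lambda>n. return_law (n + k)) \<nu>" by (rule weak_conv_m_offset[of return_law k \<nu>, THEN iffD2])
    from weak_conv_imp_laplace[OF nonneg nu this]
    have "(\<lambda>n. laplace_transform (return_law (n + k)) s) \<longlonglongrightarrow> laplace_transform \<nu> s" if "0 < s" for s using that by simp
    from LIMSEQ_offset[OF this] show "\<forall>s>0. er.mean s \<longlonglongrightarrow> laplace_transform \<nu> s" by (simp add: lim)
  next
    assume mean: "\<forall>s>0. er.mean s \<longlonglongrightarrow> laplace_transform \<nu> s"
    have "weak_conv_m (\<lambda>n. return_law (n + k)) \<nu>"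
    proof (rule laplace_imp_weak_conv[OF nonneg nu])
      fix i :: nat assume "1 \<le> i"
      then have "(\<lambda>n. laplace_transform (return_law n) (real i)) \<longlonglongrightarrow> laplace_transform \<nu> (real i)" using mean by (simp add: lim)
      then show "(\<lambda>n. laplace_transform (return_law (n + k)) (real i)) \<longlonglongrightarrow> laplace_transform \<nu> (real i)"
        by (rule LIMSEQ_ignore_initial_segment)
    qed
    then show "weak_conv_m return_law \<nu>" by (rule weak_conv_m_offset[of return_law k \<nu>, THEN iffD1])
  qed
qed

end

section \<open>Limiting moments of the hitting process\<close>

lemma hit_time_cong:
  assumes "\<And>i. shift_by i z \<in> B \<longleftrightarrow> shift_by i z \<in> B'"
  shows "hit_time B k z = hit_time B' k z"
  by (induction k) (simp_all add: assms funpow_left_shift)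

lemma tendsto_prod_list:
  fixes f :: "'b \<Rightarrow> nat \<Rightarrow> real"
  shows "(\<And>t. t \<in> set ts \<Longrightarrow> f t \<longlonglongrightarrow> c t) \<Longrightarrow> (\<lambda>n. \<Prod>t\<leftarrow>ts. f t n) \<longlonglongrightarrow> (\<Prod>t\<leftarrow>ts. c t)"
  by (induction ts) (auto intro: tendsto_mult)

context orbit_renewal
begin

definition code :: "nat \<Rightarrow> 'v seq \<Rightarrow> nat \<Rightarrow> real" where
  "code n = hit_code (exp (- (1 / real (\<N> n)))) (target n)"

abbreviation process :: "nat \<Rightarrow> 'v seq \<Rightarrow> real measure" where
  "process n \<equiv> hitting_process a mu (target n)"

lemma hit_code_target: "z \<in> shift_space A \<Longrightarrow> hit_code c (target n) z = hit_code c (cyl n x) z"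
proof
  fix k
  assume z: "z \<in> shift_space A"
  have "hit_time (target n) (Suc k) z = hit_time (cyl n x) (Suc k) z"
  proof (rule hit_time_cong)
    fix i
    have "shift_by i z \<in> shift_space A" using z by (simp add: shift_space_def shift_by_def)
    then show "shift_by i z \<in> target n \<longleftrightarrow> shift_by i z \<in> cyl n x" by (simp add: target_def)
  qed
  then show "hit_code c (target n) z k = hit_code c (cyl n x) z k" by (simp add: hit_code_def del: hit_time.simps)
qed

lemma q_power: "exp (- (1 / real (\<N> n))) ^ t = er.q (real t) n"
  by (simp add: er.q_def exp_of_nat_mult[symmetric])

lemma monomial_code:
  assumes "0 < \<N> n" "es = [] \<or> last es \<noteq> 0" "z \<in> shift_space A"
  shows "monomial es (code n z) = enn2real (er.Gaps n (er.gaps (map real (tails es)) n) z)"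
proof -
  have "monomial es (code n z) = enn2real (er.Gaps n (map (\<lambda>t. ennreal (exp (- (1 / real (\<N> n))) ^ t)) (tails es)) z)"
    unfolding code_def hit_code_target[OF assms(3)] using assms by (intro er.monomial_hit_code) auto
  then show ?thesis by (simp only: q_power er.gaps_def map_map o_def)
qed

text \<open>Monomials reach integer rates only. A real power of the first code is obtained by coding
  with the base raised to that power.\<close>

lemma code_powr:
  assumes "0 < s" "0 < \<N> n" "z \<in> shift_space A"
  shows "code n z 0 powr s = enn2real (er.Gaps n (er.gaps [s] n) z)"
proof -
  have q: "0 < er.q s n" "er.q s n < 1" using er.q_bounds[OF assms(1,2)] by auto
  have "code n z 0 powr s = hit_code (er.q s n) (cyl n x) z 0"
    unfolding code_def hit_code_target[OF assms(3)] hit_code_def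
  proof (cases "hit_time (cyl n x) (Suc 0) z")
    case (enat t)
    have "(exp (- (1 / real (\<N> n))) ^ t) powr s = exp (- (s / real (\<N> n))) ^ t"
      by (simp add: exp_of_nat_mult[symmetric] powr_def)
    then show "(case hit_time (cyl n x) (Suc 0) z of enat t \<Rightarrow> exp (- (1 / real (\<N> n))) ^ t | \<infinity> \<Rightarrow> 0) powr s =
        (case hit_time (cyl n x) (Suc 0) z of enat t \<Rightarrow> er.q s n ^ t | \<infinity> \<Rightarrow> 0)"
      unfolding enat by (simp add: er.q_def)
  qed (simp del: hit_time.simps)
  also have "\<dots> = monomial [1] (hit_code (er.q s n) (cyl n x) z)" by simp
  also have "\<dots> = enn2real (er.Gaps n (er.gaps [s] n) z)"
    using er.monomial_hit_code[OF q, of "[1]" n z] by (simp add: er.gaps_def del: er.Gaps.simps monomial.simps)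
  finally show ?thesis .
qed

lemma Gaps_bound:
  assumes "\<forall>t\<in>set ss. 0 < t"
  shows "er.Gaps n (er.gaps ss n) z \<le> 1"
  using assms by (intro er.Gaps_le_1) (auto simp: er.gaps_def er.q_def)

lemma Gaps_real:
  assumes "\<forall>t\<in>set ss. 0 < t"
  shows "(\<lambda>z. enn2real (er.Gaps n (er.gaps ss n) z)) \<in> borel_measurable seq_algebra"
    "0 \<le> enn2real (er.Gaps n (er.gaps ss n) z) \<and> enn2real (er.Gaps n (er.gaps ss n) z) \<le> 1"
proof -
  have "er.Gaps n (er.gaps ss n) \<in> borel_measurable M" by measurable
  then show "(\<lambda>z. enn2real (er.Gaps n (er.gaps ss n) z)) \<in> borel_measurable seq_algebra"
    unfolding measurable_cong_sets[OF sets_M refl] by measurable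
  show "0 \<le> enn2real (er.Gaps n (er.gaps ss n) z) \<and> enn2real (er.Gaps n (er.gaps ss n) z) \<le> 1"
    using Gaps_bound[OF assms, of n z] enn2real_mono[of _ 1] by simp
qed

lemma gaps_from_start:
  assumes ss: "\<forall>t\<in>set ss. 0 < t" "ss \<noteq> []"
  shows "(\<lambda>n. (\<integral>z. enn2real (er.Gaps n (er.gaps ss n) z) \<partial>start n) - er.gap_product ss n) \<longlonglongrightarrow> 0"
proof -
  let ?F = "\<lambda>n z. enn2real (er.Gaps n (er.gaps ss n) z)"
  have F_M: "(\<integral>z. ?F n z * indicator (cyl n x) z \<partial>M) = enn2real (\<integral>\<^sup>+z\<in>cyl n x. er.Gaps n (er.gaps ss n) z \<partial>M)" for n
  proof -
    have fin: "ennreal (?F n z) = er.Gaps n (er.gaps ss n) z" for z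
      using le_less_trans[OF Gaps_bound[OF ss(1), of n z] ennreal_one_less_top] by simp
    have "(\<integral>z. ?F n z * indicator (cyl n x) z \<partial>M) = enn2real (\<integral>\<^sup>+z. ennreal (?F n z * indicator (cyl n x) z) \<partial>M)"
      using Gaps_real[OF ss(1)] by (intro integral_eq_nn_integral AE_I2) auto
    also have "(\<integral>\<^sup>+z. ennreal (?F n z * indicator (cyl n x) z) \<partial>M) = (\<integral>\<^sup>+z\<in>cyl n x. er.Gaps n (er.gaps ss n) z \<partial>M)"
      by (intro nn_integral_cong) (simp add: fin split: split_indicator)
    finally show ?thesis .
  qed
  from tendsto_add[OF start_compare[of ?F, OF Gaps_real[OF ss(1)]] er.gaps_from_B[OF ss]]
  show ?thesis unfolding F_M by simp
qed

text \<open>The law lives on the shift space; it is first pushed to all sequences, where it is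
  absolutely continuous with respect to \<open>M\<close> since the density is positive.\<close>

lemma gaps_from_density:
  assumes P: "prob_space P" "sets P = sets mu" "absolutely_continuous mu P"
    and ss: "\<forall>t\<in>set (s # ss). 0 < t" and c: "(\<lambda>n. er.J s n * er.gap_product ss n) \<longlonglongrightarrow> c0"
  shows "(\<lambda>n. \<integral>z. enn2real (er.Gaps n (er.gaps (s # ss) n) z) \<partial>P) \<longlonglongrightarrow> c0"
proof -
  interpret P: prob_space P by fact
  have id: "(\<lambda>z. z) \<in> measurable P seq_algebra"
    using id_mu[of "\<lambda>z. z" seq_algebra] measurable_cong_sets[OF P(2) refl] by auto
  define P' where "P' = distr P seq_algebra (\<lambda>z. z)"
  have "absolutely_continuous M P'"
    unfolding absolutely_continuous_def
  proof
    fix E assume E: "E \<in> null_sets M"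
    then have Es: "E \<in> sets seq_algebra" by (auto simp: sets_M)
    then have "AE z in mu. z \<notin> E" using E by (simp add: mu_null_iff)
    then have "AE z in P. z \<notin> E" by (rule absolutely_continuous_AE[OF P(2,3)])
    moreover have EP: "E \<inter> space P \<in> sets P" using measurable_sets[OF id Es] by simp
    ultimately have "emeasure P (E \<inter> space P) = 0"
      using AE_iff_null_sets[OF EP] by (auto elim: eventually_mono)
    then show "E \<in> null_sets P'" using Es id by (simp add: null_sets_def P'_def emeasure_distr)
  qed
  moreover have "prob_space P'" unfolding P'_def by (rule P.prob_space_distr[OF id])
  moreover have "sets P' = sets M" by (simp add: P'_def sets_M)
  ultimately have "(\<lambda>n. \<integral>z. enn2real (er.Gaps n (er.gaps (s # ss) n) z) \<partial>P') \<longlonglongrightarrow> c0"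
    using ss c by (intro er.gaps_from_P) auto
  then show ?thesis
    unfolding P'_def by (subst (asm) integral_distr[OF id Gaps_real(1)[OF ss]])
qed

lemma eventually_coded:
  assumes "eventually (\<lambda>n. prob_space (P n) \<and> sets (P n) = sets mu) sequentially"
  shows "eventually (\<lambda>n. coded_process (P n) (code n) (process n)) sequentially"
  using assms eventually_start
proof eventually_elim
  case (elim n)
  have sc: "scaling a (\<beta> n) = 1 / real (\<N> n)" "0 < \<N> n" using elim by auto
  have space: "space (P n) = space mu" using elim by (intro sets_eq_imp_space_eq) simp
  show ?case
    unfolding code_def
  proof (rule hitting_coded)
    show "shift_by k -` target n \<inter> space (P n) \<in> sets (P n)" for k
      using visits_mu[OF target_mu, of k n] elim space by simp
  qed (use elim sc in auto)
qed

lemma start_ok: "eventually (\<lambda>n. prob_space (start n) \<and> sets (start n) = sets mu) sequentially"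
  using eventually_start by eventually_elim (auto intro: prob_start)

lemma R_inverse: "0 < s \<Longrightarrow> 1 / er.R s = s powr \<alpha> / Gamma (1 + \<alpha>)"
  by (simp add: er.R_def powr_minus field_simps)

end

locale mean_limit = orbit_renewal A \<eta> \<phi> h m x a \<alpha> j
  for A :: "'v::countable \<Rightarrow> 'v \<Rightarrow> bool" and \<eta> \<phi> h m x a \<alpha> j +
  fixes w :: "real \<Rightarrow> real"
  assumes mean_limit: "\<And>s. 0 < s \<Longrightarrow> er.mean s \<longlonglongrightarrow> w s" and w_pos: "\<And>s. 0 < s \<Longrightarrow> 0 < w s"
begin

text \<open>The limit of \<open>J\<close> written in the form of the defining transform; the second
  summand is \<open>1 / R s\<close>.\<close>

definition LJ :: "real \<Rightarrow> real" where "LJ s = inverse (w s + s powr \<alpha> / Gamma (1 + \<alpha>))"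

lemma J_limit:
  assumes s: "0 < s"
  shows "er.J s \<longlonglongrightarrow> LJ s"
proof -
  have R: "0 < er.R s" by (rule er.R_pos[OF s])
  have pos: "0 < 1 + er.R s * w s" using R w_pos[OF s] by (intro add_pos_pos mult_pos_pos) auto
  have "(\<lambda>n. er.R s / (1 + er.R s * er.mean s n)) \<longlonglongrightarrow> er.R s / (1 + er.R s * w s)"
    using pos by (intro tendsto_intros mean_limit s) auto
  moreover have "er.R s / (1 + er.R s * w s) = LJ s"
    unfolding LJ_def R_inverse[OF s, symmetric] using R pos by (simp add: field_simps)
  ultimately show ?thesis by (simp add: er.J_def[abs_def])
qed

lemma gap_product_limit:
  "\<forall>t\<in>set ss. 0 < t \<Longrightarrow> er.gap_product ss \<longlonglongrightarrow> (\<Prod>t\<leftarrow>ss. w t * LJ t)"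
  unfolding er.gap_product_def[abs_def] by (intro tendsto_prod_list tendsto_mult mean_limit J_limit) auto

lemma start_moments:
  assumes es: "es = [] \<or> last es \<noteq> 0"
  shows "(\<lambda>n. \<integral>z. monomial es (code n z) \<partial>start n) \<longlonglongrightarrow> (\<Prod>t\<leftarrow>map real (tails es). w t * LJ t)"
proof (cases "es = []")
  case True
  have "eventually (\<lambda>n. (\<integral>z. monomial es (code n z) \<partial>start n) = 1) sequentially"
    using start_ok
  proof eventually_elim
    case (elim n)
    then have "measure (start n) (space (start n)) = 1" by (intro prob_space.prob_space) simp
    then show ?case by (simp add: True)
  qed
  from tendsto_eventually[OF this] show ?thesis using True by simp
next
  case False
  let ?ss = "map real (tails es)"
  have ss: "\<forall>t\<in>set ?ss. 0 < t" using tails_pos[OF es] by auto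
  have ne: "?ss \<noteq> []" using False by (cases es) auto
  have "(\<lambda>n. (\<integral>z. enn2real (er.Gaps n (er.gaps ?ss n) z) \<partial>start n)) \<longlonglongrightarrow> (\<Prod>t\<leftarrow>?ss. w t * LJ t)"
    using tendsto_add[OF gaps_from_start[OF ss ne] gap_product_limit[OF ss]] by simp
  moreover have "eventually (\<lambda>n. (\<integral>z. enn2real (er.Gaps n (er.gaps ?ss n) z) \<partial>start n) = (\<integral>z. monomial es (code n z) \<partial>start n)) sequentially"
    using eventually_start
  proof eventually_elim
    case (elim n)
    then show ?case by (intro Bochner_Integration.integral_cong refl monomial_code[symmetric] es) (auto simp: space_mu)
  qed
  ultimately show ?thesis by (rule Lim_transform_eventually)
qed

lemma density_moments:
  assumes P: "prob_space P" "sets P = sets mu" "absolutely_continuous mu P" and es: "es = [] \<or> last es \<noteq> 0"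
  shows "(\<lambda>n. \<integral>z. monomial es (code n z) \<partial>P) \<longlonglongrightarrow>
    (case map real (tails es) of [] \<Rightarrow> 1 | s # ss \<Rightarrow> LJ s * (\<Prod>t\<leftarrow>ss. w t * LJ t))"
proof (cases "map real (tails es)")
  case Nil
  then have "es = []" by (cases es) auto
  then show ?thesis using Nil P(1) by (simp add: prob_space.prob_space)
next
  case (Cons s ss)
  have ss: "\<forall>t\<in>set (s # ss). 0 < t" using tails_pos[OF es] unfolding Cons[symmetric] by auto
  have "(\<lambda>n. er.J s n * er.gap_product ss n) \<longlonglongrightarrow> LJ s * (\<Prod>t\<leftarrow>ss. w t * LJ t)"
    using ss by (intro tendsto_mult J_limit gap_product_limit) auto
  from gaps_from_density[OF P ss this]
  have "(\<lambda>n. \<integral>z. enn2real (er.Gaps n (er.gaps (s # ss) n) z) \<partial>P) \<longlonglongrightarrow> LJ s * (\<Prod>t\<leftarrow>ss. w t * LJ t)" .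
  moreover have "eventually (\<lambda>n. (\<integral>z. enn2real (er.Gaps n (er.gaps (s # ss) n) z) \<partial>P) = (\<integral>z. monomial es (code n z) \<partial>P)) sequentially"
    using eventually_start
  proof eventually_elim
    case (elim n)
    have "space P = space mu" using P(2) by (rule sets_eq_imp_space_eq)
    then show ?case using elim unfolding Cons[symmetric]
      by (intro Bochner_Integration.integral_cong refl monomial_code[symmetric] es) (auto simp: space_mu)
  qed
  ultimately show ?thesis unfolding Cons by (auto dest: Lim_transform_eventually)
qed

lemma prod_list_nth: "(\<Prod>t\<leftarrow>ts. f t) = (\<Prod>i<length ts. f (ts ! i))" for f :: "'b \<Rightarrow> real"
  by (simp add: prod.list_conv_set_nth atLeast0LessThan)

context
  fixes law_J law_Jt
  assumes J: "nonneg_law law_J" "\<And>s. 0 < s \<Longrightarrow> laplace_transform law_J s = LJ s"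
    and Jt: "nonneg_law law_Jt" "\<And>s. 0 < s \<Longrightarrow> laplace_transform law_Jt s = w s * LJ s"
begin

text \<open>The waiting time is not almost surely 0, which makes the arrivals of the limit process
  tend to infinity.\<close>

lemma law_Jt_1: "laplace_transform law_Jt 1 < 1"
proof -
  have "0 < w 1" by (rule w_pos) simp
  moreover have "0 < 1 / Gamma (1 + \<alpha>)" using a by (intro divide_pos_pos Gamma_real_pos) auto
  ultimately show ?thesis unfolding Jt(2)[OF zero_less_one] LJ_def by (simp add: field_simps add_pos_pos)
qed

lemma RPP_converges: "converges_in_law vague_topology start process (RPP_space law_Jt) renewal_process"
proof (rule moments_imp_converges_in_law[where X = code and Y = arrival_code])
  show "eventually (\<lambda>n. coded_process (start n) (code n) (process n)) sequentially"
    by (rule eventually_coded[OF start_ok])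
  show "coded_process (RPP_space law_Jt) arrival_code renewal_process"
    unfolding RPP_space_def using Jt(1) law_Jt_1 by (intro renewal_coded[of "\<lambda>_. law_Jt" "laplace_transform law_Jt 1"]) auto
  fix es
  obtain fs where fs: "fs = [] \<or> last fs \<noteq> 0" "\<And>p. monomial es p = monomial fs p" using monomial_strip[of es] by blast
  have "(\<integral>w. monomial fs (arrival_code w) \<partial>RPP_space law_Jt) = (\<Prod>i<length fs. laplace_transform law_Jt (real (tails fs ! i)))"
    unfolding RPP_space_def by (rule renewal_moments[OF Jt(1)])
  also have "\<dots> = (\<Prod>i<length fs. w (real (tails fs ! i)) * LJ (real (tails fs ! i)))"
    using tails_pos[OF fs(1)] by (intro prod.cong refl Jt(2)) auto
  also have "\<dots> = (\<Prod>t\<leftarrow>map real (tails fs). w t * LJ t)" unfolding prod_list_nth by simp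
  finally show "(\<lambda>n. \<integral>z. monomial es (code n z) \<partial>start n) \<longlonglongrightarrow> (\<integral>w. monomial es (arrival_code w) \<partial>RPP_space law_Jt)"
    unfolding fs(2) using start_moments[OF fs(1)] by simp
qed

lemma DRPP_converges:
  assumes P: "prob_space P" "sets P = sets mu" "absolutely_continuous mu P"
  shows "converges_in_law vague_topology (\<lambda>_. P) process (DRPP_space law_J law_Jt) renewal_process"
proof (rule moments_imp_converges_in_law[where X = code and Y = arrival_code])
  show "eventually (\<lambda>n. coded_process P (code n) (process n)) sequentially"
    using P by (intro eventually_coded) simp
  let ?law = "\<lambda>i::nat. if i = 0 then law_J else law_Jt"
  have law: "nonneg_law (?law i)" for i using J(1) Jt(1) by simp
  show "coded_process (DRPP_space law_J law_Jt) arrival_code renewal_process"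
    unfolding DRPP_space_def using law_Jt_1 by (intro renewal_coded[of ?law "laplace_transform law_Jt 1"] law) auto
  fix es
  obtain fs where fs: "fs = [] \<or> last fs \<noteq> 0" "\<And>p. monomial es p = monomial fs p" using monomial_strip[of es] by blast
  have "(\<integral>w. monomial fs (arrival_code w) \<partial>DRPP_space law_J law_Jt) = (\<Prod>i<length fs. laplace_transform (?law i) (real (tails fs ! i)))"
    unfolding DRPP_space_def by (rule renewal_moments[OF law])
  also have "\<dots> = (case map real (tails fs) of [] \<Rightarrow> 1 | s # ss \<Rightarrow> LJ s * (\<Prod>t\<leftarrow>ss. w t * LJ t))"
  proof (cases fs)
    case (Cons e fs')
    have pos: "\<forall>t\<in>set (tails fs). 0 < t" by (rule tails_pos[OF fs(1)])
    have "(\<Prod>i<length fs. laplace_transform (?law i) (real (tails fs ! i))) =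
        laplace_transform law_J (real (e + sum_list fs')) * (\<Prod>i<length fs'. laplace_transform law_Jt (real (tails fs' ! i)))"
      unfolding Cons length_Cons prod.lessThan_Suc_shift by simp
    also have "laplace_transform law_J (real (e + sum_list fs')) = LJ (real (e + sum_list fs'))"
    proof (rule J(2))
      have "0 < e + sum_list fs'" using pos Cons by simp
      then show "0 < real (e + sum_list fs')" by (simp only: of_nat_0_less_iff)
    qed
    also have "(\<Prod>i<length fs'. laplace_transform law_Jt (real (tails fs' ! i))) = (\<Prod>i<length fs'. w (real (tails fs' ! i)) * LJ (real (tails fs' ! i)))"
      using pos Cons by (intro prod.cong refl Jt(2)) auto
    finally show ?thesis using Cons unfolding prod_list_nth by simp
  qed simp
  finally show "(\<lambda>n. \<integral>z. monomial es (code n z) \<partial>P) \<longlonglongrightarrow> (\<integral>w. monomial es (arrival_code w) \<partial>DRPP_space law_J law_Jt)"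
    unfolding fs(2) using density_moments[OF P fs(1)] by simp
qed

end

end

section \<open>Existence of the limit laws and the equivalence\<close>

context orbit_renewal
begin

lemma start_power:
  assumes s: "0 < s"
  shows "(\<lambda>n. (\<integral>z. code n z 0 powr s \<partial>start n) - er.mean s n * er.J s n) \<longlonglongrightarrow> 0"
proof -
  have "(\<lambda>n. (\<integral>z. enn2real (er.Gaps n (er.gaps [s] n) z) \<partial>start n) - er.gap_product [s] n) \<longlonglongrightarrow> 0"
    using s by (intro gaps_from_start) auto
  moreover have "eventually (\<lambda>n. (\<integral>z. enn2real (er.Gaps n (er.gaps [s] n) z) \<partial>start n) - er.gap_product [s] n =
      (\<integral>z. code n z 0 powr s \<partial>start n) - er.mean s n * er.J s n) sequentially"
    using eventually_start
  proof eventually_elim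
    case (elim n)
    then have "(\<integral>z. code n z 0 powr s \<partial>start n) = (\<integral>z. enn2real (er.Gaps n (er.gaps [s] n) z) \<partial>start n)"
      by (intro Bochner_Integration.integral_cong refl code_powr s) (auto simp: space_mu)
    then show ?case by (simp add: er.gap_product_def)
  qed
  ultimately show ?thesis by (rule Lim_transform_eventually)
qed

lemma target_density:
  assumes "0 < \<beta> n"
  shows "prob_space (start n)" "sets (start n) = sets mu" "absolutely_continuous mu (start n)"
proof -
  show "prob_space (start n)" by (rule prob_start) fact
  have "(\<lambda>z. indicator (target n) z / emeasure mu (target n)) \<in> borel_measurable mu"
    using target_mu by measurable
  then show "absolutely_continuous mu (start n)" unfolding uniform_measure_def by (rule absolutely_continuousI_density)
qed simp

text \<open>The required transforms are limits of transforms of actual first hitting times, started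
  from a fixed absolutely continuous law and from the targets; \<open>laplace_limit_law\<close>
  turns them into laws.\<close>

lemma laws_exist:
  assumes nu: "nonneg_law \<nu>" and mean: "\<And>s. 0 < s \<Longrightarrow> er.mean s \<longlonglongrightarrow> laplace_transform \<nu> s"
  shows "\<exists>law_J. is_J_law \<alpha> \<nu> law_J" "\<exists>law_Jt. is_J_tilde_law \<alpha> \<nu> law_Jt"
proof -
  let ?w = "laplace_transform \<nu>"
  have w_pos: "0 < ?w s" if "0 < s" for s using laplace_transform_bounds(1)[OF nu, of s] that by simp
  interpret mean_limit A \<eta> \<phi> h m x a \<alpha> j ?w by unfold_locales (use mean w_pos in auto)
  have pw: "((\<lambda>s. s powr \<alpha> / Gamma (1 + \<alpha>)) \<longlongrightarrow> 0) (at_right 0)"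
  proof -
    have "((\<lambda>s. s powr \<alpha>) \<longlongrightarrow> 0) (at_right (0::real))"
    proof -
      have "((\<lambda>s. s powr \<alpha>) \<longlongrightarrow> 0 powr \<alpha>) (at_right (0::real))"
        using a(3) by (intro tendsto_powr2 tendsto_ident_at tendsto_const) (auto simp: eventually_at_filter)
      then show ?thesis by simp
    qed
    moreover have "Gamma (1 + \<alpha>) \<noteq> 0"
      using Gamma_real_pos[of "1 + \<alpha>"] a(3) by linarith
    ultimately show ?thesis using tendsto_divide[OF _ tendsto_const] by fastforce
  qed
  have LJ0: "(LJ \<longlongrightarrow> 1) (at_right 0)"
    unfolding LJ_def[abs_def] using tendsto_inverse[OF tendsto_add[OF laplace_transform_at_0[OF nu] pw]] by simp
  have LJt0: "((\<lambda>s. ?w s * LJ s) \<longlongrightarrow> 1) (at_right 0)"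
    using tendsto_mult[OF laplace_transform_at_0[OF nu] LJ0] by simp
  obtain k where k: "\<And>n. k \<le> n \<Longrightarrow> 0 < \<beta> n \<and> 0 < \<N> n"
    using eventually_start unfolding eventually_sequentially by blast
  \<comment> \<open>One conditioned target serves as a concrete absolutely continuous
    probability.\<close>
  define P where "P = start k"
  have P: "prob_space P" "sets P = sets mu" "absolutely_continuous mu P"
    unfolding P_def using target_density[of k] k by auto
  have space_P: "space P = shift_space A" using sets_eq_imp_space_eq[OF P(2)] by (simp add: space_mu)
  have "eventually (\<lambda>n. coded_process P (code n) (process n) \<and> coded_process (start n) (code n) (process n)) sequentially"
    using eventually_coded[of "\<lambda>_. P"] P eventually_coded[OF start_ok] by (auto intro: eventually_conj)
  then obtain l where l: "\<And>n. l \<le> n \<Longrightarrow> coded_process P (code n) (process n) \<and> coded_process (start n) (code n) (process n)"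
    unfolding eventually_sequentially by blast
  have "\<exists>\<rho>. nonneg_law \<rho> \<and> (\<forall>s>0. laplace_transform \<rho> s = LJ s)"
  proof (rule laplace_limit_law[where P = "\<lambda>_. P" and U = "\<lambda>n z. code (n + l) z 0"])
    show "prob_space P" by (rule P)
    show "(\<lambda>z. code (n + l) z 0) \<in> borel_measurable P" "AE z in P. 0 \<le> code (n + l) z 0 \<and> code (n + l) z 0 \<le> 1" for n
      using coded_process.first_coordinate[of P "code (n + l)" "process (n + l)"] l[of "n + l"] by auto
    show "(\<lambda>n. \<integral>z. code (n + l) z 0 powr s \<partial>P) \<longlonglongrightarrow> LJ s" if s: "0 < s" for s
    proof -
      have "(\<lambda>n. \<integral>z. enn2real (er.Gaps n (er.gaps [s] n) z) \<partial>P) \<longlonglongrightarrow> LJ s"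
        using gaps_from_density[OF P, of s "[]" "LJ s"] J_limit[OF s] s by (simp add: er.gap_product_def)
      moreover have "eventually (\<lambda>n. (\<integral>z. enn2real (er.Gaps n (er.gaps [s] n) z) \<partial>P) = (\<integral>z. code n z 0 powr s \<partial>P)) sequentially"
        using eventually_start
      proof eventually_elim
        case (elim n)
        then show ?case by (intro Bochner_Integration.integral_cong refl code_powr[symmetric] s) (auto simp: space_P)
      qed
      ultimately have "(\<lambda>n. \<integral>z. code n z 0 powr s \<partial>P) \<longlonglongrightarrow> LJ s" by (rule Lim_transform_eventually)
      then show ?thesis by (rule LIMSEQ_ignore_initial_segment)
    qed
  qed (rule LJ0)
  then obtain law_J where J: "nonneg_law law_J" "\<And>s. 0 < s \<Longrightarrow> laplace_transform law_J s = LJ s" by blast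
  have "laplace_transform law_J s = inverse (?w s + s powr \<alpha> / Gamma (1 + \<alpha>))" if "0 \<le> s" for s
    using that J(2)[of s] laplace_transform_0[OF J(1)] laplace_transform_0[OF nu] by (cases "s = 0") (simp_all add: LJ_def)
  with J(1) show "\<exists>law_J. is_J_law \<alpha> \<nu> law_J" unfolding is_J_law_def by blast
  have "\<exists>\<rho>. nonneg_law \<rho> \<and> (\<forall>s>0. laplace_transform \<rho> s = ?w s * LJ s)"
  proof (rule laplace_limit_law[where P = "\<lambda>n. start (n + l)" and U = "\<lambda>n z. code (n + l) z 0"])
    show "prob_space (start (n + l))" for n using l[of "n + l"] by (simp add: coded_process_def)
    show "(\<lambda>z. code (n + l) z 0) \<in> borel_measurable (start (n + l))" "AE z in start (n + l). 0 \<le> code (n + l) z 0 \<and> code (n + l) z 0 \<le> 1" for n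
      using coded_process.first_coordinate[of "start (n + l)" "code (n + l)" "process (n + l)"] l[of "n + l"] by auto
    show "(\<lambda>n. \<integral>z. code (n + l) z 0 powr s \<partial>start (n + l)) \<longlonglongrightarrow> ?w s * LJ s" if s: "0 < s" for s
    proof -
      have "(\<lambda>n. \<integral>z. code n z 0 powr s \<partial>start n) \<longlonglongrightarrow> ?w s * LJ s"
        using tendsto_add[OF start_power[OF s] tendsto_mult[OF mean[OF s] J_limit[OF s]]] by simp
      then show ?thesis by (rule LIMSEQ_ignore_initial_segment)
    qed
  qed (rule LJt0)
  then obtain law_Jt where Jt: "nonneg_law law_Jt" "\<And>s. 0 < s \<Longrightarrow> laplace_transform law_Jt s = ?w s * LJ s" by blast
  have "laplace_transform law_Jt s = ?w s / (?w s + s powr \<alpha> / Gamma (1 + \<alpha>))" if "0 \<le> s" for s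
    using that Jt(2)[of s] laplace_transform_0[OF Jt(1)] laplace_transform_0[OF nu]
    by (cases "s = 0") (simp_all add: LJ_def divide_inverse)
  with Jt(1) show "\<exists>law_Jt. is_J_tilde_law \<alpha> \<nu> law_Jt" unfolding is_J_tilde_law_def by blast
qed

text \<open>The limit process determines the limit of \<open>m * J\<close> through its first point.
  As \<open>m * J\<close> equals \<open>R * m / (1 + R * m)\<close>, solving for \<open>m\<close> is
  continuous and gives the limit of the mean.\<close>

lemma RPP_imp_mean:
  assumes nu: "nonneg_law \<nu>" and Jt: "is_J_tilde_law \<alpha> \<nu> law_Jt"
    and conv: "converges_in_law vague_topology start process (RPP_space law_Jt) renewal_process" and s: "0 < s"
  shows "er.mean s \<longlonglongrightarrow> laplace_transform \<nu> s"
proof -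
  let ?w = "laplace_transform \<nu>"
  have law: "nonneg_law law_Jt" and lt: "\<And>s. 0 \<le> s \<Longrightarrow> laplace_transform law_Jt s = ?w s / (?w s + s powr \<alpha> / Gamma (1 + \<alpha>))"
    using Jt by (simp_all add: is_J_tilde_law_def)
  have w: "0 < ?w s" if "0 < s" for s using laplace_transform_bounds(1)[OF nu, of s] that by simp
  have "0 < 1 / Gamma (1 + \<alpha>)" using a by (intro divide_pos_pos Gamma_real_pos) auto
  then have lt1: "laplace_transform law_Jt 1 < 1"
    using w[of 1] lt[of 1] by (simp add: field_simps add_pos_pos)
  have coded: "coded_process (RPP_space law_Jt) arrival_code renewal_process"
    unfolding RPP_space_def using law lt1 by (intro renewal_coded[of "\<lambda>_. law_Jt" "laplace_transform law_Jt 1"]) auto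
  have int: "integrable law_Jt (\<lambda>w. exp (- (s * w)))" by (rule laplace_integrable[OF law]) (use s in simp)
  have "(\<integral>w. exp (- (\<Sum>i\<le>0. w i)) powr s \<partial>RPP_space law_Jt) = (\<integral>w. (\<Prod>i<Suc 0. exp (- (s * w i))) \<partial>RPP_space law_Jt)"
    by (simp add: powr_def)
  also have "\<dots> = laplace_transform law_Jt s"
    unfolding RPP_space_def laplace_transform_def
    using PiM_integral_prod[of "\<lambda>_. law_Jt" "\<lambda>_ w. exp (- (s * w))" "Suc 0", OF law int] by simp
  finally have limit: "(\<integral>w. exp (- (\<Sum>i\<le>0. w i)) powr s \<partial>RPP_space law_Jt) = laplace_transform law_Jt s" .
  have "(\<lambda>n. \<integral>z. code n z 0 powr s \<partial>start n) \<longlonglongrightarrow> laplace_transform law_Jt s"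
    using converges_in_law_imp_first_point[OF eventually_coded[OF start_ok] coded conv s] unfolding limit .
  from tendsto_diff[OF this start_power[OF s]]
  have lim: "(\<lambda>n. er.mean s n * er.J s n) \<longlonglongrightarrow> laplace_transform law_Jt s" by simp
  define y where "y = laplace_transform law_Jt s"
  have R: "0 < er.R s" by (rule er.R_pos[OF s])
  have y: "y = er.R s * ?w s / (1 + er.R s * ?w s)"
    unfolding y_def lt[OF less_imp_le[OF s]] R_inverse[OF s, symmetric] using R w[OF s] by (simp add: field_simps add_pos_pos)
  have pos: "0 < 1 + er.R s * ?w s" using R w[OF s] by (simp add: add_pos_pos)
  have y1: "1 - y = 1 / (1 + er.R s * ?w s)" unfolding y using pos by (simp add: field_simps)
  have "er.mean s n * er.J s n / (er.R s * (1 - er.mean s n * er.J s n)) = er.mean s n" for n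
  proof -
    have "0 < 1 + er.R s * er.mean s n" using R er.mean_bounds(1)[of s n] by (intro add_pos_nonneg) auto
    moreover from this have "1 - er.mean s n * er.J s n = 1 / (1 + er.R s * er.mean s n)"
      by (simp add: er.J_def field_simps)
    ultimately show ?thesis using R by (simp add: er.J_def)
  qed
  moreover have "(\<lambda>n. er.mean s n * er.J s n / (er.R s * (1 - er.mean s n * er.J s n))) \<longlonglongrightarrow> y / (er.R s * (1 - y))"
    using lim R pos unfolding y_def[symmetric] by (intro tendsto_intros) (simp_all add: y1)
  moreover have "y / (er.R s * (1 - y)) = ?w s" unfolding y1 unfolding y using R pos by simp
  ultimately show ?thesis by simp
qed

text \<open>Convergence of the excursion means is the common middle term: it gives the limit laws
  and both process limits, and the process started on the targets gives it back.\<close>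

theorem return_law_iff_process:
  assumes nu: "nonneg_law \<nu>"
  shows "weak_conv_m return_law \<nu> \<longleftrightarrow>
    (\<exists>law_J law_Jt. is_J_law \<alpha> \<nu> law_J \<and> is_J_tilde_law \<alpha> \<nu> law_Jt \<and>
      converges_in_law vague_topology start process (RPP_space law_Jt) renewal_process \<and>
      (\<forall>P. prob_space P \<and> sets P = sets mu \<and> absolutely_continuous mu P \<longrightarrow>
        converges_in_law vague_topology (\<lambda>n. P) process (DRPP_space law_J law_Jt) renewal_process))"
    (is "_ \<longleftrightarrow> ?R")
  unfolding return_law_converges_iff[OF nu]
proof
  assume "\<forall>s>0. er.mean s \<longlonglongrightarrow> laplace_transform \<nu> s"
  then have mean: "\<And>s. 0 < s \<Longrightarrow> er.mean s \<longlonglongrightarrow> laplace_transform \<nu> s" by blast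
  interpret mean_limit A \<eta> \<phi> h m x a \<alpha> j "laplace_transform \<nu>"
    by unfold_locales (use mean laplace_transform_bounds(1)[OF nu] in auto)
  obtain law_J law_Jt where J: "is_J_law \<alpha> \<nu> law_J" and Jt: "is_J_tilde_law \<alpha> \<nu> law_Jt"
    using laws_exist[OF nu mean] by blast
  have J': "nonneg_law law_J" "\<And>s. 0 < s \<Longrightarrow> laplace_transform law_J s = LJ s"
    using J by (simp_all add: is_J_law_def LJ_def)
  have Jt': "nonneg_law law_Jt" "\<And>s. 0 < s \<Longrightarrow> laplace_transform law_Jt s = laplace_transform \<nu> s * LJ s"
    using Jt by (simp_all add: is_J_tilde_law_def LJ_def divide_inverse)
  show ?R
    using J Jt RPP_converges[OF J' Jt'] DRPP_converges[OF J' Jt']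
    by (intro exI[of _ law_J] exI[of _ law_Jt] conjI allI impI) auto
next
  assume ?R
  then obtain law_Jt where "is_J_tilde_law \<alpha> \<nu> law_Jt"
    "converges_in_law vague_topology start process (RPP_space law_Jt) renewal_process"
    by (elim exE conjE)
  then show "\<forall>s>0. er.mean s \<longlonglongrightarrow> laplace_transform \<nu> s" using RPP_imp_mean[OF nu] by blast
qed

end

theorem theorem4p3:
  fixes A :: "'v::countable \<Rightarrow> 'v \<Rightarrow> bool"
    and \<eta> \<alpha> :: real
    and \<phi> :: "(nat \<Rightarrow> 'v) \<Rightarrow> real"
    and \<mu> :: "(nat \<Rightarrow> 'v) measure"
    and a :: "nat \<Rightarrow> real"
    and x :: "nat \<Rightarrow> 'v"
    and B :: "nat \<Rightarrow> (nat \<Rightarrow> 'v) set"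
    and j :: nat
    and \<nu> :: "real measure"
  assumes "infinite (UNIV :: 'v set)"
    and "0 < \<eta>" and "\<eta> < 1"
    and "topologically_mixing A"
    and "\<phi> \<in> borel_measurable (shift_borel A \<eta>)"
    and "walters_condition A \<phi>"
    and "gurevich_pressure A \<phi> < \<infinity>"
    and "null_recurrent A \<phi>"
    and "associated_invariant_measure A \<eta> \<phi> \<mu>"
    and "mono a"
    and "normalizing_sequence \<mu> left_shift a"
    and "0 < \<alpha>" and "\<alpha> \<le> 1"
    and "regularly_varying_seq a \<alpha>"
    and "x \<in> shift_space A"
    and "B = (\<lambda>n. cylinder A (map x [0..<n]))"
    and "finite (visit_times (cylinder A [x 0]) x)"
    and "j = Max (visit_times (cylinder A [x 0]) x)"
    and "nonneg_law \<nu>"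
  shows
    "weak_conv_m
       (\<lambda>n. distr (uniform_measure \<mu> (B n)) borel
          (\<lambda>y. scaling a (measure \<mu> (B n))
                 * real_of_ereal (ereal_of_enat
                     (hit_time (cylinder A [x 0]) 1 ((left_shift ^^ j) y)))))
       \<nu>
     \<longleftrightarrow>
     (\<exists>law_J law_Jt. is_J_law \<alpha> \<nu> law_J \<and> is_J_tilde_law \<alpha> \<nu> law_Jt \<and>
        converges_in_law vague_topology
          (\<lambda>n. uniform_measure \<mu> (B n)) (\<lambda>n. hitting_process a \<mu> (B n))
          (RPP_space law_Jt) renewal_process \<and>
        (\<forall>P. prob_space P \<and> sets P = sets \<mu> \<and> absolutely_continuous \<mu> P \<longrightarrow>
           converges_in_law vague_topology
             (\<lambda>n. P) (\<lambda>n. hitting_process a \<mu> (B n))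
             (DRPP_space law_J law_Jt) renewal_process))"
proof -
  obtain h m where eigen: "ruelle_eigendata A \<eta> \<phi> h m" and \<mu>: "\<mu> = density m (\<lambda>x. ennreal (h x))"
    using assms(9) unfolding associated_invariant_measure_def by blast
  interpret ruelle_system A \<eta> \<phi> h m
    by unfold_locales (use assms(2-6) eigen in auto)
  have mu: "\<mu> = mu" unfolding \<mu> mu_def ..
  have visits: "visit_times (cylinder A [x 0]) x = {k. x k = x 0}"
  proof -
    have "shift_by k x \<in> shift_space A" for k using assms(15) by (simp add: shift_space_def shift_by_def)
    then show ?thesis by (simp add: visit_times_def funpow_left_shift cylinder_def shift_by_apply)
  qed
  have fin: "finite {k. x k = x 0}" using assms(17) unfolding visits .
  have j: "j = Max {k. x k = x 0}" using assms(18) unfolding visits .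
  interpret orbit_renewal A \<eta> \<phi> h m x a \<alpha> j
  proof
    show "x \<in> shift_space A" by (rule assms(15))
    show "normalizing_sequence mu left_shift a" using assms(11) unfolding mu .
    show "mono a" "regularly_varying_seq a \<alpha>" "0 < \<alpha>" "\<alpha> \<le> 1" by (fact assms)+
    \<comment> \<open>The visit times are nonempty because they contain 0, so the maximum is itself
      a visit and the last one.\<close>
    show "x j = x 0" using Max_in[OF fin] unfolding j by blast
    show "x i \<noteq> x 0" if "j < i" for i using Max_ge[OF fin, of i] that unfolding j by auto
  qed
  have B: "B n = target n" for n
    unfolding assms(16) by (auto simp: cylinder_def target_def cyl_def)
  show ?thesis
    using return_law_iff_process[OF assms(19)]
    unfolding B mu scaled_return_def[abs_def] return_def .
qed

end
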